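(* Assume the Riemann hypothesis, let $b\ge1$ and $\ell>0$. Then, as $T\to\infty$, \[ \mathcal{C}^-_{\blacktriangle}(\ell)+o(1)\le\int_b^{b+\ell}F(\alpha,T)\,\mathrm{d}\alpha\le\mathcal{C}^+_{\blacktriangle}(\ell)+o(1), \] where, writing $\{\ell\}$ for the fractional part and $x_+=\max\{x,0\}$, \[ \mathcal{C}^+_{\blacktriangle}(\ell)=\tfrac43(\ell+1)+\tfrac{\{\ell\}^3}{12}-\tfrac{\{\ell\}}{3}-\tfrac14\big(1-\{\ell\}-\{\ell\}^2\big)_+\quad(\ell\ge1), \] \[ \mathcal{C}^+_{\blacktriangle}(\ell)=\min\Big\{\tfrac43(\ell+1)+\tfrac{\ell^3}{12}-\tfrac{\ell}{3}-\tfrac14(1-\ell-\ell^2)_+\,;\,(1+c)\Big(1+\tfrac{\ell^2(1+c)^2}{12c^2}\Big)\Big\},\ c=\max\Big\{6^{-1/3}\ell^{2/3},\tfrac{\ell}{2-\ell}\Big\}\quad(0<\ell\le1), \] and \[ \mathcal{C}^-_{\blacktriangle}(\ell)=\tfrac23(\ell-1)-\tfrac{2\{\ell\}}{3}+\Big(\tfrac{1+\{\ell\}}{2}\Big)\Big(\{\ell\}-\tfrac{(1+\{\ell\})^2}{12}\Big)_+\quad(\ell\ge2),\qquad \mathcal{C}^-_{\blacktriangle}(\ell)=\Big(\ell-1-\tfrac{\ell^2}{12}\Big)_+\quad(0<\ell\le2). \]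
   Context: $F(\alpha,T)=\frac{2\pi}{T\log T}\sum_{0<\gamma,\gamma'\le T}T^{i\alpha(\gamma-\gamma')}w(\gamma-\gamma')$, $w(u)=4/(4+u^2)$, the sum over ordinates of non-trivial zeros of the Riemann zeta-function counted with multiplicity. "$A+o(1)\le X(T)\le B+o(1)$ as $T\to\infty$" means $\liminf X(T)\ge A$ and $\limsup X(T)\le B$. *)

theory Defs
  imports "HOL-Complex_Analysis.Complex_Analysis"
begin

section \<open>The Riemann zeta function\<close>

text \<open>The analytic continuation of the Dirichlet series to the whole plane without the pole;
  the irrelevant value at the pole is set to 0, so that the function is uniquely determined.\<close>

definition zeta_continuation :: "(complex \<Rightarrow> complex) \<Rightarrow> bool" where
  "zeta_continuation f \<longleftrightarrow>
     f holomorphic_on - {1} \<and> f 1 = 0 \<and>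
     (\<forall>s. Re s > 1 \<longrightarrow> (\<lambda>n. 1 / of_nat (Suc n) powr s) sums f s)"

definition riemann_zeta :: "complex \<Rightarrow> complex" where
  "riemann_zeta = (THE f. zeta_continuation f)"


subsection \<open>Existence and uniqueness of the continuation\<close>

lemma holomorphic_series:
  fixes f :: "nat \<Rightarrow> complex \<Rightarrow> complex" and r :: real
  assumes hol: "\<And>n. f n holomorphic_on UNIV"
    and bound: "\<And>R. \<exists>C\<ge>0. \<forall>n s. norm s \<le> R \<longrightarrow> norm (f n s) \<le> C * real (Suc n) powr (- Re s - r)"
  shows "(\<lambda>s. \<Sum>n. f n s) holomorphic_on {s. Re s > 1 - r}"
    and "\<And>s. Re s > 1 - r \<Longrightarrow> summable (\<lambda>n. f n s)"
proof -
  have summ: "summable (\<lambda>n. C * real (Suc n) powr e)" if "e < -1" for C e :: real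
    using that summable_real_powr_iff[of e] summable_Suc_iff[of "\<lambda>n. real n powr e"]
    by (intro summable_mult) simp
  show "summable (\<lambda>n. f n s)" if s: "Re s > 1 - r" for s
  proof -
    obtain C where C: "\<And>n. norm (f n s) \<le> C * real (Suc n) powr (- Re s - r)"
      using bound[of "norm s"] by auto
    show ?thesis
      by (rule summable_comparison_test'[OF summ[of "- Re s - r" C], of 0]) (use s C in auto)
  qed
  show "(\<lambda>s. \<Sum>n. f n s) holomorphic_on {s. Re s > 1 - r}"
  proof (rule holomorphic_uniform_sequence[where f = "\<lambda>N s. \<Sum>n<N. f n s"])
    show "open {s. Re s > 1 - r}" by (simp add: open_halfspace_Re_gt)
    show "(\<lambda>s. \<Sum>n<N. f n s) holomorphic_on {s. Re s > 1 - r}" for N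
      by (intro holomorphic_intros holomorphic_on_subset[OF hol]) auto
    fix x assume x: "x \<in> {s. Re s > 1 - r}"
    define d where "d = (Re x - (1 - r)) / 2"
    have d: "d > 0" using x by (simp add: d_def)
    obtain C where C: "C \<ge> 0"
      "\<And>n s. norm s \<le> norm x + d \<Longrightarrow> norm (f n s) \<le> C * real (Suc n) powr (- Re s - r)"
      using bound[of "norm x + d"] by auto
    have re: "Re s \<ge> Re x - d" "norm s \<le> norm x + d" if "s \<in> cball x d" for s
    proof -
      have "norm (x - s) \<le> d" using that by (simp add: dist_norm)
      then show "Re s \<ge> Re x - d" using complex_Re_le_cmod[of "x - s"] by simp
      show "norm s \<le> norm x + d"
        using \<open>norm (x - s) \<le> d\<close> norm_triangle_ineq2[of s x] by (simp add: norm_minus_commute)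
    qed
    have "uniform_limit (cball x d) (\<lambda>N s. \<Sum>n<N. f n s) (\<lambda>s. \<Sum>n. f n s) sequentially"
    proof (rule Weierstrass_m_test)
      show "summable (\<lambda>n. C * real (Suc n) powr (- (Re x - d) - r))"
        using d by (intro summ) (simp add: d_def field_simps)
      fix n s assume s: "s \<in> cball x d"
      have "norm (f n s) \<le> C * real (Suc n) powr (- Re s - r)"
        using C(2) re(2)[OF s] by blast
      also have "\<dots> \<le> C * real (Suc n) powr (- (Re x - d) - r)"
        using C(1) re(1)[OF s] by (intro mult_left_mono powr_mono) auto
      finally show "norm (f n s) \<le> C * real (Suc n) powr (- (Re x - d) - r)" .
    qed
    moreover have "cball x d \<subseteq> {s. Re s > 1 - r}"
    proof
      fix s assume "s \<in> cball x d"
      then show "s \<in> {s. Re s > 1 - r}" using re(1)[of s] d by (simp add: d_def field_simps)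
    qed
    ultimately show "\<exists>d>0. cball x d \<subseteq> {s. Re s > 1 - r} \<and>
        uniform_limit (cball x d) (\<lambda>N s. \<Sum>n<N. f n s) (\<lambda>s. \<Sum>n. f n s) sequentially"
      using d by blast
  qed
qed

lemma holomorphic_on_gchoose [holomorphic_intros]:
  fixes f :: "complex \<Rightarrow> complex"
  assumes "f holomorphic_on A"
  shows "(\<lambda>s. f s gchoose k) holomorphic_on A"
  unfolding gbinomial_prod_rev using assms by (intro holomorphic_intros) auto

lemma norm_of_nat_Suc_powr: "norm (of_nat (Suc n) powr s) = real (Suc n) powr Re s"
  by (subst norm_powr_real_powr) auto

definition zeta_series :: "complex \<Rightarrow> complex" where
  "zeta_series s = (\<Sum>n. 1 / of_nat (Suc n) powr s)"

lemma zeta_series_bound: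
  "\<exists>C\<ge>0. \<forall>n s. norm s \<le> R \<longrightarrow>
     norm (1 / of_nat (Suc n) powr s) \<le> C * real (Suc n) powr (- Re s - 0)"
  by (rule exI[of _ 1])
     (auto simp del: of_nat_Suc simp: norm_divide norm_of_nat_Suc_powr powr_minus field_simps)

lemma zeta_series_holomorphic: "zeta_series holomorphic_on {s. Re s > 1}"
  and summable_zeta_series: "Re s > 1 \<Longrightarrow> summable (\<lambda>n. 1 / of_nat (Suc n) powr s :: complex)"
proof -
  have hol: "(\<lambda>s. 1 / of_nat (Suc n) powr s :: complex) holomorphic_on UNIV" for n
    by (intro holomorphic_intros) (auto simp del: of_nat_Suc)
  note * = holomorphic_series[of "\<lambda>n s. 1 / of_nat (Suc n) powr s" 0, OF hol zeta_series_bound]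
  show "zeta_series holomorphic_on {s. Re s > 1}"
    using *(1) by (simp add: zeta_series_def[abs_def])
  show "Re s > 1 \<Longrightarrow> summable (\<lambda>n. 1 / of_nat (Suc n) powr s :: complex)"
    using *(2) by simp
qed

definition zeta_rem :: "nat \<Rightarrow> nat \<Rightarrow> complex \<Rightarrow> complex" where
  "zeta_rem K n s = of_nat (Suc (Suc n)) powr (1 - s) -
     (\<Sum>k\<le>Suc K. (1 - s gchoose k) * of_nat (Suc n) powr (1 - s - of_nat k))"

lemma zeta_rem_bound_single:
  "norm (zeta_rem K n s) \<le>
     norm (fact (K + 2) * (1 - s gchoose (K + 2))) * 2 powr (norm s + real K + 1) *
     real (Suc n) powr (- Re s - real (Suc K))"
proof -
  define a where "a = 1 - s"
  define m where "m = real (Suc n)"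
  have m: "m \<ge> 1" by (simp add: m_def)
  define S where "S = closed_segment (complex_of_real m) (complex_of_real (m + 1))"
  have S: "\<exists>y. x = of_real y \<and> m \<le> y \<and> y \<le> m + 1" if "x \<in> S" for x
    using that unfolding S_def closed_segment_of_real closed_segment_eq_real_ivl by (auto split: if_splits)
  define f where "f i x = fact i * (a gchoose i) * x powr (a - of_nat i)" for i and x :: complex
  define e where "e = - Re s - real (Suc K)"
  define B where "B = norm (fact (K + 2) * (a gchoose (K + 2))) * (2 powr (norm s + real K + 1) * m powr e)"
  have "norm (f 0 (of_real (m + 1)) - (\<Sum>i\<le>Suc K. f i (of_real m) * (of_real (m + 1) - of_real m) ^ i / fact i))
        \<le> B * norm (complex_of_real (m + 1) - of_real m) ^ Suc (Suc K) / fact (Suc K)"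
  proof (rule complex_Taylor)
    show "convex S" by (simp add: S_def)
    show "complex_of_real m \<in> S" "complex_of_real (m + 1) \<in> S" by (simp_all add: S_def)
  next
    fix i x assume "x \<in> S" "i \<le> Suc K"
    then obtain y where y: "x = of_real y" "m \<le> y" using S by blast
    have x: "x \<notin> \<real>\<^sub>\<le>\<^sub>0" using y m by auto
    have g: "of_nat (Suc i) * (a gchoose Suc i) = (a - of_nat i) * (a gchoose i)"
      using gbinomial_mult_1[of a i] by (simp add: algebra_simps)
    have "f (Suc i) x = fact i * (of_nat (Suc i) * (a gchoose Suc i)) * x powr (a - of_nat (Suc i))"
      by (simp add: f_def algebra_simps)
    also have "\<dots> = fact i * (a gchoose i) * ((a - of_nat i) * x powr (a - of_nat i - 1))"
      by (subst g) (simp add: algebra_simps)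
    finally have "f (Suc i) x = fact i * (a gchoose i) * ((a - of_nat i) * x powr (a - of_nat i - 1))" .
    moreover have "(f i has_field_derivative fact i * (a gchoose i) * ((a - of_nat i) * x powr (a - of_nat i - 1)))
        (at x within S)"
      unfolding f_def
      by (intro DERIV_cmult has_field_derivative_at_within[OF has_field_derivative_powr[OF x]])
    ultimately show "(f i has_field_derivative f (Suc i) x) (at x within S)" by simp
  next
    fix x assume "x \<in> S"
    then obtain y where y: "x = of_real y" "m \<le> y" "y \<le> m + 1" using S by blast
    have "norm (x powr (a - of_nat (K + 2))) = y powr e"
    proof -
      have "Re (a - of_nat (K + 2)) = e" by (simp add: a_def e_def)
      then show ?thesis using y m by (subst norm_powr_real_powr) auto
    qed
    also have "\<dots> = (y / m) powr e * m powr e"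
      using m y by (simp add: powr_divide)
    also have "\<dots> \<le> 2 powr (norm s + real K + 1) * m powr e"
    proof (rule mult_right_mono)
      have "(y / m) powr e \<le> (y / m) powr (norm s + real K + 1)"
        using m y abs_Re_le_cmod[of s] by (intro powr_mono) (auto simp: e_def)
      also have "\<dots> \<le> 2 powr (norm s + real K + 1)"
        using m y by (intro powr_mono2) (auto simp: field_simps)
      finally show "(y / m) powr e \<le> 2 powr (norm s + real K + 1)" .
    qed simp
    finally have "norm (x powr (a - of_nat (K + 2))) \<le> 2 powr (norm s + real K + 1) * m powr e" .
    then show "norm (f (Suc (Suc K)) x) \<le> B"
      unfolding f_def B_def by (simp add: norm_mult mult_left_mono)
  qed
  also have "B * norm (complex_of_real (m + 1) - of_real m) ^ Suc (Suc K) / fact (Suc K) = B / fact (Suc K)"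
    by simp
  also have "\<dots> \<le> B / 1"
    by (intro divide_left_mono) (auto simp: B_def fact_ge_1 simp del: fact_Suc)
  also have "f 0 (of_real (m + 1)) - (\<Sum>i\<le>Suc K. f i (of_real m) * (of_real (m + 1) - of_real m) ^ i / fact i)
             = zeta_rem K n s"
    by (simp add: zeta_rem_def f_def a_def m_def del: sum.atMost_Suc)
  finally show ?thesis
    by (simp add: B_def a_def m_def e_def mult.assoc)
qed

lemma zeta_rem_bound:
  "\<exists>C\<ge>0. \<forall>n s. norm s \<le> R \<longrightarrow> norm (zeta_rem K n s) \<le> C * real (Suc n) powr (- Re s - real (Suc K))"
proof -
  define h :: "complex \<Rightarrow> real" where
    "h s = norm (fact (K + 2) * (1 - s gchoose (K + 2))) * 2 powr (norm s + real K + 1)" for s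
  have hol: "(\<lambda>s. fact (K + 2) * (1 - s gchoose (K + 2)) :: complex) holomorphic_on cball 0 R"
    by (intro holomorphic_intros)
  have "continuous_on (cball 0 R) h"
    unfolding h_def
    by (intro continuous_intros continuous_on_powr continuous_on_norm
          holomorphic_on_imp_continuous_on[OF hol]) auto
  then have "compact (h ` cball 0 R)" by (intro compact_continuous_image) auto
  then have "bounded (h ` cball 0 R)" by (rule compact_imp_bounded)
  then obtain C where C: "C > 0" "\<And>s. norm s \<le> R \<Longrightarrow> h s \<le> C"
    by (force simp: bounded_pos dest: spec)
  show ?thesis
  proof (intro exI[of _ C] conjI allI impI)
    show "0 \<le> C" using C by simp
    fix n and s :: complex assume s: "norm s \<le> R"
    have "norm (zeta_rem K n s) \<le> h s * real (Suc n) powr (- Re s - real (Suc K))"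
      using zeta_rem_bound_single[of K n s] by (simp add: h_def)
    also have "\<dots> \<le> C * real (Suc n) powr (- Re s - real (Suc K))"
      using C(2)[OF s] by (intro mult_right_mono) auto
    finally show "norm (zeta_rem K n s) \<le> C * real (Suc n) powr (- Re s - real (Suc K))" .
  qed
qed

lemma zeta_rem_sum_holomorphic:
  "(\<lambda>s. \<Sum>n. zeta_rem K n s) holomorphic_on {s. Re s > - real K}"
  and summable_zeta_rem: "Re s > - real K \<Longrightarrow> summable (\<lambda>n. zeta_rem K n s)"
proof -
  have hol: "zeta_rem K n holomorphic_on UNIV" for n
    unfolding zeta_rem_def[abs_def]
    by (intro holomorphic_intros) (auto simp del: of_nat_Suc)
  note * = holomorphic_series[of "zeta_rem K" "real (Suc K)", OF hol zeta_rem_bound]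
  show "(\<lambda>s. \<Sum>n. zeta_rem K n s) holomorphic_on {s. Re s > - real K}"
    using *(1) by simp
  show "Re s > - real K \<Longrightarrow> summable (\<lambda>n. zeta_rem K n s)"
    using *(2) by simp
qed

text \<open>Expanding the terms of the telescoping sum of $n^{1-s} - (n+1)^{1-s}$ binomially expresses
  $(s-1)\zeta(s)$ through the values $\zeta(s+1), \dots, \zeta(s+K)$ and a remainder that is
  holomorphic for $\Re s > -K$.\<close>

lemma zeta_series_recurrence:
  assumes s: "Re s > 1"
  shows "(s - 1) * zeta_series s =
    1 - (\<Sum>k\<in>{2..Suc K}. (1 - s gchoose (k - 1)) / of_nat k *
          ((s + of_nat k - 2) * zeta_series (s + of_nat k - 1))) + (\<Sum>n. zeta_rem K n s)"
proof -
  define u :: "nat \<Rightarrow> complex" where "u n = of_nat (Suc n) powr (1 - s)" for n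
  have norm_u: "norm (u n) = real (Suc n) powr (1 - Re s)" for n
    unfolding u_def by (subst norm_of_nat_Suc_powr) simp
  have "(\<lambda>n. real (Suc n) powr (1 - Re s)) \<longlonglongrightarrow> 0"
    using s by (intro tendsto_neg_powr filterlim_compose[OF filterlim_real_sequentially filterlim_Suc]) auto
  then have "u \<longlonglongrightarrow> 0"
    by (subst tendsto_norm_zero_iff[symmetric]) (simp only: norm_u)
  then have tele: "(\<lambda>n. u (Suc n) - u n) sums (0 - u 0)"
    by (rule telescope_sums)
  have ser: "(\<lambda>n. of_nat (Suc n) powr (1 - s - of_nat k)) sums zeta_series (s + of_nat k - 1)"
    if "k \<ge> 1" for k
  proof -
    have "Re (s + of_nat k - 1) > 1" using s that by simp
    from summable_sums[OF summable_zeta_series[OF this]]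
    have "(\<lambda>n. 1 / of_nat (Suc n) powr (s + of_nat k - 1)) sums zeta_series (s + of_nat k - 1)"
      by (simp add: zeta_series_def)
    also have "(\<lambda>n. 1 / of_nat (Suc n) powr (s + of_nat k - 1) :: complex)
               = (\<lambda>n. of_nat (Suc n) powr (1 - s - of_nat k))"
      by (rule ext, subst powr_minus_divide[symmetric]) (simp add: algebra_simps)
    finally show ?thesis .
  qed
  have "(\<lambda>n. zeta_rem K n s + (\<Sum>k=1..Suc K. (1 - s gchoose k) * of_nat (Suc n) powr (1 - s - of_nat k)))
        sums ((\<Sum>n. zeta_rem K n s) + (\<Sum>k=1..Suc K. (1 - s gchoose k) * zeta_series (s + of_nat k - 1)))"
    using s by (intro sums_add sums_sum sums_mult ser summable_sums summable_zeta_rem) auto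
  also have "(\<lambda>n. zeta_rem K n s + (\<Sum>k=1..Suc K. (1 - s gchoose k) * of_nat (Suc n) powr (1 - s - of_nat k)))
             = (\<lambda>n. u (Suc n) - u n)"
  proof
    fix n
    have "{..Suc K} = insert 0 {1..Suc K}" by auto
    then have "(\<Sum>k\<le>Suc K. (1 - s gchoose k) * of_nat (Suc n) powr (1 - s - of_nat k)) =
      u n + (\<Sum>k=1..Suc K. (1 - s gchoose k) * of_nat (Suc n) powr (1 - s - of_nat k))"
      by (simp add: u_def del: of_nat_Suc)
    then show "zeta_rem K n s + (\<Sum>k=1..Suc K. (1 - s gchoose k) * of_nat (Suc n) powr (1 - s - of_nat k))
               = u (Suc n) - u n"
      unfolding zeta_rem_def by (simp add: u_def del: of_nat_Suc)
  qed
  finally have "(\<Sum>n. zeta_rem K n s) + (\<Sum>k=1..Suc K. (1 - s gchoose k) * zeta_series (s + of_nat k - 1)) = 0 - u 0"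
    using tele sums_unique2 by blast
  moreover have "u 0 = 1" by (simp add: u_def)
  moreover have "(\<Sum>k=1..Suc K. (1 - s gchoose k) * zeta_series (s + of_nat k - 1)) =
    (1 - s) * zeta_series s + (\<Sum>k=2..Suc K. (1 - s gchoose k) * zeta_series (s + of_nat k - 1))"
  proof -
    have "{1..Suc K} = insert 1 {2..Suc K}" by auto
    then show ?thesis by simp
  qed
  moreover have "(\<Sum>k=2..Suc K. (1 - s gchoose k) * zeta_series (s + of_nat k - 1)) =
    - (\<Sum>k\<in>{2..Suc K}. (1 - s gchoose (k - 1)) / of_nat k *
          ((s + of_nat k - 2) * zeta_series (s + of_nat k - 1)))"
    unfolding sum_negf[symmetric]
  proof (rule sum.cong[OF refl])
    fix k assume "k \<in> {2..Suc K}"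
    then obtain j where k: "k = Suc j" by (cases k) auto
    have "of_nat (Suc j) * (1 - s gchoose Suc j) = - (s + of_nat j - 1) * (1 - s gchoose j)"
      using gbinomial_mult_1[of "1 - s" j] by (simp add: algebra_simps)
    then have "(1 - s gchoose Suc j) = - (s + of_nat j - 1) * (1 - s gchoose j) / of_nat (Suc j)"
      by (metis nonzero_mult_div_cancel_left of_nat_neq_0)
    moreover have "s + of_nat (Suc j) - 2 = s + of_nat j - 1" by simp
    moreover have "(- A * Y / Z) * W = - (Y / Z * (A * W))" for A W Y Z :: complex
      by (simp add: mult_ac)
    ultimately show "(1 - s gchoose k) * zeta_series (s + of_nat k - 1) =
      - ((1 - s gchoose (k - 1)) / of_nat k * ((s + of_nat k - 2) * zeta_series (s + of_nat k - 1)))"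
      unfolding k by (simp only: diff_Suc_1)
  qed
  moreover have "(s - 1) * Z = 1 - X + R"
    if "R + A = 0 - u0" "u0 = 1" "A = (1 - s) * Z + B" "B = - X" for R A B X Z u0
    using that by (simp add: algebra_simps)
  ultimately show ?thesis by blast
qed

lemma zeta_extension:
  "\<exists>g. g holomorphic_on {s. Re s > 1 - real K} \<and> (\<forall>s. Re s > 1 \<longrightarrow> g s = (s - 1) * zeta_series s)"
proof (induction K)
  case 0
  show ?case
    by (rule exI[of _ "\<lambda>s. (s - 1) * zeta_series s"])
       (auto intro!: holomorphic_intros zeta_series_holomorphic)
next
  case (Suc K)
  then obtain g where g: "g holomorphic_on {s. Re s > 1 - real K}"
    "\<And>s. Re s > 1 \<Longrightarrow> g s = (s - 1) * zeta_series s" by blast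
  define G where "G s = 1 - (\<Sum>k\<in>{2..Suc K}. (1 - s gchoose (k - 1)) / of_nat k *
          g (s + of_nat k - 1)) + (\<Sum>n. zeta_rem K n s)" for s
  have shift: "(\<lambda>s. g (s + of_nat k - 1)) holomorphic_on {s. Re s > - real K}" if "k \<in> {2..Suc K}" for k
  proof -
    have "(g \<circ> (\<lambda>s. s + of_nat k - 1)) holomorphic_on {s. Re s > - real K}"
      by (rule holomorphic_on_compose_gen[OF _ g(1)]) (use that in \<open>auto intro!: holomorphic_intros\<close>)
    then show ?thesis by (simp add: o_def)
  qed
  have "G holomorphic_on {s. Re s > - real K}"
    unfolding G_def by (intro holomorphic_intros shift zeta_rem_sum_holomorphic) auto
  moreover have "G s = (s - 1) * zeta_series s" if s: "Re s > 1" for s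
  proof -
    have "(\<Sum>k\<in>{2..Suc K}. (1 - s gchoose (k - 1)) / of_nat k * g (s + of_nat k - 1)) =
      (\<Sum>k\<in>{2..Suc K}. (1 - s gchoose (k - 1)) / of_nat k *
          ((s + of_nat k - 2) * zeta_series (s + of_nat k - 1)))"
      by (intro sum.cong refl) (use s in \<open>auto simp: g(2) algebra_simps\<close>)
    then show ?thesis unfolding G_def by (subst zeta_series_recurrence[OF s, of K]) simp
  qed
  ultimately show ?case by (intro exI[of _ G]) auto
qed

lemma zeta_entire:
  "\<exists>h. h holomorphic_on UNIV \<and> (\<forall>s. Re s > 1 \<longrightarrow> h s = (s - 1) * zeta_series s)"
proof -
  obtain g where g: "\<And>K. g K holomorphic_on {s. Re s > 1 - real K}"
    "\<And>K s. Re s > 1 \<Longrightarrow> g K s = (s - 1) * zeta_series s"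
    using zeta_extension by metis
  have agree: "g K s = g L s" if "Re s > 1 - real K" "K \<le> L" for K L s
  proof (rule analytic_continuation_open[of "{s. Re s > 1}" "{s. Re s > 1 - real K}" "g K" "g L" s])
    show "g L holomorphic_on {s. Re s > 1 - real K}"
      by (rule holomorphic_on_subset[OF g(1)]) (use that in auto)
    show "{s. Re s > 1} \<noteq> {}" by (auto intro: exI[of _ 2])
    show "connected {s. Re s > 1 - real K}"
      by (intro convex_connected convex_halfspace_Re_gt)
  qed (use that in \<open>auto simp: g open_halfspace_Re_gt\<close>)
  define h where "h s = g (nat \<lceil>2 - Re s\<rceil>) s" for s
  have h_eq: "h s = g K s" if "Re s > 1 - real K" for s K
  proof -
    have "Re s > 1 - real (nat \<lceil>2 - Re s\<rceil>)" by linarith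
    then show ?thesis
      unfolding h_def using agree[of _ s] that by (metis nat_le_linear)
  qed
  have "h holomorphic_on UNIV"
  proof -
    have "h holomorphic_on (\<Union>K. {s. Re s > 1 - real K})"
    proof (rule holomorphic_on_UN_open)
      show "h holomorphic_on {s. Re s > 1 - real K}" for K
        by (rule holomorphic_transform[OF g(1)]) (simp add: h_eq)
    qed (simp add: open_halfspace_Re_gt)
    moreover have "(\<Union>K. {s. Re s > 1 - real K}) = (UNIV :: complex set)"
    proof -
      have "\<exists>K. Re s > 1 - real K" for s
        using reals_Archimedean2[of "1 - Re s"] by (auto simp: algebra_simps)
      then show ?thesis by auto
    qed
    ultimately show ?thesis by simp
  qed
  moreover have "h s = (s - 1) * zeta_series s" if "Re s > 1" for s
    using h_eq[of 0 s] that by (simp add: g(2))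
  ultimately show ?thesis by blast
qed

lemma zeta_continuation_if_entire:
  assumes "h holomorphic_on UNIV" and h: "\<And>s. Re s > 1 \<Longrightarrow> h s = (s - 1) * zeta_series s"
  shows "zeta_continuation (\<lambda>s. h s / (s - 1))"
proof -
  have "(\<lambda>s. h s / (s - 1)) holomorphic_on - {1}"
    using assms(1) by (intro holomorphic_intros) (auto intro: holomorphic_on_subset)
  moreover have "(\<lambda>n. 1 / of_nat (Suc n) powr s) sums (h s / (s - 1))" if "Re s > 1" for s
  proof -
    have "s \<noteq> 1" using that by auto
    then have "h s / (s - 1) = zeta_series s"
      using that by (simp add: h)
    then show ?thesis
      using summable_sums[OF summable_zeta_series[OF that]] by (simp add: zeta_series_def)
  qed
  ultimately show ?thesis
    unfolding zeta_continuation_def by auto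
qed

lemma connected_minus_one: "connected (- {1 :: complex})"
  by (rule connected_punctured_universe) simp

lemma zeta_continuation_unique:
  assumes "zeta_continuation f" "zeta_continuation g"
  shows "f = g"
proof
  fix s
  show "f s = g s"
  proof (cases "s = 1")
    case False
    show ?thesis
    proof (rule analytic_continuation_open[of "{s. Re s > 1}" "- {1}" f g s])
      show "{s. Re s > 1} \<noteq> {}" by (auto intro: exI[of _ 2])
      show "f z = g z" if "z \<in> {s. Re s > 1}" for z
        using assms that sums_unique2 unfolding zeta_continuation_def by blast
    qed (use assms False connected_minus_one in
          \<open>auto simp: zeta_continuation_def open_halfspace_Re_gt\<close>)
  qed (use assms in \<open>auto simp: zeta_continuation_def\<close>)
qed

lemma zeta_continuation_riemann_zeta: "zeta_continuation riemann_zeta"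
  unfolding riemann_zeta_def
  using zeta_entire zeta_continuation_if_entire zeta_continuation_unique by (metis theI)


section \<open>Non-trivial zeros and the Riemann hypothesis\<close>

definition nontrivial_zeros :: "complex set" where
  "nontrivial_zeros = {\<rho>. riemann_zeta \<rho> = 0 \<and> 0 < Re \<rho> \<and> Re \<rho> < 1}"

definition riemann_hypothesis :: bool where
  "riemann_hypothesis \<longleftrightarrow> (\<forall>\<rho>\<in>nontrivial_zeros. Re \<rho> = 1 / 2)"

definition zeros_upto :: "real \<Rightarrow> complex set" where
  "zeros_upto T = {\<rho>\<in>nontrivial_zeros. 0 < Im \<rho> \<and> Im \<rho> \<le> T}"

definition zero_mult :: "complex \<Rightarrow> nat" where
  "zero_mult \<rho> = nat (zorder riemann_zeta \<rho>)"

lemma riemann_zeta_not_constant: "\<not> riemann_zeta constant_on - {1}"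
proof
  assume "riemann_zeta constant_on - {1}"
  then obtain c where c: "\<And>s. s \<noteq> 1 \<Longrightarrow> riemann_zeta s = c"
    by (auto simp: constant_on_def)
  have ser: "(\<lambda>n. 1 / of_nat (Suc n) powr of_nat k) sums c" if "k \<ge> 2" for k
  proof -
    have "Re (of_nat k) > 1" using that by simp
    moreover have "(of_nat k :: complex) \<noteq> 1" using that by auto
    ultimately show ?thesis
      using zeta_continuation_riemann_zeta c[of "of_nat k"] unfolding zeta_continuation_def by metis
  qed
  have "(\<lambda>n. Re (1 / of_nat (Suc n) powr of_nat 2 - 1 / of_nat (Suc n) powr of_nat 3)) sums Re (c - c)"
    by (intro sums_Re sums_diff ser) auto
  moreover have "Re (1 / of_nat (Suc n) powr of_nat 2 - 1 / of_nat (Suc n) powr of_nat 3)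
     = 1 / real (Suc n) ^ 2 - 1 / real (Suc n) ^ 3" for n
  proof -
    have "of_nat (Suc n) powr of_nat k = complex_of_real (real (Suc n) ^ k)" for k
      by (subst powr_nat') (auto simp del: of_nat_Suc)
    then show ?thesis by (simp del: of_nat_Suc flip: of_real_divide of_real_power)
  qed
  ultimately have sums0: "(\<lambda>n. 1 / real (Suc n) ^ 2 - 1 / real (Suc n) ^ 3) sums 0" by simp
  have nonneg: "1 / real (Suc n) ^ 2 - 1 / real (Suc n) ^ 3 \<ge> 0" for n
    by (simp add: divide_left_mono power_increasing del: of_nat_Suc)
  have "1 / real (Suc 1) ^ 2 - 1 / real (Suc 1) ^ 3 = 0"
    using suminf_eq_zero_iff[OF sums_summable[OF sums0] nonneg] sums_unique[OF sums0] by metis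
  then show False by simp
qed

lemma finite_zeros_upto: "finite (zeros_upto T)"
proof -
  obtain h where h: "h holomorphic_on UNIV" "\<And>s. Re s > 1 \<Longrightarrow> h s = (s - 1) * zeta_series s"
    using zeta_entire by blast
  have zeta_eq: "riemann_zeta s = h s / (s - 1)" for s
    using zeta_continuation_unique[OF zeta_continuation_riemann_zeta zeta_continuation_if_entire[OF h]]
    by metis
  define K where "K = cbox (Complex 0 0) (Complex 1 T)"
  have sub: "zeros_upto T \<subseteq> {z\<in>K. h z = 0}"
    by (auto simp: zeros_upto_def nontrivial_zeros_def zeta_eq K_def in_cbox_complex_iff)
  show ?thesis
  proof (cases "h constant_on UNIV")
    case False
    have "finite {z\<in>K. h z = 0}"
      by (rule holomorphic_compact_finite_zeros[OF h(1)]) (use False in \<open>auto simp: K_def\<close>)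
    then show ?thesis using sub finite_subset by blast
  next
    case True
    then obtain c where c: "\<And>s. h s = c" by (auto simp: constant_on_def)
    show ?thesis
    proof (cases "c = 0")
      case True
      then have "riemann_zeta constant_on - {1}" by (auto simp: zeta_eq c constant_on_def)
      then show ?thesis using riemann_zeta_not_constant by blast
    next
      case False
      then have "zeros_upto T = {}" using sub c by auto
      then show ?thesis by simp
    qed
  qed
qed


section \<open>The form factor\<close>

definition pair_weight :: "real \<Rightarrow> real" where
  "pair_weight u = 4 / (4 + u\<^sup>2)"

definition form_factor_complex :: "real \<Rightarrow> real \<Rightarrow> complex" where
  "form_factor_complex \<alpha> T =
     of_real (2 * pi / (T * ln T)) *
     (\<Sum>\<rho>\<in>zeros_upto T. \<Sum>\<rho>'\<in>zeros_upto T.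
        of_nat (zero_mult \<rho> * zero_mult \<rho>') *
        of_real T powr (\<i> * of_real (\<alpha> * (Im \<rho> - Im \<rho>'))) *
        of_real (pair_weight (Im \<rho> - Im \<rho>')))"

text \<open>The double sum is real by symmetry, see the lemma below.\<close>

definition form_factor :: "real \<Rightarrow> real \<Rightarrow> real" where
  "form_factor \<alpha> T = Re (form_factor_complex \<alpha> T)"

lemma of_real_form_factor:
  assumes "T > 0"
  shows "of_real (form_factor \<alpha> T) = form_factor_complex \<alpha> T"
proof -
  have cnj_powr: "cnj (of_real T powr (\<i> * of_real x)) = of_real T powr (\<i> * of_real (- x))" for x
    using assms by (simp add: powr_def exp_cnj Ln_of_real)
  have w: "pair_weight (x - y) = pair_weight (y - x)" for x y
    by (simp add: pair_weight_def power2_commute[of x y])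
  have "cnj (form_factor_complex \<alpha> T) = form_factor_complex \<alpha> T"
    unfolding form_factor_complex_def complex_cnj_mult complex_cnj_complex_of_real cnj_sum
    by (subst sum.swap)
       (intro arg_cong2[of _ _ _ _ "(*)"] refl sum.cong,
        simp_all only: cnj_powr complex_cnj_of_nat mult.commute minus_mult_right minus_diff_eq,
        simp_all add: w)
  then show ?thesis
    by (simp add: form_factor_def complex_eq_iff)
qed


section \<open>The bounds\<close>

definition pos_part :: "real \<Rightarrow> real" where
  "pos_part x = max x 0"

definition C_plus :: "real \<Rightarrow> real" where
  "C_plus l =
     (if l \<ge> 1 then
        4 / 3 * (l + 1) + frac l ^ 3 / 12 - frac l / 3 - 1 / 4 * pos_part (1 - frac l - (frac l)\<^sup>2)
      else
        (let c = max (6 powr (- 1 / 3) * l powr (2 / 3)) (l / (2 - l)) in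
         min (4 / 3 * (l + 1) + l ^ 3 / 12 - l / 3 - 1 / 4 * pos_part (1 - l - l\<^sup>2))
             ((1 + c) * (1 + l\<^sup>2 * (1 + c)\<^sup>2 / (12 * c\<^sup>2)))))"

definition C_minus :: "real \<Rightarrow> real" where
  "C_minus l =
     (if l \<ge> 2 then
        2 / 3 * (l - 1) - 2 * frac l / 3 +
        (1 + frac l) / 2 * pos_part (frac l - (1 + frac l)\<^sup>2 / 12)
      else pos_part (l - 1 - l\<^sup>2 / 12))"

text \<open>The two formulas agree where their ranges of validity overlap.\<close>

lemma C_plus_le_1:
  assumes "0 < l" "l \<le> 1" "c = max (6 powr (- 1 / 3) * l powr (2 / 3)) (l / (2 - l))"
  shows "C_plus l = min (4 / 3 * (l + 1) + l ^ 3 / 12 - l / 3 - 1 / 4 * pos_part (1 - l - l\<^sup>2))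
                        ((1 + c) * (1 + l\<^sup>2 * (1 + c)\<^sup>2 / (12 * c\<^sup>2)))"
proof (cases "l = 1")
  case True
  have "6 powr (- 1 / 3) \<le> (1 :: real)"
    using powr_mono[of "- 1 / 3" 0 "6 :: real"] by simp
  then have "c = 1" using True assms(3) by simp
  then show ?thesis using True by (simp add: C_plus_def pos_part_def)
qed (use assms in \<open>auto simp: C_plus_def Let_def\<close>)

lemma C_minus_le_2:
  assumes "0 < l" "l \<le> 2"
  shows "C_minus l = pos_part (l - 1 - l\<^sup>2 / 12)"
proof (cases "l = 2")
  case True
  have fr: "frac (2 :: real) = 0" by (simp add: frac_def)
  show ?thesis unfolding C_minus_def pos_part_def True fr by simp
qed (use assms in \<open>auto simp: C_minus_def\<close>)

end

theory Submission
  imports Defs "HOL-Number_Theory.Prime_Powers" "HOL-Real_Asymp.Real_Asymp" "HOL-Probability.Sinc_Integral"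
begin

text \<open>
  Write $S(y) = \sum_{0<\gamma\le T} e^{iy\gamma}$ and average $F(\cdot, T)$ against the triangle
  $(h-|\alpha-\beta|)_+$, whose Fourier transform, a Fejer kernel, is nonnegative. Since
  $0 \le w \le 1 = w(0)$, every off-diagonal term of the resulting double sum is at most its value for
  $\beta = 0$ and $w = 1$ in modulus, so
  \[ \frac{2\pi}{T\log T}\Bigl(2h^2 N(T) - M\Bigr) \le \int (h-|\alpha-\beta|)_+ F(\alpha,T)\,d\alpha \le \frac{2\pi}{T\log T} M,
     \qquad M = \int_{-h}^{h} (h-|\alpha|)\,|S(\alpha\log T)|^2\,d\alpha, \]
  where $N(T) \ge (1+o(1))\frac{T\log T}{2\pi}$. For $h<1$ the mean square $M$ is bounded by means of a
  Landau--Gonek type formula: integrating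
  $\zeta'/\zeta(s)\,e^{y(s-1/2)}$ around a rectangle, the right edge contributes only the prime power
  nearest to $e^y$ and the left edge, by the functional equation, only the logarithmic derivative of
  $\chi$. Bessel's inequality turns both into a mean value, and Mertens' theorem gives
  $M \le (1+o(1))\frac{T\log T}{2\pi}(h + h^3/3)$. Hence all triangular averages of $F$ with $h \le 1$ lie
  asymptotically between $h(2h-1-h^2/3)$ and $h+h^3/3$, and the theorem follows by bounding the indicator
  function of an interval above and below by sums of triangles.
\<close>

section \<open>Triangular averages and the Fejer kernel\<close>

definition tri :: "real \<Rightarrow> real \<Rightarrow> real" where
  "tri h u = max 0 (h - \<bar>u\<bar>)"

definition tri_avg :: "real \<Rightarrow> real \<Rightarrow> (real \<Rightarrow> real) \<Rightarrow> real" where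
  "tri_avg h \<beta> G = integral {\<beta> - h..\<beta> + h} (\<lambda>\<alpha>. tri h (\<alpha> - \<beta>) * G \<alpha>)"

definition fejer :: "real \<Rightarrow> real \<Rightarrow> real" where
  "fejer h v = (h * sinc (h * v / 2))\<^sup>2"

lemma tri_nonneg: "tri h u \<ge> 0"
  by (simp add: tri_def)

lemma continuous_on_tri [continuous_intros]:
  "continuous_on A f \<Longrightarrow> continuous_on A (\<lambda>x. tri h (f x))"
  unfolding tri_def by (intro continuous_intros)

lemma has_integral_tri_avg:
  assumes "continuous_on UNIV G"
  shows "((\<lambda>\<alpha>. tri h (\<alpha> - \<beta>) * G \<alpha>) has_integral tri_avg h \<beta> G) UNIV"
proof (rule has_integral_on_superset)
  show "((\<lambda>\<alpha>. tri h (\<alpha> - \<beta>) * G \<alpha>) has_integral tri_avg h \<beta> G) {\<beta> - h..\<beta> + h}"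
    unfolding tri_avg_def
    by (intro integrable_integral integrable_continuous_interval continuous_intros
          continuous_on_subset[OF assms]) auto
qed (auto simp: tri_def)

lemma integral_le_tri_avg_0:
  assumes G_cont: "continuous_on UNIV G" and "\<And>\<alpha>. G \<alpha> \<ge> 0" and "M \<le> h"
  shows "(h - M) * integral {- M..M} G \<le> tri_avg h 0 G"
proof -
  note integrable = integrable_continuous_interval continuous_intros continuous_on_subset[OF G_cont]
  have "(h - M) * integral {- M..M} G \<le> integral {- M..M} (\<lambda>\<alpha>. tri h \<alpha> * G \<alpha>)"
    unfolding integral_mult_right[symmetric]
    using assms by (intro integral_le mult_right_mono integrable) (auto simp: tri_def)
  also have "\<dots> \<le> integral {- h..h} (\<lambda>\<alpha>. tri h \<alpha> * G \<alpha>)"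
    using assms by (intro integral_subset_le integrable) (auto simp: tri_nonneg)
  finally show ?thesis by (simp add: tri_avg_def)
qed

lemma fejer_nonneg: "fejer h v \<ge> 0"
  by (simp add: fejer_def)

lemma fejer_0: "fejer h 0 = h\<^sup>2"
  by (simp add: fejer_def)

lemma fejer_minus: "fejer h (- v) = fejer h v"
  by (simp add: fejer_def)

lemma fejer_altdef:
  assumes "v \<noteq> 0"
  shows "fejer h v = 2 * (1 - cos (h * v)) / v\<^sup>2"
proof -
  have "1 - cos (h * v) = 2 * (sin (h * v / 2))\<^sup>2"
    using cos_double_sin[of "h * v / 2"] by simp
  then show ?thesis
    using assms by (auto simp: fejer_def power_mult_distrib power_divide)
qed

lemma continuous_on_fejer [continuous_intros]:
  assumes "continuous_on A f"
  shows "continuous_on A (\<lambda>x. fejer h (f x))"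
  unfolding fejer_def
  by (intro continuous_intros continuous_on_compose2[OF continuous_on_sinc[OF continuous_on_id]] assms) auto

lemma has_integral_affine_mult_cos:
  fixes k s v c :: real
  defines "P \<equiv> \<lambda>x. if v = 0 then (k * x + s * x\<^sup>2 / 2) * cos c
      else (k + s * x) * sin (x * v + c) / v + s * cos (x * v + c) / v\<^sup>2"
  assumes "a \<le> b"
  shows "((\<lambda>x. (k + s * x) * cos (x * v + c)) has_integral P b - P a) {a..b}"
proof (rule fundamental_theorem_of_calculus[OF \<open>a \<le> b\<close>])
  fix x
  show "(P has_vector_derivative (k + s * x) * cos (x * v + c)) (at x within {a..b})"
    unfolding P_def has_real_derivative_iff_has_vector_derivative[symmetric]
    by (cases "v = 0") (auto intro!: derivative_eq_intros simp: field_simps power2_eq_square)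
qed

lemma has_integral_tri_mult_cos_centered:
  assumes "h \<ge> 0"
  shows "((\<lambda>x. tri h x * cos (x * v + c)) has_integral cos c * fejer h v) {- h..h}"
proof -
  define P where "P s x = (if v = 0 then (h * x + s * x\<^sup>2 / 2) * cos c
      else (h + s * x) * sin (x * v + c) / v + s * cos (x * v + c) / v\<^sup>2)" for s x
  have "((\<lambda>x. (h + 1 * x) * cos (x * v + c)) has_integral P 1 0 - P 1 (- h)) {- h..0}"
    unfolding P_def using assms by (intro has_integral_affine_mult_cos) simp
  then have "((\<lambda>x. tri h x * cos (x * v + c)) has_integral P 1 0 - P 1 (- h)) {- h..0}"
    by (rule has_integral_eq[rotated]) (auto simp: tri_def)
  moreover have "((\<lambda>x. (h + (- 1) * x) * cos (x * v + c)) has_integral P (- 1) h - P (- 1) 0) {0..h}"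
    unfolding P_def using assms by (intro has_integral_affine_mult_cos) simp
  then have "((\<lambda>x. tri h x * cos (x * v + c)) has_integral P (- 1) h - P (- 1) 0) {0..h}"
    by (rule has_integral_eq[rotated]) (auto simp: tri_def)
  ultimately have "((\<lambda>x. tri h x * cos (x * v + c)) has_integral
      (P 1 0 - P 1 (- h)) + (P (- 1) h - P (- 1) 0)) {- h..h}"
    using assms by (intro has_integral_combine[of "- h" 0 h]) auto
  also have "(P 1 0 - P 1 (- h)) + (P (- 1) h - P (- 1) 0) = cos c * fejer h v"
  proof (cases "v = 0")
    case False
    have "(P 1 0 - P 1 (- h)) + (P (- 1) h - P (- 1) 0) =
        (2 * cos c - cos (h * v + c) - cos (c - h * v)) / v\<^sup>2"
      using False by (simp add: P_def diff_divide_distrib add_divide_distrib)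
    also have "\<dots> = cos c * (2 * (1 - cos (h * v))) / v\<^sup>2"
      by (simp add: cos_add cos_diff algebra_simps)
    finally show ?thesis using False by (simp add: fejer_altdef)
  qed (simp add: P_def fejer_0 power2_eq_square algebra_simps)
  finally show ?thesis .
qed

lemma has_integral_tri_mult_cos:
  assumes "h \<ge> 0"
  shows "((\<lambda>\<alpha>. tri h (\<alpha> - \<beta>) * cos (\<alpha> * v + c)) has_integral cos (\<beta> * v + c) * fejer h v)
    {\<beta> - h..\<beta> + h}"
proof -
  have "((\<lambda>x. tri h x * cos (x * v + (\<beta> * v + c))) has_integral cos (\<beta> * v + c) * fejer h v) (cbox (- h) h)"
    using has_integral_tri_mult_cos_centered[OF assms, of v "\<beta> * v + c"] by simp
  from has_integral_affinity'[OF this, of 1 "- \<beta>"] show ?thesis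
    by (simp add: algebra_simps)
qed

lemma has_integral_tri_mult_cis:
  assumes "h \<ge> 0"
  shows "((\<lambda>y. of_real (tri h y) * cis (y * v)) has_integral of_real (fejer h v)) {- h..h}"
proof -
  have "((\<lambda>y. of_real (tri h y * cos (y * v + 0)) + \<i> * of_real (tri h y * cos (y * v + (- pi / 2))))
      has_integral of_real (cos 0 * fejer h v) + \<i> * of_real (cos (- pi / 2) * fejer h v)) {- h..h}"
    by (intro has_integral_add has_integral_mult_right has_integral_of_real
          has_integral_tri_mult_cos_centered assms)
  moreover have "cos (y * v + (- pi / 2)) = sin (y * v)" for y
    by (simp add: cos_diff)
  ultimately show ?thesis
    by (simp add: complex_eq_iff algebra_simps cis.code Complex_eq)
qed

lemma tri_avg_cos_sum:
  fixes g :: "'a \<Rightarrow> real" and A :: "'a \<Rightarrow> 'a \<Rightarrow> real"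
  assumes "finite Z" "h \<ge> 0"
  shows "tri_avg h \<beta> (\<lambda>\<alpha>. \<Sum>p\<in>Z. \<Sum>q\<in>Z. A p q * cos (\<alpha> * (g p - g q))) =
     (\<Sum>p\<in>Z. \<Sum>q\<in>Z. A p q * (cos (\<beta> * (g p - g q)) * fejer h (g p - g q)))"
proof -
  have "((\<lambda>\<alpha>. \<Sum>p\<in>Z. \<Sum>q\<in>Z. A p q * (tri h (\<alpha> - \<beta>) * cos (\<alpha> * (g p - g q) + 0))) has_integral
     (\<Sum>p\<in>Z. \<Sum>q\<in>Z. A p q * (cos (\<beta> * (g p - g q) + 0) * fejer h (g p - g q)))) {\<beta> - h..\<beta> + h}"
    by (intro has_integral_sum has_integral_mult_right has_integral_tri_mult_cos assms)
  then show ?thesis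
    unfolding tri_avg_def by (simp add: integral_unique sum_distrib_left mult_ac)
qed

lemma norm_cis_sum_squared:
  fixes g m :: "'a \<Rightarrow> real"
  shows "(norm (\<Sum>p\<in>Z. of_real (m p) * cis (\<alpha> * g p)))\<^sup>2 =
    (\<Sum>p\<in>Z. \<Sum>q\<in>Z. m p * m q * cos (\<alpha> * (g p - g q)))"
proof -
  have "(norm (\<Sum>p\<in>Z. of_real (m p) * cis (\<alpha> * g p)))\<^sup>2 =
     (\<Sum>p\<in>Z. m p * cos (\<alpha> * g p))\<^sup>2 + (\<Sum>p\<in>Z. m p * sin (\<alpha> * g p))\<^sup>2"
    by (simp add: cmod_power2 Re_sum Im_sum)
  also have "\<dots> = (\<Sum>p\<in>Z. \<Sum>q\<in>Z. m p * cos (\<alpha> * g p) * (m q * cos (\<alpha> * g q))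
      + m p * sin (\<alpha> * g p) * (m q * sin (\<alpha> * g q)))"
    by (simp add: power2_eq_square sum_product sum.distrib)
  also have "\<dots> = (\<Sum>p\<in>Z. \<Sum>q\<in>Z. m p * m q * cos (\<alpha> * (g p - g q)))"
    by (intro sum.cong refl) (simp add: right_diff_distrib cos_diff algebra_simps)
  finally show ?thesis .
qed

lemma tri_avg_weighted_cos_sum_bounds:
  fixes g m :: "'a \<Rightarrow> real" and W :: "'a \<Rightarrow> 'a \<Rightarrow> real"
  assumes "finite Z" "h \<ge> 0" and m_nonneg: "\<And>p. p \<in> Z \<Longrightarrow> m p \<ge> 0"
    and W_nonneg: "\<And>p q. 0 \<le> W p q" and W_le_1: "\<And>p q. W p q \<le> 1" and W_diag: "\<And>p. W p p = 1"
  defines "G \<equiv> \<lambda>\<alpha>. \<Sum>p\<in>Z. \<Sum>q\<in>Z. m p * m q * W p q * cos (\<alpha> * (g p - g q))"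
    and "M \<equiv> tri_avg h 0 (\<lambda>\<alpha>. (norm (\<Sum>p\<in>Z. of_real (m p) * cis (\<alpha> * g p)))\<^sup>2)"
  shows "tri_avg h \<beta> G \<le> M" and "2 * h\<^sup>2 * (\<Sum>p\<in>Z. (m p)\<^sup>2) - M \<le> tri_avg h \<beta> G"
proof -
  define mass where "mass p q = m p * m q * fejer h (g p - g q)" for p q
  define phase where "phase p q = W p q * cos (\<beta> * (g p - g q))" for p q
  have avg_G: "tri_avg h \<beta> G = (\<Sum>p\<in>Z. \<Sum>q\<in>Z. phase p q * mass p q)"
    unfolding G_def by (subst tri_avg_cos_sum[OF assms(1,2)]) (simp add: phase_def mass_def mult_ac)
  have M_eq: "M = (\<Sum>p\<in>Z. \<Sum>q\<in>Z. mass p q)"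
    unfolding M_def norm_cis_sum_squared by (subst tri_avg_cos_sum[OF assms(1,2)]) (simp add: mass_def)
  have phase_le: "\<bar>phase p q\<bar> \<le> 1" for p q
    unfolding phase_def abs_mult
    using W_nonneg[of p q] W_le_1[of p q] mult_mono[of "\<bar>W p q\<bar>" 1 "\<bar>cos (\<beta> * (g p - g q))\<bar>" 1] by simp
  have mass_nonneg: "0 \<le> mass p q" if "p \<in> Z" "q \<in> Z" for p q
    using m_nonneg that fejer_nonneg by (simp add: mass_def)
  show "tri_avg h \<beta> G \<le> M"
    unfolding avg_G M_eq
  proof (intro sum_mono)
    fix p q assume "p \<in> Z" "q \<in> Z"
    then show "phase p q * mass p q \<le> mass p q"
      using mult_right_mono[OF order_trans[OF abs_ge_self phase_le] mass_nonneg] by simp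
  qed
  have "2 * h\<^sup>2 * (\<Sum>p\<in>Z. (m p)\<^sup>2) = (\<Sum>p\<in>Z. \<Sum>q\<in>Z. if p = q then 2 * mass p q else 0)"
    using assms(1) by (simp add: sum_distrib_left mass_def fejer_0 power2_eq_square mult_ac)
  also have "\<dots> \<le> (\<Sum>p\<in>Z. \<Sum>q\<in>Z. phase p q * mass p q + mass p q)"
  proof (intro sum_mono)
    fix p q assume "p \<in> Z" "q \<in> Z"
    then have "0 \<le> (phase p q + 1) * mass p q"
      using phase_le[of p q] mass_nonneg by (simp add: abs_le_iff)
    moreover have "phase p p = 1" by (simp add: phase_def W_diag)
    ultimately show "(if p = q then 2 * mass p q else 0) \<le> phase p q * mass p q + mass p q"
      by (auto simp: distrib_right)
  qed
  finally show "2 * h\<^sup>2 * (\<Sum>p\<in>Z. (m p)\<^sup>2) - M \<le> tri_avg h \<beta> G"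
    unfolding avg_G M_eq sum.distrib by simp
qed

lemma has_integral_fejer:
  assumes "a \<le> b"
  shows "(fejer h has_integral (2 * h * Si (h * b) - 2 * (1 - cos (h * b)) / b) -
    (2 * h * Si (h * a) - 2 * (1 - cos (h * a)) / a)) {a..b}"
proof (rule fundamental_theorem_of_calculus_strong[where S = "{0}"])
  define \<Phi> where "\<Phi> v = 2 * h * Si (h * v) - 2 * (1 - cos (h * v)) / v" for v
  have "\<Phi> v = 2 * h * Si (h * v) - v * fejer h v" for v
    by (cases "v = 0") (simp_all add: \<Phi>_def fejer_altdef power2_eq_square)
  moreover have "continuous_on {a..b} (\<lambda>v. 2 * h * Si (h * v) - v * fejer h v)"
    by (intro continuous_intros continuous_at_imp_continuous_on ballI
          continuous_within_compose3[OF isCont_Si])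
  ultimately show "continuous_on {a..b} (\<lambda>v. 2 * h * Si (h * v) - 2 * (1 - cos (h * v)) / v)"
    by (simp add: \<Phi>_def)
  fix v assume "v \<in> {a..b} - {0}"
  then have "v \<noteq> 0" by simp
  then have "h * sinc (h * v) = sin (h * v) / v" by simp
  then show "((\<lambda>v. 2 * h * Si (h * v) - 2 * (1 - cos (h * v)) / v) has_vector_derivative fejer h v) (at v)"
    unfolding has_real_derivative_iff_has_vector_derivative[symmetric] fejer_altdef[OF \<open>v \<noteq> 0\<close>]
    using \<open>v \<noteq> 0\<close>
    by (auto intro!: derivative_eq_intros DERIV_chain2[OF DERIV_Si] simp: field_simps power2_eq_square)
qed (use assms in auto)

lemma integral_fejer_le:
  assumes "h > 0"
  shows "integral {a..b} (fejer h) \<le> 2 * pi * h"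
proof (rule tendsto_lowerbound)
  have "filterlim (\<lambda>X. h * X) at_top at_top"
    using assms by (intro filterlim_tendsto_pos_mult_at_top[OF tendsto_const _ filterlim_ident])
  then have "((\<lambda>X. 4 * h * Si (h * X)) \<longlongrightarrow> 4 * h * (pi / 2)) at_top"
    by (intro tendsto_intros filterlim_compose[OF Si_at_top])
  then show "((\<lambda>X. 4 * h * Si (h * X)) \<longlongrightarrow> 2 * pi * h) at_top" by (simp add: mult_ac)
  show "eventually (\<lambda>X. integral {a..b} (fejer h) \<le> 4 * h * Si (h * X)) at_top"
    using eventually_ge_at_top[of "\<bar>a\<bar> + \<bar>b\<bar>"] eventually_gt_at_top[of 0]
  proof eventually_elim
    case (elim X)
    have "integral {a..b} (fejer h) \<le> integral {- X..X} (fejer h)"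
      using elim fejer_nonneg
      by (intro integral_subset_le integrable_continuous_interval continuous_intros) auto
    also have "\<dots> = 4 * h * Si (h * X) - 4 * (1 - cos (h * X)) / X"
      using has_integral_fejer[of "- X" X h] elim assms Si_neg[of "h * X"]
      by (simp add: integral_unique diff_divide_distrib)
    also have "\<dots> \<le> 4 * h * Si (h * X)" using elim by simp
    finally show ?case .
  qed
qed simp

lemma integral_translated_fejer_le:
  assumes "h > 0"
  shows "integral {a..b} (\<lambda>u. fejer h (t - u)) \<le> 2 * pi * h"
proof -
  have "(fejer h has_integral integral {a - t..b - t} (fejer h)) (cbox (a - t) (b - t))"
    by (auto intro!: integrable_integral integrable_continuous_interval continuous_intros)
  from has_integral_affinity'[OF this, of 1 "- t"]
  have "integral {a..b} (\<lambda>u. fejer h (u - t)) = integral {a - t..b - t} (fejer h)"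
    by (simp add: integral_unique)
  moreover have "fejer h (t - u) = fejer h (u - t)" for u
    using fejer_minus[of h "t - u"] by simp
  ultimately show ?thesis using integral_fejer_le[OF assms] by simp
qed


section \<open>Bessel's inequality for Fourier integrals\<close>

definition fourier_integral :: "real \<Rightarrow> real \<Rightarrow> (real \<Rightarrow> complex) \<Rightarrow> real \<Rightarrow> complex" where
  "fourier_integral a b f y = integral {a..b} (\<lambda>t. f t * cis (y * t))"

lemma continuous_on_cis_compose [continuous_intros]:
  "continuous_on A f \<Longrightarrow> continuous_on A (\<lambda>t. cis (f t))"
  unfolding cis_conv_exp by (intro continuous_intros)

lemma continuous_on_fourier_integral [continuous_intros]:
  assumes "continuous_on {a..b} f" "continuous_on A g"
  shows "continuous_on A (\<lambda>x. fourier_integral a b f (g x))"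
proof -
  have "continuous_on UNIV (fourier_integral a b f)"
    unfolding fourier_integral_def interval_cbox
    by (rule integral_continuous_on_param)
       (auto simp: case_prod_unfold intro!: continuous_intros continuous_on_compose2[OF assms(1)])
  then show ?thesis by (rule continuous_on_compose2[OF _ assms(2)]) auto
qed

lemma norm_fourier_integral_squared:
  "of_real ((norm (fourier_integral a b f y))\<^sup>2) =
    integral {a..b} (\<lambda>t. integral {a..b} (\<lambda>u. f t * cnj (f u) * cis (y * (t - u))))"
proof -
  have phase: "f t * cis (y * t) * cnj (f u * cis (y * u)) = f t * cnj (f u) * cis (y * (t - u))" for t u
  proof -
    have "cis (y * t) * cis (- (y * u)) = cis (y * (t - u))"
      by (simp add: cis_mult right_diff_distrib)
    then show ?thesis by (simp add: cis_cnj mult_ac)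
  qed
  have "of_real ((norm (fourier_integral a b f y))\<^sup>2) =
      integral {a..b} (\<lambda>t. f t * cis (y * t)) * integral {a..b} (\<lambda>u. cnj (f u * cis (y * u)))"
    unfolding complex_norm_square fourier_integral_def by (simp only: integral_cnj)
  also have "\<dots> = integral {a..b} (\<lambda>t. integral {a..b} (\<lambda>u. f t * cis (y * t) * cnj (f u * cis (y * u))))"
    by (simp only: integral_mult_left[symmetric] integral_mult_right)
  finally show ?thesis by (simp only: phase)
qed

lemma integral_swap_continuous_inwards:
  fixes \<Phi> :: "real \<Rightarrow> real \<Rightarrow> real \<Rightarrow> 'a::banach"
  assumes cont: "continuous_on (({c..d} \<times> {a..b}) \<times> {a'..b'}) (\<lambda>(p, u). \<Phi> (fst p) (snd p) u)"
  shows "integral {c..d} (\<lambda>y. integral {a..b} (\<lambda>t. integral {a'..b'} (\<Phi> y t))) =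
    integral {a..b} (\<lambda>t. integral {a'..b'} (\<lambda>u. integral {c..d} (\<lambda>y. \<Phi> y t u)))"
proof -
  have "continuous_on ({c..d} \<times> {a..b}) (\<lambda>p. integral {a'..b'} (\<Phi> (fst p) (snd p)))"
    using cont unfolding interval_cbox[of a' b'] by (intro integral_continuous_on_param) simp
  then have "integral {c..d} (\<lambda>y. integral {a..b} (\<lambda>t. integral {a'..b'} (\<Phi> y t))) =
      integral {a..b} (\<lambda>t. integral {c..d} (\<lambda>y. integral {a'..b'} (\<Phi> y t)))"
    using integral_swap_continuous[of c a d b "\<lambda>y t. integral {a'..b'} (\<Phi> y t)"]
    by (simp add: case_prod_unfold cbox_Pair_eq)
  also have "\<dots> = integral {a..b} (\<lambda>t. integral {a'..b'} (\<lambda>u. integral {c..d} (\<lambda>y. \<Phi> y t u)))"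
  proof (rule Henstock_Kurzweil_Integration.integral_cong)
    fix t assume "t \<in> {a..b}"
    then have "continuous_on ({c..d} \<times> {a'..b'}) (\<lambda>(y, u). \<Phi> y t u)"
      unfolding case_prod_unfold
      by (intro continuous_on_compose2[OF cont, of _ "\<lambda>q. ((fst q, t), snd q)", simplified] continuous_intros) auto
    then show "integral {c..d} (\<lambda>y. integral {a'..b'} (\<Phi> y t)) =
        integral {a'..b'} (\<lambda>u. integral {c..d} (\<lambda>y. \<Phi> y t u))"
      using integral_swap_continuous[of c a' d b' "\<lambda>y u. \<Phi> y t u"] by (simp add: cbox_Pair_eq)
  qed
  finally show ?thesis .
qed

lemma tri_avg_norm_fourier_integral_squared:
  fixes f :: "real \<Rightarrow> complex"
  assumes f_cont: "continuous_on {a..b} f" and "h \<ge> 0"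
  shows "of_real (tri_avg h 0 (\<lambda>y. (norm (fourier_integral a b f y))\<^sup>2)) =
    integral {a..b} (\<lambda>t. integral {a..b} (\<lambda>u. f t * cnj (f u) * of_real (fejer h (t - u))))"
proof -
  define \<Phi> where "\<Phi> y t u = f t * cnj (f u) * (of_real (tri h y) * cis (y * (t - u)))" for y t u
  have "of_real (tri_avg h 0 (\<lambda>y. (norm (fourier_integral a b f y))\<^sup>2)) =
      integral {- h..h} (\<lambda>y. complex_of_real (tri h y * (norm (fourier_integral a b f y))\<^sup>2))"
  proof -
    have "(\<lambda>y. tri h y * (norm (fourier_integral a b f y))\<^sup>2) integrable_on {- h..h}"
      by (intro integrable_continuous_interval continuous_intros f_cont)
    from integral_linear[OF this bounded_linear_of_real[where 'a = complex]] show ?thesis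
      by (simp add: tri_avg_def o_def)
  qed
  also have "\<dots> = integral {- h..h} (\<lambda>y. integral {a..b} (\<lambda>t. integral {a..b} (\<Phi> y t)))"
    unfolding of_real_mult norm_fourier_integral_squared integral_mult_right[symmetric] \<Phi>_def
    by (simp only: mult.left_commute)
  also have "\<dots> = integral {a..b} (\<lambda>t. integral {a..b} (\<lambda>u. integral {- h..h} (\<lambda>y. \<Phi> y t u)))"
    unfolding \<Phi>_def
    by (intro integral_swap_continuous_inwards)
       (auto simp: case_prod_unfold intro!: continuous_intros continuous_on_compose2[OF f_cont])
  finally show ?thesis
    unfolding \<Phi>_def integral_mult_right
    by (simp only: integral_unique[OF has_integral_tri_mult_cis[OF \<open>h \<ge> 0\<close>]])
qed

lemma integral_mult_kernel_le:
  fixes g :: "real \<Rightarrow> real" and k :: "real \<Rightarrow> real \<Rightarrow> real"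
  assumes g_cont: "continuous_on {a..b} g" and g_nonneg: "\<And>t. g t \<ge> 0"
    and k_cont: "continuous_on UNIV (\<lambda>(t, u). k t u)" and k_le: "\<And>t. integral {a..b} (k t) \<le> B"
  shows "integral {a..b} (\<lambda>t. integral {a..b} (\<lambda>u. g t * k t u)) \<le> B * integral {a..b} g"
proof -
  have "continuous_on {a..b} (\<lambda>t. integral {a..b} (k t))"
    unfolding interval_cbox[of a b]
    by (rule integral_continuous_on_param) (use continuous_on_subset[OF k_cont] in blast)
  then have "integral {a..b} (\<lambda>t. g t * integral {a..b} (k t)) \<le> integral {a..b} (\<lambda>t. g t * B)"
    using g_cont g_nonneg k_le
    by (intro integral_le integrable_continuous_interval continuous_intros mult_left_mono) auto
  then show ?thesis by (simp add: mult.commute)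
qed

lemma schur_test_symmetric_kernel:
  fixes f :: "real \<Rightarrow> complex" and k :: "real \<Rightarrow> real \<Rightarrow> real"
  assumes f_cont: "continuous_on {a..b} f" and k_cont: "continuous_on UNIV (\<lambda>(t, u). k t u)"
    and k_nonneg: "\<And>t u. k t u \<ge> 0" and k_sym: "\<And>t u. k t u = k u t"
    and k_le: "\<And>t. integral {a..b} (k t) \<le> B"
  shows "norm (integral {a..b} (\<lambda>t. integral {a..b} (\<lambda>u. f t * cnj (f u) * of_real (k t u))))
    \<le> B * integral {a..b} (\<lambda>t. (norm (f t))\<^sup>2)"
proof -
  define g where "g t = (norm (f t))\<^sup>2 / 2" for t
  define J where "J = integral {a..b} (\<lambda>t. integral {a..b} (\<lambda>u. g t * k t u))"
  have g_cont: "continuous_on {a..b} g" unfolding g_def by (intro continuous_intros f_cont) auto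
  have k_compose: "continuous_on A (\<lambda>x. k (p x) (q x))"
    if "continuous_on A p" "continuous_on A q" for A :: "'b::topological_space set" and p q
    using continuous_on_compose2[OF k_cont continuous_on_Pair[OF that]] by simp
  note integrable = integrable_continuous_interval continuous_intros k_compose
    continuous_on_compose2[OF f_cont] continuous_on_compose2[OF g_cont]
  have param_cont: "continuous_on {a..b} (\<lambda>t. integral {a..b} (\<phi> t))"
    if "continuous_on ({a..b} \<times> {a..b}) (\<lambda>(t, u). \<phi> t u)" for \<phi> :: "real \<Rightarrow> real \<Rightarrow> 'c::banach"
    unfolding interval_cbox[of a b] by (rule integral_continuous_on_param) (use that in simp)
  have "norm (integral {a..b} (\<lambda>t. integral {a..b} (\<lambda>u. f t * cnj (f u) * of_real (k t u))))
      \<le> integral {a..b} (\<lambda>t. integral {a..b} (\<lambda>u. g t * k t u + g u * k t u))"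
  proof (intro integral_norm_bound_integral)
    fix t u
    have "norm (f t) * norm (f u) * k t u \<le> (g t + g u) * k t u"
      using sum_squares_bound[of "norm (f t)" "norm (f u)"] k_nonneg
      by (intro mult_right_mono) (auto simp: g_def)
    then show "norm (f t * cnj (f u) * of_real (k t u)) \<le> g t * k t u + g u * k t u"
      using k_nonneg by (simp add: norm_mult distrib_right)
  qed (auto simp: case_prod_unfold intro!: integrable param_cont)
  also have "\<dots> = integral {a..b} (\<lambda>t. integral {a..b} (\<lambda>u. g t * k t u) + integral {a..b} (\<lambda>u. g u * k t u))"
    by (intro Henstock_Kurzweil_Integration.integral_cong Henstock_Kurzweil_Integration.integral_add)
       (auto intro!: integrable)
  also have "\<dots> = J + integral {a..b} (\<lambda>t. integral {a..b} (\<lambda>u. g u * k t u))"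
    unfolding J_def by (intro Henstock_Kurzweil_Integration.integral_add)
       (auto simp: case_prod_unfold intro!: integrable param_cont)
  also have "integral {a..b} (\<lambda>t. integral {a..b} (\<lambda>u. g u * k t u)) = J"
  proof -
    have "continuous_on (cbox (a, a) (b, b)) (\<lambda>(t, u). g u * k t u)"
      unfolding cbox_Pair_eq case_prod_unfold by (auto intro!: integrable)
    from integral_swap_continuous[OF this] show ?thesis unfolding J_def by (simp only: box_real k_sym)
  qed
  also have "J \<le> B * integral {a..b} g"
    unfolding J_def by (rule integral_mult_kernel_le[OF g_cont _ k_cont k_le]) (simp add: g_def)
  finally show ?thesis by (simp add: g_def[abs_def])
qed

theorem bessel_inequality:
  fixes f :: "real \<Rightarrow> complex"
  assumes f_cont: "continuous_on {a..b} f"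
  shows "integral {-M..M} (\<lambda>y. (norm (fourier_integral a b f y))\<^sup>2) \<le> 2 * pi * integral {a..b} (\<lambda>t. (norm (f t))\<^sup>2)"
proof (rule tendsto_upperbound)
  define H where "H y = (norm (fourier_integral a b f y))\<^sup>2" for y
  define energy where "energy = integral {a..b} (\<lambda>t. (norm (f t))\<^sup>2)"
  have H_cont: "continuous_on A H" for A
    unfolding H_def by (intro continuous_intros f_cont)
  have "((\<lambda>N. (1 - M * (1 / N)) * integral {-M..M} H) \<longlongrightarrow> (1 - M * 0) * integral {-M..M} H) at_top"
    by (intro tendsto_intros) real_asymp
  then show "((\<lambda>N. (1 - M * (1 / N)) * integral {-M..M} H) \<longlongrightarrow> integral {-M..M} (\<lambda>y. (norm (fourier_integral a b f y))\<^sup>2)) at_top"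
    by (simp add: H_def[abs_def])
  show "eventually (\<lambda>N. (1 - M * (1 / N)) * integral {-M..M} H \<le> 2 * pi * energy) at_top"
    using eventually_gt_at_top[of 0] eventually_ge_at_top[of M]
  proof eventually_elim
    case (elim N)
    have "N * ((1 - M * (1 / N)) * integral {-M..M} H) = (N - M) * integral {-M..M} H"
      using elim by (simp add: field_simps)
    also have "\<dots> \<le> tri_avg N 0 H"
      using elim by (intro integral_le_tri_avg_0 H_cont) (auto simp: H_def)
    also have "\<dots> \<le> norm (complex_of_real (tri_avg N 0 H))" by simp
    also have "\<dots> = norm (integral {a..b} (\<lambda>t. integral {a..b} (\<lambda>u. f t * cnj (f u) * of_real (fejer N (t - u)))))"
      unfolding H_def using elim by (subst tri_avg_norm_fourier_integral_squared[OF f_cont]) auto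
    also have "\<dots> \<le> 2 * pi * N * energy"
      unfolding energy_def
    proof (rule schur_test_symmetric_kernel[OF f_cont])
      show "fejer N (t - u) = fejer N (u - t)" for t u
        using fejer_minus[of N "t - u"] by simp
    qed (use elim integral_translated_fejer_le in
          \<open>auto simp: case_prod_unfold fejer_nonneg intro!: continuous_intros\<close>)
    finally show ?case using elim by (simp add: mult.assoc mult.left_commute[of _ N])
  qed
qed simp

section \<open>Sums over prime powers\<close>

lemma sum_mangoldt_mult_div:
  fixes N :: nat
  shows "(\<Sum>d=1..N. mangoldt d * real (N div d)) = ln (fact N)"
proof -
  have card_multiples: "card {n\<in>{1..N}. d dvd n} = N div d" if "d \<in> {1..N}" for d
  proof -
    have "{n\<in>{1..N}. d dvd n} = (\<lambda>k. d * k) ` {1..N div d}"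
    proof (intro equalityI subsetI)
      fix n assume n_multiple: "n \<in> {n\<in>{1..N}. d dvd n}"
      then obtain k where n_eq: "n = d * k" by auto
      with n_multiple that have "k \<in> {1..N div d}"
        by (auto simp: less_eq_div_iff_mult_less_eq mult.commute Suc_le_eq intro!: Nat.gr0I)
      then show "n \<in> (\<lambda>k. d * k) ` {1..N div d}" using n_eq by auto
    next
      fix n assume "n \<in> (\<lambda>k. d * k) ` {1..N div d}"
      then show "n \<in> {n\<in>{1..N}. d dvd n}"
        using that by (auto simp: less_eq_div_iff_mult_less_eq mult.commute Suc_le_eq)
    qed
    moreover have "inj_on (\<lambda>k. d * k) {1..N div d}" using that by (auto simp: inj_on_def)
    ultimately show ?thesis by (simp add: card_image)
  qed
  have "ln (fact N :: real) = (\<Sum>n=1..N. ln (real n))"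
    unfolding fact_prod of_nat_prod by (subst ln_prod) auto
  also have "\<dots> = (\<Sum>n=1..N. \<Sum>d | d dvd n. mangoldt d)"
    by (intro sum.cong refl) (subst mangoldt_sum, auto)
  also have "\<dots> = (\<Sum>n=1..N. \<Sum>d | d \<in> {1..N} \<and> d dvd n. mangoldt d)"
  proof (intro sum.cong refl Collect_cong)
    fix n d assume n_range: "n \<in> {1..N}"
    have "d \<le> n" "d \<noteq> 0" if "d dvd n" using that n_range by (auto dest: dvd_imp_le)
    then show "d dvd n \<longleftrightarrow> d \<in> {1..N} \<and> d dvd n" using n_range by auto
  qed
  also have "\<dots> = (\<Sum>d=1..N. \<Sum>n | n \<in> {1..N} \<and> d dvd n. mangoldt d)"
    by (rule sum.swap_restrict) auto
  also have "\<dots> = (\<Sum>d=1..N. mangoldt d * real (N div d))"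
    using card_multiples by (intro sum.cong refl) (simp add: mult.commute)
  finally show ?thesis ..
qed

lemma sum_mangoldt_dyadic_le: "(\<Sum>d=Suc m..2*m. mangoldt d) \<le> 2 * real m * ln 2"
proof -
  have floor_le: "2 * real (m div d) \<le> real (2 * m div d)" if "d \<ge> 1" for d
  proof -
    have "2 * (m div d) \<le> 2 * m div d"
      using that by (subst less_eq_div_iff_mult_less_eq) (auto simp: mult.assoc)
    then show ?thesis by (metis of_nat_le_iff of_nat_mult of_nat_numeral)
  qed
  have "(\<Sum>d=Suc m..2*m. mangoldt d) \<le> (\<Sum>d=Suc m..2*m. mangoldt d * (real (2 * m div d) - 2 * real (m div d)))"
  proof (intro sum_mono)
    fix d assume "d \<in> {Suc m..2*m}"
    then have "m div d = 0" "2 * m div d \<ge> 1" by (auto simp: less_eq_div_iff_mult_less_eq)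
    then show "mangoldt d \<le> (mangoldt d * (real (2 * m div d) - 2 * real (m div d)) :: real)"
      using mangoldt_nonneg[of d] by (simp add: mult_le_cancel_left1)
  qed
  also have "\<dots> \<le> (\<Sum>d=1..2*m. mangoldt d * (real (2 * m div d) - 2 * real (m div d)))"
    using floor_le mangoldt_nonneg by (intro sum_mono2) auto
  also have "\<dots> = (\<Sum>d=1..2*m. mangoldt d * real (2 * m div d)) - 2 * (\<Sum>d=1..2*m. mangoldt d * real (m div d))"
    by (simp add: algebra_simps sum_subtractf sum_distrib_left)
  also have "(\<Sum>d=1..2*m. mangoldt d * real (m div d)) = (\<Sum>d=1..m. mangoldt d * real (m div d))"
    by (rule sum.mono_neutral_right) auto
  also have "(\<Sum>d=1..2*m. mangoldt d * real (2 * m div d)) - 2 * (\<Sum>d=1..m. mangoldt d * real (m div d))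
      = ln (real (2 * m choose m))"
  proof -
    have "real (2 * m choose m) = fact (2 * m) / (fact m * fact m)"
      using binomial_fact[of m "2 * m", where 'a = real] by (simp add: mult_2)
    then show ?thesis by (simp only: sum_mangoldt_mult_div ln_div ln_mult) (simp del: fact_Suc)
  qed
  also have "\<dots> \<le> ln (2 ^ (2 * m))"
  proof -
    have "real (2 * m choose m) \<le> real (2 ^ (2 * m))"
      using binomial_le_pow2[of "2 * m" m] by (simp only: of_nat_le_iff)
    moreover have "0 < real (2 * m choose m)" by (simp add: zero_less_binomial_iff)
    ultimately show ?thesis by (subst ln_le_cancel_iff) simp_all
  qed
  also have "\<dots> = 2 * real m * ln 2" by (simp add: ln_realpow)
  finally show ?thesis .
qed

lemma sum_mangoldt_le: "(\<Sum>d=1..N. mangoldt d) \<le> 4 * real N"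
proof (induction N rule: less_induct)
  case (less N)
  show ?case
  proof (cases "N = 0")
    case False
    define m where "m = N div 2"
    have N_cases: "N = 2 * m \<or> N = Suc (2 * m)" unfolding m_def by linarith
    have lower_half: "(\<Sum>d=1..m. mangoldt d) \<le> 4 * real m"
      using False by (intro less.IH) (auto simp: m_def)
    have "mangoldt (Suc (2 * m)) \<le> ln (real (Suc (2 * m)))" by (rule mangoldt_le) simp
    then have "(\<Sum>d=1..N. mangoldt d) \<le> (\<Sum>d=1..2*m. mangoldt d) + ln (real N)"
      using False N_cases by auto
    also have "{1..2*m} = {1..m} \<union> {Suc m..2*m}" by auto
    also have "(\<Sum>d\<in>{1..m} \<union> {Suc m..2*m}. mangoldt d :: real) = (\<Sum>d=1..m. mangoldt d) + (\<Sum>d=Suc m..2*m. mangoldt d)"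
      by (rule sum.union_disjoint) auto
    also have "\<dots> + ln (real N) \<le> 4 * real m + 2 * real m * ln 2 + (real N - 1)"
      using lower_half sum_mangoldt_dyadic_le[of m] ln_le_minus_one[of "real N"] False by simp
    also have "\<dots> \<le> 4 * real m + 2 * real m * 1 + real N"
      using ln_2_less_1 by (intro add_mono mult_left_mono) auto
    also have "\<dots> \<le> 4 * real N" using N_cases by auto
    finally show ?thesis by simp
  qed simp
qed

lemma ln_fact_ge: "N \<ge> 1 \<Longrightarrow> real N * ln (real N) - real N \<le> ln (fact N)"
proof (induction N rule: nat_induct_at_least)
  case (Suc n)
  have "real n * (ln (real (Suc n)) - ln (real n)) \<le> 1"
  proof -
    have "ln (real (Suc n)) - ln (real n) = ln (1 + 1 / real n)"
      using Suc.hyps by (subst ln_divide_pos[symmetric]) (auto simp: field_simps)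
    also have "\<dots> \<le> 1 / real n" using ln_add_one_self_le_self[of "1 / real n"] by simp
    finally show ?thesis using Suc by (simp add: field_simps)
  qed
  moreover have "ln (fact (Suc n) :: real) = ln (real (Suc n)) + ln (fact n)"
    by (simp add: ln_mult)
  ultimately show ?case using Suc.IH by (simp add: algebra_simps)
qed simp

lemma ln_fact_le:
  assumes "N \<ge> 1" shows "ln (fact N) \<le> real N * ln (real N)"
proof -
  have "ln (fact N :: real) \<le> ln (real N ^ N)"
    using assms fact_le_power[of N, where 'a = real] by (subst ln_le_cancel_iff) auto
  then show ?thesis using assms by (simp add: ln_realpow)
qed

lemma ln_le_iff_le_exp: "0 < x \<Longrightarrow> ln x \<le> v \<longleftrightarrow> x \<le> exp (v::real)"
  by (metis exp_le_cancel_iff exp_ln)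

lemma mertens_sum_mangoldt:
  assumes "N \<ge> 1"
  shows "(\<Sum>d=1..N. mangoldt d / real d) \<le> ln (real N) + 4"
    and "ln (real N) - 1 \<le> (\<Sum>d=1..N. mangoldt d / real d)"
proof -
  have "real N * (\<Sum>d=1..N. mangoldt d / real d) - (\<Sum>d=1..N. mangoldt d)
      = (\<Sum>d=1..N. mangoldt d * (real N / real d - 1))"
    by (simp add: algebra_simps sum_subtractf sum_distrib_left)
  also have "\<dots> \<le> (\<Sum>d=1..N. mangoldt d * real (N div d))"
  proof (intro sum_mono mult_left_mono mangoldt_nonneg)
    fix d assume d_range: "d \<in> {1..N}"
    have "real N / real d < real (N div d) + 1"
      using d_range floor_divide_of_nat_eq[of N d, where 'a = real] floor_correct[of "real N / real d"] by simp
    then show "real N / real d - 1 \<le> real (N div d)" by simp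
  qed
  also have "\<dots> \<le> real N * ln (real N)"
    unfolding sum_mangoldt_mult_div using assms by (rule ln_fact_le)
  finally have "real N * (\<Sum>d=1..N. mangoldt d / real d) \<le> real N * (ln (real N) + 4)"
    using sum_mangoldt_le[of N] by (simp add: algebra_simps)
  then show "(\<Sum>d=1..N. mangoldt d / real d) \<le> ln (real N) + 4"
    using assms by simp
  have "real N * (ln (real N) - 1) \<le> ln (fact N)"
    using ln_fact_ge[OF assms] by (simp add: algebra_simps)
  also have "\<dots> = (\<Sum>d=1..N. mangoldt d * real (N div d))"
    by (simp only: sum_mangoldt_mult_div)
  also have "\<dots> \<le> (\<Sum>d=1..N. mangoldt d * (real N / real d))"
    by (intro sum_mono mult_left_mono mangoldt_nonneg of_nat_div_le_of_nat)
  also have "\<dots> = real N * (\<Sum>d=1..N. mangoldt d / real d)"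
    by (simp add: sum_distrib_left mult_ac)
  finally show "ln (real N) - 1 \<le> (\<Sum>d=1..N. mangoldt d / real d)"
    using assms by simp
qed

lemma Collect_ln_le: "{n::nat. 1 \<le> n \<and> ln (real n) \<le> v} = {1..nat \<lfloor>exp v\<rfloor>}"
proof -
  have "ln (real n) \<le> v \<longleftrightarrow> n \<le> nat \<lfloor>exp v\<rfloor>" if "n \<ge> 1" for n
    using that by (subst ln_le_iff_le_exp) (auto simp: le_nat_iff le_floor_iff)
  then show ?thesis by auto
qed

lemma sum_mangoldt_over_ln_le_bound:
  assumes "v \<ge> 0"
  shows "\<bar>(\<Sum>n | 1 \<le> n \<and> ln (real n) \<le> v. mangoldt n / real n) - v\<bar> \<le> 4"
proof -
  define N where "N = nat \<lfloor>exp v\<rfloor>"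
  have "exp v \<ge> 1" using assms by simp
  then have N: "real N \<le> exp v" "exp v < real N + 1" "N \<ge> 1"
    unfolding N_def by linarith+
  have "ln (real N) \<le> v" using N by (subst ln_le_iff_le_exp) auto
  moreover have "v - 1 \<le> ln (real N)"
  proof -
    have "2 * real N \<le> exp 1 * real N" using exp_ge_add_one_self[of 1] by (intro mult_right_mono) auto
    then have "exp v \<le> exp 1 * real N" using N by linarith
    then have "v \<le> ln (exp 1 * real N)" using N by (subst ln_ge_iff) auto
    then show ?thesis using N by (simp add: ln_mult)
  qed
  moreover note mertens_sum_mangoldt[OF N(3)]
  ultimately show ?thesis unfolding Collect_ln_le N_def[symmetric] by linarith
qed

lemma has_integral_abel_summation:
  fixes x c :: "'i \<Rightarrow> real"
  assumes "finite A" and x_range: "\<And>n. n \<in> A \<Longrightarrow> x n \<in> {a..b}"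
    and \<phi>_deriv: "\<And>v. v \<in> {a..b} \<Longrightarrow> (\<phi> has_real_derivative \<phi>' v) (at v)"
  shows "((\<lambda>v. \<phi>' v * (\<Sum>n | n \<in> A \<and> x n \<le> v. c n)) has_integral (\<Sum>n\<in>A. c n * (\<phi> b - \<phi> (x n)))) {a..b}"
proof -
  have "((\<lambda>v. \<Sum>n\<in>A. c n * (if v \<in> {x n..b} then \<phi>' v else 0)) has_integral (\<Sum>n\<in>A. c n * (\<phi> b - \<phi> (x n)))) {a..b}"
  proof (intro has_integral_sum has_integral_mult_right assms(1))
    fix n assume n: "n \<in> A"
    have "(\<phi>' has_integral \<phi> b - \<phi> (x n)) {x n..b}"
      using x_range[OF n] \<phi>_deriv
      by (intro fundamental_theorem_of_calculus)
         (auto simp: has_real_derivative_iff_has_vector_derivative intro: has_vector_derivative_at_within)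
    then show "((\<lambda>v. if v \<in> {x n..b} then \<phi>' v else 0) has_integral \<phi> b - \<phi> (x n)) {a..b}"
      using x_range[OF n] by (subst has_integral_restrict) auto
  qed
  then show ?thesis
  proof (rule has_integral_eq[rotated])
    fix v assume "v \<in> {a..b}"
    then have "(\<Sum>n\<in>A. c n * (if v \<in> {x n..b} then \<phi>' v else 0)) = (\<Sum>n\<in>A. \<phi>' v * (if x n \<le> v then c n else 0))"
      by (intro sum.cong) auto
    then show "(\<Sum>n\<in>A. c n * (if v \<in> {x n..b} then \<phi>' v else 0)) = \<phi>' v * (\<Sum>n | n \<in> A \<and> x n \<le> v. c n)"
      using assms(1) by (simp add: sum.inter_filter sum_distrib_left)
  qed
qed

lemma sum_mangoldt_triangle_le:
  assumes "V > 0"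
  shows "(\<Sum>n | 1 \<le> n \<and> ln (real n) \<le> V. mangoldt n * ln (real n) / real n * (1 - ln (real n) / V))
         \<le> V\<^sup>2 / 6 + 4 * V"
proof -
  define A where "A = {n::nat. 1 \<le> n \<and> ln (real n) \<le> V}"
  define M where "M v = (\<Sum>n | n \<in> A \<and> ln (real n) \<le> v. mangoldt n / real n)" for v :: real
  define \<phi> where "\<phi> v = - (v * (1 - v / V))" for v
  have "((\<lambda>v. (2 * v / V - 1) * M v) has_integral
      (\<Sum>n\<in>A. mangoldt n / real n * (\<phi> V - \<phi> (ln (real n))))) {0..V}"
    unfolding M_def
  proof (rule has_integral_abel_summation)
    show "finite A" unfolding A_def Collect_ln_le by simp
    show "(\<phi> has_real_derivative (2 * v / V - 1)) (at v)" for v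
      unfolding \<phi>_def[abs_def] using assms by (auto intro!: derivative_eq_intros simp: field_simps)
  qed (auto simp: A_def)
  moreover have "((\<lambda>v. (2 * v / V - 1) * v + 4) has_integral
      ((2 * V^3 / (3 * V) - V\<^sup>2 / 2 + 4 * V) - (2 * 0^3 / (3 * V) - 0\<^sup>2 / 2 + 4 * 0))) {0..V}"
    using assms by (intro fundamental_theorem_of_calculus)
       (auto intro!: derivative_eq_intros simp: has_real_derivative_iff_has_vector_derivative[symmetric] field_simps power2_eq_square)
  ultimately have "(\<Sum>n\<in>A. mangoldt n / real n * (\<phi> V - \<phi> (ln (real n)))) \<le>
      (2 * V^3 / (3 * V) - V\<^sup>2 / 2 + 4 * V) - (2 * 0^3 / (3 * V) - 0\<^sup>2 / 2 + 4 * 0)"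
  proof (rule has_integral_le)
    fix v assume v: "v \<in> {0..V}"
    have "M v = (\<Sum>n | 1 \<le> n \<and> ln (real n) \<le> v. mangoldt n / real n)"
      unfolding M_def A_def using v by (intro sum.cong) auto
    then have M_close: "\<bar>M v - v\<bar> \<le> 4" using sum_mangoldt_over_ln_le_bound[of v] v by simp
    have "\<bar>2 * v / V - 1\<bar> \<le> 1" using v assms by (auto simp: abs_le_iff field_simps)
    then have "\<bar>(2 * v / V - 1) * (M v - v)\<bar> \<le> 1 * 4"
      unfolding abs_mult using M_close by (intro mult_mono) auto
    then show "(2 * v / V - 1) * M v \<le> (2 * v / V - 1) * v + 4"
      by (simp add: abs_le_iff right_diff_distrib)
  qed
  also have "\<dots> = V\<^sup>2 / 6 + 4 * V" using assms by (simp add: field_simps power3_eq_cube power2_eq_square)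
  finally show ?thesis using assms by (simp add: A_def \<phi>_def mult_ac)
qed

section \<open>Logarithmic derivatives\<close>

definition logderiv :: "(complex \<Rightarrow> complex) \<Rightarrow> complex \<Rightarrow> complex" where
  "logderiv f z = deriv f z / f z"

lemma logderiv_eqI:
  "(f has_field_derivative f z * d) (at z) \<Longrightarrow> f z \<noteq> 0 \<Longrightarrow> logderiv f z = d"
  by (simp add: logderiv_def DERIV_imp_deriv)

lemma has_field_derivative_logderiv:
  "f field_differentiable at z \<Longrightarrow> f z \<noteq> 0 \<Longrightarrow> (f has_field_derivative f z * logderiv f z) (at z)"
  by (simp add: logderiv_def DERIV_deriv_iff_field_differentiable)

lemma logderiv_cong:
  "eventually (\<lambda>u. f u = g u) (nhds z) \<Longrightarrow> logderiv f z = logderiv g z"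
  using deriv_cong_ev[of f g z z] eventually_nhds_x_imp_x[of "\<lambda>u. f u = g u" z]
  by (simp add: logderiv_def)

lemma logderiv_mult:
  assumes "f field_differentiable at z" "g field_differentiable at z" "f z \<noteq> 0" "g z \<noteq> 0"
  shows "logderiv (\<lambda>u. f u * g u) z = logderiv f z + logderiv g z"
proof (rule logderiv_eqI)
  show "((\<lambda>u. f u * g u) has_field_derivative f z * g z * (logderiv f z + logderiv g z)) (at z)"
    using DERIV_mult[OF has_field_derivative_logderiv[OF assms(1,3)] has_field_derivative_logderiv[OF assms(2,4)]]
    by (simp add: algebra_simps)
qed (use assms in simp)

lemma field_differentiable_prod:
  assumes "\<And>p. p \<in> A \<Longrightarrow> f p field_differentiable at z"
  shows "(\<lambda>u. \<Prod>p\<in>A. f p u) field_differentiable at z"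
  using has_field_derivative_prod[of A f _ z] assms unfolding field_differentiable_def by metis

lemma logderiv_prod:
  assumes "\<And>p. p \<in> A \<Longrightarrow> f p field_differentiable at z" "\<And>p. p \<in> A \<Longrightarrow> f p z \<noteq> 0"
  shows "logderiv (\<lambda>u. \<Prod>p\<in>A. f p u) z = (\<Sum>p\<in>A. logderiv (f p) z)"
proof (cases "finite A")
  case True
  have "((\<lambda>u. \<Prod>p\<in>A. f p u) has_field_derivative (\<Prod>p\<in>A. f p z) * (\<Sum>p\<in>A. deriv (f p) z / f p z)) (at z)"
    using assms by (intro has_field_derivative_prod') (auto simp: DERIV_deriv_iff_field_differentiable)
  then show ?thesis
    using assms(2) True by (intro logderiv_eqI) (auto simp: logderiv_def)
qed (simp add: logderiv_def)

lemma logderiv_power: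
  assumes "f field_differentiable at z" "f z \<noteq> 0"
  shows "logderiv (\<lambda>u. f u ^ n) z = of_nat n * logderiv f z"
  using logderiv_prod[of "{..<n}" "\<lambda>_. f" z] assms by simp

lemma logderiv_prod_power:
  assumes "\<And>p. p \<in> A \<Longrightarrow> f p field_differentiable at z" "\<And>p. p \<in> A \<Longrightarrow> f p z \<noteq> 0"
  shows "logderiv (\<lambda>u. \<Prod>p\<in>A. f p u ^ m p) z = (\<Sum>p\<in>A. of_nat (m p) * logderiv (f p) z)"
  using assms by (simp add: logderiv_prod logderiv_power derivative_intros)

lemma logderiv_minus_const: "logderiv (\<lambda>u. u - p) z = 1 / (z - p)"
  by (simp add: logderiv_def)

lemma logderiv_Gamma:
  assumes "z \<notin> \<int>\<^sub>\<le>\<^sub>0"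
  shows "logderiv Gamma z = Digamma z"
  using has_field_derivative_Gamma[OF assms] assms by (intro logderiv_eqI) (auto simp: Gamma_eq_zero_iff)

lemma tendsto_mult_logderiv_at_right:
  assumes "r > 0" and g_holo: "g holomorphic_on ball z r" and "g z \<noteq> 0"
    and f_eq: "\<And>w. w \<in> ball z r \<Longrightarrow> w \<noteq> z \<Longrightarrow> f w = g w * (w - z) powi n"
  shows "((\<lambda>x. of_real x * logderiv f (z + of_real x)) \<longlongrightarrow> of_int n) (at_right 0)"
proof -
  have shift: "((\<lambda>x. z + complex_of_real x) \<longlongrightarrow> z) (at_right 0)"
    by (rule tendsto_eq_intros refl | simp)+
  have "isCont g z" "isCont (deriv g) z"
    using g_holo holomorphic_deriv[OF g_holo] \<open>r > 0\<close>
    by (auto intro!: continuous_on_interior[of "ball z r"] holomorphic_on_imp_continuous_on)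
  from this[THEN isCont_tendsto_compose[OF _ shift]]
  have g_lim: "((\<lambda>x. g (z + of_real x)) \<longlongrightarrow> g z) (at_right 0)"
    and g'_lim: "((\<lambda>x. deriv g (z + of_real x)) \<longlongrightarrow> deriv g z) (at_right 0)" by auto
  have "((\<lambda>x. of_real x * logderiv g (z + of_real x) + of_int n) \<longlongrightarrow> of_real 0 * (deriv g z / g z) + of_int n) (at_right 0)"
    unfolding logderiv_def by (intro tendsto_intros g_lim g'_lim \<open>g z \<noteq> 0\<close>)
  moreover have "eventually (\<lambda>x. of_real x * logderiv g (z + of_real x) + of_int n =
      of_real x * logderiv f (z + of_real x)) (at_right 0)"
    using eventually_at_right_real[OF \<open>r > 0\<close>] tendsto_imp_eventually_ne[OF g_lim \<open>g z \<noteq> 0\<close>]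
  proof eventually_elim
    case (elim x)
    define w where "w = z + of_real x"
    have w: "w \<in> ball z r - {z}" "w - z = of_real x" using elim by (auto simp: w_def dist_norm)
    have "eventually (\<lambda>u. f u = g u * (u - z) powi n) (nhds w)"
      using eventually_nhds_in_open[OF open_delete[OF open_ball] w(1)] f_eq by (auto elim!: eventually_mono)
    then have "logderiv f w = logderiv (\<lambda>u. g u * (u - z) powi n) w" by (rule logderiv_cong)
    also have "\<dots> = logderiv g w + logderiv (\<lambda>u. (u - z) powi n) w"
    proof (rule logderiv_mult)
      show "g field_differentiable at w"
        by (rule holomorphic_on_imp_differentiable_at[OF g_holo]) (use w in auto)
      show "(\<lambda>u. (u - z) powi n) field_differentiable at w"
        by (rule holomorphic_on_imp_differentiable_at[of _ "- {z}"]) (use w in \<open>auto intro!: holomorphic_intros\<close>)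
    qed (use elim w in \<open>auto simp: w_def\<close>)
    also have "logderiv (\<lambda>u. (u - z) powi n) w = of_int n / of_real x"
      using w elim by (intro logderiv_eqI)
        (auto intro!: derivative_eq_intros simp: power_int_diff field_simps)
    finally show ?case using elim by (simp add: w_def field_simps)
  qed
  ultimately show ?thesis by (auto intro: Lim_transform_eventually)
qed

lemma holomorphic_factor_out_zero:
  assumes "open S" "connected S" and f_holo: "f holomorphic_on S" and "w \<in> S" "f w \<noteq> 0" and "a \<in> S"
  obtains g n where "g holomorphic_on S" "\<And>z. z \<in> S \<Longrightarrow> f z = g z * (z - a) ^ n" "g a \<noteq> 0"
proof -
  obtain h r where "r > 0" "cball a r \<subseteq> S" and h_holo: "h holomorphic_on cball a r"
    and h: "\<And>z. z \<in> cball a r \<Longrightarrow> f z = h z * (z - a) ^ nat (zorder f a) \<and> h z \<noteq> 0"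
    using zorder_exist_zero[of f S a] assms by blast
  define g where "g z = (if z = a then h a else f z / (z - a) ^ nat (zorder f a))" for z
  have "g holomorphic_on (S - {a}) \<union> ball a r"
  proof (rule holomorphic_on_Un)
    have "(\<lambda>z. f z / (z - a) ^ nat (zorder f a)) holomorphic_on S - {a}"
      using f_holo by (intro holomorphic_intros) (auto intro: holomorphic_on_subset)
    then show "g holomorphic_on S - {a}"
      by (rule holomorphic_transform) (auto simp: g_def)
    have "h holomorphic_on ball a r" using h_holo by (rule holomorphic_on_subset) auto
    then show "g holomorphic_on ball a r"
      by (rule holomorphic_transform) (use h in \<open>auto simp: g_def\<close>)
  qed (use \<open>open S\<close> in auto)
  moreover have "(S - {a}) \<union> ball a r = S" using \<open>cball a r \<subseteq> S\<close> \<open>r > 0\<close> \<open>a \<in> S\<close> by auto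
  ultimately have "g holomorphic_on S" by simp
  moreover have "f z = g z * (z - a) ^ nat (zorder f a)" if "z \<in> S" for z
    using h[of a] \<open>r > 0\<close> by (cases "z = a") (auto simp: g_def)
  moreover have "g a \<noteq> 0" using h[of a] \<open>r > 0\<close> by (simp add: g_def)
  ultimately show ?thesis using that by blast
qed

lemma holomorphic_factor_out_zeros:
  assumes "open S" "connected S" and "f holomorphic_on S" and "w \<in> S" "f w \<noteq> 0"
    and "finite Z" "Z \<subseteq> S"
  shows "\<exists>g. g holomorphic_on S \<and> (\<forall>z\<in>S. f z = g z * (\<Prod>p\<in>Z. (z - p) ^ nat (zorder f p))) \<and> (\<forall>p\<in>Z. g p \<noteq> 0)"
  using assms(6,7)
proof (induction Z rule: finite_induct)
  case (insert a Z)
  define P where "P z = (\<Prod>p\<in>Z. (z - p) ^ nat (zorder f p))" for z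
  obtain g where g_holo: "g holomorphic_on S" and f_eq: "\<And>z. z \<in> S \<Longrightarrow> f z = g z * P z"
    and g_nz: "\<And>p. p \<in> Z \<Longrightarrow> g p \<noteq> 0" using insert by (auto simp: P_def)
  have "g w \<noteq> 0" using f_eq[of w] assms(4,5) by auto
  with assms(1,2,4) g_holo insert.prems obtain G n where G_holo: "G holomorphic_on S"
    and g_eq: "\<And>z. z \<in> S \<Longrightarrow> g z = G z * (z - a) ^ n" and "G a \<noteq> 0"
    using holomorphic_factor_out_zero[of S g w a] by auto
  have "zorder f a = int n"
  proof (rule zorder_eqI[of S _ "\<lambda>z. G z * P z"])
    show "(\<lambda>z. G z * P z) holomorphic_on S"
      unfolding P_def by (intro holomorphic_intros G_holo)
    show "G a * P a \<noteq> 0" using \<open>G a \<noteq> 0\<close> insert.hyps by (auto simp: P_def)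
  qed (use assms(1) insert.prems f_eq g_eq in auto)
  then have "f z = G z * (\<Prod>p\<in>insert a Z. (z - p) ^ nat (zorder f p))" if "z \<in> S" for z
    using that insert.hyps f_eq g_eq by (simp add: P_def)
  moreover have "G p \<noteq> 0" if "p \<in> insert a Z" for p
    using that g_nz[of p] g_eq[of p] insert.prems \<open>G a \<noteq> 0\<close> by auto
  ultimately show ?case using G_holo by blast
qed (use assms(3) in auto)


subsection \<open>The Borel--Caratheodory theorem\<close>

lemma borel_caratheodory:
  assumes L_holo: "L holomorphic_on ball z0 r" and "L z0 = 0"
    and Re_less: "\<And>z. z \<in> ball z0 r \<Longrightarrow> Re (L z) < A" and y: "y \<in> ball z0 r"
  shows "norm (L y) \<le> 2 * A * norm (y - z0) / (r - norm (y - z0))"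
proof -
  have "r > 0" using y by (auto intro: le_less_trans[OF zero_le_dist])
  have "A > 0" using Re_less[of z0] \<open>L z0 = 0\<close> \<open>r > 0\<close> by simp
  define \<psi> where "\<psi> l = l / (2 * of_real A - l)" for l :: complex
  have \<psi>_denom: "2 * of_real A - l \<noteq> 0" if "Re l < A" for l
    using that \<open>A > 0\<close> by (auto simp: complex_eq_iff)
  have norm_\<psi>: "norm (\<psi> l) < 1" if "Re l < A" for l
  proof -
    have "(Re l)\<^sup>2 < (2 * A - Re l)\<^sup>2"
      using \<open>A > 0\<close> that by (simp add: power2_eq_square algebra_simps)
    then have "(norm l)\<^sup>2 < (norm (2 * of_real A - l))\<^sup>2" by (simp add: cmod_power2)
    then have "norm l < norm (2 * of_real A - l)" by (rule power2_less_imp_less) simp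
    then show ?thesis unfolding \<psi>_def norm_divide
      by (subst divide_less_eq_1) (auto intro: le_less_trans[OF norm_ge_zero])
  qed
  have in_ball: "z0 + of_real r * u \<in> ball z0 r" if "norm u < 1" for u
    using that \<open>r > 0\<close> by (simp add: dist_norm norm_mult)
  define u where "u = (y - z0) / of_real r"
  have y_eq: "y = z0 + of_real r * u" and norm_u: "norm u = norm (y - z0) / r"
    using \<open>r > 0\<close> by (auto simp: u_def norm_divide)
  have "norm u < 1" using y \<open>r > 0\<close> by (simp add: norm_u dist_norm norm_minus_commute)
  have "norm (\<psi> (L (z0 + of_real r * u))) \<le> norm u"
  proof (rule Schwarz_Lemma(1)[of "\<lambda>u. \<psi> (L (z0 + of_real r * u))"])
    have "(L \<circ> (\<lambda>u. z0 + of_real r * u)) holomorphic_on ball 0 1"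
      by (rule holomorphic_on_compose_gen[OF _ L_holo]) (use in_ball in \<open>auto intro!: holomorphic_intros\<close>)
    then show "(\<lambda>u. \<psi> (L (z0 + of_real r * u))) holomorphic_on ball 0 1"
      unfolding \<psi>_def o_def using \<psi>_denom Re_less in_ball by (intro holomorphic_intros) auto
  qed (use norm_\<psi> Re_less in_ball \<open>L z0 = 0\<close> \<open>norm u < 1\<close> in \<open>auto simp: \<psi>_def\<close>)
  then have "norm (L y) \<le> norm u * norm (2 * of_real A - L y)"
    using \<psi>_denom[OF Re_less[OF y]] by (simp add: \<psi>_def y_eq[symmetric] norm_divide pos_divide_le_eq)
  also have "\<dots> \<le> norm u * (2 * A + norm (L y))"
    using norm_triangle_ineq4[of "2 * complex_of_real A" "L y"] \<open>A > 0\<close>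
    by (intro mult_left_mono) (auto simp: norm_mult)
  finally have "norm (L y) * (r - norm (y - z0)) \<le> 2 * A * norm (y - z0)"
    using \<open>r > 0\<close> by (simp add: norm_u field_simps)
  then show ?thesis
    using y by (simp add: pos_le_divide_eq dist_norm norm_minus_commute)
qed

lemma borel_caratheodory_deriv:
  assumes "0 < r'" "r' < r" and L_holo: "L holomorphic_on ball z0 r" and "L z0 = 0"
    and Re_less: "\<And>z. z \<in> ball z0 r \<Longrightarrow> Re (L z) < A" and z: "z \<in> cball z0 r'"
  shows "norm (deriv L z) \<le> 8 * r / (r - r')\<^sup>2 * A"
proof -
  define d where "d = (r - r') / 2"
  have "d > 0" using assms(2) by (simp add: d_def)
  have "A > 0" using Re_less[of z0] \<open>L z0 = 0\<close> assms(1,2) by simp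
  have dist_le: "norm (y - z0) \<le> (r + r') / 2" if "y \<in> cball z d" for y
    using that z norm_triangle_ineq[of "y - z" "z - z0"]
    by (simp add: d_def dist_norm norm_minus_commute field_simps)
  have sub: "cball z d \<subseteq> ball z0 r"
  proof
    fix y assume "y \<in> cball z d"
    then show "y \<in> ball z0 r" using dist_le[of y] assms(2) by (simp add: dist_norm norm_minus_commute)
  qed
  have "norm ((deriv ^^ 1) L z) \<le> fact 1 * (4 * A * r / (r - r')) / d ^ 1"
  proof (rule Cauchy_inequality)
    show "L holomorphic_on ball z d" by (rule holomorphic_on_subset[OF L_holo]) (use sub in auto)
    show "continuous_on (cball z d) L"
      by (rule continuous_on_subset[OF holomorphic_on_imp_continuous_on[OF L_holo] sub])
    fix y assume "norm (z - y) = d"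
    then have y: "y \<in> cball z d" by (simp add: dist_norm)
    have "norm (L y) \<le> 2 * A * norm (y - z0) / (r - norm (y - z0))"
      using L_holo \<open>L z0 = 0\<close> Re_less y sub by (intro borel_caratheodory) auto
    also have "\<dots> \<le> 2 * A * r / d"
      using dist_le[OF y] \<open>A > 0\<close> \<open>d > 0\<close> assms(1,2) by (intro frac_le mult_left_mono) (auto simp: d_def)
    finally show "norm (L y) \<le> 4 * A * r / (r - r')" using \<open>d > 0\<close> by (simp add: d_def field_simps)
  qed (fact \<open>d > 0\<close>)
  also have "fact 1 * (4 * A * r / (r - r')) / d ^ 1 = 8 * r / (r - r')\<^sup>2 * A"
    using \<open>d > 0\<close> by (simp add: d_def field_simps power2_eq_square)
  finally show ?thesis by simp
qed

lemma borel_caratheodory_logderiv: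
  assumes radii: "0 < r'" "r' < r" and g_holo: "g holomorphic_on ball z0 r" and g_nz: "\<And>z. z \<in> ball z0 r \<Longrightarrow> g z \<noteq> 0"
    and g_less: "\<And>z. z \<in> ball z0 r \<Longrightarrow> norm (g z) < exp A * norm (g z0)"
    and z: "z \<in> cball z0 r'"
  shows "norm (logderiv g z) \<le> 8 * r / (r - r')\<^sup>2 * A"
proof -
  have "z0 \<in> ball z0 r" using radii by simp
  have "(\<lambda>z. g z / g z0) holomorphic_on ball z0 r" using g_holo g_nz \<open>z0 \<in> ball z0 r\<close> by (intro holomorphic_intros) auto
  then obtain L0 where L0: "L0 holomorphic_on ball z0 r" "\<And>z. z \<in> ball z0 r \<Longrightarrow> g z / g z0 = exp (L0 z)"
    by (rule contractible_imp_holomorphic_log) (use g_nz \<open>z0 \<in> ball z0 r\<close> in \<open>auto intro: convex_imp_contractible\<close>)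
  define L where "L z = L0 z - L0 z0" for z
  have "exp (L0 z0) = 1" using L0(2)[OF \<open>z0 \<in> ball z0 r\<close>] g_nz[OF \<open>z0 \<in> ball z0 r\<close>] by simp
  then have L_holo: "L holomorphic_on ball z0 r"
    and g_eq: "\<And>z. z \<in> ball z0 r \<Longrightarrow> g z = g z0 * exp (L z)"
    using L0 g_nz[OF \<open>z0 \<in> ball z0 r\<close>]
    by (auto simp: L_def[abs_def] exp_diff divide_eq_eq mult.commute intro!: holomorphic_intros)
  have "norm (deriv L z) \<le> 8 * r / (r - r')\<^sup>2 * A"
  proof (rule borel_caratheodory_deriv[OF radii L_holo _ _ z])
    fix u assume u: "u \<in> ball z0 r"
    have "norm (g z0) * exp (Re (L u)) < norm (g z0) * exp A"
      using g_less[OF u] g_eq[OF u] by (simp add: norm_mult mult.commute)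
    then show "Re (L u) < A" using g_nz[OF \<open>z0 \<in> ball z0 r\<close>] by simp
  qed (simp add: L_def)
  moreover have "logderiv g z = deriv L z"
  proof -
    have z_in: "z \<in> ball z0 r" using z radii by auto
    have "eventually (\<lambda>u. g u = g z0 * exp (L u)) (nhds z)"
      using eventually_nhds_in_open[of "ball z0 r" z] z_in g_eq by (auto elim!: eventually_mono)
    then have "logderiv g z = logderiv (\<lambda>u. g z0 * exp (L u)) z" by (rule logderiv_cong)
    also have "\<dots> = deriv L z"
      using L_holo z_in g_nz[OF \<open>z0 \<in> ball z0 r\<close>]
      by (intro logderiv_eqI) (auto intro!: derivative_eq_intros holomorphic_derivI[of _ "ball z0 r"])
    finally show ?thesis .
  qed
  ultimately show ?thesis by simp
qed


subsection \<open>Zeros in discs\<close>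

text \<open>The quotient $(z - p) / b_p(z)$ by this function is the Blaschke factor at $p$ of the disc of
  radius $R$ about $z_0$.\<close>

definition blaschke_denominator :: "real \<Rightarrow> complex \<Rightarrow> complex \<Rightarrow> complex \<Rightarrow> complex" where
  "blaschke_denominator R z0 p z = (of_real (R\<^sup>2) - cnj (p - z0) * (z - z0)) / of_real R"

lemma blaschke_denominator_holomorphic: "R > 0 \<Longrightarrow> blaschke_denominator R z0 p holomorphic_on A"
  unfolding blaschke_denominator_def by (intro holomorphic_intros) auto

lemma norm_blaschke_denominator_sphere:
  assumes "R > 0" "norm (z - z0) = R"
  shows "norm (blaschke_denominator R z0 p z) = norm (z - p)"
proof -
  have "of_real (R\<^sup>2) = (z - z0) * cnj (z - z0)"
    using assms by (simp only: complex_norm_square[symmetric])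
  then have "of_real (R\<^sup>2) - cnj (p - z0) * (z - z0) = (z - z0) * cnj (z - p)"
    by (simp add: algebra_simps)
  then have "norm (of_real (R\<^sup>2) - cnj (p - z0) * (z - z0)) = R * norm (z - p)"
    using assms by (simp only: norm_mult complex_mod_cnj)
  then show ?thesis unfolding blaschke_denominator_def norm_divide using assms by simp
qed

lemma norm_blaschke_denominator_ge:
  assumes "R > 0" "norm (p - z0) \<le> r"
  shows "(R\<^sup>2 - r * norm (z - z0)) / R \<le> norm (blaschke_denominator R z0 p z)"
proof -
  have "norm (cnj (p - z0) * (z - z0)) \<le> r * norm (z - z0)"
    unfolding norm_mult complex_mod_cnj using assms(2) by (rule mult_right_mono) simp
  moreover have "norm (complex_of_real (R\<^sup>2)) = R\<^sup>2" by (simp only: norm_of_real) simp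
  ultimately have "R\<^sup>2 - r * norm (z - z0) \<le> norm (of_real (R\<^sup>2) - cnj (p - z0) * (z - z0))"
    using norm_triangle_ineq2[of "of_real (R\<^sup>2)" "cnj (p - z0) * (z - z0)"] by linarith
  then show ?thesis
    unfolding blaschke_denominator_def norm_divide using assms(1) by (simp add: divide_right_mono)
qed

lemma blaschke_denominator_nonzero:
  assumes "norm (p - z0) < R" "norm (z - z0) \<le> R"
  shows "blaschke_denominator R z0 p z \<noteq> 0"
proof -
  have "R > 0" using assms(1) norm_ge_zero le_less_trans by blast
  have "norm (p - z0) * norm (z - z0) \<le> norm (p - z0) * R" using assms(2) by (rule mult_left_mono) simp
  also have "\<dots> < R * R" using assms(1) \<open>R > 0\<close> by (rule mult_strict_right_mono)
  finally have "(R\<^sup>2 - norm (p - z0) * norm (z - z0)) / R > 0" using \<open>R > 0\<close> by (simp add: power2_eq_square)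
  then show ?thesis using norm_blaschke_denominator_ge[OF \<open>R > 0\<close> order_refl, of p z0 z] by auto
qed

lemma norm_logderiv_blaschke_denominator_le:
  assumes "norm (p - z0) \<le> r" "norm (z - z0) \<le> r" "r < R"
  shows "norm (logderiv (blaschke_denominator R z0 p) z) \<le> R / (R\<^sup>2 - r\<^sup>2)"
proof -
  have "r \<ge> 0" using assms(1) norm_ge_zero order_trans by blast
  then have "R > 0" "R\<^sup>2 - r\<^sup>2 > 0" using assms(3) by (simp_all add: power_strict_mono)
  have "(R\<^sup>2 - r\<^sup>2) / R \<le> (R\<^sup>2 - r * norm (z - z0)) / R"
    using \<open>R > 0\<close> \<open>r \<ge> 0\<close> assms(2) by (intro divide_right_mono) (auto simp: power2_eq_square intro: mult_left_mono)
  then have denom_ge: "(R\<^sup>2 - r\<^sup>2) / R \<le> norm (blaschke_denominator R z0 p z)"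
    using norm_blaschke_denominator_ge[OF \<open>R > 0\<close> assms(1), of z] by linarith
  have "(blaschke_denominator R z0 p has_field_derivative - cnj (p - z0) / of_real R) (at z)"
    unfolding blaschke_denominator_def[abs_def] using \<open>R > 0\<close> by (auto intro!: derivative_eq_intros)
  then have "norm (logderiv (blaschke_denominator R z0 p) z) =
      norm (p - z0) / R / norm (blaschke_denominator R z0 p z)"
    using \<open>R > 0\<close>
    by (simp only: logderiv_def DERIV_imp_deriv norm_divide norm_minus_cancel complex_mod_cnj norm_of_real abs_of_pos)
  also have "\<dots> \<le> 1 / ((R\<^sup>2 - r\<^sup>2) / R)"
    using denom_ge \<open>R\<^sup>2 - r\<^sup>2 > 0\<close> \<open>R > 0\<close> assms by (intro frac_le) auto
  finally show ?thesis by simp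
qed

locale bounded_on_disc =
  fixes f :: "complex \<Rightarrow> complex" and S :: "complex set" and z0 :: complex and r R M :: real
  assumes r_pos: "0 < r" and r_less: "r < R"
    and domain: "open S" "connected S" "cball z0 R \<subseteq> S"
    and f_holo: "f holomorphic_on S" and f_center: "f z0 \<noteq> 0"
    and M_pos: "M > 0" and f_le: "\<And>z. z \<in> cball z0 R \<Longrightarrow> norm (f z) \<le> exp M * norm (f z0)"
begin

definition zeros :: "complex set" where
  "zeros = {z \<in> cball z0 r. f z = 0}"

abbreviation mult :: "complex \<Rightarrow> nat" where
  "mult p \<equiv> nat (zorder f p)"

abbreviation blaschke :: "complex \<Rightarrow> complex \<Rightarrow> complex" where
  "blaschke \<equiv> blaschke_denominator R z0"

lemma zeros_dist_le: "p \<in> zeros \<Longrightarrow> norm (p - z0) \<le> r"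
  by (simp add: zeros_def dist_norm norm_minus_commute)

lemma center_in: "z0 \<in> S"
  using domain(3) r_pos r_less by auto

lemma zeros_subset: "zeros \<subseteq> S"
  using domain(3) r_less by (auto simp: zeros_def)

lemma finite_zeros: "finite zeros"
proof (cases "f constant_on S")
  case True
  then have "zeros = {}" using f_center center_in zeros_subset unfolding constant_on_def zeros_def by force
  then show ?thesis by simp
next
  case False
  then show ?thesis
    unfolding zeros_def using domain r_less by (intro holomorphic_compact_finite_zeros[OF f_holo]) auto
qed

lemma zero_free_part_exists:
  "\<exists>G. G holomorphic_on S \<and> (\<forall>z\<in>cball z0 r. G z \<noteq> 0) \<and>
    (\<forall>z\<in>S. f z * (\<Prod>p\<in>zeros. blaschke p z ^ mult p) = G z * (\<Prod>p\<in>zeros. (z - p) ^ mult p))"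
proof -
  obtain g where g_holo: "g holomorphic_on S"
    and f_eq: "\<And>z. z \<in> S \<Longrightarrow> f z = g z * (\<Prod>p\<in>zeros. (z - p) ^ mult p)" and g_nz: "\<And>p. p \<in> zeros \<Longrightarrow> g p \<noteq> 0"
    using holomorphic_factor_out_zeros[OF domain(1,2) f_holo center_in f_center finite_zeros zeros_subset] by blast
  have "g z * (\<Prod>p\<in>zeros. blaschke p z ^ mult p) \<noteq> 0" if z: "z \<in> cball z0 r" for z
  proof -
    have "g z \<noteq> 0"
    proof (cases "z \<in> zeros")
      case False
      then have "f z \<noteq> 0" using z by (simp add: zeros_def)
      moreover have "z \<in> S" using z domain(3) r_less by auto
      ultimately show ?thesis using f_eq by force
    qed (fact g_nz)
    moreover have "blaschke p z \<noteq> 0" if "p \<in> zeros" for p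
      using zeros_dist_le[OF that] z r_less
      by (intro blaschke_denominator_nonzero) (auto simp: dist_norm norm_minus_commute)
    ultimately show ?thesis using finite_zeros by simp
  qed
  moreover have "(\<lambda>z. g z * (\<Prod>p\<in>zeros. blaschke p z ^ mult p)) holomorphic_on S"
    using r_pos r_less by (intro holomorphic_intros g_holo blaschke_denominator_holomorphic) auto
  ultimately show ?thesis
    using f_eq by (intro exI[of _ "\<lambda>z. g z * (\<Prod>p\<in>zeros. blaschke p z ^ mult p)"]) (auto simp: mult_ac)
qed

definition zero_free_part :: "complex \<Rightarrow> complex" where
  "zero_free_part = (SOME G. G holomorphic_on S \<and> (\<forall>z\<in>cball z0 r. G z \<noteq> 0) \<and>
    (\<forall>z\<in>S. f z * (\<Prod>p\<in>zeros. blaschke p z ^ mult p) = G z * (\<Prod>p\<in>zeros. (z - p) ^ mult p)))"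

lemma zero_free_part_holomorphic: "zero_free_part holomorphic_on S"
  and zero_free_part_nonzero: "z \<in> cball z0 r \<Longrightarrow> zero_free_part z \<noteq> 0"
  and zero_free_part_eq: "z \<in> S \<Longrightarrow>
    f z * (\<Prod>p\<in>zeros. blaschke p z ^ mult p) = zero_free_part z * (\<Prod>p\<in>zeros. (z - p) ^ mult p)"
  using someI_ex[OF zero_free_part_exists, folded zero_free_part_def] by auto

lemma norm_zero_free_part_le:
  assumes "z \<in> cball z0 R"
  shows "norm (zero_free_part z) \<le> exp M * norm (f z0)"
proof (rule maximum_modulus_frontier[of zero_free_part "cball z0 R"])
  show "zero_free_part holomorphic_on interior (cball z0 R)"
    by (rule holomorphic_on_subset[OF zero_free_part_holomorphic]) (use domain(3) interior_subset in blast)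
  show "continuous_on (closure (cball z0 R)) zero_free_part"
    using domain(3) by (auto intro!: continuous_on_subset[OF holomorphic_on_imp_continuous_on[OF zero_free_part_holomorphic]])
  fix z assume "z \<in> frontier (cball z0 R)"
  then have z: "norm (z - z0) = R" "z \<in> cball z0 R"
    using r_pos r_less by (auto simp: dist_norm norm_minus_commute)
  have "(\<Prod>p\<in>zeros. norm (z - p) ^ mult p) \<noteq> 0"
    using z(1) r_less finite_zeros by (auto dest!: zeros_dist_le)
  moreover have "norm (f z) * (\<Prod>p\<in>zeros. norm (blaschke p z) ^ mult p) =
      norm (zero_free_part z) * (\<Prod>p\<in>zeros. norm (z - p) ^ mult p)"
    using arg_cong[OF zero_free_part_eq[of z], of norm] z(2) domain(3)
    by (auto simp: norm_mult prod_norm[symmetric] norm_power)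
  ultimately have "norm (zero_free_part z) = norm (f z)"
    using norm_blaschke_denominator_sphere[OF _ z(1)] r_pos r_less by simp
  then show "norm (zero_free_part z) \<le> exp M * norm (f z0)" using f_le[OF z(2)] by simp
qed (use assms in auto)

lemma norm_zero_free_part_center_ge:
  "(R / r) ^ (\<Sum>p\<in>zeros. mult p) * norm (f z0) \<le> norm (zero_free_part z0)"
proof -
  define N where "N = (\<Sum>p\<in>zeros. mult p)"
  have "norm (blaschke p z0) = R" for p
    using r_pos r_less by (simp add: blaschke_denominator_def power2_eq_square norm_mult)
  then have "norm (f z0) * R ^ N = norm (zero_free_part z0) * (\<Prod>p\<in>zeros. norm (z0 - p) ^ mult p)"
    using arg_cong[OF zero_free_part_eq[OF center_in], of norm]
    by (simp add: norm_mult prod_norm[symmetric] norm_power N_def power_sum)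
  also have "\<dots> \<le> norm (zero_free_part z0) * (\<Prod>p\<in>zeros. r ^ mult p)"
    using zeros_dist_le by (intro mult_left_mono prod_mono power_mono conjI) (auto simp: norm_minus_commute)
  finally have "norm (f z0) * R ^ N \<le> norm (zero_free_part z0) * r ^ N" by (simp add: N_def power_sum)
  then show ?thesis
    using r_pos unfolding N_def[symmetric] by (simp add: power_divide field_simps)
qed

lemma sum_mult_zeros_le: "(\<Sum>p\<in>zeros. real (mult p)) \<le> M / ln (R / r)"
proof -
  define N where "N = (\<Sum>p\<in>zeros. mult p)"
  have "(R / r) ^ N * norm (f z0) \<le> exp M * norm (f z0)"
    using norm_zero_free_part_center_ge norm_zero_free_part_le[of z0] r_pos r_less by (simp add: N_def)
  then have "ln ((R / r) ^ N) \<le> ln (exp M)" using f_center r_pos r_less by (subst ln_le_cancel_iff) auto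
  then have "real N * ln (R / r) \<le> M" using r_pos r_less by (simp add: ln_realpow)
  moreover have "ln (R / r) > 0" using r_pos r_less by (intro ln_gt_zero) (auto simp: field_simps)
  ultimately show ?thesis by (simp add: N_def field_simps)
qed

lemma norm_logderiv_zero_free_part_le:
  assumes "0 < r'" "r' < r" "z \<in> cball z0 r'"
  shows "norm (logderiv zero_free_part z) \<le> 16 * r / (r - r')\<^sup>2 * M"
proof -
  have "norm (logderiv zero_free_part z) \<le> 8 * r / (r - r')\<^sup>2 * (2 * M)"
  proof (rule borel_caratheodory_logderiv[OF assms(1,2) _ _ _ assms(3)])
    show "zero_free_part holomorphic_on ball z0 r"
      by (rule holomorphic_on_subset[OF zero_free_part_holomorphic]) (use domain(3) r_less in auto)
    fix y assume y: "y \<in> ball z0 r"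
    show "zero_free_part y \<noteq> 0" using y by (intro zero_free_part_nonzero) auto
    have "norm (zero_free_part y) \<le> exp M * norm (f z0)" using y r_less by (intro norm_zero_free_part_le) auto
    also have "\<dots> < exp (2 * M) * norm (f z0)" using f_center M_pos by simp
    also have "1 * norm (f z0) \<le> (R / r) ^ (\<Sum>p\<in>zeros. mult p) * norm (f z0)"
      using r_pos r_less by (intro mult_right_mono one_le_power) auto
    then have "exp (2 * M) * norm (f z0) \<le> exp (2 * M) * norm (zero_free_part z0)"
      using norm_zero_free_part_center_ge by simp
    finally show "norm (zero_free_part y) < exp (2 * M) * norm (zero_free_part z0)" .
  qed
  then show ?thesis by simp
qed

lemma logderiv_minus_zeros_eq:
  assumes z: "z \<in> cball z0 r" "f z \<noteq> 0"
  shows "logderiv f z - (\<Sum>p\<in>zeros. of_nat (mult p) / (z - p)) =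
    logderiv zero_free_part z - (\<Sum>p\<in>zeros. of_nat (mult p) * logderiv (blaschke p) z)"
proof -
  have z_in: "z \<in> S" "norm (z - z0) \<le> R"
    using z(1) domain(3) r_less by (auto simp: dist_norm norm_minus_commute)
  have not_zero: "z \<noteq> p" if "p \<in> zeros" for p using that z by (auto simp: zeros_def)
  have logderiv_factors: "logderiv (\<lambda>u. \<Prod>p\<in>zeros. (u - p) ^ mult p) z = (\<Sum>p\<in>zeros. of_nat (mult p) / (z - p))"
    using not_zero
    by (subst logderiv_prod_power[of zeros "\<lambda>p u. u - p" z mult])
       (auto simp: logderiv_minus_const intro!: derivative_intros)
  have differentiable: "h field_differentiable at z" if "h holomorphic_on S" for h
    using holomorphic_on_imp_differentiable_at[OF that domain(1) z_in(1)] .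
  have blaschke_nz: "blaschke p z \<noteq> 0" if "p \<in> zeros" for p
    using zeros_dist_le[OF that] r_less z_in(2) by (intro blaschke_denominator_nonzero) auto
  have blaschke_diff: "blaschke p field_differentiable at z" for p
    using r_pos r_less by (intro differentiable blaschke_denominator_holomorphic) simp
  have "logderiv f z + (\<Sum>p\<in>zeros. of_nat (mult p) * logderiv (blaschke p) z) =
      logderiv (\<lambda>u. f u * (\<Prod>p\<in>zeros. blaschke p u ^ mult p)) z"
    using z(2) blaschke_nz blaschke_diff finite_zeros differentiable[OF f_holo]
    by (subst logderiv_mult)
       (auto simp: logderiv_prod_power intro!: field_differentiable_prod derivative_intros)
  also have "\<dots> = logderiv (\<lambda>u. zero_free_part u * (\<Prod>p\<in>zeros. (u - p) ^ mult p)) z"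
    using eventually_nhds_in_open[OF domain(1) z_in(1)] zero_free_part_eq
    by (intro logderiv_cong) (auto elim!: eventually_mono)
  also have "\<dots> = logderiv zero_free_part z + (\<Sum>p\<in>zeros. of_nat (mult p) / (z - p))"
    using not_zero finite_zeros zero_free_part_nonzero[OF z(1)] differentiable[OF zero_free_part_holomorphic]
    by (subst logderiv_mult)
       (auto simp: logderiv_factors intro!: field_differentiable_prod derivative_intros)
  finally show ?thesis by (simp add: algebra_simps)
qed

theorem norm_logderiv_minus_zeros_le:
  assumes "0 < r'" "r' < r" and z: "z \<in> cball z0 r'" "f z \<noteq> 0"
  shows "norm (logderiv f z - (\<Sum>p\<in>zeros. of_nat (mult p) / (z - p))) \<le>
    (R / (R\<^sup>2 - r\<^sup>2) / ln (R / r) + 16 * r / (r - r')\<^sup>2) * M"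
proof -
  have z_dist: "norm (z - z0) \<le> r" using z(1) assms(2) by (simp add: dist_norm norm_minus_commute)
  have "norm (\<Sum>p\<in>zeros. of_nat (mult p) * logderiv (blaschke p) z) \<le> (\<Sum>p\<in>zeros. real (mult p) * (R / (R\<^sup>2 - r\<^sup>2)))"
    using norm_logderiv_blaschke_denominator_le[OF zeros_dist_le z_dist r_less]
    by (intro sum_norm_le) (simp only: norm_mult norm_of_nat, rule mult_left_mono, auto)
  also have "\<dots> = (\<Sum>p\<in>zeros. real (mult p)) * (R / (R\<^sup>2 - r\<^sup>2))" by (rule sum_distrib_right[symmetric])
  also have "\<dots> \<le> M / ln (R / r) * (R / (R\<^sup>2 - r\<^sup>2))"
    using r_pos r_less by (intro mult_right_mono sum_mult_zeros_le divide_nonneg_nonneg) (auto intro: power_mono)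
  finally have "norm (\<Sum>p\<in>zeros. of_nat (mult p) * logderiv (blaschke p) z) \<le> M / ln (R / r) * (R / (R\<^sup>2 - r\<^sup>2))" .
  moreover have "norm (logderiv zero_free_part z) \<le> 16 * r / (r - r')\<^sup>2 * M"
    by (rule norm_logderiv_zero_free_part_le[OF assms(1,2) z(1)])
  moreover have "logderiv f z - (\<Sum>p\<in>zeros. of_nat (mult p) / (z - p)) =
      logderiv zero_free_part z - (\<Sum>p\<in>zeros. of_nat (mult p) * logderiv (blaschke p) z)"
    using z assms(2) by (intro logderiv_minus_zeros_eq) auto
  ultimately show ?thesis
    using norm_triangle_ineq4[of "logderiv zero_free_part z" "\<Sum>p\<in>zeros. of_nat (mult p) * logderiv (blaschke p) z"]
    by (simp add: distrib_right mult.commute[of M] mult.commute[of "ln _"])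
qed

end


section \<open>The Digamma function\<close>

lemma norm_Ln_plus_1_minus_Ln_le:
  assumes "\<And>t. 0 \<le> t \<Longrightarrow> t \<le> 1 \<Longrightarrow> w + of_real t \<notin> \<real>\<^sub>\<le>\<^sub>0"
    and "\<And>t. 0 \<le> t \<Longrightarrow> t \<le> 1 \<Longrightarrow> 1 / (norm (w + of_real t))\<^sup>2 \<le> B"
  shows "norm (Ln (w + 1) - Ln w - inverse w) \<le> B"
proof -
  have on_segment: "\<exists>t. 0 \<le> t \<and> t \<le> 1 \<and> u = w + of_real t" if "u \<in> closed_segment w (w + 1)" for u
    using that by (auto simp: closed_segment_def scaleR_conv_of_real algebra_simps)
  define f where "f i u = (if i = 0 then Ln u else if i = (1::nat) then inverse u else - inverse (u\<^sup>2))" for i u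
  have "norm (f 0 (w + 1) - (\<Sum>i\<le>1. f i w * ((w + 1) - w) ^ i / fact i)) \<le> B * norm ((w + 1) - w) ^ Suc 1 / fact 1"
  proof (rule complex_Taylor)
    fix i u assume "u \<in> closed_segment w (w + 1)" "i \<le> (1::nat)"
    moreover from this have "u \<notin> \<real>\<^sub>\<le>\<^sub>0" using on_segment assms(1) by blast
    moreover from this have "u \<noteq> 0" by auto
    ultimately show "(f i has_field_derivative f (Suc i) u) (at u within closed_segment w (w + 1))"
      unfolding f_def by (cases "i = 0") (auto intro!: derivative_eq_intros simp: power2_eq_square field_simps)
  next
    fix u assume "u \<in> closed_segment w (w + 1)"
    then obtain t where "0 \<le> t" "t \<le> 1" "u = w + of_real t" using on_segment by blast
    then show "norm (f (Suc 1) u) \<le> B"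
      using assms(2) by (simp add: f_def norm_divide norm_power inverse_eq_divide)
  qed auto
  then show ?thesis by (simp add: f_def diff_diff_eq)
qed

lemma Digamma_minus_Ln_sums:
  assumes "Im z \<noteq> 0"
  shows "(\<lambda>n. Ln (z + of_nat n + 1) - Ln (z + of_nat n) - inverse (z + of_nat n)) sums (Digamma z - Ln z)"
proof -
  have "(\<lambda>m. Ln (z + of_nat m) - of_real (ln (real m))) \<longlonglongrightarrow> 0"
  proof (rule Lim_transform_eventually)
    have "(\<lambda>m. Ln (1 + z / of_nat m)) \<longlonglongrightarrow> Ln (1 + 0)"
      by (intro tendsto_intros lim_const_over_n) auto
    then show "(\<lambda>m. Ln (1 + z / of_nat m)) \<longlonglongrightarrow> 0" by simp
    show "eventually (\<lambda>m. Ln (1 + z / of_nat m) = Ln (z + of_nat m) - of_real (ln (real m))) sequentially"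
      using eventually_gt_at_top[of 0]
    proof eventually_elim
      case (elim m)
      have "z + of_nat m = of_real (real m) * (1 + z / of_nat m)"
        using elim by (simp add: field_simps)
      moreover have "1 + z / of_nat m \<noteq> 0"
        using assms elim by (auto simp: complex_eq_iff Im_divide_of_nat)
      ultimately show ?case
        using elim Ln_times_of_real[of "real m" "1 + z / of_nat m"] by simp
    qed
  qed
  moreover have "(\<lambda>m. of_real (ln (real m)) - (\<Sum>n<m. inverse (z + of_nat n))) \<longlonglongrightarrow> Digamma z"
    using assms by (intro Digamma_LIMSEQ) auto
  ultimately have "(\<lambda>m. (Ln (z + of_nat m) - of_real (ln (real m))) +
      (of_real (ln (real m)) - (\<Sum>n<m. inverse (z + of_nat n))) - Ln z) \<longlonglongrightarrow> 0 + Digamma z - Ln z"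
    by (intro tendsto_intros)
  moreover have telescoped: "(\<Sum>n<m. Ln (z + of_nat n + 1) - Ln (z + of_nat n) - inverse (z + of_nat n)) =
      Ln (z + of_nat m) - Ln z - (\<Sum>n<m. inverse (z + of_nat n))" for m
    by (induction m) (auto simp: algebra_simps)
  ultimately show ?thesis unfolding sums_def telescoped by (simp add: algebra_simps)
qed

lemma norm_Digamma_minus_Ln_le:
  assumes z: "\<bar>Re z\<bar> \<le> 2" "\<bar>Im z\<bar> \<ge> 1 / 2"
  shows "norm (Digamma z - Ln z) \<le> 6 * pi\<^sup>2"
proof -
  have "Im z \<noteq> 0" using z by auto
  have "1 / 4 \<le> (Im z)\<^sup>2"
    using z(2) power_mono[of "1/2" "\<bar>Im z\<bar>" 2] by (simp add: power2_eq_square)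
  define step where "step n = Ln (z + of_nat n + 1) - Ln (z + of_nat n) - inverse (z + of_nat n)" for n
  have step_le: "norm (step n) \<le> 36 * (1 / real (n + 1) ^ 2)" for n
    unfolding step_def
  proof (rule norm_Ln_plus_1_minus_Ln_le)
    fix t :: real assume t: "0 \<le> t" "t \<le> 1"
    show "z + of_nat n + of_real t \<notin> \<real>\<^sub>\<le>\<^sub>0" using \<open>Im z \<noteq> 0\<close> by (simp add: complex_nonpos_Reals_iff)
    have "(real (n + 1) / 6)\<^sup>2 \<le> (Re z + real n + t)\<^sup>2 + (Im z)\<^sup>2"
    proof (cases "n \<le> 2")
      case True
      then have "(real (n + 1) / 6)\<^sup>2 \<le> (1 / 2)\<^sup>2" by (intro power_mono) auto
      then show ?thesis using \<open>1 / 4 \<le> (Im z)\<^sup>2\<close> by (simp add: power2_eq_square add_increasing)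
    next
      case False
      then have "(real (n + 1) / 6)\<^sup>2 \<le> (Re z + real n + t)\<^sup>2" using z(1) t by (intro power_mono) auto
      then show ?thesis by (simp add: add_increasing2)
    qed
    then have "1 / (norm (z + of_nat n + of_real t))\<^sup>2 \<le> 1 / (real (n + 1) / 6)\<^sup>2"
      by (intro divide_left_mono) (auto simp: cmod_power2 intro!: mult_pos_pos elim: less_le_trans[rotated])
    then show "1 / (norm (z + of_nat n + of_real t))\<^sup>2 \<le> 36 * (1 / real (n + 1) ^ 2)"
      by (simp add: power_divide)
  qed
  have "(\<lambda>n. 36 * (1 / real (n + 1) ^ 2)) sums (36 * (pi\<^sup>2 / 6))"
    using sums_mult[OF inverse_squares_sums, of 36] by (simp add: add.commute)
  then have "norm (suminf step) \<le> 36 * (pi\<^sup>2 / 6)"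
    using norm_suminf_le[of step, OF step_le] by (simp add: sums_iff)
  then show ?thesis
    using Digamma_minus_Ln_sums[OF \<open>Im z \<noteq> 0\<close>] by (simp add: sums_iff step_def[abs_def])
qed

lemma norm_Digamma_minus_ln_norm_le:
  assumes z: "\<bar>Re z\<bar> \<le> 2" "\<bar>Im z\<bar> \<ge> 1 / 2"
  shows "norm (Digamma z - of_real (ln (norm z))) \<le> 6 * pi\<^sup>2 + pi"
proof -
  have "z \<noteq> 0" using z by auto
  then have "Ln z - of_real (ln (norm z)) = \<i> * of_real (Im (Ln z))" by (simp add: complex_eq_iff)
  then have "norm (Ln z - of_real (ln (norm z))) \<le> pi"
    using mpi_less_Im_Ln[OF \<open>z \<noteq> 0\<close>] Im_Ln_le_pi[OF \<open>z \<noteq> 0\<close>] by (simp add: norm_mult abs_le_iff)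
  then show ?thesis
    using norm_Digamma_minus_Ln_le[OF z] norm_triangle_ineq[of "Digamma z - Ln z" "Ln z - of_real (ln (norm z))"]
    by simp
qed

section \<open>Dirichlet series\<close>

definition dirichlet_series :: "(nat \<Rightarrow> complex) \<Rightarrow> complex \<Rightarrow> complex" where
  "dirichlet_series a s = (\<Sum>n. a n / of_nat n powr s)"

lemma norm_dirichlet_term:
  "norm (a / of_nat n powr s :: complex) = norm a * real n powr (- Re s)"
proof (cases "n = 0")
  case False
  then have "norm (of_nat n powr s :: complex) = real n powr Re s"
    by (subst norm_powr_real_powr) auto
  then show ?thesis by (simp add: norm_divide powr_minus_divide)
qed simp

lemma dirichlet_term_Complex:
  "a / of_nat n powr Complex c t = a * of_real (real n powr (- c)) * cis (- (t * ln (real n)))"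
proof (cases "n = 0")
  case False
  have "1 / of_nat n powr Complex c t = exp (- (Complex c t * of_real (ln (real n))))"
    using False by (simp add: powr_def Ln_of_nat exp_minus inverse_eq_divide)
  also have "- (Complex c t * of_real (ln (real n))) = of_real (- c * ln (real n)) + \<i> * of_real (- (t * ln (real n)))"
    by (simp add: complex_eq_iff)
  also have "exp \<dots> = of_real (exp (- c * ln (real n))) * cis (- (t * ln (real n)))"
    by (simp only: exp_add exp_of_real cis_conv_exp)
  also have "exp (- c * ln (real n)) = real n powr (- c)" using False by (simp add: powr_def)
  finally show ?thesis by (simp add: divide_inverse mult.assoc)
qed simp

lemma
  assumes "summable (\<lambda>n. norm (a n) * real n powr (- c))" "c \<le> Re s"
  shows summable_norm_dirichlet_series: "summable (\<lambda>n. norm (a n / of_nat n powr s))"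
    and dirichlet_series_sums: "(\<lambda>n. a n / of_nat n powr s) sums dirichlet_series a s"
proof -
  show summable_norm: "summable (\<lambda>n. norm (a n / of_nat n powr s))"
  proof (rule summable_comparison_test'[OF assms(1), of 1])
    fix n :: nat assume "n \<ge> 1"
    then show "norm (norm (a n / of_nat n powr s)) \<le> norm (a n) * real n powr (- c)"
      unfolding norm_dirichlet_term real_norm_def abs_mult abs_norm_cancel
      using assms(2) by (intro mult_mono) (auto intro: powr_mono)
  qed
  show "(\<lambda>n. a n / of_nat n powr s) sums dirichlet_series a s"
    unfolding dirichlet_series_def by (rule summable_sums[OF summable_norm_cancel[OF summable_norm]])
qed

lemma has_field_derivative_dirichlet_series:
  assumes abs_conv: "summable (\<lambda>n. norm (a n) * real n powr (- c))" and s: "c < Re s"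
  shows "(dirichlet_series a has_field_derivative - dirichlet_series (\<lambda>n. of_real (ln (real n)) * a n) s) (at s)"
proof -
  define a' where "a' n x = - (of_real (ln (real n)) * a n / of_nat n powr x)" for n x
  have halfplane: "open {s. c < Re s}" by (simp add: open_halfspace_Re_gt)
  obtain g g' where g: "\<forall>x\<in>{s. c < Re s}. ((\<lambda>n. a n / of_nat n powr x) sums g x) \<and>
      ((\<lambda>n. a' n x) sums g' x) \<and> (g has_field_derivative g' x) (at x)"
  proof (rule series_and_derivative_comparison[OF halfplane abs_conv])
    show "((\<lambda>s. a n / of_nat n powr s) has_field_derivative a' n x) (at x)" for n x
      by (cases "n = 0") (auto simp: a'_def Ln_of_nat intro!: derivative_eq_intros)
    show "\<forall>\<^sub>F n in sequentially. \<forall>x\<in>{s. c < Re s}. norm (a n / of_nat n powr x) \<le> norm (a n) * real n powr (- c)"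
      using eventually_ge_at_top[of 1]
      by eventually_elim (auto simp: norm_dirichlet_term intro!: mult_left_mono powr_mono)
  qed
  have g'_sums: "(\<lambda>n. - a' n s) sums (- g' s)" using g s by (intro sums_minus) auto
  have "\<forall>\<^sub>F x in nhds s. g x = dirichlet_series a x"
    using eventually_nhds_in_open[OF halfplane, of s] s g
    by (auto elim!: eventually_mono simp: dirichlet_series_def sums_iff)
  then have "(dirichlet_series a has_field_derivative g' s) (at s)"
    using DERIV_cong_ev[of s s g "dirichlet_series a" "g' s"] g s by simp
  then show ?thesis using g'_sums by (simp add: a'_def dirichlet_series_def sums_iff)
qed

lemma has_sum_product_abs:
  fixes f g :: "nat \<Rightarrow> complex"
  assumes "summable (\<lambda>n. norm (f n))" "summable (\<lambda>n. norm (g n))"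
  shows "((\<lambda>(m, n). f m * g n) has_sum (suminf f * suminf g)) UNIV"
proof -
  have f_sum: "(f has_sum suminf f) UNIV" and g_sum: "(g has_sum suminf g) UNIV"
    using assms by (auto intro!: norm_summable_imp_has_sum summable_sums summable_norm_cancel)
  have "(\<lambda>n. norm (f n)) summable_on UNIV" "(\<lambda>n. norm (g n)) summable_on UNIV"
    using assms by (auto intro!: summable_nonneg_imp_summable_on)
  then have "(\<lambda>x. norm ((\<lambda>(m, n). f m * g n) x)) summable_on UNIV \<times> UNIV"
    unfolding Infinite_Sum.abs_summable_on_Sigma_iff
    by (auto simp: norm_mult infsum_cmult_right' abs_mult infsum_nonneg
        intro!: summable_on_cmult_right summable_on_cmult_left)
  then have "(\<lambda>(m, n). f m * g n) summable_on UNIV \<times> UNIV" by (rule abs_summable_summable)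
  then have "((\<lambda>(m, n). f m * g n) has_sum (suminf f * suminf g)) (UNIV \<times> UNIV)"
    by (rule has_sum_SigmaI[rotated 2]) (auto intro!: has_sum_cmult_right g_sum has_sum_cmult_left f_sum)
  then show ?thesis by simp
qed

lemma dirichlet_series_mult_sums:
  fixes f g :: "nat \<Rightarrow> complex"
  assumes "summable (\<lambda>n. norm (f n / of_nat n powr s))" "summable (\<lambda>n. norm (g n / of_nat n powr s))"
  shows "(\<lambda>N. (\<Sum>d | d dvd N. f (N div d) * g d) / of_nat N powr s) sums (dirichlet_series f s * dirichlet_series g s)"
proof -
  define A where "A = {n::nat. n > 0}"
  define F G where "F m = f m / of_nat m powr s" and "G m = g m / of_nat m powr s" for m
  define P where "P = dirichlet_series f s * dirichlet_series g s"
  have "((\<lambda>(m, n). F m * G n) has_sum P) UNIV"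
    using has_sum_product_abs[OF assms] by (simp add: F_def G_def P_def dirichlet_series_def)
  then have "((\<lambda>(m, n). F m * G n) has_sum P) (A \<times> A)"
    by (rule has_sum_cong_neutral[THEN iffD1, rotated -1]) (auto simp: A_def F_def G_def)
  then have pair_sum: "((\<lambda>(N, d). F (N div d) * G d) has_sum P) (Sigma A (\<lambda>N. {d. d dvd N}))"
    by (subst (asm) has_sum_reindex_bij_witness[of _ "\<lambda>(N, d). (N div d, d)" "\<lambda>(m, n). (m * n, n)"
          "Sigma A (\<lambda>N. {d. d dvd N})" "\<lambda>(N, d). F (N div d) * G d" _ _ P])
       (auto simp: A_def div_greater_zero_iff dvd_imp_le dvd_pos_nat)
  have "((\<lambda>N. (\<Sum>d | d dvd N. f (N div d) * g d) / of_nat N powr s) has_sum P) A"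
  proof (rule has_sum_SigmaD[OF pair_sum])
    fix N assume N: "N \<in> A"
    have "F (N div d) * G d = f (N div d) * g d / of_nat N powr s" if "d dvd N" for d
    proof -
      have "of_nat N powr s = (of_nat (N div d) * of_nat d) powr s"
        using that by (simp flip: of_nat_mult)
      also have "\<dots> = of_nat (N div d) powr s * of_nat d powr s"
        by (rule powr_times_real) auto
      finally show ?thesis by (simp add: F_def G_def)
    qed
    then have "(\<Sum>d | d dvd N. F (N div d) * G d) = (\<Sum>d | d dvd N. f (N div d) * g d) / of_nat N powr s"
      by (simp add: sum_divide_distrib)
    then show "((\<lambda>d. case (N, d) of (N, d) \<Rightarrow> F (N div d) * G d) has_sum
        (\<Sum>d | d dvd N. f (N div d) * g d) / of_nat N powr s) {d. d dvd N}"
      using has_sum_finite[of "{d. d dvd N}" "\<lambda>d. F (N div d) * G d"] N by (simp add: A_def)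
  qed
  then have "((\<lambda>N. (\<Sum>d | d dvd N. f (N div d) * g d) / of_nat N powr s) has_sum P) UNIV"
    by (rule has_sum_cong_neutral[THEN iffD1, rotated -1]) (auto simp: A_def)
  then show ?thesis unfolding P_def by (rule has_sum_imp_sums)
qed


section \<open>The zeta function to the right of the critical strip\<close>

lemma riemann_zeta_holomorphic: "riemann_zeta holomorphic_on - {1}"
  using zeta_continuation_riemann_zeta by (simp add: zeta_continuation_def)

lemma riemann_zeta_differentiable: "s \<noteq> 1 \<Longrightarrow> riemann_zeta field_differentiable at s"
  by (rule holomorphic_on_imp_differentiable_at[OF riemann_zeta_holomorphic]) auto

lemma riemann_zeta_sums:
  assumes "Re s > 1"
  shows "(\<lambda>n. 1 / of_nat (Suc n) powr s) sums riemann_zeta s"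
  using assms zeta_continuation_riemann_zeta by (simp add: zeta_continuation_def)

lemma riemann_zeta_eq_dirichlet_series:
  assumes "Re s > 1"
  shows "riemann_zeta s = dirichlet_series (\<lambda>_. 1) s"
proof -
  have "(\<lambda>n. 1 / of_nat n powr s) sums riemann_zeta s"
    using riemann_zeta_sums[OF assms] by (subst (asm) sums_Suc_iff) simp
  then show ?thesis by (simp add: dirichlet_series_def sums_iff)
qed

lemma riemann_zeta_minus_one_mult:
  assumes "Re s > 0" "s \<noteq> 1"
  shows "(s - 1) * riemann_zeta s = 1 + (\<Sum>n. zeta_rem 0 n s)"
proof -
  obtain h where h: "h holomorphic_on UNIV" "\<And>s. Re s > 1 \<Longrightarrow> h s = (s - 1) * zeta_series s"
    using zeta_entire by blast
  have zeta_eq: "riemann_zeta s = h s / (s - 1)" for s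
    using zeta_continuation_unique[OF zeta_continuation_riemann_zeta zeta_continuation_if_entire[OF h]]
    by metis
  have "h s = 1 + (\<Sum>n. zeta_rem 0 n s)"
  proof (rule analytic_continuation_open[of "{s. Re s > 1}" "{s. Re s > 0}" h "\<lambda>s. 1 + (\<Sum>n. zeta_rem 0 n s)"])
    show "(\<lambda>s. 1 + (\<Sum>n. zeta_rem 0 n s)) holomorphic_on {s. Re s > 0}"
      using zeta_rem_sum_holomorphic[of 0] by (intro holomorphic_intros) simp
    show "h holomorphic_on {s. Re s > 0}" using h(1) holomorphic_on_subset by blast
    show "{s. Re s > 1} \<noteq> {}" by (auto intro: exI[of _ 2])
    show "connected {s. Re s > 0}" by (intro convex_connected convex_halfspace_Re_gt)
    show "h z = 1 + (\<Sum>n. zeta_rem 0 n z)" if "z \<in> {s. Re s > 1}" for z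
      using that h(2)[of z] zeta_series_recurrence[of z 0] by simp
  qed (use assms in \<open>auto simp: open_halfspace_Re_gt\<close>)
  then show ?thesis using assms by (simp add: zeta_eq)
qed

lemma zeta_rem_0_bound:
  assumes "Re s > 0"
  shows "norm (zeta_rem 0 n s) \<le> norm s * norm (1 - s) * real (Suc n) powr (- Re s - 1)"
proof -
  define m where "m = real (Suc n)"
  have m_ge: "m \<ge> 1" by (simp add: m_def)
  define S where "S = closed_segment (complex_of_real m) (complex_of_real (m + 1))"
  have on_segment: "\<exists>y. x = of_real y \<and> m \<le> y \<and> y \<le> m + 1" if "x \<in> S" for x
    using that unfolding S_def closed_segment_of_real closed_segment_eq_real_ivl by (auto split: if_splits)
  define f where "f i x = (if i = 0 then x powr (1 - s) else if i = (1::nat) then (1 - s) * x powr (- s)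
      else (1 - s) * (- s * x powr (- s - 1)))" for i and x :: complex
  have "norm (f 0 (of_real (m + 1)) - (\<Sum>i\<le>1. f i (of_real m) * (of_real (m + 1) - of_real m) ^ i / fact i))
        \<le> (norm s * norm (1 - s) * m powr (- Re s - 1)) * norm (complex_of_real (m + 1) - of_real m) ^ Suc 1 / fact 1"
  proof (rule complex_Taylor)
    show "convex S" by (simp add: S_def)
    show "complex_of_real m \<in> S" "complex_of_real (m + 1) \<in> S" by (simp_all add: S_def)
  next
    fix i x assume x: "x \<in> S" "i \<le> (1::nat)"
    then obtain y where y: "x = of_real y" "m \<le> y" using on_segment by blast
    have "x \<notin> \<real>\<^sub>\<le>\<^sub>0" using y m_ge by auto
    then show "(f i has_field_derivative f (Suc i) x) (at x within S)"
      using x(2) unfolding f_def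
      by (cases "i = 0") (auto intro!: derivative_eq_intros has_field_derivative_at_within[OF has_field_derivative_powr] simp: algebra_simps)
  next
    fix x assume "x \<in> S"
    then obtain y where y: "x = of_real y" "m \<le> y" using on_segment by blast
    have "norm (x powr (- s - 1)) = y powr (- Re s - 1)"
      using y m_ge by (subst norm_powr_real_powr) auto
    also have "\<dots> \<le> m powr (- Re s - 1)" using y m_ge assms by (intro powr_mono2') auto
    finally show "norm (f (Suc 1) x) \<le> norm s * norm (1 - s) * m powr (- Re s - 1)"
      by (simp add: f_def norm_mult mult_left_mono mult_ac)
  qed
  also have "f 0 (of_real (m + 1)) - (\<Sum>i\<le>1. f i (of_real m) * (of_real (m + 1) - of_real m) ^ i / fact i)
             = zeta_rem 0 n s"
    by (simp add: zeta_rem_def f_def m_def)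
  finally show ?thesis by (simp add: m_def)
qed

lemma riemann_zeta_growth:
  assumes "\<sigma>0 > 0"
  shows "\<exists>C\<ge>0. \<forall>s. Re s \<ge> \<sigma>0 \<and> \<bar>Im s\<bar> \<ge> 1 \<longrightarrow> norm (riemann_zeta s) \<le> C * norm s"
proof -
  define C where "C = (\<Sum>n. real (Suc n) powr (- \<sigma>0 - 1))"
  have summable_rhs: "summable (\<lambda>n. real (Suc n) powr (- \<sigma>0 - 1))"
    using assms summable_real_powr_iff[of "- \<sigma>0 - 1"] summable_Suc_iff[of "\<lambda>n. real n powr (- \<sigma>0 - 1)"] by simp
  have C_nonneg: "C \<ge> 0" unfolding C_def by (intro suminf_nonneg summable_rhs) auto
  show ?thesis
  proof (intro exI[of _ "C + 1"] conjI allI impI)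
    fix s assume s: "Re s \<ge> \<sigma>0 \<and> \<bar>Im s\<bar> \<ge> 1"
    have norm_ge_1: "norm (s - 1) \<ge> 1" "norm s \<ge> 1" using s abs_Im_le_cmod[of "s - 1"] abs_Im_le_cmod[of s] by auto
    have s_ne: "s \<noteq> 1" using s by auto
    have rem_le: "norm (zeta_rem 0 n s) \<le> norm s * norm (1 - s) * real (Suc n) powr (- \<sigma>0 - 1)" for n
    proof -
      have "real (Suc n) powr (- Re s - 1) \<le> real (Suc n) powr (- \<sigma>0 - 1)"
        using s by (intro powr_mono) auto
      then show ?thesis
        using s assms by (intro order_trans[OF zeta_rem_0_bound[of s n]] mult_left_mono) auto
    qed
    have summable_scaled: "summable (\<lambda>n. norm s * norm (1 - s) * real (Suc n) powr (- \<sigma>0 - 1))"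
      by (intro summable_mult summable_rhs)
    have "norm (\<Sum>n. zeta_rem 0 n s) \<le> (\<Sum>n. norm s * norm (1 - s) * real (Suc n) powr (- \<sigma>0 - 1))"
      by (rule norm_suminf_le[OF rem_le summable_scaled])
    also have "\<dots> = norm s * norm (s - 1) * C"
      unfolding C_def by (subst suminf_mult[OF summable_rhs]) (simp add: norm_minus_commute)
    finally have "norm ((s - 1) * riemann_zeta s) \<le> 1 + norm s * norm (s - 1) * C"
      using riemann_zeta_minus_one_mult[of s] s s_ne assms norm_triangle_ineq[of 1 "\<Sum>n. zeta_rem 0 n s"] by simp
    also have "\<dots> \<le> norm (s - 1) * norm s + norm s * norm (s - 1) * C"
      using mult_mono[OF norm_ge_1] by simp
    finally have "norm (s - 1) * norm (riemann_zeta s) \<le> norm (s - 1) * ((C + 1) * norm s)"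
      unfolding norm_mult by (simp add: distrib_left distrib_right mult_ac)
    moreover have "norm (s - 1) > 0" using norm_ge_1 by linarith
    ultimately show "norm (riemann_zeta s) \<le> (C + 1) * norm s"
      by (simp only: mult_le_cancel_left_pos)
  qed (use C_nonneg in auto)
qed


lemma norm_riemann_zeta_2_ge: "norm (riemann_zeta (Complex 2 t)) \<ge> 1 / 5"
proof -
  define s where "s = Complex 2 t"
  define a where "a n = 1 / of_nat (Suc n) powr s" for n :: nat
  have "a sums riemann_zeta s"
    unfolding a_def by (rule riemann_zeta_sums) (simp add: s_def)
  then have tail_sums: "(\<lambda>n. a (Suc n)) sums (riemann_zeta s - a 0)" by (subst sums_Suc_iff) simp
  have norm_a: "norm (a n) = 1 / real (Suc n) ^ 2" for n
  proof -
    have "norm (of_nat (Suc n) powr s) = real (Suc n) powr 2"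
      by (subst norm_powr_real_powr) (auto simp: s_def simp del: of_nat_Suc)
    also have "\<dots> = real (Suc n) ^ 2" by (rule powr_numeral) simp
    finally show ?thesis by (simp add: a_def norm_divide del: of_nat_Suc)
  qed
  have squares_sums: "(\<lambda>n. 1 / real (Suc n) ^ 2) sums (pi\<^sup>2 / 6)"
    using inverse_squares_sums by (simp add: add.commute)
  from squares_sums have squares_tail_sums: "(\<lambda>n. 1 / real (Suc (Suc n)) ^ 2) sums (pi\<^sup>2 / 6 - 1)"
    using sums_Suc_iff[of "\<lambda>n. 1 / real (Suc n) ^ 2" "pi\<^sup>2 / 6 - 1"] by simp
  have "norm (riemann_zeta s - a 0) \<le> pi\<^sup>2 / 6 - 1"
  proof -
    have "norm (\<Sum>n. a (Suc n)) \<le> (\<Sum>n. 1 / real (Suc (Suc n)) ^ 2)"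
      using squares_tail_sums norm_a by (intro norm_suminf_le) (auto simp: sums_iff)
    then show ?thesis using tail_sums squares_tail_sums by (simp add: sums_iff)
  qed
  moreover have "a 0 = 1" by (simp add: a_def)
  moreover have "pi\<^sup>2 \<le> (3.2)\<^sup>2" using pi_approx by (intro power_mono) auto
  ultimately have "norm (riemann_zeta s - 1) \<le> 4 / 5" by (simp add: power2_eq_square)
  then show ?thesis using norm_triangle_ineq2[of 1 "1 - riemann_zeta s"] by (simp add: s_def norm_minus_commute)
qed

lemma riemann_zeta_2_nonzero: "riemann_zeta 2 \<noteq> 0"
proof -
  have "(2 :: complex) = Complex 2 0" by (simp add: complex_eq_iff)
  then show ?thesis using norm_riemann_zeta_2_ge[of 0] by auto
qed

abbreviation mangoldt_series :: "complex \<Rightarrow> complex" where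
  "mangoldt_series \<equiv> dirichlet_series mangoldt"

lemma summable_mangoldt_powr:
  assumes "c > 1"
  shows "summable (\<lambda>n. mangoldt n * real n powr (- c))"
proof -
  define e where "e = (c - 1) / 2"
  have e_bounds: "e > 0" "e - c < -1" using assms by (auto simp: e_def field_simps)
  show ?thesis
  proof (rule summable_comparison_test')
    show "summable (\<lambda>n. 1 / e * real n powr (e - c))"
      using e_bounds by (intro summable_mult) (simp add: summable_real_powr_iff)
    fix n :: nat assume "n \<ge> 1"
    have "mangoldt n \<le> ln (real n)" using \<open>n \<ge> 1\<close> by (intro mangoldt_le) auto
    also have "\<dots> \<le> real n powr e / e" using e_bounds \<open>n \<ge> 1\<close> by (intro ln_powr_bound) auto
    finally have "mangoldt n * real n powr (- c) \<le> real n powr e / e * real n powr (- c)"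
      by (intro mult_right_mono) auto
    also have "\<dots> = 1 / e * real n powr (e - c)"
      using \<open>n \<ge> 1\<close> by (simp add: powr_add[symmetric])
    finally show "norm (mangoldt n * real n powr (- c)) \<le> 1 / e * real n powr (e - c)"
      using mangoldt_nonneg[of n] by simp
  qed
qed

lemma summable_norm_mangoldt_powr:
  "c > 1 \<Longrightarrow> summable (\<lambda>n. norm (mangoldt n :: complex) * real n powr (- c))"
  using summable_mangoldt_powr[of c] by (simp add: mangoldt_nonneg)

lemma mangoldt_series_sums:
  assumes "Re s > 1"
  shows "(\<lambda>n. mangoldt n / of_nat n powr s) sums mangoldt_series s"
  by (rule dirichlet_series_sums[OF summable_norm_mangoldt_powr[OF assms] order_refl])

lemma mangoldt_series_holomorphic: "mangoldt_series holomorphic_on {s. Re s > 1}"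
proof (rule holomorphic_onI)
  fix s :: complex assume "s \<in> {s. Re s > 1}"
  then have "(mangoldt_series has_field_derivative
      - dirichlet_series (\<lambda>n. of_real (ln (real n)) * mangoldt n) s) (at s)"
    by (intro has_field_derivative_dirichlet_series[of _ "(1 + Re s) / 2"] summable_norm_mangoldt_powr) auto
  then show "mangoldt_series field_differentiable at s within {s. Re s > 1}"
    unfolding field_differentiable_def by (blast intro: has_field_derivative_at_within)
qed

lemma deriv_riemann_zeta:
  assumes s: "Re s > 1"
  shows "deriv riemann_zeta s = - (riemann_zeta s * mangoldt_series s)"
proof -
  define c where "c = (1 + Re s) / 2"
  have c: "c > 1" "c < Re s" using s by (auto simp: c_def)
  have abs_conv: "summable (\<lambda>n. norm (1 :: complex) * real n powr (- c))"
    using c(1) by (simp add: summable_real_powr_iff)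
  have "\<forall>\<^sub>F x in nhds s. riemann_zeta x = dirichlet_series (\<lambda>_. 1) x"
    using eventually_nhds_in_open[OF open_halfspace_Re_gt, of s 1] s
    by (auto elim!: eventually_mono simp: riemann_zeta_eq_dirichlet_series)
  then have "deriv riemann_zeta s = deriv (dirichlet_series (\<lambda>_. 1)) s"
    by (intro deriv_cong_ev refl)
  also have "\<dots> = - dirichlet_series (\<lambda>n. of_real (ln (real n)) * 1) s"
    by (intro DERIV_imp_deriv has_field_derivative_dirichlet_series[OF abs_conv c(2)])
  also have "dirichlet_series (\<lambda>n. of_real (ln (real n)) * 1) s = dirichlet_series (\<lambda>_. 1) s * mangoldt_series s"
  proof -
    have "(\<Sum>d | d dvd n. 1 * mangoldt d) / of_nat n powr s = of_real (ln (real n)) * 1 / of_nat n powr s" for n :: nat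
      by (cases "n = 0") (simp_all add: mangoldt_sum)
    then have "(\<lambda>n. of_real (ln (real n)) * 1 / of_nat n powr s) sums (dirichlet_series (\<lambda>_. 1) s * mangoldt_series s)"
      using dirichlet_series_mult_sums[of "\<lambda>_. 1" s mangoldt] s abs_conv c(2) summable_norm_mangoldt_powr[OF s]
      by (simp only: summable_norm_dirichlet_series[OF abs_conv less_imp_le[OF c(2)]]
            summable_norm_dirichlet_series[OF _ order_refl])
    then show ?thesis by (simp add: dirichlet_series_def sums_iff)
  qed
  finally show ?thesis using s by (simp add: riemann_zeta_eq_dirichlet_series)
qed

text \<open>Multiplied by $e^P$ for a primitive $P$ of the Mangoldt series, $\zeta$ becomes constant.\<close>

lemma riemann_zeta_nonzero_Re_gt_1:
  assumes "Re s > 1"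
  shows "riemann_zeta s \<noteq> 0"
proof -
  define H where "H = {s. Re s > (1::real)}"
  have H: "convex H" "open H" by (auto simp: H_def convex_halfspace_Re_gt open_halfspace_Re_gt)
  obtain P where P_deriv: "\<And>x. x \<in> H \<Longrightarrow> (P has_field_derivative mangoldt_series x) (at x within H)"
    using holomorphic_convex_primitive'[OF H] mangoldt_series_holomorphic by (auto simp: H_def)
  have "\<exists>c. \<forall>x\<in>H. riemann_zeta x * exp (P x) = c"
  proof (rule has_field_derivative_zero_constant[OF H(1)])
    fix x assume x: "x \<in> H"
    then have "x \<noteq> 1" by (auto simp: H_def)
    then have "(riemann_zeta has_field_derivative deriv riemann_zeta x) (at x within H)"
      by (rule has_field_derivative_at_within[OF field_differentiable_derivI[OF riemann_zeta_differentiable]])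
    from DERIV_mult[OF this DERIV_chain2[OF DERIV_exp P_deriv[OF x]]]
    show "((\<lambda>x. riemann_zeta x * exp (P x)) has_field_derivative 0) (at x within H)"
      using x by (simp add: deriv_riemann_zeta H_def algebra_simps)
  qed
  then have "riemann_zeta s * exp (P s) = riemann_zeta 2 * exp (P 2)"
    using assms by (auto simp: H_def)
  then show ?thesis using riemann_zeta_2_nonzero by auto
qed

lemma logderiv_riemann_zeta:
  "Re s > 1 \<Longrightarrow> logderiv riemann_zeta s = - mangoldt_series s"
  by (simp add: logderiv_def deriv_riemann_zeta riemann_zeta_nonzero_Re_gt_1)


subsection \<open>The line of real part one\<close>

lemma riemann_zeta_zorder_factor:
  assumes "s \<noteq> 1"
  obtains r g where "r > 0" "g holomorphic_on ball s r" "g s \<noteq> 0"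
    "\<And>w. w \<in> ball s r \<Longrightarrow> riemann_zeta w = g w * (w - s) powi zorder riemann_zeta s"
    "zorder riemann_zeta s \<ge> 0" "riemann_zeta s = 0 \<Longrightarrow> zorder riemann_zeta s > 0"
proof -
  define n where "n = zorder riemann_zeta s"
  define g where "g = zor_poly riemann_zeta s"
  have "open (- {1 :: complex})" "s \<in> - {1}" "\<exists>w\<in>- {1}. riemann_zeta w \<noteq> 0"
    using assms riemann_zeta_2_nonzero by (auto intro!: bexI[of _ 2])
  note zorder_facts = zorder_exist_zero[OF riemann_zeta_holomorphic this(1) connected_minus_one this(2,3)]
  have order: "if riemann_zeta s = 0 then n > 0 else n = 0"
    unfolding n_def by (rule conjunct1[OF zorder_facts])
  obtain r where r: "r > 0" "cball s r \<subseteq> - {1}" "g holomorphic_on cball s r"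
    "\<forall>w\<in>cball s r. riemann_zeta w = g w * (w - s) ^ nat n \<and> g w \<noteq> 0"
    using conjunct2[OF zorder_facts, folded n_def g_def] by (elim exE conjE)
  have "n \<ge> 0" using order by (auto split: if_splits)
  show ?thesis
  proof (rule that[of r g])
    show "g holomorphic_on ball s r" by (rule holomorphic_on_subset[OF r(3) ball_subset_cball])
    show "g s \<noteq> 0" using r(1,4) by simp
    show "zorder riemann_zeta s \<ge> 0" using \<open>n \<ge> 0\<close> by (simp only: n_def)
    show "zorder riemann_zeta s > 0" if "riemann_zeta s = 0" using order that by (simp add: n_def)
    fix w assume "w \<in> ball s r"
    then have "riemann_zeta w = g w * (w - s) powi n"
      using r(4) \<open>n \<ge> 0\<close> by (simp add: power_int_def)
    then show "riemann_zeta w = g w * (w - s) powi zorder riemann_zeta s" by (simp only: n_def)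
  qed (fact r(1))
qed

lemma zorder_riemann_zeta_nonneg: "s \<noteq> 1 \<Longrightarrow> zorder riemann_zeta s \<ge> 0"
  by (rule riemann_zeta_zorder_factor)

lemma zorder_riemann_zeta_pos: "s \<noteq> 1 \<Longrightarrow> riemann_zeta s = 0 \<Longrightarrow> zorder riemann_zeta s > 0"
  by (rule riemann_zeta_zorder_factor)

lemma tendsto_mult_mangoldt_series:
  assumes "Re s = 1"
    and lim: "((\<lambda>x. of_real x * logderiv riemann_zeta (s + of_real x)) \<longlongrightarrow> of_int n) (at_right 0)"
  shows "((\<lambda>x. of_real x * mangoldt_series (s + of_real x)) \<longlongrightarrow> - of_int n) (at_right 0)"
proof (rule Lim_transform_eventually[OF tendsto_minus[OF lim]])
  show "eventually (\<lambda>x. - (of_real x * logderiv riemann_zeta (s + of_real x)) =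
      of_real x * mangoldt_series (s + of_real x)) (at_right 0)"
    using eventually_at_right_less[of 0] by eventually_elim (use assms(1) in \<open>simp add: logderiv_riemann_zeta\<close>)
qed

lemma tendsto_mult_mangoldt_series_zorder:
  assumes "Re s = 1" "s \<noteq> 1"
  shows "((\<lambda>x. of_real x * mangoldt_series (s + of_real x)) \<longlongrightarrow> - of_int (zorder riemann_zeta s)) (at_right 0)"
proof -
  obtain r g where "r > 0" "g holomorphic_on ball s r" "g s \<noteq> 0"
    "\<And>w. w \<in> ball s r \<Longrightarrow> riemann_zeta w = g w * (w - s) powi zorder riemann_zeta s"
    by (rule riemann_zeta_zorder_factor[OF assms(2)]) blast
  then show ?thesis
    using assms(1) by (intro tendsto_mult_mangoldt_series tendsto_mult_logderiv_at_right) auto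
qed

lemma tendsto_mult_mangoldt_series_pole:
  "((\<lambda>x. of_real x * mangoldt_series (1 + of_real x)) \<longlongrightarrow> 1) (at_right 0)"
proof -
  define h where "h s = 1 + (\<Sum>n. zeta_rem 0 n s)" for s
  have "zeta_rem 0 n 1 = 0" for n by (simp add: zeta_rem_def del: of_nat_Suc)
  then have "h 1 = 1" by (simp add: h_def)
  have in_halfplane: "Re w > 0" if "w \<in> ball 1 1" for w :: complex
    using that abs_Re_le_cmod[of "1 - w"] by (simp add: dist_norm)
  have "((\<lambda>x. of_real x * logderiv riemann_zeta (1 + of_real x)) \<longlongrightarrow> of_int (- 1)) (at_right 0)"
  proof (rule tendsto_mult_logderiv_at_right[of 1 h])
    show "h holomorphic_on ball 1 1"
      unfolding h_def using in_halfplane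
      by (intro holomorphic_intros holomorphic_on_subset[OF zeta_rem_sum_holomorphic]) auto
    fix w :: complex assume "w \<in> ball 1 1" "w \<noteq> 1"
    then show "riemann_zeta w = h w * (w - 1) powi (- 1)"
      using riemann_zeta_minus_one_mult[of w] in_halfplane[of w]
      by (simp add: h_def power_int_minus field_simps)
  qed (use \<open>h 1 = 1\<close> in auto)
  from tendsto_mult_mangoldt_series[OF _ this] show ?thesis by simp
qed

lemma mangoldt_series_341:
  assumes "x > 0"
  shows "0 \<le> Re (3 * mangoldt_series (1 + of_real x) + 4 * mangoldt_series (Complex 1 t + of_real x)
    + mangoldt_series (Complex 1 (2 * t) + of_real x))"
proof -
  define trm where "trm n u = mangoldt n / of_nat n powr (Complex 1 u + of_real x)" for n :: nat and u
  have trm_sums: "(\<lambda>n. trm n u) sums mangoldt_series (Complex 1 u + of_real x)" for u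
    unfolding trm_def using assms by (intro mangoldt_series_sums) auto
  have sums: "(\<lambda>n. Re (3 * trm n 0 + 4 * trm n t + trm n (2 * t))) sums
      Re (3 * mangoldt_series (Complex 1 0 + of_real x) + 4 * mangoldt_series (Complex 1 t + of_real x)
        + mangoldt_series (Complex 1 (2 * t) + of_real x))"
    by (intro sums_Re sums_add sums_mult trm_sums)
  have "0 \<le> Re (3 * trm n 0 + 4 * trm n t + trm n (2 * t))" for n
  proof -
    define \<theta> where "\<theta> = t * ln (real n)"
    have "Complex 1 u + of_real x = Complex (1 + x) u" for u by (simp add: complex_eq_iff)
    then have trm_eq: "trm n u = of_real (mangoldt n * real n powr (- (1 + x))) * cis (- (u * ln (real n)))" for u
      by (simp add: trm_def dirichlet_term_Complex del: minus_add_distrib)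
    have "Re (3 * trm n 0 + 4 * trm n t + trm n (2 * t)) =
        (mangoldt n * real n powr (- (1 + x))) * (3 + 4 * cos \<theta> + cos (2 * \<theta>))"
      unfolding trm_eq by (simp add: \<theta>_def algebra_simps)
    also have "3 + 4 * cos \<theta> + cos (2 * \<theta>) = 2 * (1 + cos \<theta>)\<^sup>2"
      unfolding cos_double_cos by (simp add: power2_eq_square algebra_simps)
    finally show ?thesis using mangoldt_nonneg[of n] by simp
  qed
  from sums_le[OF this sums_zero sums] show ?thesis by (simp add: Complex_eq)
qed

lemma riemann_zeta_nonzero_Re_1:
  assumes "Re s = 1" "Im s \<noteq> 0"
  shows "riemann_zeta s \<noteq> 0"
proof
  assume zero: "riemann_zeta s = 0"
  define t where "t = Im s"
  define order where "order u = zorder riemann_zeta (Complex 1 u)" for u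
  have not_1: "Complex 1 u \<noteq> 1" if "u \<noteq> 0" for u using that by (auto simp: complex_eq_iff)
  have "t \<noteq> 0" "2 * t \<noteq> 0" "s = Complex 1 t" using assms by (auto simp: t_def complex_eq_iff)
  then have "order t > 0" "order (2 * t) \<ge> 0"
    using zero not_1 by (auto simp: order_def intro!: zorder_riemann_zeta_pos zorder_riemann_zeta_nonneg)
  have lim: "((\<lambda>x. of_real x * mangoldt_series (Complex 1 u + of_real x)) \<longlongrightarrow> - of_int (order u)) (at_right 0)"
    if "u \<noteq> 0" for u
    unfolding order_def by (rule tendsto_mult_mangoldt_series_zorder) (use not_1[OF that] in auto)
  have "((\<lambda>x. Re (3 * (of_real x * mangoldt_series (1 + of_real x)) + 4 * (of_real x * mangoldt_series (Complex 1 t + of_real x))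
      + of_real x * mangoldt_series (Complex 1 (2 * t) + of_real x))) \<longlongrightarrow>
      Re (3 * 1 + 4 * (- of_int (order t)) + (- of_int (order (2 * t))))) (at_right 0)"
    by (intro tendsto_intros tendsto_mult_mangoldt_series_pole lim \<open>t \<noteq> 0\<close> \<open>2 * t \<noteq> 0\<close>)
  moreover have "eventually (\<lambda>x. 0 \<le> Re (3 * (of_real x * mangoldt_series (1 + of_real x))
      + 4 * (of_real x * mangoldt_series (Complex 1 t + of_real x))
      + of_real x * mangoldt_series (Complex 1 (2 * t) + of_real x))) (at_right 0)"
    using eventually_at_right_less[of 0]
  proof eventually_elim
    case (elim x)
    then have "0 \<le> x * Re (3 * mangoldt_series (1 + of_real x) + 4 * mangoldt_series (Complex 1 t + of_real x)
        + mangoldt_series (Complex 1 (2 * t) + of_real x))"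
      by (intro mult_nonneg_nonneg mangoldt_series_341) auto
    then show ?case by (simp add: algebra_simps)
  qed
  ultimately have "0 \<le> Re (3 * 1 + 4 * (- of_int (order t)) + (- of_int (order (2 * t))) :: complex)"
    by (rule tendsto_lowerbound) simp
  then have "real_of_int (4 * order t + order (2 * t)) \<le> 3" by simp
  then show False using \<open>order t > 0\<close> \<open>order (2 * t) \<ge> 0\<close> by linarith
qed

lemma riemann_zeta_cnj: "riemann_zeta (cnj s) = cnj (riemann_zeta s)"
proof -
  have "zeta_continuation (cnj \<circ> riemann_zeta \<circ> cnj)"
    unfolding zeta_continuation_def
  proof (intro conjI allI impI)
    have "cnj ` (- {1}) = - {1}" 
      by (auto simp: image_cnj_conv_vimage_cnj)
    then show "cnj \<circ> riemann_zeta \<circ> cnj holomorphic_on - {1}"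
      using riemann_zeta_holomorphic by (intro holomorphic_on_compose_cnj_cnj) auto
    show "(cnj \<circ> riemann_zeta \<circ> cnj) 1 = 0"
      using zeta_continuation_riemann_zeta by (simp add: zeta_continuation_def)
    fix s assume "1 < Re s"
    then have "(\<lambda>n. 1 / of_nat (Suc n) powr cnj s) sums riemann_zeta (cnj s)"
      using zeta_continuation_riemann_zeta by (simp add: zeta_continuation_def)
    then have "(\<lambda>n. cnj (1 / of_nat (Suc n) powr cnj s)) sums cnj (riemann_zeta (cnj s))"
      by (subst sums_cnj)
    moreover have "cnj (1 / of_nat (Suc n) powr cnj s) = 1 / of_nat (Suc n) powr s" for n
      by (simp add: cnj_powr del: of_nat_Suc)
    ultimately show "(\<lambda>n. 1 / of_nat (Suc n) powr s) sums (cnj \<circ> riemann_zeta \<circ> cnj) s" by simp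
  qed
  from zeta_continuation_unique[OF this zeta_continuation_riemann_zeta]
  show ?thesis by (metis comp_apply complex_cnj_cnj)
qed

lemma logderiv_riemann_zeta_cnj:
  assumes "s \<noteq> 1"
  shows "logderiv riemann_zeta (cnj s) = cnj (logderiv riemann_zeta s)"
proof -
  have "(cnj \<circ> riemann_zeta \<circ> cnj has_field_derivative cnj (deriv riemann_zeta s)) (at (cnj s))"
    using has_field_derivative_cnj_cnj[of riemann_zeta "deriv riemann_zeta s" "cnj s"]
      field_differentiable_derivI[OF riemann_zeta_differentiable[OF assms]] by simp
  moreover have "cnj \<circ> riemann_zeta \<circ> cnj = riemann_zeta" by (auto simp: riemann_zeta_cnj)
  ultimately show ?thesis by (simp add: logderiv_def riemann_zeta_cnj DERIV_imp_deriv)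
qed

section \<open>The functional equation\<close>

lemma not_Int_imp_not_nonpos_Int: "z \<notin> \<int> \<Longrightarrow> z \<notin> \<int>\<^sub>\<le>\<^sub>0"
  using nonpos_Ints_subset_Ints by blast

lemma one_minus_notin_Ints: "z \<notin> \<int> \<Longrightarrow> 1 - z \<notin> (\<int> :: 'a::ring_1 set)"
  using Ints_diff[OF Ints_1, of "1 - z"] by auto

lemma half_shift_notin_Ints:
  assumes "s \<notin> (\<int> :: complex set)"
  shows "(1 + s) / 2 \<notin> \<int>" "(1 - s) / 2 \<notin> \<int>"
proof -
  have "s = (1 + s) / 2 + (1 + s) / 2 - 1" "s = 1 - ((1 - s) / 2 + (1 - s) / 2)" by (simp_all add: field_simps)
  then show "(1 + s) / 2 \<notin> \<int>" "(1 - s) / 2 \<notin> \<int>" using assms by (metis Ints_1 Ints_add Ints_diff)+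
qed

lemma Digamma_reflection:
  fixes z :: complex
  assumes "z \<notin> \<int>"
  shows "Digamma z - Digamma (1 - z) = - of_real pi * cos (of_real pi * z) / sin (of_real pi * z)"
proof -
  have not_pole: "z \<notin> \<int>\<^sub>\<le>\<^sub>0" "1 - z \<notin> \<int>\<^sub>\<le>\<^sub>0"
    using assms one_minus_notin_Ints by (auto intro!: not_Int_imp_not_nonpos_Int)
  then have Gamma_nz: "Gamma z \<noteq> 0" "Gamma (1 - z) \<noteq> 0" by (auto simp: Gamma_eq_zero_iff)
  then have sin_nz: "sin (of_real pi * z) \<noteq> 0" using Gamma_reflection_complex[of z] by auto
  have "((\<lambda>u. Gamma u * Gamma (1 - u)) has_field_derivative
      Gamma z * Gamma (1 - z) * (Digamma z - Digamma (1 - z))) (at z)"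
    using not_pole by (auto intro!: derivative_eq_intros simp: algebra_simps)
  then have "Digamma z - Digamma (1 - z) = logderiv (\<lambda>u. Gamma u * Gamma (1 - u)) z"
    using Gamma_nz by (intro logderiv_eqI[symmetric]) (auto simp: mult_ac)
  also have "\<dots> = logderiv (\<lambda>u. of_real pi / sin (of_real pi * u)) z"
    using Gamma_reflection_complex by (simp add: logderiv_def)
  also have "\<dots> = - of_real pi * cos (of_real pi * z) / sin (of_real pi * z)"
    using sin_nz by (intro logderiv_eqI) (auto intro!: derivative_eq_intros simp: field_simps)
  finally show ?thesis .
qed

lemma Digamma_diff_sums:
  fixes z w :: complex
  assumes "z \<noteq> 0" "w \<noteq> 0"
  shows "(\<lambda>n. inverse (w + of_nat n) - inverse (z + of_nat n)) sums (Digamma z - Digamma w)"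
proof -
  have "(\<lambda>m. (of_real (ln (real m)) - (\<Sum>n<m. inverse (z + of_nat n))) -
      (of_real (ln (real m)) - (\<Sum>n<m. inverse (w + of_nat n)))) \<longlonglongrightarrow> Digamma z - Digamma w"
    by (intro tendsto_diff Digamma_LIMSEQ assms)
  then show ?thesis unfolding sums_def by (simp add: sum_subtractf)
qed

text \<open>The partial fractions of the cotangent on the line of real part one half.\<close>

lemma tanh_pi_sums:
  assumes "\<tau> > 0"
  shows "(\<lambda>n. 2 * \<tau> / ((real n + 1/2)\<^sup>2 + \<tau>\<^sup>2)) sums (pi * tanh (pi * \<tau>))"
proof -
  define z where "z = Complex (1 / 2) \<tau>"
  have z: "z \<noteq> 0" "1 - z \<noteq> 0" "z \<notin> \<int>"
    using assms by (auto simp: z_def complex_eq_iff elim!: Ints_cases)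
  have partial_fraction: "inverse (1 - z + of_nat n) - inverse (z + of_nat n) = \<i> * of_real (2 * \<tau> / ((real n + 1/2)\<^sup>2 + \<tau>\<^sup>2))" for n
  proof -
    have "z + of_nat n = Complex (real n + 1/2) \<tau>" "1 - z + of_nat n = Complex (real n + 1/2) (- \<tau>)"
      by (auto simp: z_def complex_eq_iff)
    moreover have "inverse (Complex q (- \<tau>)) - inverse (Complex q \<tau>) = \<i> * of_real (2 * \<tau> / (q\<^sup>2 + \<tau>\<^sup>2))" for q
      by (simp add: complex_eq_iff add_divide_distrib)
    ultimately show ?thesis by (simp only:)
  qed
  have "of_real pi * z = of_real (pi / 2) + \<i> * of_real (pi * \<tau>)"
    by (simp add: z_def complex_eq_iff)
  then have "cos (of_real pi * z) = - sin (\<i> * of_real (pi * \<tau>))" "sin (of_real pi * z) = cos (\<i> * of_real (pi * \<tau>))"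
    by (simp_all add: cos_add sin_add flip: cos_of_real sin_of_real)
  then have "Digamma z - Digamma (1 - z) = of_real pi * tan (\<i> * of_real (pi * \<tau>))"
    using Digamma_reflection[OF z(3)] by (simp add: tan_def)
  also have "tan (\<i> * of_real (pi * \<tau>)) = \<i> * of_real (tanh (pi * \<tau>))"
  proof -
    have "complex_of_real (tanh y) = tanh (of_real y)" for y
      by (simp add: tanh_altdef exp_of_real flip: of_real_minus)
    from this[of "pi * \<tau>"] have "complex_of_real (tanh (pi * \<tau>)) = tanh (of_real (pi * \<tau>))" .
    then show ?thesis using tanh_conv_tan[of "of_real (pi * \<tau>)"] by simp
  qed
  finally show ?thesis
    using sums_Im[OF Digamma_diff_sums[OF z(1,2)]] by (simp add: partial_fraction)
qed

lemma tanh_sums: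
  assumes "x > (0::real)"
  shows "(\<lambda>n. 4 * x / (x\<^sup>2 + (pi * (2 * real n + 1))\<^sup>2)) sums tanh (x / 2)"
proof -
  define \<tau> where "\<tau> = x / (2 * pi)"
  have "(\<lambda>n. 2 * \<tau> / ((real n + 1/2)\<^sup>2 + \<tau>\<^sup>2) / pi) sums (pi * tanh (pi * \<tau>) / pi)"
    using assms by (intro sums_divide tanh_pi_sums) (simp add: \<tau>_def)
  moreover have "2 * \<tau> / ((real n + 1/2)\<^sup>2 + \<tau>\<^sup>2) / pi = 4 * x / (x\<^sup>2 + (pi * (2 * real n + 1))\<^sup>2)" for n
  proof -
    have "(real n + 1/2)\<^sup>2 + \<tau>\<^sup>2 = (x\<^sup>2 + (pi * (2 * real n + 1))\<^sup>2) / (4 * pi\<^sup>2)"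
      by (simp add: \<tau>_def field_simps power2_eq_square)
    moreover have "2 * (x / (2 * pi)) / (Q / (4 * pi\<^sup>2)) / pi = 4 * x / Q" for Q
      by (cases "Q = 0") (auto simp: field_simps power2_eq_square)
    ultimately show ?thesis by (simp only: \<tau>_def)
  qed
  ultimately show ?thesis by (simp add: \<tau>_def)
qed


subsection \<open>Integrals against powers\<close>

lemma nn_integral_cmult_eq:
  assumes "f \<in> borel_measurable M" "k \<ge> 0" "(\<integral>\<^sup>+x. ennreal (f x) \<partial>M) = ennreal I"
  shows "(\<integral>\<^sup>+x. ennreal (k * f x) \<partial>M) = ennreal (k * I)"
  using assms by (simp add: ennreal_mult' nn_integral_cmult)

lemma nn_integral_Gamma_scaled:
  assumes p_pos: "p > (0::real)" and c_pos: "c > 0"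
  shows "(\<integral>\<^sup>+r. ennreal (indicator {0<..} r * (r powr (p - 1) * exp (- (c * r)))) \<partial>lborel) = ennreal (Gamma p * c powr (- p))"
proof -
  have "ennreal (Gamma p) = (\<integral>\<^sup>+t. ennreal (indicator {0..} t * t powr (p - 1) / exp t) \<partial>lborel)"
    by (rule Gamma_conv_nn_integral_real[OF p_pos])
  also have "\<dots> = \<bar>c\<bar> * (\<integral>\<^sup>+r. ennreal (indicator {0..} (0 + c * r) * (0 + c * r) powr (p - 1) / exp (0 + c * r)) \<partial>lborel)"
    by (rule nn_integral_real_affine) (use c_pos in auto)
  also have "(\<integral>\<^sup>+r. ennreal (indicator {0..} (0 + c * r) * (0 + c * r) powr (p - 1) / exp (0 + c * r)) \<partial>lborel) =
      (\<integral>\<^sup>+r. ennreal (c powr (p - 1)) * ennreal (indicator {0<..} r * (r powr (p - 1) * exp (- (c * r)))) \<partial>lborel)"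
  proof (rule nn_integral_cong_AE)
    have "AE r in lborel. r \<noteq> (0::real)" by (rule AE_lborel_singleton)
    then show "AE r in lborel. ennreal (indicator {0..} (0 + c * r) * (0 + c * r) powr (p - 1) / exp (0 + c * r)) =
       ennreal (c powr (p - 1)) * ennreal (indicator {0<..} r * (r powr (p - 1) * exp (- (c * r))))"
    proof (rule AE_mp, intro AE_I2 impI)
      fix r :: real assume "r \<noteq> 0"
      then show "ennreal (indicator {0..} (0 + c * r) * (0 + c * r) powr (p - 1) / exp (0 + c * r)) =
       ennreal (c powr (p - 1)) * ennreal (indicator {0<..} r * (r powr (p - 1) * exp (- (c * r))))"
        using c_pos by (subst ennreal_mult'[symmetric])
          (auto simp: indicator_def zero_le_mult_iff powr_mult exp_minus field_simps)
    qed
  qed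
  also have "\<dots> = ennreal (c powr (p - 1)) * (\<integral>\<^sup>+r. ennreal (indicator {0<..} r * (r powr (p - 1) * exp (- (c * r)))) \<partial>lborel)"
    by (rule nn_integral_cmult) measurable
  finally have "ennreal (c powr (- p)) * ennreal (Gamma p) =
      ennreal (c powr (- p)) * (ennreal \<bar>c\<bar> * (ennreal (c powr (p - 1)) * (\<integral>\<^sup>+r. ennreal (indicator {0<..} r * (r powr (p - 1) * exp (- (c * r)))) \<partial>lborel)))"
    by simp
  also have "\<dots> = ennreal (c powr (- p) * (c * c powr (p - 1))) * (\<integral>\<^sup>+r. ennreal (indicator {0<..} r * (r powr (p - 1) * exp (- (c * r)))) \<partial>lborel)"
    using c_pos by (simp add: ennreal_mult' mult.assoc)
  also have "c powr (- p) * (c * c powr (p - 1)) = 1"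
  proof -
    have "c * c powr (p - 1) = c powr p" using c_pos by (simp add: powr_mult_base)
    then show ?thesis using c_pos by (simp add: powr_minus)
  qed
  finally show ?thesis using p_pos by (simp add: ennreal_mult' mult.commute)
qed

lemma has_integral_square_substitution:
  fixes f :: "real \<Rightarrow> real"
  assumes f_int: "(f has_integral I) {0<..}" and f_nonneg: "\<And>v. v > 0 \<Longrightarrow> f v \<ge> 0"
  shows "((\<lambda>u. 2 * u * f (u\<^sup>2)) has_integral I) {0<..}"
proof -
  have f_abs: "f absolutely_integrable_on {0<..}"
    using f_int f_nonneg by (intro nonnegative_absolutely_integrable_1) auto
  have image: "(\<lambda>u::real. u\<^sup>2) ` {0<..} = {0<..}"
  proof (intro equalityI subsetI)
    fix v :: real assume "v \<in> {0<..}"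
    then show "v \<in> (\<lambda>u. u\<^sup>2) ` {0<..}" by (intro image_eqI[of _ _ "sqrt v"]) auto
  qed auto
  have "((\<lambda>u. \<bar>2 * u\<bar> * f (u\<^sup>2)) absolutely_integrable_on {0<..} \<and> integral {0<..} (\<lambda>u. \<bar>2 * u\<bar> * f (u\<^sup>2)) = I) \<longleftrightarrow>
      (f absolutely_integrable_on (\<lambda>u. u\<^sup>2) ` {0<..} \<and> integral ((\<lambda>u. u\<^sup>2) ` {0<..}) f = I)"
  proof (rule has_absolute_integral_change_of_variables_1')
    show "((\<lambda>u. u\<^sup>2) has_field_derivative 2 * x) (at x within {0<..})" for x :: real
      by (auto intro!: derivative_eq_intros)
  qed (auto simp: inj_on_def power2_eq_iff)
  then have "(\<lambda>u. \<bar>2 * u\<bar> * f (u\<^sup>2)) absolutely_integrable_on {0<..} \<and> integral {0<..} (\<lambda>u. \<bar>2 * u\<bar> * f (u\<^sup>2)) = I"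
    unfolding image using f_abs f_int by (auto simp: integral_unique)
  then have "((\<lambda>u. \<bar>2 * u\<bar> * f (u\<^sup>2)) has_integral I) {0<..}"
    by (auto simp: absolutely_integrable_on_def has_integral_integral)
  then show ?thesis by (rule has_integral_eq[rotated]) auto
qed

lemma nn_integral_powr_gauss:
  assumes s: "-1 < s" and r: "r > (0::real)"
  shows "(\<integral>\<^sup>+u. ennreal (indicator {0<..} u * (u powr s * exp (- (r * u\<^sup>2)))) \<partial>lborel) =
    ennreal (Gamma ((1 + s) / 2) * r powr (- (1 + s) / 2) / 2)"
proof -
  define p where "p = (1 + s) / 2"
  have p: "p > 0" using s by (simp add: p_def)
  define I where "I = Gamma p * r powr (- p)"
  define f where "f v = v powr (p - 1) * exp (- (r * v))" for v :: real
  have "((\<lambda>v. indicator {0<..} v * f v) has_integral I) UNIV"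
    using nn_integral_Gamma_scaled[OF p r] p
    by (intro nn_integral_has_integral) (auto simp: f_def I_def indicator_def)
  then have "((\<lambda>v. if v \<in> {0<..} then f v else 0) has_integral I) UNIV"
    by (rule has_integral_eq[rotated]) auto
  then have "((\<lambda>u. 2 * u * f (u\<^sup>2)) has_integral I) {0<..}"
    by (intro has_integral_square_substitution) (simp_all only: has_integral_restrict_UNIV, simp add: f_def)
  from has_integral_divide[OF this, of 2]
  have "((\<lambda>u. u powr s * exp (- (r * u\<^sup>2))) has_integral I / 2) {0<..}"
  proof (rule has_integral_eq[rotated])
    fix u :: real assume u: "u \<in> {0<..}"
    then have "u\<^sup>2 = u powr 2" by (simp add: powr_numeral)
    then have "(u\<^sup>2) powr (p - 1) = u powr (2 * (p - 1))" by (simp only: powr_powr)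
    also have "2 * (p - 1) = s - 1" by (simp add: p_def field_simps)
    finally have "u * (u\<^sup>2) powr (p - 1) = u powr s" using u by (simp add: powr_mult_base)
    then show "2 * u * f (u\<^sup>2) / 2 = u powr s * exp (- (r * u\<^sup>2))"
      by (simp add: f_def mult.assoc[symmetric])
  qed
  then have "(\<integral>\<^sup>+u. ennreal (indicator {0<..} u * (u powr s * exp (- (r * u\<^sup>2)))) \<partial>lborel) = ennreal (I / 2)"
    by (intro nn_integral_has_integral_lebesgue) auto
  moreover have "- (1 + s) / 2 = - p" by (simp add: p_def field_simps)
  ultimately show ?thesis by (simp only: I_def p_def[symmetric])
qed

lemma nn_integral_powr_rational:
  assumes s: "-1 < s" "s < 1" and a: "a > (0::real)"
  shows "(\<integral>\<^sup>+u. ennreal (indicator {0<..} u * (u powr s / (u\<^sup>2 + a\<^sup>2))) \<partial>lborel) =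
     ennreal (Gamma ((1 + s) / 2) * Gamma ((1 - s) / 2) * a powr (s - 1) / 2)"
proof -
  define h where "h u r = indicator {0<..} u * indicator {0<..} r * (u powr s * exp (- (r * u\<^sup>2)) * exp (- (a\<^sup>2 * r)))" for u r :: real
  have inner_r: "(\<integral>\<^sup>+r. ennreal (h u r) \<partial>lborel) = ennreal (indicator {0<..} u * (u powr s / (u\<^sup>2 + a\<^sup>2)))" for u
  proof (cases "u > 0")
    case True
    have c_pos: "u\<^sup>2 + a\<^sup>2 > 0" using a by (simp add: add_nonneg_pos)
    have "h u r = u powr s * (indicator {0<..} r * (r powr (1 - 1) * exp (- ((u\<^sup>2 + a\<^sup>2) * r))))" for r
      using True by (auto simp: h_def indicator_def exp_add[symmetric] algebra_simps)
    then show ?thesis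
      using True nn_integral_cmult_eq[OF _ _ nn_integral_Gamma_scaled[OF zero_less_one c_pos], of "u powr s"] c_pos
      by (simp add: powr_minus divide_inverse)
  qed (simp add: h_def)
  have inner_u: "(\<integral>\<^sup>+u. ennreal (h u r) \<partial>lborel) = ennreal (Gamma ((1 + s) / 2) / 2 *
      (indicator {0<..} r * (r powr ((1 - s) / 2 - 1) * exp (- (a\<^sup>2 * r)))))" for r
  proof (cases "r > 0")
    case True
    have "h u r = exp (- (a\<^sup>2 * r)) * (indicator {0<..} u * (u powr s * exp (- (r * u\<^sup>2))))" for u
      using True by (simp add: h_def mult_ac)
    then have "(\<integral>\<^sup>+u. ennreal (h u r) \<partial>lborel) =
        ennreal (exp (- (a\<^sup>2 * r)) * (Gamma ((1 + s) / 2) * r powr (- (1 + s) / 2) / 2))"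
      by (simp only:) (intro nn_integral_cmult_eq nn_integral_powr_gauss s True; measurable)
    also have "- (1 + s) / 2 = (1 - s) / 2 - 1" by (simp add: field_simps)
    finally show ?thesis using True by (simp add: mult_ac)
  qed (simp add: h_def)
  have "(\<lambda>(u, r). ennreal (h u r)) \<in> borel_measurable (lborel \<Otimes>\<^sub>M lborel)"
    unfolding h_def by measurable
  from lborel_pair.Fubini'[OF this]
  have "(\<integral>\<^sup>+u. ennreal (indicator {0<..} u * (u powr s / (u\<^sup>2 + a\<^sup>2))) \<partial>lborel) =
      (\<integral>\<^sup>+r. ennreal (Gamma ((1 + s) / 2) / 2 * (indicator {0<..} r * (r powr ((1 - s) / 2 - 1) * exp (- (a\<^sup>2 * r))))) \<partial>lborel)"
    by (simp add: inner_r inner_u)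
  also have "\<dots> = ennreal (Gamma ((1 + s) / 2) / 2 * (Gamma ((1 - s) / 2) * (a\<^sup>2) powr (- ((1 - s) / 2))))"
    using s a by (intro nn_integral_cmult_eq nn_integral_Gamma_scaled) auto
  also have "(a\<^sup>2) powr (- ((1 - s) / 2)) = a powr (s - 1)"
    using a powr_powr[of a 2 "(s - 1) / 2"] by (simp add: powr_numeral minus_divide_left diff_divide_distrib)
  finally show ?thesis by (simp add: mult_ac)
qed

lemma nn_integral_powr_atLeast:
  assumes "s < 0" "x > (0::real)"
  shows "(\<integral>\<^sup>+u. ennreal (indicator {x..} u * (- s * u powr (s - 1))) \<partial>lborel) = ennreal (x powr s)"
proof -
  have "(\<integral>\<^sup>+u. ennreal (- s * u powr (s - 1)) * indicator {x..} u \<partial>lborel) = ennreal (0 - (- (x powr s)))"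
  proof (rule nn_integral_FTC_atLeast)
    show "((\<lambda>u. - (u powr s)) has_real_derivative - s * u powr (s - 1)) (at u)" if "x \<le> u" for u
      using that assms by (auto intro!: derivative_eq_intros)
    have "((\<lambda>u::real. u powr s) \<longlongrightarrow> 0) at_top"
      using assms by (intro tendsto_neg_powr filterlim_ident)
    from tendsto_minus[OF this] show "((\<lambda>u. - (u powr s)) \<longlongrightarrow> 0) at_top" by simp
  qed (use assms in \<open>auto simp: mult_le_0_iff\<close>)
  moreover have "ennreal (- s * u powr (s - 1)) * indicator {x..} u = ennreal (indicator {x..} u * (- s * u powr (s - 1)))" for u
    by (simp add: indicator_def)
  ultimately show ?thesis by simp
qed


subsection \<open>The logistic density\<close>

definition logistic_density :: "real \<Rightarrow> real" where
  "logistic_density x = exp x / (exp x + 1)\<^sup>2"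

lemma logistic_density_nonneg: "logistic_density x \<ge> 0"
  by (simp add: logistic_density_def)

lemma logistic_density_le: "logistic_density x \<le> exp (- x)"
proof -
  have "exp x * exp x \<le> (exp x + 1)\<^sup>2"
    by (simp add: power2_eq_square algebra_simps)
  then have "exp x / (exp x + 1)\<^sup>2 \<le> 1 / exp x"
    by (simp add: divide_simps add_nonneg_eq_0_iff)
  then show ?thesis by (simp add: logistic_density_def exp_minus divide_inverse)
qed

lemma borel_measurable_logistic_density [measurable]: "logistic_density \<in> borel_measurable borel"
  unfolding logistic_density_def by measurable

lemma nn_integral_logistic_density:
  assumes "u \<ge> 0"
  shows "(\<integral>\<^sup>+x. ennreal (indicator {0..u} x * logistic_density x) \<partial>lborel) = ennreal (tanh (u / 2) / 2)"
proof -
  have denom_nz: "exp x + 1 \<noteq> (0::real)" for x by (smt (verit) exp_gt_zero)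
  have "ennreal (indicator {0..u} x * logistic_density x) = ennreal (logistic_density x) * indicator {0..u} x" for x
    by (simp add: indicator_def)
  then have "(\<integral>\<^sup>+x. ennreal (indicator {0..u} x * logistic_density x) \<partial>lborel) =
      (\<integral>\<^sup>+x. ennreal (logistic_density x) * indicator {0..u} x \<partial>lborel)" by simp
  also have "\<dots> = ennreal (- 1 / (exp u + 1) - (- 1 / (exp 0 + 1)))"
  proof (rule nn_integral_FTC_Icc)
    show "((\<lambda>x. - 1 / (exp x + 1)) has_real_derivative logistic_density x) (at x)" for x
      unfolding logistic_density_def using denom_nz[of x]
      by (auto intro!: derivative_eq_intros simp: power2_eq_square)
  qed (use assms logistic_density_nonneg in auto)
  also have "- 1 / (exp u + 1) - (- 1 / (exp 0 + 1)) = tanh (u / 2) / 2"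
  proof -
    have "- 1 / (e + 1) - (- 1 / (1 + 1)) = ((1 - inverse e) / (1 + inverse e)) / 2" if "e > 0" for e :: real
    proof -
      have "1 - inverse e = (e - 1) / e" "1 + inverse e = (e + 1) / e" using that by (simp_all add: field_simps)
      then have ratio: "(1 - inverse e) / (1 + inverse e) = (e - 1) / (e + 1)" using that by simp
      show ?thesis unfolding ratio using that by (simp add: field_simps)
    qed
    from this[of "exp u"] show ?thesis by (simp add: tanh_real_altdef exp_minus)
  qed
  finally show ?thesis .
qed

lemma nn_integral_powr_logistic_tanh:
  assumes s: "s < 0"
  shows "(\<integral>\<^sup>+x. ennreal (indicator {0<..} x * (x powr s * logistic_density x)) \<partial>lborel) =
    (\<integral>\<^sup>+u. ennreal (indicator {0<..} u * (- s * u powr (s - 1) * (tanh (u / 2) / 2))) \<partial>lborel)"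
proof -
  define h where "h x u = indicator {0<..} x * logistic_density x * (- s * u powr (s - 1)) * (if x \<le> u then 1 else 0)" for x u :: real
  have inner_u: "(\<integral>\<^sup>+u. ennreal (h x u) \<partial>lborel) = ennreal (indicator {0<..} x * (x powr s * logistic_density x))" for x
  proof (cases "x > 0")
    case True
    have "h x u = logistic_density x * (indicator {x..} u * (- s * u powr (s - 1)))" for u
      using True by (simp add: h_def indicator_def)
    then have "(\<integral>\<^sup>+u. ennreal (h x u) \<partial>lborel) = ennreal (logistic_density x * x powr s)"
      by (simp only:) (intro nn_integral_cmult_eq nn_integral_powr_atLeast s True logistic_density_nonneg; measurable)
    then show ?thesis using True by (simp add: mult.commute)
  qed (simp add: h_def)
  have inner_x: "(\<integral>\<^sup>+x. ennreal (h x u) \<partial>lborel) = ennreal (indicator {0<..} u * (- s * u powr (s - 1) * (tanh (u / 2) / 2)))" for u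
  proof (cases "u > 0")
    case True
    have "(\<integral>\<^sup>+x. ennreal (h x u) \<partial>lborel) = (\<integral>\<^sup>+x. ennreal (- s * u powr (s - 1) * (indicator {0..u} x * logistic_density x)) \<partial>lborel)"
    proof (rule nn_integral_cong_AE)
      have "AE x in lborel. x \<noteq> (0::real)" by (rule AE_lborel_singleton)
      then show "AE x in lborel. ennreal (h x u) = ennreal (- s * u powr (s - 1) * (indicator {0..u} x * logistic_density x))"
        by eventually_elim (use True in \<open>auto simp: h_def indicator_def mult_ac\<close>)
    qed
    also have "\<dots> = ennreal (- s * u powr (s - 1) * (tanh (u / 2) / 2))"
      using s True by (intro nn_integral_cmult_eq nn_integral_logistic_density) (auto simp: mult_le_0_iff)
    finally show ?thesis using True by simp
  next
    case False
    then have "h x u = 0" for x by (auto simp: h_def indicator_def)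
    then show ?thesis using False by simp
  qed
  have "(\<lambda>(x, u). ennreal (h x u)) \<in> borel_measurable (lborel \<Otimes>\<^sub>M lborel)"
    unfolding h_def by measurable
  from lborel_pair.Fubini'[OF this] show ?thesis by (simp add: inner_u inner_x)
qed

lemma nn_integral_powr_logistic:
  assumes s: "-1 < s" "s < 0"
  defines "a \<equiv> \<lambda>n::nat. pi * (2 * real n + 1)"
  shows "(\<integral>\<^sup>+x. ennreal (indicator {0<..} x * (x powr s * logistic_density x)) \<partial>lborel) =
    (\<Sum>n. ennreal (- s * (Gamma ((1 + s) / 2) * Gamma ((1 - s) / 2)) * a n powr (s - 1)))"
proof -
  define k where "k n u = - 2 * s * (indicator {0<..} u * (u powr s / (u\<^sup>2 + (a n)\<^sup>2)))" for n u
  have expand: "ennreal (indicator {0<..} u * (- s * u powr (s - 1) * (tanh (u / 2) / 2))) = (\<Sum>n. ennreal (k n u))" for u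
  proof (cases "u > 0")
    case True
    have "(\<lambda>n. - s * u powr (s - 1) * (4 * u / (u\<^sup>2 + (a n)\<^sup>2) / 2)) sums (- s * u powr (s - 1) * (tanh (u / 2) / 2))"
      unfolding a_def by (intro sums_mult sums_divide tanh_sums True)
    moreover have "- s * u powr (s - 1) * (4 * u / (u\<^sup>2 + (a n)\<^sup>2) / 2) = k n u" for n
    proof -
      have "k n u = - 2 * s * (u * u powr (s - 1) / (u\<^sup>2 + (a n)\<^sup>2))"
        using True by (simp add: k_def powr_mult_base)
      moreover have "- s * v * (4 * u / q / 2) = - 2 * s * (u * v / q)" for q v by (simp add: field_simps)
      ultimately show ?thesis by (simp only:)
    qed
    moreover have "k n u \<ge> 0" for n
      unfolding k_def by (rule mult_nonneg_nonneg) (use s in auto)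
    ultimately show ?thesis using True by (simp add: sums_iff suminf_ennreal2)
  qed (simp add: k_def)
  have "(\<integral>\<^sup>+u. ennreal (k n u) \<partial>lborel) = ennreal (- 2 * s * (Gamma ((1 + s) / 2) * Gamma ((1 - s) / 2) * a n powr (s - 1) / 2))" for n
    unfolding k_def
  proof (intro nn_integral_cmult_eq nn_integral_powr_rational)
    show "a n > 0" by (simp add: a_def add_nonneg_pos)
  qed (use s in auto)
  moreover have "(\<integral>\<^sup>+u. (\<Sum>n. ennreal (k n u)) \<partial>lborel) = (\<Sum>n. \<integral>\<^sup>+u. ennreal (k n u) \<partial>lborel)"
    unfolding k_def by (rule nn_integral_suminf) measurable
  ultimately show ?thesis
    unfolding nn_integral_powr_logistic_tanh[OF s(2)] expand by (simp add: mult_ac)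
qed


subsection \<open>Complex moments\<close>

definition moment_integrand :: "(real \<Rightarrow> real) \<Rightarrow> complex \<Rightarrow> real \<Rightarrow> complex" where
  "moment_integrand \<phi> s x = indicator {0<..} x *\<^sub>R (exp (s * of_real (ln x)) * of_real (\<phi> x))"

definition moment :: "(real \<Rightarrow> real) \<Rightarrow> complex \<Rightarrow> complex" where
  "moment \<phi> s = (LINT x|lborel. moment_integrand \<phi> s x)"

lemma moment_integrand_of_real:
  "moment_integrand \<phi> (of_real p) x = of_real (indicator {0<..} x * (x powr p * \<phi> x))"
proof (cases "x > 0")
  case True
  then have "exp (of_real p * of_real (ln x)) = complex_of_real (x powr p)"
    by (simp add: powr_def exp_of_real flip: of_real_mult)
  then show ?thesis using True by (simp add: moment_integrand_def)
qed (simp add: moment_integrand_def)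

lemma moment_of_real: "moment \<phi> (of_real p) = of_real (LINT x|lborel. indicator {0<..} x * (x powr p * \<phi> x))"
  unfolding moment_def moment_integrand_of_real by (rule integral_complex_of_real)

lemma norm_moment_integrand:
  "norm (moment_integrand \<phi> s x) = \<bar>indicator {0<..} x * (x powr Re s * \<phi> x)\<bar>"
  by (auto simp: moment_integrand_def indicator_def norm_mult powr_def abs_mult)

lemma integrable_moment_integrand:
  assumes "\<phi> \<in> borel_measurable borel" "integrable lborel (\<lambda>x. indicator {0<..} x * (x powr Re s * \<phi> x))"
  shows "integrable lborel (moment_integrand \<phi> s)"
proof (rule Bochner_Integration.integrable_bound[OF assms(2)])
  show "moment_integrand \<phi> s \<in> borel_measurable lborel"
    using assms(1) unfolding moment_integrand_def[abs_def] by measurable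
qed (simp add: norm_moment_integrand)

lemma powr_le_powr_add_powr:
  assumes "x > (0::real)" "p \<le> r" "r \<le> q"
  shows "x powr r \<le> x powr p + x powr q"
proof (cases "x \<ge> 1")
  case True
  then have "x powr r \<le> x powr q" using assms by (intro powr_mono) auto
  then show ?thesis by (simp add: add_increasing)
next
  case False
  then have "x powr r \<le> x powr p" using assms by (intro powr_mono') auto
  then show ?thesis by (simp add: add_increasing2)
qed

lemma truncated_moment_holomorphic:
  assumes "a > 0" "continuous_on {a..b} \<phi>"
  shows "(\<lambda>s. integral {a..b} (\<lambda>x. exp (s * of_real (ln x)) * of_real (\<phi> x))) holomorphic_on A"
proof -
  have pos: "x \<noteq> 0" if "x \<in> {a..b}" for x using that assms(1) by auto
  have "(\<lambda>s. integral (cbox a b) (\<lambda>x. exp (s * of_real (ln x)) * of_real (\<phi> x))) holomorphic_on UNIV"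
  proof (rule leibniz_rule_holomorphic[where fx = "\<lambda>s x. of_real (ln x) * exp (s * of_real (ln x)) * of_real (\<phi> x)"])
    show "((\<lambda>s. exp (s * of_real (ln x)) * of_real (\<phi> x)) has_field_derivative
        of_real (ln x) * exp (s * of_real (ln x)) * of_real (\<phi> x)) (at s within UNIV)" for s x
      by (auto intro!: derivative_eq_intros)
    show "(\<lambda>x. exp (s * of_real (ln x)) * of_real (\<phi> x)) integrable_on cbox a b" for s :: complex
      using pos assms(2) by (intro integrable_continuous continuous_intros) auto
    show "continuous_on (UNIV \<times> cbox a b) (\<lambda>(s :: complex, x). of_real (ln x) * exp (s * of_real (ln x)) * of_real (\<phi> x))"
    proof -
      have "continuous_on (UNIV \<times> {a..b}) (\<lambda>q :: complex \<times> real. \<phi> (snd q))"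
        by (intro continuous_on_compose2[OF assms(2)] continuous_intros) auto
      then show ?thesis
        unfolding case_prod_unfold using pos by (auto intro!: continuous_intros)
    qed
  qed auto
  then show ?thesis using holomorphic_on_subset by simp blast
qed

lemma tendsto_tail_integral_0:
  fixes w :: "real \<Rightarrow> real"
  assumes w_int: "integrable lborel w" and w_zero: "\<And>x. x \<le> 0 \<Longrightarrow> w x = 0"
  shows "(\<lambda>n. LINT x|lborel. indicator (- {1 / real (Suc n)..real (Suc n)}) x * w x) \<longlonglongrightarrow> 0"
proof -
  define I where "I n = {1 / real (Suc n)..real (Suc n)}" for n
  have "(\<lambda>n. LINT x|lborel. indicator (- I n) x * w x) \<longlonglongrightarrow> (LINT x|(lborel :: real measure). 0)"
  proof (rule Bochner_Integration.integral_dominated_convergence[where s = "\<lambda>n x. indicator (- I n) x * w x" and w = "\<lambda>x. norm (w x)"])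
    show "AE x in lborel. (\<lambda>n. indicator (- I n) x * w x) \<longlonglongrightarrow> 0"
    proof (intro AE_I2)
      fix x :: real
      show "(\<lambda>n. indicator (- I n) x * w x) \<longlonglongrightarrow> 0"
      proof (cases "x > 0")
        case True
        obtain N where N: "real N > max x (1 / x)" using reals_Archimedean2 by blast
        have "x \<in> I n" if "n \<ge> N" for n
        proof -
          have "x \<le> real (Suc n)" "1 / x \<le> real (Suc n)" using N that by auto
          then show ?thesis using True by (simp add: I_def field_simps)
        qed
        then show ?thesis by (intro tendsto_eventually eventually_sequentiallyI[of N]) simp
      qed (simp add: w_zero)
    qed
    show "(\<lambda>x. indicator (- I n) x * w x) \<in> borel_measurable lborel" for n
      using w_int unfolding I_def by measurable
  qed (use w_int in \<open>auto simp: indicator_def\<close>)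
  then show ?thesis by (simp add: I_def)
qed

lemma norm_moment_minus_truncated_le:
  assumes meas: "\<phi> \<in> borel_measurable borel" and \<phi>_nonneg: "\<And>x. \<phi> x \<ge> 0"
    and \<phi>_int: "\<And>p. p \<in> {\<sigma>0..\<sigma>1} \<Longrightarrow> integrable lborel (\<lambda>x. indicator {0<..} x * (x powr p * \<phi> x))"
    and s: "\<sigma>0 \<le> Re s" "Re s \<le> \<sigma>1" and a: "a > 0"
  shows "norm (moment \<phi> s - integral {a..b} (\<lambda>x. exp (s * of_real (ln x)) * of_real (\<phi> x))) \<le>
    (LINT x|lborel. indicator (- {a..b}) x * (indicator {0<..} x * ((x powr \<sigma>0 + x powr \<sigma>1) * \<phi> x)))"
proof -
  let ?g = "moment_integrand \<phi> s"
  have g_int: "integrable lborel ?g" using meas \<phi>_int s by (intro integrable_moment_integrand) auto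
  have restrict: "indicator {a..b} x *\<^sub>R (exp (s * of_real (ln x)) * of_real (\<phi> x)) = indicator {a..b} x *\<^sub>R ?g x" for x
    using a by (auto simp: moment_integrand_def indicator_def)
  have g_restrict_int: "integrable lborel (\<lambda>x. indicator A x *\<^sub>R ?g x)" if "A \<in> sets borel" for A
    using that by (intro integrable_mult_indicator g_int) auto
  have "integral {a..b} (\<lambda>x. exp (s * of_real (ln x)) * of_real (\<phi> x)) = (LINT x|lborel. indicator {a..b} x *\<^sub>R ?g x)"
    using g_restrict_int[of "{a..b}"]
      set_borel_integral_eq_integral(2)[of "{a..b}" "\<lambda>x. exp (s * of_real (ln x)) * of_real (\<phi> x)"]
    by (simp add: set_integrable_def set_lebesgue_integral_def restrict)
  then have "moment \<phi> s - integral {a..b} (\<lambda>x. exp (s * of_real (ln x)) * of_real (\<phi> x)) =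
      (LINT x|lborel. ?g x - indicator {a..b} x *\<^sub>R ?g x)"
    using g_int g_restrict_int by (simp add: moment_def)
  also have "\<dots> = (LINT x|lborel. indicator (- {a..b}) x *\<^sub>R ?g x)"
    by (intro Bochner_Integration.integral_cong) (auto simp: indicator_def)
  also have "norm \<dots> \<le> (LINT x|lborel. norm (indicator (- {a..b}) x *\<^sub>R ?g x))"
    by (rule integral_norm_bound)
  also have "\<dots> \<le> (LINT x|lborel. indicator (- {a..b}) x * (indicator {0<..} x * ((x powr \<sigma>0 + x powr \<sigma>1) * \<phi> x)))"
  proof (rule integral_mono)
    show "integrable lborel (\<lambda>x. norm (indicator (- {a..b}) x *\<^sub>R ?g x))"
      by (intro integrable_norm g_restrict_int) auto
    have "integrable lborel (\<lambda>x. indicator {0<..} x * (x powr \<sigma>0 * \<phi> x) + indicator {0<..} x * (x powr \<sigma>1 * \<phi> x))"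
      using s by (intro Bochner_Integration.integrable_add \<phi>_int) auto
    then have "integrable lborel (\<lambda>x. indicator {0<..} x * ((x powr \<sigma>0 + x powr \<sigma>1) * \<phi> x))"
      by (simp add: algebra_simps)
    from integrable_mult_indicator[OF _ this, of "- {a..b}"]
    show "integrable lborel (\<lambda>x. indicator (- {a..b}) x * (indicator {0<..} x * ((x powr \<sigma>0 + x powr \<sigma>1) * \<phi> x)))"
      by simp
    show "norm (indicator (- {a..b}) x *\<^sub>R ?g x) \<le> indicator (- {a..b}) x * (indicator {0<..} x * ((x powr \<sigma>0 + x powr \<sigma>1) * \<phi> x))" for x
      using s \<phi>_nonneg[of x] by (auto simp: norm_moment_integrand indicator_def intro!: mult_right_mono powr_le_powr_add_powr)
  qed
  finally show ?thesis .
qed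

theorem moment_holomorphic:
  assumes cont: "continuous_on UNIV \<phi>" and \<phi>_nonneg: "\<And>x. \<phi> x \<ge> 0"
    and \<phi>_int: "\<And>p. p > \<sigma> \<Longrightarrow> integrable lborel (\<lambda>x. indicator {0<..} x * (x powr p * \<phi> x))"
  shows "moment \<phi> holomorphic_on {s. Re s > \<sigma>}"
proof (rule holomorphic_uniform_sequence)
  define F where "F n s = integral {1 / real (Suc n)..real (Suc n)} (\<lambda>x. exp (s * of_real (ln x)) * of_real (\<phi> x))" for n and s :: complex
  show "F n holomorphic_on {s. Re s > \<sigma>}" for n
    unfolding F_def by (intro truncated_moment_holomorphic continuous_on_subset[OF cont]) auto
  fix z assume z: "z \<in> {s. Re s > \<sigma>}"
  define d where "d = (Re z - \<sigma>) / 2"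
  have d: "d > 0" and above: "Re z - d > \<sigma>" using z by (simp_all add: d_def field_simps)
  have Re_near: "Re z - d \<le> Re s" "Re s \<le> Re z + d" if "s \<in> cball z d" for s
    using that abs_Re_le_cmod[of "z - s"] by (auto simp: dist_norm)
  define w where "w x = indicator {0<..} x * ((x powr (Re z - d) + x powr (Re z + d)) * \<phi> x)" for x
  have "integrable lborel (\<lambda>x. indicator {0<..} x * (x powr (Re z - d) * \<phi> x) + indicator {0<..} x * (x powr (Re z + d) * \<phi> x))"
    using above d by (intro Bochner_Integration.integrable_add \<phi>_int) auto
  then have "integrable lborel w" by (simp add: w_def[abs_def] distrib_left distrib_right)
  then have tail: "(\<lambda>n. LINT x|lborel. indicator (- {1 / real (Suc n)..real (Suc n)}) x * w x) \<longlonglongrightarrow> 0"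
    by (rule tendsto_tail_integral_0) (simp add: w_def)
  have bound: "dist (F n s) (moment \<phi> s) \<le> (LINT x|lborel. indicator (- {1 / real (Suc n)..real (Suc n)}) x * w x)"
    if "s \<in> cball z d" for n s
    unfolding F_def w_def dist_norm using above Re_near[OF that] \<phi>_nonneg cont
    by (subst norm_minus_commute, intro norm_moment_minus_truncated_le \<phi>_int) (auto intro: borel_measurable_continuous_onI)
  have "uniform_limit (cball z d) F (moment \<phi>) sequentially"
  proof (rule uniform_limitI)
    fix e :: real assume "e > 0"
    from order_tendstoD(2)[OF tail this]
    show "\<forall>\<^sub>F n in sequentially. \<forall>s\<in>cball z d. dist (F n s) (moment \<phi> s) < e"
      by eventually_elim (use bound le_less_trans in blast)
  qed
  moreover have "cball z d \<subseteq> {s. Re s > \<sigma>}" using Re_near above by fastforce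
  ultimately show "\<exists>d>0. cball z d \<subseteq> {s. Re s > \<sigma>} \<and> uniform_limit (cball z d) F (moment \<phi>) sequentially"
    using d by blast
qed (rule open_halfspace_Re_gt)

lemma summable_norm_exp_series:
  fixes c :: "nat \<Rightarrow> real"
  assumes "\<And>x. x > 0 \<Longrightarrow> summable (\<lambda>n. c n * exp (- x) ^ Suc n)" and "x > 0"
  shows "summable (\<lambda>n. norm (c n * exp (- x) ^ n))"
proof (rule powser_insidea)
  have "summable (\<lambda>n. exp (- (x / 2)) * (c n * exp (- (x / 2)) ^ n))"
    using assms(1)[of "x / 2"] \<open>x > 0\<close> by (simp add: mult_ac)
  then show "summable (\<lambda>n. c n * exp (- (x / 2)) ^ n)" by simp
qed (use \<open>x > 0\<close> in simp)

lemma sums_moment_exp_series: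
  assumes p: "p > -1" and sums: "\<And>x. x > 0 \<Longrightarrow> (\<lambda>n. c n * exp (- x) ^ Suc n) sums \<phi> x"
    and summable: "summable (\<lambda>n. \<bar>c n\<bar> * real (Suc n) powr - (p + 1))"
  shows "(\<lambda>n. Gamma (p + 1) * (c n * real (Suc n) powr - (p + 1))) sums
    (LINT x|lborel. indicator {0<..} x * (x powr p * \<phi> x))"
proof -
  define f where "f n x = c n * (indicator {0<..} x * (x powr p * exp (- (real (Suc n) * x))))" for n x
  have exp_Suc: "exp (- (real (Suc n) * x)) = exp (- x) ^ Suc n" for n and x :: real
    by (simp add: exp_of_nat_mult[symmetric] del: of_nat_Suc power_Suc)
  have Gamma_int: "has_bochner_integral lborel (\<lambda>x. indicator {0<..} x * (x powr p * exp (- (real (Suc n) * x))))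
      (Gamma (p + 1) * real (Suc n) powr - (p + 1))" for n
    using p nn_integral_Gamma_scaled[of "p + 1" "real (Suc n)"]
    by (intro has_bochner_integral_nn_integral) (auto simp: indicator_def)
  have f_int: "has_bochner_integral lborel (f n) (c n * (Gamma (p + 1) * real (Suc n) powr - (p + 1)))" for n
    unfolding f_def[abs_def] by (intro has_bochner_integral_mult_right Gamma_int)
  have abs_f_int: "has_bochner_integral lborel (\<lambda>x. \<bar>f n x\<bar>) (\<bar>c n\<bar> * (Gamma (p + 1) * real (Suc n) powr - (p + 1)))" for n
  proof -
    have "\<bar>f n x\<bar> = \<bar>c n\<bar> * (indicator {0<..} x * (x powr p * exp (- (real (Suc n) * x))))" for x
      by (simp add: f_def abs_mult)
    then show ?thesis by (simp only:) (intro has_bochner_integral_mult_right Gamma_int)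
  qed
  have f_altdef: "f n x = indicator {0<..} x * (x powr p * (c n * exp (- x) ^ Suc n))" for n x
    unfolding f_def exp_Suc by (simp only: mult_ac)
  have f_sums: "(\<lambda>n. f n x) sums (indicator {0<..} x * (x powr p * \<phi> x))" for x
    using sums_mult[OF sums, of x "x powr p"] by (cases "x > 0") (simp_all add: f_altdef)
  have f_summable: "summable (\<lambda>n. norm (f n x))" for x
  proof (cases "x > 0")
    case True
    have "summable (\<lambda>n. norm (c n * exp (- x) ^ n))"
      by (rule summable_norm_exp_series[OF sums_summable[OF sums] True])
    then have "summable (\<lambda>n. x powr p * exp (- x) * norm (c n * exp (- x) ^ n))" by (rule summable_mult)
    then show ?thesis using True by (simp add: f_altdef abs_mult mult_ac)
  qed (simp add: f_def)
  have "(\<lambda>n. integral\<^sup>L lborel (f n)) sums (LINT x|lborel. (\<Sum>n. f n x))"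
  proof (rule sums_integral)
    have "summable (\<lambda>n. Gamma (p + 1) * (\<bar>c n\<bar> * real (Suc n) powr - (p + 1)))"
      by (intro summable_mult summable)
    then show "summable (\<lambda>n. LINT x|lborel. norm (f n x))"
      using abs_f_int by (simp add: has_bochner_integral_iff mult_ac)
  qed (use f_int f_summable in \<open>auto simp: has_bochner_integral_iff\<close>)
  then show ?thesis using f_sums f_int by (simp add: sums_iff has_bochner_integral_iff mult_ac)
qed


subsection \<open>The functional equation from two evaluations of the logistic moments\<close>

lemma riemann_zeta_real_sums:
  assumes "p > 1"
  shows "(\<lambda>n. real (Suc n) powr (- p)) sums Re (riemann_zeta (of_real p))"
proof -
  have "1 / of_nat (Suc n) powr complex_of_real p = of_real (real (Suc n) powr (- p))" for n
    using powr_of_real[of "real (Suc n)" p] by (simp add: powr_minus_divide)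
  then have "(\<lambda>n. complex_of_real (real (Suc n) powr (- p))) sums riemann_zeta (of_real p)"
    using riemann_zeta_sums[of "of_real p"] assms by (simp only: Re_complex_of_real)
  from sums_Re[OF this] show ?thesis by simp
qed

lemma of_real_Re_riemann_zeta: "of_real (Re (riemann_zeta (of_real p))) = riemann_zeta (of_real p)"
  using riemann_zeta_cnj[of "of_real p"] by (simp add: complex_eq_iff)

lemma sums_pairs:
  fixes f :: "nat \<Rightarrow> 'a :: real_normed_vector"
  assumes "f sums s"
  shows "(\<lambda>n. f (2 * n) + f (2 * n + 1)) sums s"
proof -
  have "sum f {n * 2..<n * 2 + 2} = f (2 * n) + f (2 * n + 1)" for n
    by (simp add: numeral_2_eq_2 mult.commute)
  then show ?thesis using sums_group[OF assms, of 2] by simp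
qed

lemma powr_odd_even_Suc:
  "real (Suc (2 * n)) powr q = (2 * real n + 1) powr q"
  "real (Suc (2 * n + 1)) powr q = 2 powr q * real (Suc n) powr q"
proof -
  show "real (Suc (2 * n)) powr q = (2 * real n + 1) powr q" by (simp add: add.commute)
  have "real (Suc (2 * n + 1)) = 2 * real (Suc n)" by simp
  then show "real (Suc (2 * n + 1)) powr q = 2 powr q * real (Suc n) powr q" by (simp only: powr_mult)
qed

lemma riemann_zeta_odd_sums:
  assumes p: "p > 1"
  shows "(\<lambda>n. (2 * real n + 1) powr (- p)) sums ((1 - 2 powr (- p)) * Re (riemann_zeta (of_real p)))"
proof -
  have sums: "(\<lambda>n. real (Suc n) powr (- p)) sums Re (riemann_zeta (of_real p))" by (rule riemann_zeta_real_sums[OF p])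
  from sums_pairs[OF this]
  have "(\<lambda>n. (2 * real n + 1) powr (- p) + 2 powr (- p) * real (Suc n) powr (- p)) sums Re (riemann_zeta (of_real p))"
    by (simp only: powr_odd_even_Suc)
  from sums_diff[OF this sums_mult[OF sums, of "2 powr (- p)"]]
  show ?thesis by (simp add: algebra_simps)
qed

lemma riemann_zeta_alternating_sums:
  assumes p: "p > 1"
  shows "(\<lambda>n. (-1) ^ n * real (Suc n) powr (- p)) sums ((1 - 2 powr (1 - p)) * Re (riemann_zeta (of_real p)))"
proof -
  let ?Z = "Re (riemann_zeta (of_real p))"
  have sums: "(\<lambda>n. real (Suc n) powr (- p)) sums ?Z" by (rule riemann_zeta_real_sums[OF p])
  then have "summable (\<lambda>n. norm ((-1) ^ n * real (Suc n) powr (- p)))"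
    by (simp add: sums_iff abs_mult)
  then have alternating: "(\<lambda>n. (-1) ^ n * real (Suc n) powr (- p)) sums (\<Sum>n. (-1) ^ n * real (Suc n) powr (- p))"
    by (rule summable_sums[OF summable_norm_cancel])
  from sums_pairs[OF this]
  have "(\<lambda>n. (2 * real n + 1) powr (- p) - 2 powr (- p) * real (Suc n) powr (- p)) sums (\<Sum>n. (-1) ^ n * real (Suc n) powr (- p))"
    by (simp only: powr_odd_even_Suc) simp
  moreover have "(\<lambda>n. (2 * real n + 1) powr (- p) - 2 powr (- p) * real (Suc n) powr (- p)) sums
      ((1 - 2 powr (- p)) * ?Z - 2 powr (- p) * ?Z)"
    by (intro sums_diff sums_mult riemann_zeta_odd_sums p sums)
  ultimately have "(\<Sum>n. (-1) ^ n * real (Suc n) powr (- p)) = (1 - 2 powr (- p)) * ?Z - 2 powr (- p) * ?Z"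
    by (rule sums_unique2)
  also have "\<dots> = (1 - 2 powr (1 - p)) * ?Z"
    by (simp add: powr_diff powr_minus divide_inverse algebra_simps)
  finally show ?thesis using alternating by simp
qed

lemma integrable_powr_logistic_density:
  assumes "p > -1"
  shows "integrable lborel (\<lambda>x. indicator {0<..} x * (x powr p * logistic_density x))"
proof (rule Bochner_Integration.integrable_bound)
  have "has_bochner_integral lborel (\<lambda>x. indicator {0<..} x * (x powr p * exp (- (1 * x)))) (Gamma (p + 1) * 1 powr - (p + 1))"
    using assms nn_integral_Gamma_scaled[of "p + 1" 1]
    by (intro has_bochner_integral_nn_integral) (auto simp: indicator_def)
  then show "integrable lborel (\<lambda>x. indicator {0<..} x * (x powr p * exp (- x)))"
    by (simp add: has_bochner_integral_iff)
  show "AE x in lborel. norm (indicator {0<..} x * (x powr p * logistic_density x)) \<le> norm (indicator {0<..} x * (x powr p * exp (- x)))"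
    using logistic_density_le logistic_density_nonneg
    by (intro AE_I2) (auto simp: indicator_def abs_mult intro!: mult_left_mono)
qed measurable

lemma moment_logistic_density_holomorphic: "moment logistic_density holomorphic_on {s. Re s > -1}"
proof (rule moment_holomorphic)
  show "continuous_on UNIV logistic_density"
    unfolding logistic_density_def by (intro continuous_intros) (auto simp: add_nonneg_eq_0_iff)
qed (use logistic_density_nonneg integrable_powr_logistic_density in auto)

lemma logistic_density_sums:
  assumes "x > 0"
  shows "(\<lambda>n. (-1) ^ n * real (Suc n) * exp (- x) ^ Suc n) sums logistic_density x"
proof -
  have "(\<lambda>n. exp (- x) * (of_nat (Suc n) * (- exp (- x)) ^ n)) sums (exp (- x) * (1 / (1 - (- exp (- x)))\<^sup>2))"
    using assms by (intro sums_mult geometric_deriv_sums) simp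
  moreover have "exp (- x) * (of_nat (Suc n) * (- exp (- x)) ^ n) = (-1) ^ n * real (Suc n) * exp (- x) ^ Suc n" for n
    by (simp add: power_minus[of "exp (- x)"])
  moreover have "exp (- x) * (1 / (1 - (- exp (- x)))\<^sup>2) = logistic_density x"
  proof -
    have "inverse e * (1 / (1 + inverse e)\<^sup>2) = e / (e + 1)\<^sup>2" if "e > 0" for e :: real
      using that by (simp add: field_simps power2_eq_square add_nonneg_eq_0_iff)
    from this[of "exp x"] show ?thesis by (simp add: logistic_density_def exp_minus)
  qed
  ultimately show ?thesis by (simp only:)
qed

lemma moment_logistic_density_gt_1:
  assumes p: "p > 1"
  shows "moment logistic_density (of_real p) = of_real (Gamma (p + 1) * ((1 - 2 powr (1 - p)) * Re (riemann_zeta (of_real p))))"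
proof -
  have shift: "real (Suc n) * real (Suc n) powr - (p + 1) = real (Suc n) powr - p" for n
    by (subst powr_mult_base) auto
  have "(\<lambda>n. Gamma (p + 1) * ((-1) ^ n * real (Suc n) * real (Suc n) powr - (p + 1))) sums
      (LINT x|lborel. indicator {0<..} x * (x powr p * logistic_density x))"
  proof (rule sums_moment_exp_series)
    show "summable (\<lambda>n. \<bar>(-1) ^ n * real (Suc n)\<bar> * real (Suc n) powr - (p + 1))"
      using riemann_zeta_real_sums[OF p] shift by (simp add: abs_mult sums_iff del: of_nat_Suc)
  qed (use p logistic_density_sums in auto)
  moreover have "(\<lambda>n. Gamma (p + 1) * ((-1) ^ n * real (Suc n) * real (Suc n) powr - (p + 1))) sums
      (Gamma (p + 1) * ((1 - 2 powr (1 - p)) * Re (riemann_zeta (of_real p))))"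
    unfolding mult.assoc shift by (intro sums_mult riemann_zeta_alternating_sums p)
  ultimately have "(LINT x|lborel. indicator {0<..} x * (x powr p * logistic_density x)) =
      Gamma (p + 1) * ((1 - 2 powr (1 - p)) * Re (riemann_zeta (of_real p)))"
    by (rule sums_unique2)
  then show ?thesis by (simp only: moment_of_real)
qed

lemma moment_logistic_density_neg:
  assumes x: "-1 < x" "x < 0"
  shows "moment logistic_density (of_real x) = of_real (- x * (Gamma ((1 + x) / 2) * Gamma ((1 - x) / 2)) * pi powr (x - 1) *
      ((1 - 2 powr (x - 1)) * Re (riemann_zeta (of_real (1 - x)))))"
proof -
  define C where "C = - x * (Gamma ((1 + x) / 2) * Gamma ((1 - x) / 2)) * pi powr (x - 1)"
  have C: "C \<ge> 0" using x unfolding C_def by (intro mult_nonneg_nonneg) auto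
  define A where "A = C * ((1 - 2 powr (x - 1)) * Re (riemann_zeta (of_real (1 - x))))"
  have sums: "(\<lambda>n. C * (2 * real n + 1) powr (x - 1)) sums A"
    using riemann_zeta_odd_sums[of "1 - x"] x unfolding A_def by (intro sums_mult) simp
  have "A \<ge> 0" using sums_le[OF _ sums_zero sums] C by simp
  have "(\<integral>\<^sup>+u. ennreal (indicator {0<..} u * (u powr x * logistic_density u)) \<partial>lborel) =
      (\<Sum>n. ennreal (C * (2 * real n + 1) powr (x - 1)))"
    unfolding nn_integral_powr_logistic[OF x]
    by (intro suminf_cong arg_cong[where f = ennreal]) (subst powr_mult, auto simp: C_def mult_ac)
  also have "\<dots> = ennreal A"
    using sums C by (subst suminf_ennreal2) (auto simp: sums_iff)
  finally have "has_bochner_integral lborel (\<lambda>u. indicator {0<..} u * (u powr x * logistic_density u)) A"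
    using \<open>A \<ge> 0\<close> logistic_density_nonneg by (intro has_bochner_integral_nn_integral) (auto simp: indicator_def)
  then show ?thesis by (simp only: moment_of_real has_bochner_integral_iff A_def C_def)
qed

lemma islimpt_of_real_image:
  assumes "open A" "x \<in> A"
  shows "complex_of_real x islimpt of_real ` A"
proof (rule islimpt_isCont_image)
  show "x islimpt A" using assms by (intro interior_limit_point) (simp add: interior_open)
qed (auto simp: eventually_at_filter)

lemma moment_logistic_density:
  assumes s: "Re s > -1" "s \<noteq> 1"
  shows "moment logistic_density s = Gamma (s + 1) * ((1 - 2 powr (1 - s)) * riemann_zeta s)"
proof -
  define S where "S = {s. Re s > -1} - {1}"
  define f where "f s = moment logistic_density s - Gamma (s + 1) * ((1 - 2 powr (1 - s)) * riemann_zeta s)" for s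
  have "f s = 0"
  proof (rule analytic_continuation[of f S "of_real ` {1<..}" "of_real 2"])
    have "s + 1 \<notin> \<int>\<^sub>\<le>\<^sub>0" if "Re s > -1" for s :: complex
      using that by (auto elim!: nonpos_Ints_cases' simp: complex_eq_iff)
    then show "f holomorphic_on S"
      unfolding f_def
      using holomorphic_on_subset[OF moment_logistic_density_holomorphic, of S]
        holomorphic_on_subset[OF riemann_zeta_holomorphic, of S]
      by (intro holomorphic_intros) (auto simp: S_def)
    show "open S" unfolding S_def by (intro open_delete open_halfspace_Re_gt)
    show "connected S" unfolding S_def
      by (intro connected_open_delete open_halfspace_Re_gt convex_connected convex_halfspace_Re_gt) simp
    show "complex_of_real 2 islimpt of_real ` {1<..}" by (rule islimpt_of_real_image) auto
    fix z :: complex assume "z \<in> of_real ` {1<..}"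
    then obtain x where x: "z = of_real x" "x > 1" by auto
    have "Gamma (z + 1) = of_real (Gamma (x + 1))" using Gamma_complex_of_real[of "x + 1"] x by simp
    moreover have "2 powr (1 - z) = of_real (2 powr (1 - x))"
      using powr_of_real[of 2 "1 - x"] x by simp
    ultimately show "f z = 0"
      using moment_logistic_density_gt_1[OF x(2)] by (simp add: f_def x(1) of_real_Re_riemann_zeta)
  qed (use s in \<open>auto simp: S_def\<close>)
  then show ?thesis by (simp add: f_def)
qed

lemma riemann_zeta_functional_equation_real:
  assumes x: "-1 < x" "x < 0"
  defines "z \<equiv> complex_of_real x"
  shows "Gamma z * riemann_zeta z =
    (2 * of_real pi) powr (z - 1) * riemann_zeta (1 - z) * (Gamma ((1 + z) / 2) * Gamma ((1 - z) / 2))"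
proof -
  define a where "a = 2 powr (x - 1)"
  define Y where "Y = Gamma ((1 + z) / 2) * Gamma ((1 - z) / 2)"
  have "2 powr (x - 1) < 2 powr (0::real)" using x by (intro powr_less_mono) auto
  then have a: "a > 0" "a \<noteq> 1" by (auto simp: a_def)
  have z_nz: "z \<noteq> 0" using x by (simp add: z_def)
  have "z \<notin> \<int>\<^sub>\<le>\<^sub>0"
    unfolding z_def of_real_in_nonpos_Ints_iff using x by (auto elim!: nonpos_Ints_cases)
  then have "Gamma (z + 1) = z * Gamma z" by (intro Gamma_plus1)
  moreover have "2 powr (1 - z) = complex_of_real (1 / a)"
    using powr_of_real[of 2 "1 - x"] powr_minus_divide[of 2 "x - 1"] by (simp add: a_def z_def)
  moreover have "Y = of_real (Gamma ((1 + x) / 2) * Gamma ((1 - x) / 2))"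
    using Gamma_complex_of_real[of "(1 + x) / 2"] Gamma_complex_of_real[of "(1 - x) / 2"] by (simp add: Y_def z_def)
  ultimately have "z * (Gamma z * ((1 - of_real (1 / a)) * riemann_zeta z)) =
      z * (- Y * of_real (pi powr (x - 1)) * ((1 - of_real a) * riemann_zeta (1 - z)))"
    using moment_logistic_density[of z] moment_logistic_density_neg[OF x] x of_real_Re_riemann_zeta[of "1 - x"]
    by (simp add: z_def a_def mult_ac)
  then have "Gamma z * ((1 - 1 / of_real a) * riemann_zeta z) =
      - Y * of_real (pi powr (x - 1)) * ((1 - of_real a) * riemann_zeta (1 - z))"
    using z_nz by (simp only: mult_cancel_left) simp
  moreover have "complex_of_real a \<noteq> 0" "complex_of_real a \<noteq> 1" using a by (auto simp: of_real_eq_1_iff)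
  moreover have "G * Z = A * P * W * Y"
    if "G * ((1 - 1 / A) * Z) = - Y * P * ((1 - A) * W)" "A \<noteq> 0" "A \<noteq> 1" for G Z A P W Y :: complex
  proof -
    have "(A - 1) * (G * Z) = A * (G * ((1 - 1 / A) * Z))" using that(2) by (simp add: field_simps)
    also have "\<dots> = (A - 1) * (A * P * W * Y)" unfolding that(1) by (simp add: algebra_simps)
    finally show ?thesis using that(3) by simp
  qed
  ultimately have "Gamma z * riemann_zeta z = of_real a * of_real (pi powr (x - 1)) * riemann_zeta (1 - z) * Y"
    by blast
  also have "of_real a * of_real (pi powr (x - 1)) = (2 * complex_of_real pi) powr (z - 1)"
    using powr_of_real[of "2 * pi" "x - 1"] by (simp add: a_def z_def powr_mult)
  finally show ?thesis by (simp add: Y_def)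
qed

theorem riemann_zeta_functional_equation:
  assumes s: "s \<notin> \<int>"
  shows "Gamma s * riemann_zeta s =
    (2 * of_real pi) powr (s - 1) * riemann_zeta (1 - s) * (Gamma ((1 + s) / 2) * Gamma ((1 - s) / 2))"
proof -
  define f where "f s = Gamma s * riemann_zeta s -
    (2 * of_real pi) powr (s - 1) * riemann_zeta (1 - s) * (Gamma ((1 + s) / 2) * Gamma ((1 - s) / 2))" for s
  have not_nonpos_Int: "w \<notin> \<int>\<^sub>\<le>\<^sub>0" "(1 + w) / 2 \<notin> \<int>\<^sub>\<le>\<^sub>0" "(1 - w) / 2 \<notin> \<int>\<^sub>\<le>\<^sub>0" if "w \<notin> \<int>" for w :: complex
    using that half_shift_notin_Ints[OF that] by (auto intro: not_Int_imp_not_nonpos_Int)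
  have "f s = 0"
  proof (rule analytic_continuation[of f "- \<int>" "of_real ` {-1<..<0}" "of_real (-1/2)"])
    have "riemann_zeta holomorphic_on - \<int>"
      by (rule holomorphic_on_subset[OF riemann_zeta_holomorphic]) auto
    moreover have "(riemann_zeta \<circ> (\<lambda>s. 1 - s)) holomorphic_on - \<int>"
      by (rule holomorphic_on_compose_gen[OF _ riemann_zeta_holomorphic]) (auto intro!: holomorphic_intros)
    ultimately show "f holomorphic_on - \<int>"
      unfolding f_def o_def using not_nonpos_Int by (intro holomorphic_intros) auto
    show "open (- \<int> :: complex set)" by (simp add: open_Compl)
    have "countable (\<int> :: complex set)" unfolding Ints_def by simp
    then show "connected (- \<int> :: complex set)"
      by (intro path_connected_imp_connected path_connected_complement_countable) simp
    have "complex_of_real x \<notin> \<int>" if "-1 < x" "x < 0" for x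
      using that by (auto elim!: Ints_cases)
    then show "of_real ` {-1<..<0} \<subseteq> - (\<int> :: complex set)" "complex_of_real (-1/2) \<in> - \<int>" by auto
    show "complex_of_real (-1/2) islimpt of_real ` {-1<..<0}" by (rule islimpt_of_real_image) auto
    show "f z = 0" if "z \<in> of_real ` {-1<..<0}" for z
      using that riemann_zeta_functional_equation_real by (auto simp: f_def)
  qed (use s in simp)
  then show ?thesis by (simp add: f_def)
qed

section \<open>Zeros and good heights\<close>

text \<open>The functional equation reads \<open>\<zeta>(s) = \<chi>(s) \<zeta>(1 - s)\<close>, and \<open>chi_logderiv\<close> is \<open>\<chi>' / \<chi>\<close>.\<close>

definition chi_logderiv :: "complex \<Rightarrow> complex" where
  "chi_logderiv s = of_real (ln (2 * pi)) + Digamma ((1 + s) / 2) / 2 - Digamma ((1 - s) / 2) / 2 - Digamma s"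

lemma not_Int_if_Im: "Im w \<noteq> 0 \<Longrightarrow> w \<notin> \<int>"
  by (auto elim!: Ints_cases)

lemma riemann_zeta_zero_reflect:
  assumes "s \<notin> \<int>"
  shows "riemann_zeta (1 - s) = 0 \<longleftrightarrow> riemann_zeta s = 0"
proof -
  have "Gamma s \<noteq> 0" "Gamma ((1 + s) / 2) \<noteq> 0" "Gamma ((1 - s) / 2) \<noteq> 0"
    using assms half_shift_notin_Ints[OF assms] by (auto simp: Gamma_eq_zero_iff dest: not_Int_imp_not_nonpos_Int)
  moreover have "(2 * complex_of_real pi) powr (s - 1) \<noteq> 0" by simp
  ultimately show ?thesis
    using riemann_zeta_functional_equation[OF assms] by (metis mult_eq_0_iff)
qed

lemma has_field_derivative_two_pi_powr:
  "((\<lambda>u :: complex. (2 * of_real pi) powr (u - 1)) has_field_derivative (2 * of_real pi) powr (s - 1) * of_real (ln (2 * pi))) (at s)"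
proof -
  have "Ln (2 * of_real pi) = of_real (ln (2 * pi))" using Ln_of_real[of "2 * pi"] by simp
  then have powr_eq: "(2 * of_real pi) powr (u - 1) = exp ((u - 1) * of_real (ln (2 * pi)))" for u :: complex
    by (simp add: powr_def)
  show ?thesis unfolding powr_eq by (auto intro!: derivative_eq_intros)
qed

lemma logderiv_functional_equation_factor:
  assumes s: "s \<notin> \<int>" and zeta_nz: "riemann_zeta (1 - s) \<noteq> 0"
  shows "logderiv (\<lambda>u. (2 * of_real pi) powr (u - 1) * riemann_zeta (1 - u) * (Gamma ((1 + u) / 2) * Gamma ((1 - u) / 2))) s =
    of_real (ln (2 * pi)) - logderiv riemann_zeta (1 - s) + Digamma ((1 + s) / 2) / 2 - Digamma ((1 - s) / 2) / 2"
proof -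
  define P A B where "P u = (2 * of_real pi) powr (u - 1)" and "A u = Gamma ((1 + u) / 2)" and "B u = Gamma ((1 - u) / 2)"
    for u :: complex
  have not_pole: "(1 + s) / 2 \<notin> \<int>\<^sub>\<le>\<^sub>0" "(1 - s) / 2 \<notin> \<int>\<^sub>\<le>\<^sub>0"
    using half_shift_notin_Ints[OF s] by (auto intro: not_Int_imp_not_nonpos_Int)
  then have nz: "P s \<noteq> 0" "A s \<noteq> 0" "B s \<noteq> 0" by (auto simp: P_def A_def B_def Gamma_eq_zero_iff)
  have P': "(P has_field_derivative P s * of_real (ln (2 * pi))) (at s)"
    unfolding P_def by (rule has_field_derivative_two_pi_powr)
  have A': "(A has_field_derivative A s * (Digamma ((1 + s) / 2) / 2)) (at s)"
    unfolding A_def[abs_def] using not_pole(1) by (auto intro!: derivative_eq_intros)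
  have B': "(B has_field_derivative B s * - (Digamma ((1 - s) / 2) / 2)) (at s)"
    unfolding B_def[abs_def] using not_pole(2) by (auto intro!: derivative_eq_intros)
  have "1 - s \<noteq> 1" using s by auto
  then have zeta': "(riemann_zeta has_field_derivative riemann_zeta (1 - s) * logderiv riemann_zeta (1 - s)) (at (1 - s))"
    by (intro has_field_derivative_logderiv riemann_zeta_differentiable zeta_nz)
  have "((\<lambda>u. 1 - u) has_field_derivative - 1) (at s)" by (auto intro!: derivative_eq_intros)
  from DERIV_chain2[OF zeta' this]
  have reflect': "((\<lambda>u. riemann_zeta (1 - u)) has_field_derivative riemann_zeta (1 - s) * - logderiv riemann_zeta (1 - s)) (at s)"
    by simp
  have "P field_differentiable at s" "A field_differentiable at s" "B field_differentiable at s"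
      "(\<lambda>u. riemann_zeta (1 - u)) field_differentiable at s"
    using P' A' B' reflect' unfolding field_differentiable_def by blast+
  then have "logderiv (\<lambda>u. P u * riemann_zeta (1 - u) * (A u * B u)) s =
      logderiv P s + logderiv (\<lambda>u. riemann_zeta (1 - u)) s + (logderiv A s + logderiv B s)"
    using nz zeta_nz by (simp add: logderiv_mult field_differentiable_mult)
  also have "\<dots> = of_real (ln (2 * pi)) + - logderiv riemann_zeta (1 - s) + (Digamma ((1 + s) / 2) / 2 + - (Digamma ((1 - s) / 2) / 2))"
    using P' A' B' reflect' nz zeta_nz by (intro arg_cong2[of _ _ _ _ "(+)"] logderiv_eqI)
  finally show ?thesis by (simp add: P_def A_def B_def)
qed

lemma logderiv_riemann_zeta_reflect:
  assumes s: "s \<notin> \<int>" and zeta_nz: "riemann_zeta s \<noteq> 0"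
  shows "logderiv riemann_zeta s = chi_logderiv s - logderiv riemann_zeta (1 - s)"
proof -
  have not_pole: "s \<notin> \<int>\<^sub>\<le>\<^sub>0" and "s \<noteq> 1" using s by (auto intro: not_Int_imp_not_nonpos_Int)
  have "open (- \<int> :: complex set)" by (simp add: open_Compl)
  then have "\<forall>\<^sub>F u in nhds s. Gamma u * riemann_zeta u =
      (2 * of_real pi) powr (u - 1) * riemann_zeta (1 - u) * (Gamma ((1 + u) / 2) * Gamma ((1 - u) / 2))"
    using eventually_nhds_in_open[of "- \<int>" s] s riemann_zeta_functional_equation by (auto elim!: eventually_mono)
  from logderiv_cong[OF this]
  have "logderiv (\<lambda>u. Gamma u * riemann_zeta u) s =
      of_real (ln (2 * pi)) - logderiv riemann_zeta (1 - s) + Digamma ((1 + s) / 2) / 2 - Digamma ((1 - s) / 2) / 2"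
    using logderiv_functional_equation_factor[OF s] riemann_zeta_zero_reflect[OF s] zeta_nz by simp
  moreover have "logderiv (\<lambda>u. Gamma u * riemann_zeta u) s = Digamma s + logderiv riemann_zeta s"
    using not_pole \<open>s \<noteq> 1\<close> zeta_nz
    by (subst logderiv_mult)
       (auto simp: logderiv_Gamma Gamma_eq_zero_iff intro!: field_differentiable_Gamma riemann_zeta_differentiable)
  ultimately show ?thesis by (simp add: chi_logderiv_def algebra_simps)
qed

lemma norm_Digamma_minus_ln_Im_le:
  assumes z: "\<bar>Re z\<bar> \<le> 2" "\<bar>Im z\<bar> \<ge> 1 / 2"
  shows "norm (Digamma z - of_real (ln \<bar>Im z\<bar>)) \<le> 6 * pi\<^sup>2 + pi + ln 5"
proof -
  have "\<bar>Im z\<bar> \<le> norm z" by (rule abs_Im_le_cmod)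
  moreover have "norm z \<le> 5 * \<bar>Im z\<bar>" using cmod_le[of z] z by linarith
  ultimately have "ln \<bar>Im z\<bar> \<le> ln (norm z)" "ln (norm z) \<le> ln (5 * \<bar>Im z\<bar>)"
    using z by (subst ln_le_cancel_iff; force)+
  moreover have "ln (5 * \<bar>Im z\<bar>) = ln 5 + ln \<bar>Im z\<bar>" using z by (subst ln_mult) auto
  ultimately have "norm (complex_of_real (ln (norm z)) - of_real (ln \<bar>Im z\<bar>)) \<le> ln 5"
    by (simp flip: of_real_diff)
  then show ?thesis
    using norm_Digamma_minus_ln_norm_le[OF z]
      norm_triangle_ineq[of "Digamma z - of_real (ln (norm z))" "complex_of_real (ln (norm z)) - of_real (ln \<bar>Im z\<bar>)"]
    by simp
qed

lemma norm_chi_logderiv_le: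
  "\<exists>C\<ge>0. \<forall>s. \<bar>Re s\<bar> \<le> 2 \<and> Im s \<ge> 1 \<longrightarrow> norm (chi_logderiv s + of_real (ln (Im s))) \<le> C"
proof -
  define C where "C = 6 * pi\<^sup>2 + pi + ln 5"
  have "C \<ge> 0" by (simp add: C_def)
  have ln_nonneg: "ln (2 * pi) \<ge> 0" using pi_ge_two by (intro ln_ge_zero) linarith
  have "norm (chi_logderiv s + of_real (ln (Im s))) \<le> 2 * C + ln (2 * pi)" if s: "\<bar>Re s\<bar> \<le> 2" "Im s \<ge> 1" for s
  proof -
    define t where "t = Im s"
    have Digamma_bounds: "norm (Digamma ((1 + s) / 2) - of_real (ln (t / 2))) \<le> C"
      "norm (Digamma ((1 - s) / 2) - of_real (ln (t / 2))) \<le> C" "norm (Digamma s - of_real (ln t)) \<le> C"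
      using norm_Digamma_minus_ln_Im_le[of "(1 + s) / 2"] norm_Digamma_minus_ln_Im_le[of "(1 - s) / 2"]
        norm_Digamma_minus_ln_Im_le[of s] s
      by (simp_all add: t_def C_def abs_le_iff)
    have "chi_logderiv s + of_real (ln t) = of_real (ln (2 * pi)) + (Digamma ((1 + s) / 2) - of_real (ln (t / 2))) / 2
       - (Digamma ((1 - s) / 2) - of_real (ln (t / 2))) / 2 - (Digamma s - of_real (ln t))"
      by (simp add: chi_logderiv_def algebra_simps diff_divide_distrib)
    also have "norm \<dots> \<le> norm (complex_of_real (ln (2 * pi))) + norm ((Digamma ((1 + s) / 2) - of_real (ln (t / 2))) / 2)
       + norm ((Digamma ((1 - s) / 2) - of_real (ln (t / 2))) / 2) + norm (Digamma s - of_real (ln t))"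
      by (intro norm_triangle_le_diff norm_triangle_le add_mono order_refl)
    also have "\<dots> \<le> ln (2 * pi) + C / 2 + C / 2 + C"
      using Digamma_bounds ln_nonneg by (intro add_mono) (auto simp: norm_divide simp del: of_real_diff)
    finally show ?thesis by (simp add: t_def)
  qed
  then show ?thesis using \<open>C \<ge> 0\<close> ln_nonneg by (intro exI[of _ "2 * C + ln (2 * pi)"]) simp
qed

lemma norm_chi_logderiv_Complex_le:
  "\<exists>C\<ge>0. \<forall>\<sigma> t. \<bar>\<sigma>\<bar> \<le> 2 \<and> t \<ge> 1 \<longrightarrow> norm (chi_logderiv (Complex \<sigma> t)) \<le> C + ln t"
proof -
  obtain C where C: "C \<ge> 0" "\<And>s. \<bar>Re s\<bar> \<le> 2 \<Longrightarrow> Im s \<ge> 1 \<Longrightarrow> norm (chi_logderiv s + of_real (ln (Im s))) \<le> C"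
    using norm_chi_logderiv_le by blast
  have "norm (chi_logderiv (Complex \<sigma> t)) \<le> C + ln t" if "\<bar>\<sigma>\<bar> \<le> 2" "t \<ge> 1" for \<sigma> t
    using C(2)[of "Complex \<sigma> t"] norm_triangle_ineq4[of "chi_logderiv (Complex \<sigma> t) + of_real (ln t)" "of_real (ln t)"] that
    by simp
  then show ?thesis using C(1) by blast
qed

lemma continuous_on_chi_logderiv:
  assumes "A \<subseteq> {s. Im s \<noteq> 0}"
  shows "continuous_on A chi_logderiv"
proof -
  have "continuous_on {s. Im s \<noteq> 0} (Digamma :: complex \<Rightarrow> complex)"
    by (intro continuous_on_Polygamma) (auto dest: not_Int_if_Im not_Int_imp_not_nonpos_Int)
  note continuous_on_Digamma = continuous_on_compose2[OF this]
  show ?thesis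
    unfolding chi_logderiv_def using assms by (intro continuous_intros continuous_on_Digamma) auto
qed

lemma riemann_zeta_zero_strip:
  assumes "riemann_zeta s = 0" "Im s \<noteq> 0"
  shows "0 < Re s" "Re s < 1"
proof -
  have Re_less_1: "Re z < 1" if "riemann_zeta z = 0" "Im z \<noteq> 0" for z
    using that riemann_zeta_nonzero_Re_gt_1[of z] riemann_zeta_nonzero_Re_1[of z]
    by (cases "Re z" "1::real" rule: linorder_cases) auto
  show "Re s < 1" using Re_less_1 assms .
  show "0 < Re s"
    using Re_less_1[of "1 - s"] riemann_zeta_zero_reflect[of s] not_Int_if_Im[of s] assms by simp
qed


subsection \<open>Zeros near a given height\<close>

lemma one_le_ln: "T \<ge> 4 \<Longrightarrow> ln T \<ge> (1::real)"
  using exp_le by (subst ln_ge_iff) auto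

lemma ln_le_two_ln:
  assumes "T \<ge> (4::real)" "0 < x" "x \<le> T + 5"
  shows "ln x \<le> 2 * ln T"
proof -
  have "4 * T \<le> T * T" using assms(1) by (intro mult_right_mono) auto
  then have "x \<le> T * T" using assms by linarith
  then have "ln x \<le> ln (T * T)" using assms by (subst ln_le_cancel_iff) auto
  then show ?thesis using assms(1) by (simp add: ln_mult)
qed

definition local_zeros :: "real \<Rightarrow> complex set" where
  "local_zeros T = {z \<in> cball (Complex 2 T) (17/10). riemann_zeta z = 0}"

lemma ball_Complex_2_bounds:
  assumes "z \<in> ball (Complex 2 T) (39/20)" "T \<ge> 4"
  shows "Re z > 1/20" "Im z > 1" "norm z \<le> T + 5"
proof -
  have n: "norm (Complex 2 T - z) < 39/20" using assms(1) by (simp add: dist_norm)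
  have "\<bar>2 - Re z\<bar> < 39/20" "\<bar>T - Im z\<bar> < 39/20"
    using n abs_Re_le_cmod[of "Complex 2 T - z"] abs_Im_le_cmod[of "Complex 2 T - z"] by auto
  then show "Re z > 1/20" "Im z > 1" using assms(2) by linarith+
  have "norm z \<le> norm (Complex 2 T) + norm (Complex 2 T - z)"
    using norm_triangle_ineq2[of z "Complex 2 T"] by (simp add: norm_minus_commute)
  then show "norm z \<le> T + 5" using n cmod_le[of "Complex 2 T"] assms(2) by simp
qed

lemma riemann_zeta_bounded_on_disc:
  "\<exists>B>0. \<forall>T\<ge>4. bounded_on_disc riemann_zeta (ball (Complex 2 T) (39/20)) (Complex 2 T) (17/10) (19/10) (B * ln T)"
proof -
  obtain C where C: "C \<ge> 0" "\<And>s. Re s \<ge> 1/20 \<Longrightarrow> \<bar>Im s\<bar> \<ge> 1 \<Longrightarrow> norm (riemann_zeta s) \<le> C * norm s"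
    using riemann_zeta_growth[of "1/20"] by auto
  define B where "B = ln (5 * (C + 1)) + 2"
  have B: "B > 0" using C(1) by (auto simp: B_def intro!: add_nonneg_pos ln_ge_zero)
  have "bounded_on_disc riemann_zeta (ball (Complex 2 T) (39/20)) (Complex 2 T) (17/10) (19/10) (B * ln T)"
    if T: "T \<ge> 4" for T
  proof
    show "riemann_zeta holomorphic_on ball (Complex 2 T) (39/20)"
      by (rule holomorphic_on_subset[OF riemann_zeta_holomorphic]) (use ball_Complex_2_bounds[OF _ T] in force)
    show "cball (Complex 2 T) (19/10) \<subseteq> ball (Complex 2 T) (39/20)" by auto
    show "riemann_zeta (Complex 2 T) \<noteq> 0" using norm_riemann_zeta_2_ge[of T] by auto
    show "B * ln T > 0" using B one_le_ln[OF T] by simp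
    fix z assume "z \<in> cball (Complex 2 T) (19/10)"
    then have "z \<in> ball (Complex 2 T) (39/20)" by auto
    note z = ball_Complex_2_bounds[OF this T]
    have "norm (riemann_zeta z) \<le> C * norm z" using C(2)[of z] z by auto
    also have "\<dots> \<le> (C + 1) * (T + 5)" using z C(1) by (intro mult_mono) auto
    also have "\<dots> = (5 * (C + 1) * (T + 5)) * (1 / 5)" by simp
    also have "\<dots> \<le> (5 * (C + 1) * (T + 5)) * norm (riemann_zeta (Complex 2 T))"
      using C(1) T by (intro mult_left_mono norm_riemann_zeta_2_ge) auto
    also have "\<dots> \<le> exp (B * ln T) * norm (riemann_zeta (Complex 2 T))"
    proof (rule mult_right_mono)
      have "ln (5 * (C + 1) * (T + 5)) = ln (5 * (C + 1)) + ln (T + 5)" using C(1) T by (subst ln_mult) auto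
      also have "\<dots> \<le> ln (5 * (C + 1)) * ln T + 2 * ln T"
        using one_le_ln[OF T] C(1) T
        by (intro add_mono ln_le_two_ln) (auto simp: mult_le_cancel_left1 ln_ge_zero)
      finally have "ln (5 * (C + 1) * (T + 5)) \<le> B * ln T" by (simp add: B_def distrib_right)
      then show "5 * (C + 1) * (T + 5) \<le> exp (B * ln T)" using C(1) T by (subst (asm) ln_le_iff_le_exp) auto
    qed simp
    finally show "norm (riemann_zeta z) \<le> exp (B * ln T) * norm (riemann_zeta (Complex 2 T))" .
  qed auto
  with B show ?thesis by blast
qed

lemma local_zeros_bounds:
  "\<exists>C\<ge>1. \<forall>T\<ge>4. finite (local_zeros T) \<and> (\<Sum>p\<in>local_zeros T. real (zero_mult p)) \<le> C * ln T \<and>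
     (\<forall>z\<in>cball (Complex 2 T) (16/10). riemann_zeta z \<noteq> 0 \<longrightarrow>
        norm (logderiv riemann_zeta z - (\<Sum>p\<in>local_zeros T. of_nat (zero_mult p) / (z - p))) \<le> C * ln T)"
proof -
  obtain B where B: "B > 0" and disc: "\<And>T. T \<ge> 4 \<Longrightarrow>
      bounded_on_disc riemann_zeta (ball (Complex 2 T) (39/20)) (Complex 2 T) (17/10) (19/10) (B * ln T)"
    using riemann_zeta_bounded_on_disc by blast
  define k where "k = (19/10 / ((19/10)\<^sup>2 - (17/10)\<^sup>2) / ln (19/10 / (17/10)) + 16 * (17/10) / (17/10 - 16/10)\<^sup>2 :: real)"
  define C where "C = max 1 (max (B / ln (19/10 / (17/10))) (k * B))"
  show ?thesis
  proof (intro exI[of _ C] conjI allI impI ballI)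
    fix T :: real assume T: "T \<ge> 4"
    interpret zeta_disc: bounded_on_disc riemann_zeta "ball (Complex 2 T) (39/20)" "Complex 2 T" "17/10" "19/10" "B * ln T"
      by (rule disc[OF T])
    have C_ge: "x * ln T \<le> C * ln T" if "x \<le> C" for x using that one_le_ln[OF T] by simp
    have zeros_eq: "zeta_disc.zeros = local_zeros T" by (simp add: zeta_disc.zeros_def local_zeros_def)
    show "finite (local_zeros T)" using zeta_disc.finite_zeros by (simp add: zeros_eq)
    have "(\<Sum>p\<in>local_zeros T. real (zero_mult p)) \<le> B / ln (19/10 / (17/10)) * ln T"
      using zeta_disc.sum_mult_zeros_le by (simp add: zeros_eq zero_mult_def)
    also have "\<dots> \<le> C * ln T" by (rule C_ge) (simp add: C_def)
    finally show "(\<Sum>p\<in>local_zeros T. real (zero_mult p)) \<le> C * ln T" .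
    fix z assume z: "z \<in> cball (Complex 2 T) (16/10)" "riemann_zeta z \<noteq> 0"
    have "norm (logderiv riemann_zeta z - (\<Sum>p\<in>local_zeros T. of_nat (zero_mult p) / (z - p))) \<le> k * (B * ln T)"
      using zeta_disc.norm_logderiv_minus_zeros_le[OF _ _ z] by (simp add: zeros_eq zero_mult_def k_def)
    also have "\<dots> \<le> C * ln T" using C_ge[of "k * B"] by (simp add: C_def mult.assoc)
    finally show "norm (logderiv riemann_zeta z - (\<Sum>p\<in>local_zeros T. of_nat (zero_mult p) / (z - p))) \<le> C * ln T" .
  qed (simp add: C_def)
qed

lemma zero_mult_pos_local_zeros:
  assumes "p \<in> local_zeros T" "T \<ge> 4"
  shows "zero_mult p > 0"
proof -
  have "p \<in> ball (Complex 2 T) (39/20)" using assms(1) by (auto simp: local_zeros_def)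
  then have "p \<noteq> 1" using ball_Complex_2_bounds(2)[OF _ assms(2)] by force
  then show ?thesis
    using assms(1) zorder_riemann_zeta_pos[of p] by (simp add: zero_mult_def local_zeros_def)
qed

lemma dist_Complex_le:
  assumes "\<bar>a - c\<bar> \<le> x" "\<bar>b - d\<bar> \<le> y" "x\<^sup>2 + y\<^sup>2 \<le> z\<^sup>2" "z \<ge> 0"
  shows "dist (Complex a b) (Complex c d) \<le> z"
proof -
  have "(a - c)\<^sup>2 \<le> x\<^sup>2" "(b - d)\<^sup>2 \<le> y\<^sup>2"
    using assms(1,2) power_mono[of "\<bar>a - c\<bar>" x 2] power_mono[of "\<bar>b - d\<bar>" y 2] by auto
  then have "(dist (Complex a b) (Complex c d))\<^sup>2 \<le> z\<^sup>2"
    using assms(3) by (simp add: dist_norm cmod_power2)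
  then show ?thesis using assms(4) by (rule power2_le_imp_le)
qed

lemma sum_zero_mult_new_zeros_le:
  assumes RH: "riemann_hypothesis"
  shows "\<exists>C\<ge>0. \<forall>T\<ge>4. (\<Sum>\<rho>\<in>zeros_upto (T + 1/10) - zeros_upto T. real (zero_mult \<rho>)) \<le> C * ln T"
proof -
  obtain C where C: "C \<ge> 1" and fin: "\<And>T. T \<ge> 4 \<Longrightarrow> finite (local_zeros T)"
    and count: "\<And>T. T \<ge> 4 \<Longrightarrow> (\<Sum>p\<in>local_zeros T. real (zero_mult p)) \<le> C * ln T"
    using local_zeros_bounds by blast
  have "zeros_upto (T + 1/10) - zeros_upto T \<subseteq> local_zeros T" for T
  proof
    fix \<rho> assume "\<rho> \<in> zeros_upto (T + 1/10) - zeros_upto T"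
    then have \<rho>: "\<rho> \<in> nontrivial_zeros" "T < Im \<rho>" "Im \<rho> \<le> T + 1/10" by (auto simp: zeros_upto_def)
    then have "\<rho> = Complex (1/2) (Im \<rho>)" using RH by (auto simp: riemann_hypothesis_def complex_eq_iff)
    moreover have "dist (Complex 2 T) (Complex (1/2) (Im \<rho>)) \<le> 17/10"
      by (rule dist_Complex_le[of _ _ "3/2" _ _ "1/10"]) (use \<rho> in \<open>auto simp: power2_eq_square\<close>)
    ultimately show "\<rho> \<in> local_zeros T" using \<rho> by (auto simp: local_zeros_def nontrivial_zeros_def)
  qed
  then have "(\<Sum>\<rho>\<in>zeros_upto (T + 1/10) - zeros_upto T. real (zero_mult \<rho>)) \<le> (\<Sum>p\<in>local_zeros T. real (zero_mult p))"
    if "T \<ge> 4" for T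
    using that by (intro sum_mono2 fin) auto
  then show ?thesis using C count order_trans by (intro exI[of _ C]) fastforce
qed


subsection \<open>Heights on which the logarithmic derivative is small\<close>

lemma exists_point_away_from_finite_set:
  fixes Y :: "real set"
  assumes Y: "finite Y" and d: "d > 0"
  shows "\<exists>x\<in>{T..T + d}. \<forall>y\<in>Y. \<bar>x - y\<bar> \<ge> d / (2 * real (card Y + 1))"
proof (rule ccontr)
  define K where "K = card Y + 1"
  define c where "c j = T + d * (real j + 1 / 2) / real K" for j :: nat
  have K: "real K > 0" by (simp add: K_def)
  assume no_gap: "\<not> ?thesis"
  have c_in: "c j \<in> {T..T + d}" if "j < K" for j
  proof -
    have "d * (real j + 1 / 2) / real K \<le> d * 1"
      unfolding times_divide_eq_right[symmetric] using that K d by (intro mult_left_mono) auto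
    moreover have "0 \<le> d * (real j + 1 / 2) / real K" using d by simp
    ultimately show ?thesis by (simp add: c_def)
  qed
  have "\<forall>j\<in>{..<K}. \<exists>y\<in>Y. \<bar>c j - y\<bar> < d / (2 * real K)"
    using no_gap c_in unfolding K_def by (meson lessThan_iff not_le)
  then obtain f where f: "\<And>j. j < K \<Longrightarrow> f j \<in> Y \<and> \<bar>c j - f j\<bar> < d / (2 * real K)" by (metis lessThan_iff)
  have "inj_on f {..<K}"
  proof (rule inj_onI, rule ccontr)
    fix i j assume ij: "i \<in> {..<K}" "j \<in> {..<K}" "f i = f j" "i \<noteq> j"
    have "\<bar>c i - c j\<bar> < d / (2 * real K) + d / (2 * real K)"
      using f[of i] f[of j] ij by auto
    also have "\<dots> = d / real K" by (simp add: field_simps)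
    also have "c i - c j = d / real K * (real i - real j)" using K by (simp add: c_def diff_divide_distrib[symmetric] right_diff_distrib[symmetric])
    also have "\<bar>d / real K * (real i - real j)\<bar> = d / real K * \<bar>real i - real j\<bar>" using d K by (simp add: abs_mult)
    finally have "\<bar>real i - real j\<bar> < 1" using d K by (simp add: field_simps)
    then show False using ij(4) by linarith
  qed
  then have "card {..<K} \<le> card Y" using f Y by (intro card_inj_on_le[of f]) auto
  then show False by (simp add: K_def)
qed

definition good_height :: "real \<Rightarrow> real \<Rightarrow> bool" where
  "good_height B t \<longleftrightarrow> (\<forall>\<sigma>\<in>{-1/2..3/2}. riemann_zeta (Complex \<sigma> t) \<noteq> 0 \<and>
     norm (logderiv riemann_zeta (Complex \<sigma> t)) \<le> B)"

lemma good_heightD: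
  assumes "good_height B t" "\<sigma> \<in> {-1/2..3/2}"
  shows "riemann_zeta (Complex \<sigma> t) \<noteq> 0" "norm (logderiv riemann_zeta (Complex \<sigma> t)) \<le> B"
  using assms by (auto simp: good_height_def)

lemma good_height_nonneg: "good_height B t \<Longrightarrow> B \<ge> 0"
  using order_trans[OF norm_ge_zero good_heightD(2)[of B t 0]] by simp

lemma norm_sum_of_nat_divide_le:
  fixes z :: "'a :: real_normed_field"
  assumes "\<delta> > 0" "\<And>p. p \<in> Z \<Longrightarrow> norm (z - p) \<ge> \<delta>"
  shows "norm (\<Sum>p\<in>Z. of_nat (m p) / (z - p)) \<le> (\<Sum>p\<in>Z. real (m p)) / \<delta>"
  unfolding sum_divide_distrib
proof (rule sum_norm_le)
  fix p assume "p \<in> Z"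
  with assms have "\<delta> \<le> norm (z - p)" "norm (z - p) > 0" by fastforce+
  then have "real (m p) / norm (z - p) \<le> real (m p) / \<delta>"
    using assms(1) by (intro divide_left_mono mult_pos_pos) auto
  then show "norm (of_nat (m p) / (z - p)) \<le> real (m p) / \<delta>" by (simp add: norm_divide)
qed

lemma exists_height_away_from_local_zeros:
  "\<exists>C\<ge>0. \<forall>T\<ge>4. \<exists>t\<in>{T..T + 1/10}. \<exists>\<delta>>0. 1 / \<delta> \<le> C * ln T \<and> (\<forall>p\<in>local_zeros T. \<bar>t - Im p\<bar> \<ge> \<delta>)"
proof -
  obtain C where C: "C \<ge> 1" and fin: "\<And>T. T \<ge> 4 \<Longrightarrow> finite (local_zeros T)"
    and count: "\<And>T. T \<ge> 4 \<Longrightarrow> (\<Sum>p\<in>local_zeros T. real (zero_mult p)) \<le> C * ln T"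
    using local_zeros_bounds by blast
  have "\<exists>t\<in>{T..T + 1/10}. \<exists>\<delta>>0. 1 / \<delta> \<le> 20 * (C + 1) * ln T \<and> (\<forall>p\<in>local_zeros T. \<bar>t - Im p\<bar> \<ge> \<delta>)"
    if T: "T \<ge> 4" for T
  proof -
    define Y where "Y = Im ` local_zeros T"
    define \<delta> where "\<delta> = (1/10) / (2 * real (card Y + 1))"
    have "\<exists>t\<in>{T..T + 1/10}. \<forall>y\<in>Y. \<bar>t - y\<bar> \<ge> \<delta>"
      unfolding \<delta>_def using fin[OF T] by (intro exists_point_away_from_finite_set) (auto simp: Y_def)
    then obtain t where t: "t \<in> {T..T + 1/10}" "\<forall>p\<in>local_zeros T. \<bar>t - Im p\<bar> \<ge> \<delta>" by (auto simp: Y_def)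
    have "real (card Y) \<le> (\<Sum>p\<in>local_zeros T. 1)"
      unfolding Y_def using card_image_le[OF fin[OF T], of Im] by simp
    also have "\<dots> \<le> (\<Sum>p\<in>local_zeros T. real (zero_mult p))"
    proof (rule sum_mono)
      show "1 \<le> real (zero_mult p)" if "p \<in> local_zeros T" for p
        using zero_mult_pos_local_zeros[OF that T] by linarith
    qed
    also note count[OF T]
    finally have "real (card Y) \<le> C * ln T" by simp
    then have "1 / \<delta> \<le> 20 * (C + 1) * ln T" using one_le_ln[OF T] by (simp add: \<delta>_def distrib_right)
    moreover have "\<delta> > 0" by (simp add: \<delta>_def)
    ultimately show ?thesis using t by blast
  qed
  then show ?thesis using C by (intro exI[of _ "20 * (C + 1)"]) auto
qed

lemma exists_height_small_right_of_critical_line: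
  "\<exists>C\<ge>0. \<forall>T\<ge>4. \<exists>t\<in>{T..T + 1/10}. \<forall>\<sigma>\<in>{1/2..3/2}. riemann_zeta (Complex \<sigma> t) \<noteq> 0 \<and>
     norm (logderiv riemann_zeta (Complex \<sigma> t)) \<le> C * (ln T)\<^sup>2"
proof -
  obtain C where C: "C \<ge> 1" and count: "\<And>T. T \<ge> 4 \<Longrightarrow> (\<Sum>p\<in>local_zeros T. real (zero_mult p)) \<le> C * ln T"
    and approx: "\<And>T z. T \<ge> 4 \<Longrightarrow> z \<in> cball (Complex 2 T) (16/10) \<Longrightarrow> riemann_zeta z \<noteq> 0 \<Longrightarrow>
        norm (logderiv riemann_zeta z - (\<Sum>p\<in>local_zeros T. of_nat (zero_mult p) / (z - p))) \<le> C * ln T"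
    using local_zeros_bounds by blast
  obtain D where D: "D \<ge> 0" and gap: "\<And>T. T \<ge> 4 \<Longrightarrow>
      \<exists>t\<in>{T..T + 1/10}. \<exists>\<delta>>0. 1 / \<delta> \<le> D * ln T \<and> (\<forall>p\<in>local_zeros T. \<bar>t - Im p\<bar> \<ge> \<delta>)"
    using exists_height_away_from_local_zeros by blast
  have "\<exists>t\<in>{T..T + 1/10}. \<forall>\<sigma>\<in>{1/2..3/2}. riemann_zeta (Complex \<sigma> t) \<noteq> 0 \<and>
      norm (logderiv riemann_zeta (Complex \<sigma> t)) \<le> (C + C * D) * (ln T)\<^sup>2" if T: "T \<ge> 4" for T
  proof -
    obtain t \<delta> where t: "t \<in> {T..T + 1/10}" "\<And>p. p \<in> local_zeros T \<Longrightarrow> \<bar>t - Im p\<bar> \<ge> \<delta>"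
      and \<delta>: "\<delta> > 0" "1 / \<delta> \<le> D * ln T"
      using gap[OF T] by blast
    have "riemann_zeta z \<noteq> 0 \<and> norm (logderiv riemann_zeta z) \<le> (C + C * D) * (ln T)\<^sup>2"
      if z: "z = Complex \<sigma> t" "\<sigma> \<in> {1/2..3/2}" for z \<sigma>
    proof -
      have z_in: "z \<in> cball (Complex 2 T) (16/10)"
        unfolding z(1) mem_cball
        by (rule dist_Complex_le[of _ _ "3/2" _ _ "1/10"]) (use t z(2) in \<open>auto simp: power2_eq_square\<close>)
      have far: "norm (z - p) \<ge> \<delta>" if "p \<in> local_zeros T" for p
        using t(2)[OF that] abs_Im_le_cmod[of "z - p"] by (simp add: z(1))
      have nz: "riemann_zeta z \<noteq> 0"
        using far[of z] z_in \<delta>(1) by (auto simp: local_zeros_def)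
      have "norm (\<Sum>p\<in>local_zeros T. of_nat (zero_mult p) / (z - p)) \<le> (\<Sum>p\<in>local_zeros T. real (zero_mult p)) / \<delta>"
        by (rule norm_sum_of_nat_divide_le) (use \<delta> far in auto)
      also have "\<dots> \<le> C * ln T * (1 / \<delta>)"
        using divide_right_mono[OF count[OF T], of \<delta>] \<delta>(1) by simp
      also have "\<dots> \<le> C * ln T * (D * ln T)"
        using C one_le_ln[OF T] \<delta>(2) by (intro mult_left_mono) auto
      finally have "norm (logderiv riemann_zeta z) \<le> C * ln T + C * D * (ln T)\<^sup>2"
        using approx[OF T z_in nz]
          norm_triangle_sub[of "logderiv riemann_zeta z" "\<Sum>p\<in>local_zeros T. of_nat (zero_mult p) / (z - p)"]
        by (simp add: power2_eq_square mult_ac)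
      moreover have "C * ln T \<le> C * (ln T)\<^sup>2" using C one_le_ln[OF T] by (simp add: power2_eq_square)
      ultimately show ?thesis using nz by (simp add: distrib_right)
    qed
    with t(1) show ?thesis by blast
  qed
  then show ?thesis using C D by (intro exI[of _ "C + C * D"]) auto
qed

lemma logderiv_riemann_zeta_left_of_critical_line:
  assumes t: "t \<noteq> 0" and chi: "norm (chi_logderiv (Complex \<sigma> t)) \<le> C"
    and reflected: "riemann_zeta (Complex (1 - \<sigma>) t) \<noteq> 0" "norm (logderiv riemann_zeta (Complex (1 - \<sigma>) t)) \<le> B"
  shows "riemann_zeta (Complex \<sigma> t) \<noteq> 0" "norm (logderiv riemann_zeta (Complex \<sigma> t)) \<le> C + B"
proof -
  define s w where "s = Complex \<sigma> t" and "w = Complex (1 - \<sigma>) t"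
  have reflect: "1 - s = cnj w" by (simp add: s_def w_def complex_eq_iff)
  have s: "s \<notin> \<int>" and w: "w \<noteq> 1" using t by (auto simp: s_def w_def complex_eq_iff intro!: not_Int_if_Im)
  show nz: "riemann_zeta (Complex \<sigma> t) \<noteq> 0"
    using riemann_zeta_zero_reflect[OF s] reflected(1) unfolding reflect riemann_zeta_cnj
    by (simp add: s_def w_def)
  have "logderiv riemann_zeta s = chi_logderiv s - cnj (logderiv riemann_zeta w)"
    using logderiv_riemann_zeta_reflect[OF s] nz logderiv_riemann_zeta_cnj[OF w] unfolding reflect by (simp add: s_def)
  then have "norm (logderiv riemann_zeta s) \<le> norm (chi_logderiv s) + norm (logderiv riemann_zeta w)"
    using norm_triangle_ineq4[of "chi_logderiv s" "cnj (logderiv riemann_zeta w)"] by (simp only: complex_mod_cnj)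
  then show "norm (logderiv riemann_zeta (Complex \<sigma> t)) \<le> C + B"
    using chi reflected(2) by (simp add: s_def w_def)
qed

theorem exists_good_height:
  "\<exists>C\<ge>0. \<forall>T\<ge>4. \<exists>t\<in>{T..T + 1/10}. good_height (C * (ln T)\<^sup>2) t"
proof -
  obtain C where C: "C \<ge> 0" and right: "\<And>T. T \<ge> 4 \<Longrightarrow> \<exists>t\<in>{T..T + 1/10}. \<forall>\<sigma>\<in>{1/2..3/2}.
      riemann_zeta (Complex \<sigma> t) \<noteq> 0 \<and> norm (logderiv riemann_zeta (Complex \<sigma> t)) \<le> C * (ln T)\<^sup>2"
    using exists_height_small_right_of_critical_line by blast
  obtain D where D: "D \<ge> 0" "\<And>\<sigma> t. \<bar>\<sigma>\<bar> \<le> 2 \<Longrightarrow> t \<ge> 1 \<Longrightarrow> norm (chi_logderiv (Complex \<sigma> t)) \<le> D + ln t"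
    using norm_chi_logderiv_Complex_le by blast
  have "\<exists>t\<in>{T..T + 1/10}. good_height ((C + D + 2) * (ln T)\<^sup>2) t" if T: "T \<ge> 4" for T
  proof -
    obtain t where t: "t \<in> {T..T + 1/10}" and right_t: "\<And>\<sigma>. \<sigma> \<in> {1/2..3/2} \<Longrightarrow>
        riemann_zeta (Complex \<sigma> t) \<noteq> 0 \<and> norm (logderiv riemann_zeta (Complex \<sigma> t)) \<le> C * (ln T)\<^sup>2"
      using right[OF T] by blast
    have ln_T: "1 \<le> (ln T)\<^sup>2" "ln T \<le> (ln T)\<^sup>2"
      using one_le_ln[OF T] by (auto simp: power2_eq_square mult_ge1_I)
    have ln_t: "ln t \<le> 2 * ln T" using t T by (intro ln_le_two_ln) auto
    have "C * (ln T)\<^sup>2 \<le> (C + D + 2) * (ln T)\<^sup>2" using D(1) by (intro mult_right_mono) auto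
    moreover have "D + ln t + C * (ln T)\<^sup>2 \<le> (C + D + 2) * (ln T)\<^sup>2"
      using mult_left_mono[OF ln_T(1) D(1)] ln_T(2) ln_t by (simp add: distrib_right)
    ultimately have "riemann_zeta (Complex \<sigma> t) \<noteq> 0 \<and> norm (logderiv riemann_zeta (Complex \<sigma> t)) \<le> (C + D + 2) * (ln T)\<^sup>2"
      if \<sigma>: "\<sigma> \<in> {-1/2..3/2}" for \<sigma>
    proof (cases "\<sigma> \<ge> 1/2")
      case False
      have "riemann_zeta (Complex \<sigma> t) \<noteq> 0" "norm (logderiv riemann_zeta (Complex \<sigma> t)) \<le> D + ln t + C * (ln T)\<^sup>2"
        using logderiv_riemann_zeta_left_of_critical_line[of t \<sigma> "D + ln t" "C * (ln T)\<^sup>2"] D(2)[of \<sigma> t]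
          right_t[of "1 - \<sigma>"] t T \<sigma> False by (auto simp: abs_le_iff)
      then show ?thesis using \<open>D + ln t + C * (ln T)\<^sup>2 \<le> _\<close> by linarith
    qed (use right_t[of \<sigma>] \<sigma> in auto)
    then show ?thesis using t unfolding good_height_def by blast
  qed
  then show ?thesis using C D(1) by (intro exI[of _ "C + D + 2"]) auto
qed

section \<open>Exponential sums over zeros\<close>

definition zero_sum :: "real \<Rightarrow> real \<Rightarrow> complex" where
  "zero_sum T y = (\<Sum>\<rho>\<in>zeros_upto T. of_nat (zero_mult \<rho>) * cis (y * Im \<rho>))"

lemma zero_sum_diff:
  assumes "a \<le> b"
  shows "zero_sum b y - zero_sum a y = (\<Sum>\<rho>\<in>zeros_upto b - zeros_upto a. of_nat (zero_mult \<rho>) * cis (y * Im \<rho>))"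
  unfolding zero_sum_def using assms finite_zeros_upto[of b] by (subst sum_diff) (auto simp: zeros_upto_def)

lemma norm_sum_zero_mult_cis_le:
  "norm (\<Sum>\<rho>\<in>Z. of_nat (zero_mult \<rho>) * cis (y * Im \<rho>)) \<le> (\<Sum>\<rho>\<in>Z. real (zero_mult \<rho>))"
  by (rule sum_norm_le) (simp add: norm_mult)


subsection \<open>Fourier integrals of constants and of Dirichlet series\<close>

lemma continuous_on_Complex_compose [continuous_intros]:
  assumes "continuous_on A f" "continuous_on A g"
  shows "continuous_on A (\<lambda>t. Complex (f t) (g t))"
proof -
  have "(\<lambda>t. Complex (f t) (g t)) = (\<lambda>t. of_real (f t) + \<i> * of_real (g t))"
    by (simp add: complex_eq_iff fun_eq_iff)
  then show ?thesis using assms by (simp only:) (intro continuous_intros)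
qed

lemma norm_fourier_integral_le:
  assumes "a \<le> b" "continuous_on {a..b} f" "\<And>t. t \<in> {a..b} \<Longrightarrow> norm (f t) \<le> B"
  shows "norm (fourier_integral a b f y) \<le> B * (b - a)"
  unfolding fourier_integral_def using assms
  by (intro integral_bound continuous_intros) (auto simp: norm_mult)

lemma fourier_integral_diff_left:
  assumes "a \<le> b" "b \<le> d" "continuous_on {a..d} f"
  shows "fourier_integral a d f y - fourier_integral a b f y = fourier_integral b d f y"
proof -
  have "(\<lambda>t. f t * cis (y * t)) integrable_on {a..d}"
    using assms(3) by (intro integrable_continuous_interval continuous_intros)
  from Henstock_Kurzweil_Integration.integral_combine[OF assms(1,2) this]
  show ?thesis by (simp add: fourier_integral_def algebra_simps)
qed

lemma fourier_integral_add:
  assumes "continuous_on {a..b} f" "continuous_on {a..b} g"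
  shows "fourier_integral a b (\<lambda>t. f t + g t) y = fourier_integral a b f y + fourier_integral a b g y"
  unfolding fourier_integral_def distrib_right using assms
  by (intro Henstock_Kurzweil_Integration.integral_add integrable_continuous_interval continuous_intros)

abbreviation cis_integral :: "real \<Rightarrow> real \<Rightarrow> real \<Rightarrow> complex" where
  "cis_integral a b \<equiv> fourier_integral a b (\<lambda>_. 1)"

lemma norm_cis_integral_le_inverse:
  assumes "a \<le> b" "v \<noteq> 0"
  shows "norm (cis_integral a b v) \<le> 2 / \<bar>v\<bar>"
proof -
  have "((\<lambda>t. cis (v * t)) has_integral (- \<i> / of_real v * cis (v * b) - - \<i> / of_real v * cis (v * a))) {a..b}"
  proof (rule fundamental_theorem_of_calculus[OF assms(1)])
    fix x assume "x \<in> {a..b}"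
    have "((\<lambda>z. - \<i> / of_real v * exp (\<i> * (of_real v * z))) has_field_derivative exp (\<i> * (of_real v * of_real x))) (at (of_real x))"
      using assms by (auto intro!: derivative_eq_intros)
    then have "((\<lambda>t. - \<i> / of_real v * exp (\<i> * (of_real v * of_real t))) has_vector_derivative exp (\<i> * (of_real v * of_real x))) (at x within {a..b})"
      by (rule has_vector_derivative_real_field[OF has_field_derivative_at_within])
    then show "((\<lambda>t. - \<i> / of_real v * cis (v * t)) has_vector_derivative cis (v * x)) (at x within {a..b})"
      by (simp add: cis_conv_exp)
  qed
  then have "cis_integral a b v = - \<i> / of_real v * (cis (v * b) - cis (v * a))"
    by (simp add: fourier_integral_def integral_unique algebra_simps)
  then have "norm (cis_integral a b v) = norm (cis (v * b) - cis (v * a)) / \<bar>v\<bar>"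
    by (simp add: norm_mult norm_divide)
  also have "\<dots> \<le> 2 / \<bar>v\<bar>"
    using norm_triangle_ineq4[of "cis (v * b)" "cis (v * a)"] by (intro divide_right_mono) auto
  finally show ?thesis .
qed

lemma fourier_integral_dirichlet_series_sums:
  assumes summable: "summable (\<lambda>n. norm (q n) * real n powr (- c))"
  shows "(\<lambda>n. q n * of_real (real n powr (- c)) * cis_integral a b (y - e * ln (real n))) sums
    fourier_integral a b (\<lambda>t. dirichlet_series q (Complex c (e * t))) y"
proof -
  define g where "g n t = q n * of_real (real n powr (- c)) * cis ((y - e * ln (real n)) * t)" for n t
  have term_eq: "q n / of_nat n powr Complex c (e * t) * cis (y * t) = g n t" for n t
    by (simp add: g_def dirichlet_term_Complex mult.assoc cis_mult algebra_simps)
  have "(\<lambda>n. q n / of_nat n powr Complex c (e * t)) sums dirichlet_series q (Complex c (e * t))" for t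
    by (rule dirichlet_series_sums[OF summable]) simp
  from sums_mult2[OF this]
  have sums: "(\<lambda>n. g n t) sums (dirichlet_series q (Complex c (e * t)) * cis (y * t))" for t
    unfolding term_eq[symmetric] .
  have "uniform_limit {a..b} (\<lambda>N t. \<Sum>n<N. g n t) (\<lambda>t. \<Sum>n. g n t) sequentially"
    by (rule Weierstrass_m_test[OF _ summable]) (simp add: g_def norm_mult)
  then have "uniform_limit {a..b} (\<lambda>N t. \<Sum>n<N. g n t) (\<lambda>t. dirichlet_series q (Complex c (e * t)) * cis (y * t)) sequentially"
    using sums by (simp add: sums_iff)
  then obtain I J where I: "\<And>N. ((\<lambda>t. \<Sum>n<N. g n t) has_integral I N) {a..b}"
    and J: "((\<lambda>t. dirichlet_series q (Complex c (e * t)) * cis (y * t)) has_integral J) {a..b}" "I \<longlonglongrightarrow> J"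
  proof (rule uniform_limit_integral)
    show "continuous_on {a..b} (\<lambda>t. \<Sum>n<N. g n t)" for N unfolding g_def by (intro continuous_intros)
  qed auto
  have "I N = (\<Sum>n<N. q n * of_real (real n powr (- c)) * cis_integral a b (y - e * ln (real n)))" for N
  proof (rule has_integral_unique[OF I])
    show "((\<lambda>t. \<Sum>n<N. g n t) has_integral (\<Sum>n<N. q n * of_real (real n powr (- c)) * cis_integral a b (y - e * ln (real n)))) {a..b}"
      unfolding g_def fourier_integral_def mult_1
      by (intro has_integral_sum has_integral_mult_right integrable_integral integrable_continuous_interval continuous_intros finite_lessThan)
  qed
  then show ?thesis using J integral_unique[OF J(1)] unfolding sums_def fourier_integral_def by presburger
qed

abbreviation mangoldt_sum :: "real \<Rightarrow> real" where
  "mangoldt_sum c \<equiv> (\<Sum>n. mangoldt n * real n powr (- c))"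

lemma fourier_integral_mangoldt_series_sums:
  assumes "c > 1"
  shows "(\<lambda>n. of_real (mangoldt n * real n powr (- c)) * cis_integral a b (y - e * ln (real n))) sums
    fourier_integral a b (\<lambda>t. mangoldt_series (Complex c (e * t))) y"
  using fourier_integral_dirichlet_series_sums[of mangoldt c a b y e] summable_mangoldt_powr[OF assms]
  by (simp add: mangoldt_nonneg)

lemma mangoldt_sum_nonneg: "c > 1 \<Longrightarrow> mangoldt_sum c \<ge> 0"
  by (intro suminf_nonneg summable_mangoldt_powr mult_nonneg_nonneg mangoldt_nonneg) auto

text \<open>The frequencies \<open>y + ln n\<close> stay away from \<open>0\<close> when \<open>n\<close> is a prime power.\<close>

lemma norm_fourier_integral_mangoldt_series_reflected_le:
  assumes c: "c > 1" and "y \<ge> 0" "a \<le> b"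
  shows "norm (fourier_integral a b (\<lambda>t. mangoldt_series (Complex c (- t))) y) \<le> 4 * mangoldt_sum c"
proof -
  define w where "w n = mangoldt n * real n powr (- c)" for n :: nat
  have w_nonneg: "w n \<ge> 0" for n using mangoldt_nonneg[of n] by (simp add: w_def)
  have w_summable: "summable w" unfolding w_def by (rule summable_mangoldt_powr[OF c])
  have sums: "(\<lambda>n. of_real (w n) * cis_integral a b (y + ln (real n))) sums fourier_integral a b (\<lambda>t. mangoldt_series (Complex c (- t))) y"
    using fourier_integral_mangoldt_series_sums[OF c, of a b y "-1"] by (simp add: w_def)
  have term_le: "norm (of_real (w n) * cis_integral a b (y + ln (real n))) \<le> 4 * w n" for n
  proof (cases "n \<le> 1")
    case True
    then have "w n = 0" by (cases "n = 0") (auto simp: w_def le_Suc_eq)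
    then show ?thesis by simp
  next
    case False
    then have "ln 2 \<le> ln (real n)" by simp
    then have v: "y + ln (real n) \<ge> 1/2" using ln2_ge_two_thirds \<open>y \<ge> 0\<close> by linarith
    have "norm (cis_integral a b (y + ln (real n))) \<le> 2 / \<bar>y + ln (real n)\<bar>"
      by (rule norm_cis_integral_le_inverse) (use v \<open>a \<le> b\<close> in auto)
    also have "\<dots> \<le> 2 / (1/2)" using v by (intro divide_left_mono) auto
    finally have "w n * norm (cis_integral a b (y + ln (real n))) \<le> w n * 4"
      using w_nonneg by (intro mult_left_mono) auto
    then show ?thesis using w_nonneg[of n] by (simp add: norm_mult)
  qed
  have "norm (fourier_integral a b (\<lambda>t. mangoldt_series (Complex c (- t))) y) \<le> (\<Sum>n. 4 * w n)"
    using sums norm_suminf_le[OF term_le summable_mult[OF w_summable]] by (simp add: sums_iff)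
  also have "\<dots> = 4 * (\<Sum>n. w n)" by (rule suminf_mult[OF w_summable])
  finally show ?thesis by (simp only: w_def)
qed


subsection \<open>The resonant prime power\<close>

definition nearest_nat_exp :: "real \<Rightarrow> nat" where
  "nearest_nat_exp y = nat (round (exp y))"

lemma nearest_nat_exp_ge_1:
  assumes "y \<ge> 0"
  shows "nearest_nat_exp y \<ge> 1"
proof -
  have "round (exp y) \<ge> 1" using assms round_mono[of 1 "exp y"] by simp
  then show ?thesis by (simp add: nearest_nat_exp_def)
qed

lemma abs_nearest_nat_exp_diff_le:
  assumes "y \<ge> 0"
  shows "\<bar>real (nearest_nat_exp y) - exp y\<bar> \<le> 1 / 2"
proof -
  have "real (nearest_nat_exp y) = of_int (round (exp y))"
    using nearest_nat_exp_ge_1[OF assms] by (simp add: nearest_nat_exp_def)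
  then show ?thesis using of_int_round_abs_le[of "exp y"] by simp
qed

lemma half_dist_nearest_nat_exp_le:
  assumes "y \<ge> 0"
  shows "\<bar>real n - real (nearest_nat_exp y)\<bar> / 2 \<le> \<bar>exp y - real n\<bar>"
proof (cases "n = nearest_nat_exp y")
  case False
  then have "\<bar>real n - real (nearest_nat_exp y)\<bar> \<ge> 1" by linarith
  moreover have "\<bar>real n - real (nearest_nat_exp y)\<bar> \<le> \<bar>exp y - real n\<bar> + 1 / 2"
    using abs_nearest_nat_exp_diff_le[OF assms] by linarith
  moreover have "d / 2 \<le> e" if "1 \<le> d" "d \<le> e + 1 / 2" for d e :: real using that by (simp add: field_simps)
  ultimately show ?thesis by blast
qed simp

lemma abs_diff_divide_max_le_abs_ln_diff:
  assumes "x > (0::real)" "z > 0"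
  shows "\<bar>x - z\<bar> / max x z \<le> \<bar>ln x - ln z\<bar>"
proof -
  have "(u - v) / u \<le> ln u - ln v" if "0 < v" "v \<le> u" for u v :: real
  proof -
    have "ln v - ln u \<le> v / u - 1" using that ln_le_minus_one[of "v / u"] by (simp add: ln_divide_pos)
    then show ?thesis using that by (simp add: diff_divide_distrib)
  qed
  from this[of z x] this[of x z] assms show ?thesis by (cases "z \<le> x") (auto simp: max_def)
qed

lemma dist_nearest_nat_exp_le:
  assumes "y \<ge> 0" "n \<ge> 1" and n_le: "real n \<le> 2 * exp y"
  shows "\<bar>real n - real (nearest_nat_exp y)\<bar> / (4 * exp y) \<le> \<bar>y - ln (real n)\<bar>"
proof -
  have "\<bar>real n - real (nearest_nat_exp y)\<bar> / 2 / (2 * exp y) \<le> \<bar>exp y - real n\<bar> / max (exp y) (real n)"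
    using half_dist_nearest_nat_exp_le[OF assms(1)] assms(2) n_le by (intro frac_le) auto
  also have "\<dots> \<le> \<bar>y - ln (real n)\<bar>"
    using abs_diff_divide_max_le_abs_ln_diff[of "exp y" "real n"] assms(2) by simp
  finally show ?thesis by simp
qed

lemma neq_ln_if_not_nearest:
  assumes "y \<ge> 0" "n \<ge> 1" "n \<noteq> nearest_nat_exp y"
  shows "y \<noteq> ln (real n)"
proof
  assume "y = ln (real n)"
  then have "exp y = real n" using assms(2) by simp
  then have "\<bar>real n - real (nearest_nat_exp y)\<bar> / 2 \<le> 0"
    using half_dist_nearest_nat_exp_le[OF assms(1), of n] by simp
  then show False using assms(3) by simp
qed

lemma sum_inverse_le: "(\<Sum>j=1..n. 1 / real j) \<le> 1 + ln (real n + 1)"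
proof (cases n)
  case (Suc m)
  have "harm (Suc m) - ln (real (Suc m)) \<le> (harm (Suc 0) - ln (real (Suc 0)) :: real)"
    using decseqD[OF decseq_harm_diff_ln, of 0 m] by simp
  moreover have "harm (Suc 0) - ln (real (Suc 0)) = (1::real)" by (simp add: harm_def)
  moreover have "ln (real (Suc m)) \<le> ln (real (Suc m) + 1)" by simp
  ultimately have "harm n \<le> 1 + ln (real n + 1)" unfolding Suc by linarith
  then show ?thesis by (simp add: harm_def inverse_eq_divide)
qed simp

lemma sum_inverse_dist_le:
  fixes n0 N :: nat
  shows "(\<Sum>n\<in>{1..N} - {n0}. 1 / \<bar>real n - real n0\<bar>) \<le> 2 * (1 + ln (real (N + n0) + 1))"
proof -
  have "(\<Sum>n\<in>{1..N} - {n0}. 1 / \<bar>real n - real n0\<bar>) \<le> (\<Sum>n\<in>{1..<n0} \<union> {n0<..N}. 1 / \<bar>real n - real n0\<bar>)"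
    by (intro sum_mono2) auto
  also have "\<dots> = (\<Sum>n\<in>{1..<n0}. 1 / \<bar>real n - real n0\<bar>) + (\<Sum>n\<in>{n0<..N}. 1 / \<bar>real n - real n0\<bar>)"
    by (rule sum.union_disjoint) auto
  also have "(\<Sum>n\<in>{1..<n0}. 1 / \<bar>real n - real n0\<bar>) = (\<Sum>j=1..n0-1. 1 / real j)"
    by (rule sum.reindex_bij_witness[of _ "\<lambda>j. n0 - j" "\<lambda>n. n0 - n"]) (auto simp: of_nat_diff)
  also have "(\<Sum>n\<in>{n0<..N}. 1 / \<bar>real n - real n0\<bar>) = (\<Sum>j=1..N-n0. 1 / real j)"
    by (rule sum.reindex_bij_witness[of _ "\<lambda>j. n0 + j" "\<lambda>n. n - n0"]) (auto simp: of_nat_diff)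
  also have "(\<Sum>j=1..n0-1. 1 / real j) \<le> 1 + ln (real (N + n0) + 1)"
    by (rule order_trans[OF sum_inverse_le]) auto
  also have "(\<Sum>j=1..N-n0. 1 / real j) \<le> 1 + ln (real (N + n0) + 1)"
    by (rule order_trans[OF sum_inverse_le]) auto
  finally show ?thesis by simp
qed

text \<open>The terms with \<open>n\<close> within a constant factor of \<open>exp y\<close> are compared with the harmonic series.\<close>

lemma off_diagonal_term_le:
  assumes c: "1 < c" "c \<le> 3/2" and y: "y \<ge> 0" and n: "n \<ge> 1" "n \<noteq> nearest_nat_exp y"
    and near: "\<bar>y - ln (real n)\<bar> < 1 / 2"
  shows "real n \<le> 2 * exp y"
    "mangoldt n * real n powr (- c) / \<bar>y - ln (real n)\<bar> \<le>
      16 * (y + 1) * exp (y * (1 - c)) * (1 / \<bar>real n - real (nearest_nat_exp y)\<bar>)"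
proof -
  let ?d = "\<bar>real n - real (nearest_nat_exp y)\<bar>"
  have exp_le_double: "exp u \<le> 2 * exp v" if "u \<le> v + 1/2" for u v :: real
  proof -
    have "exp u \<le> exp v * exp (1/2)" using that by (simp add: exp_add[symmetric])
    also have "\<dots> \<le> exp v * 2" using exp_half_le2 by (intro mult_left_mono) auto
    finally show ?thesis by simp
  qed
  have ln_near: "ln (real n) \<le> y + 1/2" "y \<le> ln (real n) + 1/2" using near by linarith+
  show n_le: "real n \<le> 2 * exp y"
    using exp_le_double[OF ln_near(1)] n(1) by simp
  have n_ge: "exp y / 2 \<le> real n"
    using exp_le_double[OF ln_near(2)] n(1) by simp
  have weight_le: "mangoldt n * real n powr (- c) \<le> (y + 1) * (4 * exp y powr (- c))"
  proof (rule mult_mono)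
    have "mangoldt n \<le> ln (real n)" using n by (intro mangoldt_le) auto
    then show "mangoldt n \<le> y + 1" using near by linarith
    have "real n powr (- c) \<le> (exp y / 2) powr (- c)" using n_ge c by (intro powr_mono2') auto
    also have "\<dots> = exp y powr (- c) * 2 powr c" by (simp add: powr_divide powr_minus field_simps)
    also have "\<dots> \<le> exp y powr (- c) * 2 powr 2" using c by (intro mult_left_mono powr_mono) auto
    finally show "real n powr (- c) \<le> 4 * exp y powr (- c)" by (simp add: powr_numeral)
  qed (use y in auto)
  have "mangoldt n * real n powr (- c) / \<bar>y - ln (real n)\<bar> \<le> ((y + 1) * (4 * exp y powr (- c))) / (?d / (4 * exp y))"
    using weight_le dist_nearest_nat_exp_le[OF y n(1) n_le] n y by (intro frac_le mult_nonneg_nonneg) auto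
  also have "\<dots> = 16 * (y + 1) * (exp y * exp y powr (- c)) * (1 / ?d)" by simp
  also have "exp y * exp y powr (- c) = exp (y * (1 - c))" by (simp add: powr_def mult_exp_exp algebra_simps)
  finally show "mangoldt n * real n powr (- c) / \<bar>y - ln (real n)\<bar> \<le> 16 * (y + 1) * exp (y * (1 - c)) * (1 / ?d)" .
qed

lemma sum_inverse_dist_nearest_nat_exp_le:
  assumes y: "y \<ge> 0"
  shows "(\<Sum>n\<in>{1..nat \<lfloor>2 * exp y\<rfloor>} - {nearest_nat_exp y}. 1 / \<bar>real n - real (nearest_nat_exp y)\<bar>) \<le> 2 * (y + 4)"
proof -
  define N where "N = nat \<lfloor>2 * exp y\<rfloor>"
  have exp_3: "8 \<le> exp (3::real)"
  proof -
    have "2 ^ 3 \<le> exp (1::real) ^ 3" using exp_ge_add_one_self[of "1::real"] by (intro power_mono) auto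
    then show ?thesis by (simp add: exp_of_nat_mult[symmetric])
  qed
  have "real N \<le> 2 * exp y" unfolding N_def by (rule of_nat_floor) simp
  then have "real (N + nearest_nat_exp y) + 1 \<le> 2 * exp y + (exp y + 1/2) + 1"
    using abs_nearest_nat_exp_diff_le[OF y] unfolding of_nat_add by linarith
  also have "\<dots> \<le> 8 * exp y" using one_le_exp_iff[of y] y by linarith
  also have "\<dots> \<le> exp 3 * exp y" using exp_3 by (intro mult_right_mono) auto
  also have "\<dots> = exp (y + 3)" by (simp add: exp_add)
  finally have ln_le: "ln (real (N + nearest_nat_exp y) + 1) \<le> y + 3"
    by (subst ln_le_iff_le_exp) auto
  have "(\<Sum>n\<in>{1..N} - {nearest_nat_exp y}. 1 / \<bar>real n - real (nearest_nat_exp y)\<bar>)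
      \<le> 2 * (1 + ln (real (N + nearest_nat_exp y) + 1))" by (rule sum_inverse_dist_le)
  also have "\<dots> \<le> 2 * (1 + (y + 3))" by (intro mult_left_mono add_left_mono ln_le) simp
  also have "\<dots> = 2 * (y + 4)" by simp
  finally show ?thesis by (simp only: N_def)
qed

lemma off_diagonal_sum_le:
  assumes c: "1 < c" "c \<le> 3/2" and y: "y \<ge> 0"
  defines "a \<equiv> \<lambda>n. if n = nearest_nat_exp y then 0 else mangoldt n * real n powr (- c) / \<bar>y - ln (real n)\<bar>"
  shows "summable a" "suminf a \<le> 2 * mangoldt_sum c + 64 * (y + 2)\<^sup>2"
proof -
  define J where "J = {1..nat \<lfloor>2 * exp y\<rfloor>} - {nearest_nat_exp y}"
  define k where "k = 16 * (y + 1) * exp (y * (1 - c))"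
  define w where "w n = mangoldt n * real n powr (- c)" for n :: nat
  define u where "u n = (if n \<in> J then k * (1 / \<bar>real n - real (nearest_nat_exp y)\<bar>) else 0)" for n
  have k: "k \<ge> 0" using y by (simp add: k_def)
  have w: "w n \<ge> 0" for n using mangoldt_nonneg[of n] by (simp add: w_def)
  have u: "u n \<ge> 0" for n using k by (simp add: u_def)
  have a_le: "a n \<le> 2 * w n + u n" for n
  proof (cases "n = nearest_nat_exp y \<or> n = 0")
    case False
    then have n: "n \<ge> 1" "n \<noteq> nearest_nat_exp y" by auto
    show ?thesis
    proof (cases "\<bar>y - ln (real n)\<bar> \<ge> 1 / 2")
      case True
      have "w n / \<bar>y - ln (real n)\<bar> \<le> w n / (1 / 2)" using True w by (intro divide_left_mono) auto
      then show ?thesis using u[of n] n by (simp add: a_def w_def)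
    next
      case far: False
      have "n \<in> J" using off_diagonal_term_le(1)[OF c y n] far n unfolding J_def by (auto simp: le_nat_floor)
      then show ?thesis using off_diagonal_term_le(2)[OF c y n] far n(2) w[of n] by (simp add: a_def u_def k_def)
    qed
  qed (use w u in \<open>auto simp: a_def\<close>)
  have w_summable: "summable w" unfolding w_def by (rule summable_mangoldt_powr[OF c(1)])
  have u_sums: "u sums (\<Sum>n\<in>J. k * (1 / \<bar>real n - real (nearest_nat_exp y)\<bar>))"
    unfolding u_def by (rule sums_If_finite_set) (auto simp: J_def)
  have bound_sums: "(\<lambda>n. 2 * w n + u n) sums (2 * suminf w + (\<Sum>n\<in>J. k * (1 / \<bar>real n - real (nearest_nat_exp y)\<bar>)))"
    by (intro sums_add sums_mult summable_sums w_summable u_sums)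
  show a_summable: "summable a"
    by (rule summable_comparison_test'[OF sums_summable[OF bound_sums], of 0]) (use a_le w in \<open>auto simp: a_def w_def\<close>)
  have "suminf a \<le> 2 * suminf w + (\<Sum>n\<in>J. k * (1 / \<bar>real n - real (nearest_nat_exp y)\<bar>))"
    using suminf_le[OF a_le a_summable sums_summable[OF bound_sums]] sums_unique[OF bound_sums] by simp
  also have "(\<Sum>n\<in>J. k * (1 / \<bar>real n - real (nearest_nat_exp y)\<bar>)) \<le> k * (2 * (y + 4))"
    unfolding sum_distrib_left[symmetric] J_def by (intro mult_left_mono sum_inverse_dist_nearest_nat_exp_le y k)
  also have "\<dots> \<le> 16 * (y + 1) * 1 * (2 * (y + 4))"
    unfolding k_def using y c by (intro mult_right_mono mult_left_mono) (auto simp: mult_nonneg_nonpos)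
  also have "\<dots> \<le> 64 * (y + 2)\<^sup>2" using y by (simp add: power2_eq_square algebra_simps)
  finally show "suminf a \<le> 2 * mangoldt_sum c + 64 * (y + 2)\<^sup>2" by (simp add: w_def)
qed

lemma fourier_integral_mangoldt_series_resonance:
  assumes c: "1 < c" "c \<le> 3/2" and y: "y \<ge> 0" and ab: "a \<le> b"
  defines "n0 \<equiv> nearest_nat_exp y"
  shows "norm (fourier_integral a b (\<lambda>t. mangoldt_series (Complex c t)) y
      - of_real (mangoldt n0 * real n0 powr (- c)) * cis_integral a b (y - ln (real n0))) \<le> 4 * mangoldt_sum c + 128 * (y + 2)\<^sup>2"
proof -
  define w where "w n = mangoldt n * real n powr (- c)" for n :: nat
  define R where "R = fourier_integral a b (\<lambda>t. mangoldt_series (Complex c t)) y"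
  define q where "q n = (if n = n0 then 0 else of_real (w n) * cis_integral a b (y - ln (real n)))" for n
  define v where "v n = (if n = n0 then 0 else w n / \<bar>y - ln (real n)\<bar>)" for n
  have v: "summable v" "suminf v \<le> 2 * mangoldt_sum c + 64 * (y + 2)\<^sup>2"
    using off_diagonal_sum_le[OF c y] unfolding v_def w_def n0_def by auto
  have "(\<lambda>n. of_real (w n) * cis_integral a b (y - ln (real n))) sums R"
    using fourier_integral_mangoldt_series_sums[OF c(1), of a b y 1] by (simp add: w_def R_def)
  from sums_diff[OF this sums_single[of n0 "\<lambda>n. of_real (w n) * cis_integral a b (y - ln (real n))"]]
  have q_sums: "q sums (R - of_real (w n0) * cis_integral a b (y - ln (real n0)))"
    by (rule sums_cong[THEN iffD1, rotated]) (simp add: q_def)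
  have q_le: "norm (q n) \<le> 2 * v n" for n
  proof (cases "n = n0 \<or> n = 0")
    case False
    then have "y - ln (real n) \<noteq> 0" using neq_ln_if_not_nearest[OF y, of n] by (auto simp: n0_def)
    then have "w n * norm (cis_integral a b (y - ln (real n))) \<le> w n * (2 / \<bar>y - ln (real n)\<bar>)"
      using ab mangoldt_nonneg[of n] by (intro mult_left_mono norm_cis_integral_le_inverse) (auto simp: w_def)
    then show ?thesis using False mangoldt_nonneg[of n] by (simp add: q_def v_def norm_mult w_def mult.commute)
  qed (auto simp: q_def v_def w_def)
  have "norm (R - of_real (w n0) * cis_integral a b (y - ln (real n0))) \<le> (\<Sum>n. 2 * v n)"
    using q_sums norm_suminf_le[OF q_le summable_mult[OF v(1)]] by (simp add: sums_iff)
  also have "\<dots> = 2 * suminf v" by (rule suminf_mult[OF v(1)])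
  finally show ?thesis using v(2) by (simp add: R_def w_def)
qed


subsection \<open>The contour integral\<close>

lemma continuous_on_logderiv:
  assumes "open S" "f holomorphic_on S" "A \<subseteq> S" "\<And>s. s \<in> A \<Longrightarrow> f s \<noteq> 0"
  shows "continuous_on A (logderiv f)"
proof -
  have "continuous_on A f" "continuous_on A (deriv f)"
    using assms holomorphic_deriv[OF assms(2,1)]
    by (auto intro!: holomorphic_on_imp_continuous_on intro: holomorphic_on_subset)
  then show ?thesis unfolding logderiv_def using assms(4) by (intro continuous_intros) auto
qed

lemma contour_integral_rectpath_Complex:
  assumes "y0 < y1" and cont: "continuous_on (path_image (rectpath (Complex x0 y0) (Complex x1 y1))) f"
  shows "contour_integral (rectpath (Complex x0 y0) (Complex x1 y1)) f =
    contour_integral (linepath (Complex x0 y0) (Complex x1 y0)) f + \<i> * integral {y0..y1} (\<lambda>t. f (Complex x1 t))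
    - contour_integral (linepath (Complex x0 y1) (Complex x1 y1)) f - \<i> * integral {y0..y1} (\<lambda>t. f (Complex x0 t))"
proof -
  define a1 a2 a3 a4 where "a1 = Complex x0 y0" and "a2 = Complex x1 y0" and "a3 = Complex x1 y1" and "a4 = Complex x0 y1"
  have "path_image (rectpath a1 a3) = closed_segment a1 a2 \<union> closed_segment a2 a3 \<union> closed_segment a3 a4 \<union> closed_segment a4 a1"
    by (simp add: rectpath_def Let_def path_image_join a1_def a2_def a3_def a4_def Un_assoc)
  then have edges: "continuous_on (closed_segment a1 a2) f" "continuous_on (closed_segment a2 a3) f"
    "continuous_on (closed_segment a3 a4) f" "continuous_on (closed_segment a4 a1) f"
    using cont by (auto simp: a1_def a3_def intro: continuous_on_subset)
  have "contour_integral (rectpath a1 a3) f = contour_integral (linepath a1 a2) f + (contour_integral (linepath a2 a3) f +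
      (contour_integral (linepath a3 a4) f + contour_integral (linepath a4 a1) f))"
    using edges by (simp add: rectpath_def Let_def a1_def a2_def a3_def a4_def contour_integrable_continuous_linepath)
  moreover have "contour_integral (linepath a3 a4) f = - contour_integral (linepath a4 a3) f"
    using edges(3) by (rule contour_integral_reverse_linepath)
  moreover have "contour_integral (linepath a4 a1) f = - contour_integral (linepath a1 a4) f"
    using edges(4) by (rule contour_integral_reverse_linepath)
  moreover have "contour_integral (linepath a2 a3) f = \<i> * integral {y0..y1} (\<lambda>t. f (Complex x1 t))"
    by (rule contour_integral_linepath_same_Re) (use assms in \<open>auto simp: a2_def a3_def\<close>)
  moreover have "contour_integral (linepath a1 a4) f = \<i> * integral {y0..y1} (\<lambda>t. f (Complex x0 t))"
    by (rule contour_integral_linepath_same_Re) (use assms in \<open>auto simp: a1_def a4_def\<close>)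
  ultimately show ?thesis by (simp add: a1_def a2_def a3_def a4_def)
qed

lemma argument_principle_rectpath:
  assumes S: "open S" "connected S" "cbox a b \<subseteq> S" and ab: "Re a < Re b" "Im a < Im b"
    and f_holo: "f holomorphic_on S" and h_holo: "h holomorphic_on S"
    and finite: "finite {w \<in> S. f w = 0}" and boundary: "\<And>s. s \<in> cbox a b - box a b \<Longrightarrow> f s \<noteq> 0"
  shows "contour_integral (rectpath a b) (\<lambda>s. logderiv f s * h s) =
    2 * pi * \<i> * (\<Sum>p\<in>{p \<in> box a b. f p = 0}. of_int (zorder f p) * h p)"
proof -
  define Z where "Z = {w \<in> S. f w = 0 \<or> w \<in> {}}"
  have image: "path_image (rectpath a b) = cbox a b - box a b"
    using ab by (intro path_image_rectpath_cbox_minus_box) auto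
  have outside: "winding_number (rectpath a b) z = 0" if "z \<notin> cbox a b" for z
    using that ab by (intro winding_number_rectpath_outside) auto
  have "contour_integral (rectpath a b) (\<lambda>x. deriv f x * h x / f x) =
      2 * pi * \<i> * (\<Sum>p\<in>Z. winding_number (rectpath a b) p * h p * zorder f p)"
    unfolding Z_def
  proof (rule argument_principle[OF S(1,2) _ h_holo])
    show "path_image (rectpath a b) \<subseteq> S - {w \<in> S. f w = 0 \<or> w \<in> {}}" using S(3) boundary by (auto simp: image)
    show "\<forall>z. z \<notin> S \<longrightarrow> winding_number (rectpath a b) z = 0" using outside S(3) by blast
  qed (use f_holo finite in auto)
  also have "(\<Sum>p\<in>Z. winding_number (rectpath a b) p * h p * zorder f p) =
      (\<Sum>p\<in>{p \<in> box a b. f p = 0}. of_int (zorder f p) * h p)"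
  proof (rule sum.mono_neutral_cong_right)
    show "finite Z" using finite by (simp add: Z_def)
    show "{p \<in> box a b. f p = 0} \<subseteq> Z" using S(3) box_subset_cbox[of a b] by (auto simp: Z_def)
    show "\<forall>p\<in>Z - {p \<in> box a b. f p = 0}. winding_number (rectpath a b) p * h p * zorder f p = 0"
    proof
      fix p assume "p \<in> Z - {p \<in> box a b. f p = 0}"
      then have "p \<notin> cbox a b" using boundary by (auto simp: Z_def)
      then show "winding_number (rectpath a b) p * h p * zorder f p = 0" by (simp add: outside)
    qed
    show "winding_number (rectpath a b) p * h p * zorder f p = of_int (zorder f p) * h p" if "p \<in> {p \<in> box a b. f p = 0}" for p
      using that by (simp add: winding_number_rectpath)
  qed
  also have "(\<lambda>x. deriv f x * h x / f x) = (\<lambda>s. logderiv f s * h s)" by (simp add: logderiv_def)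
  finally show ?thesis .
qed

lemma riemann_zeta_nonzero_vertical:
  assumes "c > 1" "t \<noteq> 0"
  shows "riemann_zeta (Complex c t) \<noteq> 0" "riemann_zeta (Complex (1 - c) t) \<noteq> 0"
proof -
  show "riemann_zeta (Complex c t) \<noteq> 0" using riemann_zeta_zero_strip(2)[of "Complex c t"] assms by force
  show "riemann_zeta (Complex (1 - c) t) \<noteq> 0" using riemann_zeta_zero_strip(1)[of "Complex (1 - c) t"] assms by force
qed

definition zeta_kernel :: "real \<Rightarrow> complex \<Rightarrow> complex" where
  "zeta_kernel y s = logderiv riemann_zeta s * exp (of_real y * (s - 1/2))"

lemma continuous_on_zeta_kernel:
  assumes "A \<subseteq> - {1}" "\<And>s. s \<in> A \<Longrightarrow> riemann_zeta s \<noteq> 0"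
  shows "continuous_on A (zeta_kernel y)"
  unfolding zeta_kernel_def[abs_def] using assms
  by (intro continuous_intros continuous_on_logderiv[OF _ riemann_zeta_holomorphic]) auto

lemma riemann_zeta_nonzero_rectangle_boundary:
  assumes c: "1 < c" "c \<le> 3/2" and ab: "1 < a" "a < b" and heights: "good_height B1 a" "good_height B2 b"
    and s: "s \<in> cbox (Complex (1 - c) a) (Complex c b) - box (Complex (1 - c) a) (Complex c b)"
  shows "riemann_zeta s \<noteq> 0"
proof
  assume zero: "riemann_zeta s = 0"
  have "1 - c \<le> Re s" "Re s \<le> c" "a \<le> Im s" "Im s \<le> b" using s by (auto simp: in_cbox_complex_iff)
  moreover have "Im s \<noteq> 0" using ab \<open>a \<le> Im s\<close> by auto
  from riemann_zeta_zero_strip[OF zero this] have "0 < Re s" "Re s < 1" .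
  moreover from this have "riemann_zeta (Complex (Re s) a) \<noteq> 0" "riemann_zeta (Complex (Re s) b) \<noteq> 0"
    by (intro heights[THEN good_heightD(1)]; simp)+
  then have "Im s \<noteq> a" "Im s \<noteq> b" using zero by auto
  ultimately
  have "s \<in> box (Complex (1 - c) a) (Complex c b)"
    using c by (auto simp: in_box_complex_iff)
  then show False using s by blast
qed

lemma riemann_zeta_zeros_rectangle_eq:
  assumes c: "1 < c" "c \<le> 3/2" and ab: "1 < a" "a < b" and heights: "good_height B1 a" "good_height B2 b"
  shows "{p \<in> box (Complex (1 - c) a) (Complex c b). riemann_zeta p = 0} = zeros_upto b - zeros_upto a"
proof (intro equalityI subsetI)
  fix p assume "p \<in> {p \<in> box (Complex (1 - c) a) (Complex c b). riemann_zeta p = 0}"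
  then show "p \<in> zeros_upto b - zeros_upto a"
    using riemann_zeta_zero_strip[of p] ab by (auto simp: in_box_complex_iff zeros_upto_def nontrivial_zeros_def)
next
  fix p assume "p \<in> zeros_upto b - zeros_upto a"
  then have "p \<in> cbox (Complex (1 - c) a) (Complex c b)" "riemann_zeta p = 0"
    using c by (auto simp: in_cbox_complex_iff zeros_upto_def nontrivial_zeros_def)
  then show "p \<in> {p \<in> box (Complex (1 - c) a) (Complex c b). riemann_zeta p = 0}"
    using riemann_zeta_nonzero_rectangle_boundary[OF c ab heights] by blast
qed

lemma contour_integral_zeta_kernel:
  assumes RH: "riemann_hypothesis" and c: "1 < c" "c \<le> 3/2" and ab: "1 < a" "a < b"
    and heights: "good_height B1 a" "good_height B2 b"
  shows "contour_integral (rectpath (Complex (1 - c) a) (Complex c b)) (zeta_kernel y) =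
    2 * pi * \<i> * (zero_sum b y - zero_sum a y)"
proof -
  let ?lo = "Complex (1 - c) a" and ?hi = "Complex c b"
  define S where "S = box (Complex (-1) (1/2)) (Complex 2 (b + 1))"
  note boundary = riemann_zeta_nonzero_rectangle_boundary[OF c ab heights]
  have "{w \<in> S. riemann_zeta w = 0} \<subseteq> zeros_upto (b + 1)"
    using riemann_zeta_zero_strip by (auto simp: S_def in_box_complex_iff zeros_upto_def nontrivial_zeros_def)
  then have finite: "finite {w \<in> S. riemann_zeta w = 0}" using finite_zeros_upto finite_subset by blast
  have "contour_integral (rectpath ?lo ?hi) (\<lambda>s. logderiv riemann_zeta s * exp (of_real y * (s - 1/2))) =
      2 * pi * \<i> * (\<Sum>p\<in>{p \<in> box ?lo ?hi. riemann_zeta p = 0}. of_int (zorder riemann_zeta p) * exp (of_real y * (p - 1/2)))"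
  proof (rule argument_principle_rectpath[OF _ _ _ _ _ _ _ finite boundary])
    show "connected S" unfolding S_def by (intro convex_connected convex_box)
    show "riemann_zeta holomorphic_on S"
      by (rule holomorphic_on_subset[OF riemann_zeta_holomorphic]) (auto simp: S_def in_box_complex_iff)
    show "(\<lambda>s. exp (of_real y * (s - 1/2))) holomorphic_on S" by (intro holomorphic_intros)
  qed (use c ab in \<open>auto simp: S_def in_box_complex_iff in_cbox_complex_iff\<close>)
  also have "{p \<in> box ?lo ?hi. riemann_zeta p = 0} = zeros_upto b - zeros_upto a"
    by (rule riemann_zeta_zeros_rectangle_eq[OF c ab heights])
  also have "(\<Sum>p\<in>zeros_upto b - zeros_upto a. of_int (zorder riemann_zeta p) * exp (of_real y * (p - 1/2))) =
      zero_sum b y - zero_sum a y"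
    unfolding zero_sum_diff[OF less_imp_le[OF ab(2)]]
  proof (rule sum.cong[OF refl])
    fix p assume "p \<in> zeros_upto b - zeros_upto a"
    then have p: "riemann_zeta p = 0" "Re p = 1/2" "p \<noteq> 1"
      using RH by (auto simp: zeros_upto_def nontrivial_zeros_def riemann_hypothesis_def)
    then have "of_real y * (p - 1/2) = \<i> * of_real (y * Im p)" by (simp add: complex_eq_iff)
    then have "exp (of_real y * (p - 1/2)) = cis (y * Im p)" by (simp only: cis_conv_exp)
    moreover have "complex_of_int (zorder riemann_zeta p) = of_nat (zero_mult p)"
      using zorder_riemann_zeta_pos[of p] p by (simp add: zero_mult_def)
    ultimately show "of_int (zorder riemann_zeta p) * exp (of_real y * (p - 1/2)) = of_nat (zero_mult p) * cis (y * Im p)"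
      by simp
  qed
  finally show ?thesis by (simp add: zeta_kernel_def[abs_def])
qed

lemma norm_contour_integral_zeta_kernel_horizontal_le:
  assumes c: "1 < c" "c \<le> 3/2" and y: "y \<ge> 0" and u: "u \<noteq> 0" "good_height B u"
  shows "norm (contour_integral (linepath (Complex (1 - c) u) (Complex c u)) (zeta_kernel y)) \<le> 2 * B * exp (y * (c - 1/2))"
proof -
  have "B \<ge> 0" by (rule good_height_nonneg[OF u(2)])
  have edge: "\<exists>\<sigma>\<in>{1 - c..c}. s = Complex \<sigma> u" if "s \<in> closed_segment (Complex (1 - c) u) (Complex c u)" for s
    using that c by (intro bexI[of _ "Re s"]) (auto simp: closed_segment_same_Im closed_segment_eq_real_ivl complex_eq_iff)
  have "norm (contour_integral (linepath (Complex (1 - c) u) (Complex c u)) (zeta_kernel y)) \<le>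
      B * exp (y * (c - 1/2)) * norm (Complex c u - Complex (1 - c) u)"
  proof (rule contour_integral_bound_linepath)
    show "zeta_kernel y contour_integrable_on linepath (Complex (1 - c) u) (Complex c u)"
    proof (intro contour_integrable_continuous_linepath continuous_on_zeta_kernel)
      show "closed_segment (Complex (1 - c) u) (Complex c u) \<subseteq> - {1}"
        using edge u(1) by (fastforce simp: complex_eq_iff)
      show "riemann_zeta s \<noteq> 0" if "s \<in> closed_segment (Complex (1 - c) u) (Complex c u)" for s
        using edge[OF that] good_heightD(1)[OF u(2)] c by force
    qed
    fix s assume "s \<in> closed_segment (Complex (1 - c) u) (Complex c u)"
    then obtain \<sigma> where \<sigma>: "\<sigma> \<in> {1 - c..c}" "s = Complex \<sigma> u" using edge by blast
    have "norm (zeta_kernel y s) = norm (logderiv riemann_zeta s) * exp (y * (\<sigma> - 1/2))"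
      by (simp add: zeta_kernel_def norm_mult \<sigma>)
    also have "\<dots> \<le> B * exp (y * (c - 1/2))"
    proof (rule mult_mono)
      show "norm (logderiv riemann_zeta s) \<le> B" using good_heightD(2)[OF u(2), of \<sigma>] \<sigma> c by simp
      show "exp (y * (\<sigma> - 1/2)) \<le> exp (y * (c - 1/2))" using \<sigma> y by (auto intro!: mult_left_mono)
    qed (use \<open>B \<ge> 0\<close> in auto)
    finally show "norm (zeta_kernel y s) \<le> B * exp (y * (c - 1/2))" .
  qed (use \<open>B \<ge> 0\<close> in simp)
  also have "Complex c u - Complex (1 - c) u = of_real (2 * c - 1)" by (simp add: complex_eq_iff)
  also have "B * exp (y * (c - 1/2)) * norm (complex_of_real (2 * c - 1)) \<le> B * exp (y * (c - 1/2)) * 2"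
    using c \<open>B \<ge> 0\<close> unfolding norm_of_real by (intro mult_left_mono) auto
  finally show ?thesis by (simp add: mult_ac)
qed

lemma integral_zeta_kernel_right:
  assumes "c > 1"
  shows "integral {a..b} (\<lambda>t. zeta_kernel y (Complex c t)) =
    - (of_real (exp (y * (c - 1/2))) * fourier_integral a b (\<lambda>t. mangoldt_series (Complex c t)) y)"
proof -
  have "zeta_kernel y (Complex c t) = - of_real (exp (y * (c - 1/2))) * (mangoldt_series (Complex c t) * cis (y * t))" for t
  proof -
    have "of_real y * (Complex c t - 1/2) = of_real (y * (c - 1/2)) + \<i> * of_real (y * t)" by (simp add: complex_eq_iff)
    then have "exp (of_real y * (Complex c t - 1/2)) = of_real (exp (y * (c - 1/2))) * cis (y * t)"
      by (simp only: exp_add exp_of_real cis_conv_exp)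
    then show ?thesis using assms by (simp add: zeta_kernel_def logderiv_riemann_zeta)
  qed
  then show ?thesis by (simp add: fourier_integral_def)
qed

lemma integral_zeta_kernel_left:
  assumes c: "c > 1" and a: "a > 0"
  shows "integral {a..b} (\<lambda>t. zeta_kernel y (Complex (1 - c) t)) =
    of_real (exp (- (y * (c - 1/2)))) * (fourier_integral a b (\<lambda>t. chi_logderiv (Complex (1 - c) t)) y
      + fourier_integral a b (\<lambda>t. mangoldt_series (Complex c (- t))) y)"
proof -
  have kernel_eq: "zeta_kernel y (Complex (1 - c) t) =
      of_real (exp (- (y * (c - 1/2)))) * ((chi_logderiv (Complex (1 - c) t) + mangoldt_series (Complex c (- t))) * cis (y * t))"
    if t: "t \<in> {a..b}" for t
  proof -
    have "of_real y * (Complex (1 - c) t - 1/2) = of_real (- (y * (c - 1/2))) + \<i> * of_real (y * t)"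
      by (simp add: complex_eq_iff algebra_simps)
    then have exp_eq: "exp (of_real y * (Complex (1 - c) t - 1/2)) = of_real (exp (- (y * (c - 1/2)))) * cis (y * t)"
      by (simp only: exp_add exp_of_real cis_conv_exp)
    have "t \<noteq> 0" using t a by auto
    moreover have "1 - Complex (1 - c) t = Complex c (- t)" by (simp add: complex_eq_iff)
    ultimately have "logderiv riemann_zeta (Complex (1 - c) t) = chi_logderiv (Complex (1 - c) t) + mangoldt_series (Complex c (- t))"
      using logderiv_riemann_zeta_reflect[of "Complex (1 - c) t"] riemann_zeta_nonzero_vertical(2)[OF c, of t] c
      by (simp add: logderiv_riemann_zeta not_Int_if_Im)
    then show ?thesis unfolding zeta_kernel_def exp_eq by (simp only: mult_ac)
  qed
  have "continuous_on {a..b} (\<lambda>t. chi_logderiv (Complex (1 - c) t))"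
    using a by (intro continuous_on_compose2[OF continuous_on_chi_logderiv[OF order_refl]] continuous_intros) auto
  moreover have "continuous_on {a..b} (\<lambda>t. mangoldt_series (Complex c (- t)))"
    using c by (intro continuous_on_compose2[OF holomorphic_on_imp_continuous_on[OF mangoldt_series_holomorphic]] continuous_intros) auto
  ultimately have "fourier_integral a b (\<lambda>t. chi_logderiv (Complex (1 - c) t) + mangoldt_series (Complex c (- t))) y =
      fourier_integral a b (\<lambda>t. chi_logderiv (Complex (1 - c) t)) y + fourier_integral a b (\<lambda>t. mangoldt_series (Complex c (- t))) y"
    by (rule fourier_integral_add)
  then show ?thesis
    using Henstock_Kurzweil_Integration.integral_cong[OF kernel_eq, of "{a..b}"] by (simp add: fourier_integral_def)
qed


subsection \<open>The resonance formula\<close>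

definition resonant_term :: "real \<Rightarrow> real \<Rightarrow> real \<Rightarrow> nat \<Rightarrow> real \<Rightarrow> complex" where
  "resonant_term c a b n y = of_real (exp (y * (c - 1/2)) * (mangoldt n * real n powr (- c)) / (2 * pi)) * cis_integral a b (y - ln (real n))"

definition chi_term :: "real \<Rightarrow> real \<Rightarrow> real \<Rightarrow> real \<Rightarrow> complex" where
  "chi_term c a b y = of_real (exp (- (y * (c - 1/2))) / (2 * pi)) * fourier_integral a b (\<lambda>t. chi_logderiv (Complex (1 - c) t)) y"

lemma zero_sum_explicit_formula:
  fixes y :: real
  assumes RH: "riemann_hypothesis" and c: "1 < c" "c \<le> 3/2" and ab: "1 < a" "a < b"
    and heights: "good_height B1 a" "good_height B2 b"
  defines "E \<equiv> exp (y * (c - 1/2))"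
    and "H \<equiv> \<lambda>u. contour_integral (linepath (Complex (1 - c) u) (Complex c u)) (zeta_kernel y)"
  shows "2 * pi * \<i> * (zero_sum b y - zero_sum a y) = H a - H b
    - \<i> * of_real E * fourier_integral a b (\<lambda>t. mangoldt_series (Complex c t)) y
    - \<i> * of_real (1 / E) * (fourier_integral a b (\<lambda>t. chi_logderiv (Complex (1 - c) t)) y
      + fourier_integral a b (\<lambda>t. mangoldt_series (Complex c (- t))) y)"
proof -
  let ?path = "path_image (rectpath (Complex (1 - c) a) (Complex c b))"
  have path_eq: "?path = cbox (Complex (1 - c) a) (Complex c b) - box (Complex (1 - c) a) (Complex c b)"
    using c ab by (intro path_image_rectpath_cbox_minus_box) auto
  have "continuous_on ?path (zeta_kernel y)"
  proof (rule continuous_on_zeta_kernel)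
    show "?path \<subseteq> - {1}" using ab by (auto simp: path_eq in_cbox_complex_iff)
    show "riemann_zeta s \<noteq> 0" if "s \<in> ?path" for s
      using that unfolding path_eq by (rule riemann_zeta_nonzero_rectangle_boundary[OF c ab heights])
  qed
  from contour_integral_rectpath_Complex[OF ab(2) this] show ?thesis
    using c ab unfolding contour_integral_zeta_kernel[OF RH c ab heights]
    by (simp add: integral_zeta_kernel_right integral_zeta_kernel_left H_def E_def exp_minus inverse_eq_divide)
qed

lemma zero_sum_between_good_heights:
  assumes RH: "riemann_hypothesis" and c: "1 < c" "c \<le> 3/2" and ab: "1 < a" "a < b"
    and heights: "good_height B1 a" "good_height B2 b" and y: "y \<ge> 0"
  shows "norm (zero_sum b y - zero_sum a y + resonant_term c a b (nearest_nat_exp y) y + chi_term c a b y)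
    \<le> (B1 + B2 + 8 * mangoldt_sum c + 128 * (y + 2)\<^sup>2) * exp (y * (c - 1/2))"
proof -
  define E p where "E = exp (y * (c - 1/2))" and "p = 2 * pi"
  define H where "H u = contour_integral (linepath (Complex (1 - c) u) (Complex c u)) (zeta_kernel y)" for u
  define R1 where "R1 = fourier_integral a b (\<lambda>t. mangoldt_series (Complex c t)) y"
  define R2 where "R2 = fourier_integral a b (\<lambda>t. mangoldt_series (Complex c (- t))) y"
  define X where "X = fourier_integral a b (\<lambda>t. chi_logderiv (Complex (1 - c) t)) y"
  define r where "r = of_real (mangoldt (nearest_nat_exp y) * real (nearest_nat_exp y) powr (- c)) * cis_integral a b (y - ln (real (nearest_nat_exp y)))"
  define G where "G = zero_sum b y - zero_sum a y + resonant_term c a b (nearest_nat_exp y) y + chi_term c a b y"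
  have E: "E \<ge> 1" and p: "p \<ge> 2" using c y pi_ge_two by (auto simp: E_def p_def)
  then have inverse_E: "0 < 1 / E" "1 / E \<le> E" by (auto simp: divide_le_eq mult_ge1_I)
  have terms: "of_real p * resonant_term c a b (nearest_nat_exp y) y = of_real E * r"
    "of_real p * chi_term c a b y = of_real (1 / E) * X"
    using p by (simp_all add: resonant_term_def chi_term_def r_def X_def E_def p_def exp_minus field_simps)
  have explicit: "of_real p * \<i> * (zero_sum b y - zero_sum a y) =
      H a - H b - \<i> * of_real E * R1 - \<i> * of_real (1 / E) * (X + R2)"
    using zero_sum_explicit_formula[OF RH c ab heights, of y] by (simp add: p_def H_def E_def R1_def R2_def X_def)
  have "of_real p * G = - \<i> * (of_real p * \<i> * (zero_sum b y - zero_sum a y))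
      + of_real p * resonant_term c a b (nearest_nat_exp y) y + of_real p * chi_term c a b y"
    unfolding G_def by (simp add: algebra_simps)
  also have "\<dots> = - \<i> * (H a - H b) - of_real E * (R1 - r) - of_real (1 / E) * R2"
    unfolding terms explicit by (simp add: algebra_simps add_divide_distrib)
  finally have "p * norm G = norm (- \<i> * (H a - H b) - of_real E * (R1 - r) - of_real (1 / E) * R2)"
    using p by (metis abs_of_nonneg norm_mult norm_of_real order_trans zero_le_numeral)
  also have "\<dots> \<le> norm (H a) + norm (H b) + E * norm (R1 - r) + (1 / E) * norm R2"
    using E norm_triangle_ineq4[of "- \<i> * (H a - H b) - of_real E * (R1 - r)" "of_real (1 / E) * R2"]
      norm_triangle_ineq4[of "- \<i> * (H a - H b)" "of_real E * (R1 - r)"] norm_triangle_ineq4[of "H a" "H b"]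
    by (simp add: norm_mult norm_divide)
  also have "\<dots> \<le> 2 * B1 * E + 2 * B2 * E + E * (4 * mangoldt_sum c + 128 * (y + 2)\<^sup>2) + E * (4 * mangoldt_sum c)"
  proof (intro add_mono mult_mono order_refl)
    show "norm (H a) \<le> 2 * B1 * E" "norm (H b) \<le> 2 * B2 * E"
      unfolding H_def E_def using ab heights by (auto intro!: norm_contour_integral_zeta_kernel_horizontal_le[OF c y])
    show "norm (R1 - r) \<le> 4 * mangoldt_sum c + 128 * (y + 2)\<^sup>2"
      unfolding R1_def r_def using ab by (intro fourier_integral_mangoldt_series_resonance c y) auto
    show "norm R2 \<le> 4 * mangoldt_sum c"
      unfolding R2_def using c ab y by (intro norm_fourier_integral_mangoldt_series_reflected_le) auto
  qed (use E inverse_E in auto)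
  also have "\<dots> = 2 * ((B1 + B2 + 4 * mangoldt_sum c + 64 * (y + 2)\<^sup>2) * E)" by (simp add: algebra_simps)
  also have "\<dots> \<le> p * ((B1 + B2 + 8 * mangoldt_sum c + 128 * (y + 2)\<^sup>2) * E)"
    using p E good_height_nonneg[OF heights(1)] good_height_nonneg[OF heights(2)] mangoldt_sum_nonneg[OF c(1)]
    by (intro mult_mono add_mono mult_nonneg_nonneg add_nonneg_nonneg) auto
  finally show ?thesis using p by (simp add: G_def E_def)
qed

lemma mangoldt_powr_le_mangoldt_sum:
  assumes "c > 1"
  shows "mangoldt n * real n powr (- c) \<le> mangoldt_sum c"
  using sum_le_suminf[OF summable_mangoldt_powr[OF assms], of "{n}"] by (simp add: mangoldt_nonneg)

lemma norm_resonant_term_diff_le: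
  assumes c: "c > 1" and "a \<le> b" "b \<le> d"
  shows "norm (resonant_term c a d n y - resonant_term c a b n y) \<le> exp (y * (c - 1/2)) * mangoldt_sum c * (d - b)"
proof -
  define q where "q = exp (y * (c - 1/2)) * (mangoldt n * real n powr (- c)) / (2 * pi)"
  have "q \<le> exp (y * (c - 1/2)) * (mangoldt n * real n powr (- c)) / 1"
    unfolding q_def using pi_ge_two mangoldt_nonneg[of n] by (intro divide_left_mono) auto
  also have "\<dots> \<le> exp (y * (c - 1/2)) * mangoldt_sum c"
    using mangoldt_powr_le_mangoldt_sum[OF c, of n] by simp
  finally have q: "0 \<le> q" "q \<le> exp (y * (c - 1/2)) * mangoldt_sum c" using mangoldt_nonneg[of n] by (simp_all add: q_def)
  have "resonant_term c a d n y - resonant_term c a b n y = of_real q * cis_integral b d (y - ln (real n))"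
    unfolding resonant_term_def q_def[symmetric] using assms
    by (simp add: fourier_integral_diff_left flip: right_diff_distrib)
  then have "norm (resonant_term c a d n y - resonant_term c a b n y) = q * norm (cis_integral b d (y - ln (real n)))"
    using q(1) by (simp add: norm_mult)
  also have "\<dots> \<le> exp (y * (c - 1/2)) * mangoldt_sum c * (1 * (d - b))"
    using q assms by (intro mult_mono norm_fourier_integral_le) auto
  finally show ?thesis by simp
qed

lemma continuous_on_chi_logderiv_vertical:
  "0 \<notin> A \<Longrightarrow> continuous_on A (\<lambda>t. chi_logderiv (Complex \<sigma> t))"
  by (intro continuous_on_compose2[OF continuous_on_chi_logderiv[OF order_refl]] continuous_intros) auto

lemma norm_chi_term_diff_le:
  assumes c: "c \<ge> 1/2" and y: "y \<ge> 0" and "0 < a" "a \<le> b" "b \<le> d"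
    and bound: "\<And>t. t \<in> {b..d} \<Longrightarrow> norm (chi_logderiv (Complex (1 - c) t)) \<le> B"
  shows "norm (chi_term c a d y - chi_term c a b y) \<le> B * (d - b)"
proof -
  define f where "f t = chi_logderiv (Complex (1 - c) t)" for t
  define q where "q = exp (- (y * (c - 1/2))) / (2 * pi)"
  have "q \<le> 1 / 1" unfolding q_def using c y pi_ge_two by (intro frac_le) auto
  then have q: "0 \<le> q" "q \<le> 1" by (simp_all add: q_def)
  have f: "continuous_on {u..v} f" if "u > 0" for u v
    unfolding f_def by (rule continuous_on_chi_logderiv_vertical) (use that in auto)
  have "chi_term c a d y - chi_term c a b y = of_real q * fourier_integral b d f y"
    unfolding chi_term_def q_def[symmetric] f_def[symmetric] using f assms
    by (simp add: fourier_integral_diff_left flip: right_diff_distrib)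
  then have "norm (chi_term c a d y - chi_term c a b y) = q * norm (fourier_integral b d f y)"
    using q(1) by (simp add: norm_mult)
  also have "\<dots> \<le> norm (fourier_integral b d f y)" using q by (simp add: mult_left_le_one_le)
  also have "\<dots> \<le> B * (d - b)"
    using f bound \<open>0 < a\<close> \<open>a \<le> b\<close> \<open>b \<le> d\<close> by (intro norm_fourier_integral_le) (auto simp: f_def)
  finally show ?thesis .
qed

lemma norm_zero_sum_increment_le:
  assumes RH: "riemann_hypothesis"
  shows "\<exists>C\<ge>0. \<forall>T\<ge>4. \<forall>T'\<in>{T..T + 1/10}. \<forall>y. norm (zero_sum T' y - zero_sum T y) \<le> C * ln T"
proof -
  obtain C where C: "C \<ge> 0"
    and count: "\<And>T. T \<ge> 4 \<Longrightarrow> (\<Sum>\<rho>\<in>zeros_upto (T + 1/10) - zeros_upto T. real (zero_mult \<rho>)) \<le> C * ln T"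
    using sum_zero_mult_new_zeros_le[OF RH] by blast
  have "norm (zero_sum T' y - zero_sum T y) \<le> C * ln T" if T: "T \<ge> 4" "T' \<in> {T..T + 1/10}" for T T' y
  proof -
    have "norm (zero_sum T' y - zero_sum T y) \<le> (\<Sum>\<rho>\<in>zeros_upto T' - zeros_upto T. real (zero_mult \<rho>))"
      using T by (simp add: zero_sum_diff norm_sum_zero_mult_cis_le)
    also have "\<dots> \<le> (\<Sum>\<rho>\<in>zeros_upto (T + 1/10) - zeros_upto T. real (zero_mult \<rho>))"
      using T finite_zeros_upto[of "T + 1/10"] by (intro sum_mono2) (auto simp: zeros_upto_def)
    also have "\<dots> \<le> C * ln T" by (rule count[OF T(1)])
    finally show ?thesis .
  qed
  then show ?thesis using C by blast
qed

lemma norm_chi_term_increment_le: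
  assumes c: "1 < c" "c \<le> 3/2"
  shows "\<exists>C\<ge>0. \<forall>T\<ge>6. \<forall>T'\<in>{T..T + 1/10}. \<forall>T0\<in>{4..5}. \<forall>y\<ge>0.
    norm (chi_term c T0 T' y - chi_term c T0 T y) \<le> C * ln T"
proof -
  obtain C where "C \<ge> 0"
    and chi_le: "\<And>\<sigma> t. \<bar>\<sigma>\<bar> \<le> 2 \<Longrightarrow> t \<ge> 1 \<Longrightarrow> norm (chi_logderiv (Complex \<sigma> t)) \<le> C + ln t"
    using norm_chi_logderiv_Complex_le by blast
  have "norm (chi_term c T0 T' y - chi_term c T0 T y) \<le> (C + 2) * ln T"
    if T: "T \<ge> 6" "T' \<in> {T..T + 1/10}" and T0: "T0 \<in> {4..5}" and y: "y \<ge> 0" for T T' T0 y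
  proof -
    have "ln T \<ge> 1" using T by (intro one_le_ln) auto
    have "norm (chi_term c T0 T' y - chi_term c T0 T y) \<le> (C + 2 * ln T) * (T' - T)"
    proof (rule norm_chi_term_diff_le)
      fix t assume t: "t \<in> {T..T'}"
      then have "norm (chi_logderiv (Complex (1 - c) t)) \<le> C + ln t" using T c by (intro chi_le) auto
      also have "ln t \<le> 2 * ln T" using t T by (intro ln_le_two_ln) auto
      finally show "norm (chi_logderiv (Complex (1 - c) t)) \<le> C + 2 * ln T" by simp
    qed (use c T T0 y in auto)
    also have "\<dots> \<le> (C + 2 * ln T) * 1" using T \<open>C \<ge> 0\<close> \<open>ln T \<ge> 1\<close> by (intro mult_left_mono) auto
    also have "\<dots> \<le> (C + 2) * ln T"
      using mult_left_mono[OF \<open>ln T \<ge> 1\<close> \<open>C \<ge> 0\<close>] by (simp add: distrib_right)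
    finally show ?thesis .
  qed
  then show ?thesis using \<open>C \<ge> 0\<close> by (intro exI[of _ "C + 2"]) auto
qed

lemma norm_change_of_height_le:
  assumes RH: "riemann_hypothesis" and c: "1 < c" "c \<le> 3/2"
  defines "F \<equiv> \<lambda>T0 n T y. zero_sum T y + resonant_term c T0 T n y + chi_term c T0 T y"
  shows "\<exists>C\<ge>0. \<forall>T\<ge>6. \<forall>T'\<in>{T..T + 1/10}. \<forall>T0\<in>{4..5}. \<forall>y\<ge>0. \<forall>n.
    norm (F T0 n T' y - F T0 n T y) \<le> C * ln T * exp (y * (c - 1/2))"
proof -
  obtain C1 where C1: "C1 \<ge> 0"
    and increment: "\<And>T T' y. T \<ge> 4 \<Longrightarrow> T' \<in> {T..T + 1/10} \<Longrightarrow> norm (zero_sum T' y - zero_sum T y) \<le> C1 * ln T"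
    using norm_zero_sum_increment_le[OF RH] by blast
  obtain C2 where C2: "C2 \<ge> 0"
    and chi_increment: "\<And>T T' T0 y. T \<ge> 6 \<Longrightarrow> T' \<in> {T..T + 1/10} \<Longrightarrow> T0 \<in> {4..5} \<Longrightarrow> y \<ge> 0 \<Longrightarrow>
      norm (chi_term c T0 T' y - chi_term c T0 T y) \<le> C2 * ln T"
    using norm_chi_term_increment_le[OF c] by blast
  define C where "C = C1 + mangoldt_sum c + C2"
  have "norm (F T0 n T' y - F T0 n T y) \<le> C * ln T * exp (y * (c - 1/2))"
    if T: "T \<ge> 6" "T' \<in> {T..T + 1/10}" and T0: "T0 \<in> {4..5}" and y: "y \<ge> 0" for T T' T0 y n
  proof -
    define E where "E = exp (y * (c - 1/2))"
    have E: "E \<ge> 1" using c y by (simp add: E_def)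
    have L: "ln T \<ge> 1" using T by (intro one_le_ln) auto
    have "norm (zero_sum T' y - zero_sum T y) \<le> C1 * ln T" using T by (intro increment) auto
    also have "\<dots> \<le> C1 * ln T * E" using mult_left_mono[OF E, of "C1 * ln T"] C1 L by simp
    finally have zeros: "norm (zero_sum T' y - zero_sum T y) \<le> C1 * ln T * E" .
    have "norm (resonant_term c T0 T' n y - resonant_term c T0 T n y) \<le> E * mangoldt_sum c * (T' - T)"
      unfolding E_def using c T T0 by (intro norm_resonant_term_diff_le) auto
    also have "\<dots> \<le> E * mangoldt_sum c * ln T"
      using T L E mangoldt_sum_nonneg[OF c(1)] by (intro mult_left_mono mult_nonneg_nonneg) auto
    finally have resonant: "norm (resonant_term c T0 T' n y - resonant_term c T0 T n y) \<le> mangoldt_sum c * ln T * E"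
      by (simp add: mult_ac)
    have "norm (chi_term c T0 T' y - chi_term c T0 T y) \<le> C2 * ln T" using T T0 y by (intro chi_increment)
    also have "\<dots> \<le> C2 * ln T * E" using mult_left_mono[OF E, of "C2 * ln T"] C2 L by simp
    finally have chi: "norm (chi_term c T0 T' y - chi_term c T0 T y) \<le> C2 * ln T * E" .
    have "norm (F T0 n T' y - F T0 n T y) \<le> norm (zero_sum T' y - zero_sum T y)
        + norm (resonant_term c T0 T' n y - resonant_term c T0 T n y) + norm (chi_term c T0 T' y - chi_term c T0 T y)"
      unfolding F_def add_diff_add by (intro norm_triangle_le add_mono order_refl)
    then show ?thesis using zeros resonant chi by (simp add: C_def E_def distrib_right)
  qed
  then show ?thesis
    using C1 C2 mangoldt_sum_nonneg[OF c(1)] by (intro exI[of _ C]) (auto simp: C_def)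
qed

lemma resonance_at_good_heights:
  assumes RH: "riemann_hypothesis" and c: "1 < c" "c \<le> 3/2" and C: "C \<ge> 0"
    and T: "T \<ge> 6" and y: "y \<in> {0..ln T}" and heights: "T0 \<in> {4..5}" "T' \<ge> T"
    and good: "good_height (C * (ln 4)\<^sup>2) T0" "good_height (C * (ln T)\<^sup>2) T'"
  shows "norm (zero_sum T' y - zero_sum T0 y + resonant_term c T0 T' (nearest_nat_exp y) y + chi_term c T0 T' y)
    \<le> (2 * C + 8 * mangoldt_sum c + 128 * 9) * (ln T)\<^sup>2 * exp (y * (c - 1/2))"
proof -
  have L: "ln T \<ge> 1" using T by (intro one_le_ln) auto
  have "norm (zero_sum T' y - zero_sum T0 y + resonant_term c T0 T' (nearest_nat_exp y) y + chi_term c T0 T' y)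
      \<le> (C * (ln 4)\<^sup>2 + C * (ln T)\<^sup>2 + 8 * mangoldt_sum c + 128 * (y + 2)\<^sup>2) * exp (y * (c - 1/2))"
    using T y heights by (intro zero_sum_between_good_heights RH c good) auto
  also have "\<dots> \<le> (2 * C + 8 * mangoldt_sum c + 128 * 9) * (ln T)\<^sup>2 * exp (y * (c - 1/2))"
  proof (rule mult_right_mono)
    have "(y + 2)\<^sup>2 \<le> (3 * ln T)\<^sup>2" using y L by (intro power_mono) auto
    moreover have "C * (ln 4)\<^sup>2 \<le> C * (ln T)\<^sup>2" using C T by (intro mult_left_mono power_mono) auto
    moreover have "mangoldt_sum c * 1 \<le> mangoldt_sum c * (ln T)\<^sup>2"
      using L mangoldt_sum_nonneg[OF c(1)] by (intro mult_left_mono) auto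
    ultimately show "C * (ln 4)\<^sup>2 + C * (ln T)\<^sup>2 + 8 * mangoldt_sum c + 128 * (y + 2)\<^sup>2 \<le> (2 * C + 8 * mangoldt_sum c + 128 * 9) * (ln T)\<^sup>2"
      by (simp add: distrib_right power_mult_distrib)
  qed simp
  finally show ?thesis .
qed

theorem landau_gonek_formula:
  assumes RH: "riemann_hypothesis" and c: "1 < c" "c \<le> 3/2"
  shows "\<exists>T0 K. 4 \<le> T0 \<and> T0 \<le> 5 \<and> 0 \<le> K \<and> (\<forall>T\<ge>6. \<forall>y\<in>{0..ln T}.
    norm (zero_sum T y + resonant_term c T0 T (nearest_nat_exp y) y + chi_term c T0 T y)
    \<le> K * (ln T)\<^sup>2 * exp (y * (c - 1/2)))"
proof -
  define F where "F T0 n T y = zero_sum T y + resonant_term c T0 T n y + chi_term c T0 T y" for T0 n T y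
  obtain C1 where C1: "C1 \<ge> 0" and good: "\<And>T. T \<ge> 4 \<Longrightarrow> \<exists>t\<in>{T..T + 1/10}. good_height (C1 * (ln T)\<^sup>2) t"
    using exists_good_height by blast
  obtain C2 where C2: "C2 \<ge> 0" and change: "\<And>T T' T0 y n. T \<ge> 6 \<Longrightarrow> T' \<in> {T..T + 1/10} \<Longrightarrow> T0 \<in> {4..5} \<Longrightarrow> y \<ge> 0 \<Longrightarrow>
      norm (F T0 n T' y - F T0 n T y) \<le> C2 * ln T * exp (y * (c - 1/2))"
    using norm_change_of_height_le[OF RH c] unfolding F_def by blast
  obtain T0 where T0: "T0 \<in> {4..4 + 1/10}" "good_height (C1 * (ln 4)\<^sup>2) T0" using good[of 4] by auto
  define N D where "N = (\<Sum>\<rho>\<in>zeros_upto T0. real (zero_mult \<rho>))" and "D = mangoldt_sum c"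
  have N: "N \<ge> 0" and D: "D \<ge> 0" using mangoldt_sum_nonneg[OF c(1)] by (auto simp: N_def D_def intro: sum_nonneg)
  define K where "K = (2 * C1 + 8 * D + 128 * 9) + N + C2"
  have "norm (F T0 (nearest_nat_exp y) T y) \<le> K * (ln T)\<^sup>2 * exp (y * (c - 1/2))"
    if T: "T \<ge> 6" and y: "y \<in> {0..ln T}" for T y
  proof -
    define L E n where "L = ln T" and "E = exp (y * (c - 1/2))" and "n = nearest_nat_exp y"
    obtain T' where T': "T' \<in> {T..T + 1/10}" "good_height (C1 * L\<^sup>2) T'"
      using good[of T] T by (auto simp: L_def)
    have L: "L \<ge> 1" unfolding L_def using T by (intro one_le_ln) auto
    then have L2: "1 \<le> L\<^sup>2" "L \<le> L\<^sup>2" by (auto simp: power2_eq_square mult_ge1_I)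
    have E: "E \<ge> 1" using c y by (simp add: E_def)
    have LE: "1 \<le> L\<^sup>2 * E" using mult_mono[OF L2(1) E] by simp
    have "norm (F T0 n T' y - zero_sum T0 y) \<le> (2 * C1 + 8 * D + 128 * 9) * L\<^sup>2 * E"
      using resonance_at_good_heights[OF RH c C1 T y _ _ T0(2) T'(2)[unfolded L_def]] T0(1) T'(1)
      by (simp add: F_def n_def D_def L_def E_def algebra_simps)
    moreover have "norm (zero_sum T0 y) \<le> N * L\<^sup>2 * E"
      using norm_sum_zero_mult_cis_le[of y "zeros_upto T0"] mult_left_mono[OF LE N] by (simp add: zero_sum_def N_def mult.assoc)
    moreover have "norm (F T0 n T' y - F T0 n T y) \<le> C2 * L\<^sup>2 * E"
      using change[OF T T'(1), of T0 y n] T0(1) y E C2 mult_right_mono[OF mult_left_mono[OF L2(2) C2], of E]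
      by (simp add: L_def E_def)
    ultimately have "norm ((F T0 n T' y - zero_sum T0 y) + zero_sum T0 y - (F T0 n T' y - F T0 n T y))
        \<le> (2 * C1 + 8 * D + 128 * 9) * L\<^sup>2 * E + N * L\<^sup>2 * E + C2 * L\<^sup>2 * E"
      using norm_triangle_ineq4[of "(F T0 n T' y - zero_sum T0 y) + zero_sum T0 y" "F T0 n T' y - F T0 n T y"]
        norm_triangle_ineq[of "F T0 n T' y - zero_sum T0 y" "zero_sum T0 y"] by linarith
    then show ?thesis by (simp add: K_def L_def E_def n_def distrib_right)
  qed
  moreover have "0 \<le> K" using N C1 C2 D by (simp add: K_def)
  ultimately show ?thesis using T0(1) unfolding F_def by (intro exI[of _ T0] exI[of _ K]) auto
qed

section \<open>Mean square of the exponential sums\<close>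

subsection \<open>The diagonal sum over prime powers\<close>

definition taper :: "real \<Rightarrow> real \<Rightarrow> real" where
  "taper Y y = max 0 (1 - y / Y)"

lemma taper_nonneg: "taper Y y \<ge> 0"
  by (simp add: taper_def)

lemma taper_le_1: "0 \<le> y \<Longrightarrow> Y > 0 \<Longrightarrow> taper Y y \<le> 1"
  by (simp add: taper_def)

lemma continuous_on_taper: "continuous_on A (taper Y)"
  unfolding taper_def divide_inverse by (intro continuous_intros)

definition resonant_weight :: "real \<Rightarrow> nat \<Rightarrow> real" where
  "resonant_weight Y n = (mangoldt n)\<^sup>2 / real n * ((taper Y (ln (real n)) + 1 / Y) * (1 + 2 / real n))"

lemma sum_mangoldt_ln_taper_le:
  assumes "Y > 0"
  shows "(\<Sum>n=2..N. mangoldt n * ln (real n) / real n * taper Y (ln (real n))) \<le> Y\<^sup>2 / 6 + 4 * Y"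
proof -
  define B where "B = {n::nat. 1 \<le> n \<and> ln (real n) \<le> Y}"
  define f where "f n = mangoldt n * ln (real n) / real n * taper Y (ln (real n))" for n
  have f_nonneg: "f n \<ge> 0" if "n \<ge> 1" for n
    using that mangoldt_nonneg[of n] taper_nonneg unfolding f_def by (intro mult_nonneg_nonneg divide_nonneg_nonneg) auto
  have "sum f {2..N} = sum f ({2..N} \<inter> B)"
    using assms by (intro sum.mono_neutral_right) (auto simp: f_def B_def taper_def max_def)
  also have "\<dots> \<le> sum f B"
  proof (rule sum_mono2)
    show "finite B" unfolding B_def Collect_ln_le by simp
  qed (use f_nonneg in \<open>auto simp: B_def\<close>)
  also have "\<dots> = (\<Sum>n\<in>B. mangoldt n * ln (real n) / real n * (1 - ln (real n) / Y))"
    using assms by (intro sum.cong) (auto simp: f_def B_def taper_def max_def)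
  also have "\<dots> \<le> Y\<^sup>2 / 6 + 4 * Y" unfolding B_def by (rule sum_mangoldt_triangle_le[OF assms])
  finally show ?thesis by (simp add: f_def)
qed

lemma sum_mangoldt_ln_le:
  assumes "N \<ge> 1"
  shows "(\<Sum>n=2..N. mangoldt n * ln (real n) / real n) \<le> ln (real N) * (ln (real N) + 4)"
proof -
  have "(\<Sum>n=2..N. mangoldt n * ln (real n) / real n) \<le> (\<Sum>n=2..N. ln (real N) * (mangoldt n / real n))"
  proof (rule sum_mono)
    fix n assume n: "n \<in> {2..N}"
    then have "mangoldt n / real n * ln (real n) \<le> mangoldt n / real n * ln (real N)"
      using mangoldt_nonneg[of n] by (intro mult_left_mono) auto
    then show "mangoldt n * ln (real n) / real n \<le> ln (real N) * (mangoldt n / real n)" by (simp add: mult.commute)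
  qed
  also have "\<dots> \<le> ln (real N) * (\<Sum>n=1..N. mangoldt n / real n)"
    unfolding sum_distrib_left[symmetric] using assms mangoldt_nonneg by (intro mult_left_mono sum_mono2) auto
  also have "\<dots> \<le> ln (real N) * (ln (real N) + 4)"
    using assms mertens_sum_mangoldt(1) by (intro mult_left_mono) auto
  finally show ?thesis .
qed

lemma ln_divide_square_le:
  assumes "x \<ge> (1::real)"
  shows "ln x / x\<^sup>2 \<le> 2 * x powr (- (3/2))"
proof -
  have "ln x = 2 * ln (sqrt x)" using assms by (simp add: ln_sqrt)
  also have "\<dots> \<le> 2 * sqrt x" using assms ln_bound[of "sqrt x"] by simp
  finally have "ln x \<le> 2 * x powr (1/2)" using assms by (simp add: powr_half_sqrt)
  then have "ln x / x\<^sup>2 \<le> 2 * x powr (1/2) / x powr 2" using assms by (simp add: powr_numeral divide_right_mono)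
  also have "\<dots> = 2 * x powr (1/2 - 2)" by (simp only: powr_diff times_divide_eq_right)
  finally show ?thesis by simp
qed

lemma resonant_weight_le:
  assumes n: "n \<ge> 2" and Y: "Y > 0"
  defines "a \<equiv> mangoldt n * ln (real n) / real n"
  shows "resonant_weight Y n \<le> a * taper Y (ln (real n)) + 4 * (mangoldt n * real n powr (- (3/2))) + 2 / Y * a"
proof -
  define t where "t = taper Y (ln (real n))"
  have t: "0 \<le> t" "t \<le> 1" using n Y by (auto simp: t_def taper_nonneg intro: taper_le_1)
  have a: "a \<ge> 0" using n mangoldt_nonneg[of n] unfolding a_def by (intro divide_nonneg_nonneg mult_nonneg_nonneg) auto
  have "(mangoldt n)\<^sup>2 \<le> mangoldt n * ln (real n)"
    unfolding power2_eq_square using n mangoldt_nonneg[of n] by (intro mult_left_mono mangoldt_le) auto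
  then have square_le: "(mangoldt n)\<^sup>2 / real n \<le> a" unfolding a_def by (intro divide_right_mono) auto
  have "t * (2 / real n) \<le> 1 * (2 / real n)" using t by (intro mult_right_mono) auto
  moreover have "1 / Y * (1 + 2 / real n) \<le> 1 / Y * 2" using n Y by (intro mult_left_mono) auto
  moreover have "(t + 1 / Y) * (1 + 2 / real n) = t + t * (2 / real n) + 1 / Y * (1 + 2 / real n)"
    by (simp only: distrib_left distrib_right mult_1_right)
  ultimately have "(t + 1 / Y) * (1 + 2 / real n) \<le> t + 2 / real n + 2 / Y" by linarith
  then have "resonant_weight Y n \<le> a * (t + 2 / real n + 2 / Y)"
    unfolding resonant_weight_def t_def[symmetric] using square_le a t n Y by (intro mult_mono) auto
  moreover have "a * (2 / real n) = 2 * mangoldt n * (ln (real n) / (real n)\<^sup>2)" by (simp add: a_def power2_eq_square)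
  moreover have "\<dots> \<le> 2 * mangoldt n * (2 * real n powr (- (3/2)))"
    using n mangoldt_nonneg[of n] by (intro mult_left_mono ln_divide_square_le) auto
  ultimately show ?thesis by (simp add: t_def algebra_simps)
qed

lemma sum_resonant_weight_le:
  "\<exists>C\<ge>0. \<forall>Y\<ge>1. (\<Sum>n=2..nat \<lceil>exp Y\<rceil>. resonant_weight Y n) \<le> Y\<^sup>2 / 6 + C * Y"
proof -
  define D where "D = mangoldt_sum (3/2)"
  have D: "D \<ge> 0" unfolding D_def by (rule mangoldt_sum_nonneg) simp
  have "(\<Sum>n=2..nat \<lceil>exp Y\<rceil>. resonant_weight Y n) \<le> Y\<^sup>2 / 6 + (28 + 4 * D) * Y" if Y: "Y \<ge> 1" for Y
  proof -
    define N where "N = nat \<lceil>exp Y\<rceil>"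
    define a where "a n = mangoldt n * ln (real n) / real n" for n
    have "N \<ge> 1" unfolding N_def by (simp add: Suc_le_eq)
    have "real N \<le> exp Y + 1" using ceiling_correct[of "exp Y"] by (simp add: N_def)
    also have "\<dots> \<le> exp Y * 2" using Y by simp
    also have "\<dots> \<le> exp Y * exp 1" using exp_ge_add_one_self[of "1::real"] by (intro mult_left_mono) auto
    finally have ln_N: "ln (real N) \<le> Y + 1" using \<open>N \<ge> 1\<close> by (simp add: ln_le_iff_le_exp exp_add)
    have "(\<Sum>n=2..N. a n) \<le> ln (real N) * (ln (real N) + 4)"
      unfolding a_def by (rule sum_mangoldt_ln_le[OF \<open>N \<ge> 1\<close>])
    also have "\<dots> \<le> (2 * Y) * (6 * Y)" using ln_N Y \<open>N \<ge> 1\<close> by (intro mult_mono) auto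
    finally have "2 / Y * (\<Sum>n=2..N. a n) \<le> 2 / Y * ((2 * Y) * (6 * Y))" using Y by (intro mult_left_mono) auto
    then have a_sum: "2 / Y * (\<Sum>n=2..N. a n) \<le> 24 * Y" using Y by simp
    have taper_sum: "(\<Sum>n=2..N. a n * taper Y (ln (real n))) \<le> Y\<^sup>2 / 6 + 4 * Y"
      unfolding a_def using Y by (intro sum_mangoldt_ln_taper_le) auto
    have "(\<Sum>n=2..N. mangoldt n * real n powr (- (3/2))) \<le> D"
      unfolding D_def using mangoldt_nonneg by (intro sum_le_suminf summable_mangoldt_powr) auto
    also have "D \<le> D * Y" using mult_left_mono[OF Y D] by simp
    finally have tail_sum: "(\<Sum>n=2..N. mangoldt n * real n powr (- (3/2))) \<le> D * Y" .
    have "(\<Sum>n=2..N. resonant_weight Y n) \<le> (\<Sum>n=2..N. a n * taper Y (ln (real n)) + 4 * (mangoldt n * real n powr (- (3/2))) + 2 / Y * a n)"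
      unfolding a_def using Y by (intro sum_mono resonant_weight_le) auto
    also have "\<dots> = (\<Sum>n=2..N. a n * taper Y (ln (real n))) + 4 * (\<Sum>n=2..N. mangoldt n * real n powr (- (3/2))) + 2 / Y * (\<Sum>n=2..N. a n)"
      by (simp add: sum.distrib sum_distrib_left)
    also have "\<dots> \<le> (Y\<^sup>2 / 6 + 4 * Y) + 4 * (D * Y) + 24 * Y"
      by (intro add_mono mult_left_mono taper_sum tail_sum a_sum) auto
    finally show ?thesis by (simp add: N_def algebra_simps)
  qed
  then show ?thesis using D by (intro exI[of _ "28 + 4 * D"]) auto
qed


subsection \<open>Mean squares of the individual terms\<close>

lemma integral_ln_ratio_squared_le:
  fixes T :: real
  assumes "0 < T0" "T0 \<le> T"
  shows "integral {T0..T} (\<lambda>t. (ln T - ln t)\<^sup>2) \<le> 2 * T"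
proof -
  define F where "F t = t * ((ln T - ln t)\<^sup>2 + 2 * (ln T - ln t) + 2)" for t
  have "((\<lambda>t. (ln T - ln t)\<^sup>2) has_integral (F T - F T0)) {T0..T}"
  proof (rule fundamental_theorem_of_calculus[OF assms(2)])
    fix t assume t: "t \<in> {T0..T}"
    have "(F has_real_derivative (ln T - ln t)\<^sup>2) (at t)"
      unfolding F_def using t assms
      by (auto intro!: derivative_eq_intros simp: field_simps power2_eq_square)
    then show "(F has_vector_derivative (ln T - ln t)\<^sup>2) (at t within {T0..T})"
      by (simp add: has_real_derivative_iff_has_vector_derivative has_vector_derivative_at_within)
  qed
  moreover have "F T0 \<ge> 0" unfolding F_def using assms by (intro mult_nonneg_nonneg add_nonneg_nonneg) auto
  moreover have "F T = 2 * T" by (simp add: F_def)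
  ultimately show ?thesis by (simp add: integral_unique)
qed

lemma integral_norm_cis_integral_squared_le:
  assumes "0 \<le> a" "a \<le> b"
  shows "integral {-M..M} (\<lambda>y. (norm (cis_integral a b (y - v)))\<^sup>2) \<le> 2 * pi * b"
proof -
  have "cis_integral a b (y - v) = fourier_integral a b (\<lambda>t. cis (- (v * t))) y" for y
    by (simp add: fourier_integral_def cis_mult algebra_simps)
  then have "integral {-M..M} (\<lambda>y. (norm (cis_integral a b (y - v)))\<^sup>2) \<le> 2 * pi * integral {a..b} (\<lambda>t. (norm (cis (- (v * t))))\<^sup>2)"
    by (simp only:) (intro bessel_inequality continuous_intros)
  also have "\<dots> \<le> 2 * pi * b" using assms by simp
  finally show ?thesis .
qed

lemma integral_norm_cis_integral_squared_half_le:
  assumes "0 \<le> a" "a \<le> b" "M \<ge> 0"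
  shows "integral {0..M} (\<lambda>y. (norm (cis_integral a b y))\<^sup>2) \<le> pi * b"
proof -
  define g where "g y = (norm (cis_integral a b y))\<^sup>2" for y
  have cont: "continuous_on A g" for A unfolding g_def by (intro continuous_intros)
  have "cis_integral a b (- y) = cnj (cis_integral a b y)" for y
    using integral_cnj[of "{a..b}" "\<lambda>t. cis (y * t)"] by (simp add: fourier_integral_def cis_cnj)
  then have "g (- y) = g y" for y by (simp add: g_def)
  then have "integral {-M..0} g = integral {0..M} g"
    using Henstock_Kurzweil_Integration.integral_reflect_real[of M 0 g] by simp
  moreover have "integral {-M..0} g + integral {0..M} g = integral {-M..M} g"
    using assms by (intro Henstock_Kurzweil_Integration.integral_combine integrable_continuous_interval cont) auto
  moreover have "integral {-M..M} g \<le> 2 * pi * b"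
    using integral_norm_cis_integral_squared_le[OF assms(1,2), of M 0] by (simp add: g_def[abs_def])
  ultimately show ?thesis unfolding g_def by linarith
qed

lemma integral_norm_fourier_integral_ln_deviation_le:
  assumes f_near: "\<And>t. t \<in> {T0..T} \<Longrightarrow> norm (f t + of_real (ln t)) \<le> C"
    and f_cont: "continuous_on {T0..T} f" and T: "0 < T0" "T0 \<le> T"
  shows "integral {-M..M} (\<lambda>y. (norm (fourier_integral T0 T (\<lambda>t. f t + of_real (ln T)) y))\<^sup>2) \<le> 2 * pi * ((2 * C\<^sup>2 + 4) * T)"
proof -
  have ln_integrable: "(\<lambda>t. (ln T - ln t)\<^sup>2) integrable_on {T0..T}"
    using T by (intro integrable_continuous_interval continuous_intros) auto
  have "integral {-M..M} (\<lambda>y. (norm (fourier_integral T0 T (\<lambda>t. f t + of_real (ln T)) y))\<^sup>2)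
     \<le> 2 * pi * integral {T0..T} (\<lambda>t. (norm (f t + of_real (ln T)))\<^sup>2)"
    by (intro bessel_inequality continuous_intros f_cont)
  also have "integral {T0..T} (\<lambda>t. (norm (f t + of_real (ln T)))\<^sup>2) \<le> integral {T0..T} (\<lambda>t. 2 * C\<^sup>2 + 2 * (ln T - ln t)\<^sup>2)"
  proof (rule integral_le)
    show "(\<lambda>t. (norm (f t + of_real (ln T)))\<^sup>2) integrable_on {T0..T}"
      by (intro integrable_continuous_interval continuous_intros f_cont)
    show "(\<lambda>t. 2 * C\<^sup>2 + 2 * (ln T - ln t)\<^sup>2) integrable_on {T0..T}"
      by (intro integrable_add integrable_const_ivl integrable_on_mult_right ln_integrable)
    fix t assume t: "t \<in> {T0..T}"
    have "norm (f t + of_real (ln T)) \<le> norm (f t + of_real (ln t)) + norm (complex_of_real (ln T - ln t))"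
      using norm_triangle_ineq[of "f t + of_real (ln t)" "complex_of_real (ln T - ln t)"] by (simp add: add.assoc)
    also have "\<dots> \<le> C + (ln T - ln t)" using f_near[OF t] t T unfolding norm_of_real by simp
    finally have "(norm (f t + of_real (ln T)))\<^sup>2 \<le> (C + (ln T - ln t))\<^sup>2" by (intro power_mono) auto
    also have "\<dots> \<le> 2 * C\<^sup>2 + 2 * (ln T - ln t)\<^sup>2"
      using zero_le_power2[of "C - (ln T - ln t)"] by (simp add: power2_eq_square algebra_simps)
    finally show "(norm (f t + of_real (ln T)))\<^sup>2 \<le> 2 * C\<^sup>2 + 2 * (ln T - ln t)\<^sup>2" .
  qed
  also have "\<dots> = 2 * C\<^sup>2 * (T - T0) + 2 * integral {T0..T} (\<lambda>t. (ln T - ln t)\<^sup>2)"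
    using T ln_integrable by (subst Henstock_Kurzweil_Integration.integral_add) (auto intro!: integrable_on_mult_right)
  also have "\<dots> \<le> 2 * C\<^sup>2 * T + 2 * (2 * T)"
    using T by (intro add_mono mult_left_mono integral_ln_ratio_squared_le) auto
  finally show ?thesis by (simp add: algebra_simps)
qed


subsection \<open>Mean squares over the resonant blocks\<close>

definition block :: "nat \<Rightarrow> real set" where
  "block n = {ln (real n - 1/2)..ln (real n + 1/2)}"

lemma nearest_nat_exp_block:
  assumes "y \<ge> 0"
  shows "y \<in> block (nearest_nat_exp y)"
proof -
  note n = nearest_nat_exp_ge_1[OF assms] abs_nearest_nat_exp_diff_le[OF assms]
  have "real (nearest_nat_exp y) - 1/2 \<le> exp y" "exp y \<le> real (nearest_nat_exp y) + 1/2" using n(2) by linarith+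
  then show ?thesis using n(1) by (simp add: block_def ln_le_iff_le_exp ln_ge_iff)
qed

lemma taper_le_on_block:
  assumes n: "n \<ge> 2" and y: "y \<in> block n" and Y: "Y > 0"
  shows "taper Y y \<le> taper Y (ln (real n)) + 1 / Y"
proof -
  have "real n \<le> (real n - 1/2) * exp 1"
    using n exp_ge_add_one_self[of "1::real"] mult_left_mono[of 2 "exp 1" "real n - 1/2"] by auto
  then have "ln (real n) \<le> ln ((real n - 1/2) * exp 1)" using n by (subst ln_le_cancel_iff) auto
  also have "\<dots> = ln (real n - 1/2) + 1" using n by (simp add: ln_mult)
  finally have "ln (real n) - 1 \<le> y" using y by (simp add: block_def)
  then have "ln (real n) / Y - 1 / Y \<le> y / Y"
    unfolding diff_divide_distrib[symmetric] using Y by (intro divide_right_mono) auto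
  moreover have "1 / Y \<ge> 0" using Y by simp
  ultimately show ?thesis unfolding taper_def by linarith
qed

lemma exp_powr_le_on_block:
  assumes n: "n \<ge> 1" and y: "y \<in> block n" and p: "0 \<le> p" "p \<le> 2"
  shows "exp (y * p) \<le> real n powr p * (1 + 2 / real n)"
proof -
  define x where "x = 1 / real n"
  have x: "0 < x" "x \<le> 1" using n by (auto simp: x_def)
  have "exp y \<le> exp (ln (real n + 1/2))" using y by (simp only: block_def exp_le_cancel_iff atLeastAtMost_iff)
  also have "\<dots> = real n * (1 + x / 2)" using n by (simp add: x_def distrib_left)
  finally have "exp y powr p \<le> (real n * (1 + x / 2)) powr p" using p by (intro powr_mono2) auto
  also have "\<dots> = real n powr p * (1 + x / 2) powr p" using x by (simp add: powr_mult)
  also have "\<dots> \<le> real n powr p * (1 + x / 2) powr 2" using p x by (intro mult_left_mono powr_mono) auto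
  also have "(1 + x / 2) powr 2 = 1 + x + x * x / 4" using x by (simp add: powr_numeral power2_eq_square algebra_simps)
  also have "\<dots> \<le> 1 + 2 * x" using x mult_left_mono[of x 1 x] by simp
  finally show ?thesis by (simp add: powr_def x_def mult.commute mult_left_mono)
qed

lemma resonant_coefficient_squared_le:
  assumes c: "1 < c" "c \<le> 3/2" and n: "n \<ge> 1" and y: "y \<in> block n"
  shows "(exp (y * (c - 1/2)) * (mangoldt n * real n powr (- c)) / (2 * pi))\<^sup>2 \<le> (mangoldt n)\<^sup>2 / real n * (1 + 2 / real n) / (4 * pi\<^sup>2)"
proof -
  have "(exp (y * (c - 1/2)))\<^sup>2 = exp (y * (2 * c - 1))"
    by (simp add: power2_eq_square mult_exp_exp algebra_simps)
  also have "\<dots> \<le> real n powr (2 * c - 1) * (1 + 2 / real n)"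
    using c by (intro exp_powr_le_on_block n y) auto
  finally have exp_le: "(exp (y * (c - 1/2)))\<^sup>2 \<le> real n powr (2 * c - 1) * (1 + 2 / real n)" .
  have "real n powr (2 * c - 1) * (real n powr (- c))\<^sup>2 = real n powr (2 * c - 1 + (- c + - c))"
    by (simp only: powr_add power2_eq_square)
  also have "2 * c - 1 + (- c + - c) = - 1" by simp
  finally have cancel: "real n powr (2 * c - 1) * (real n powr (- c))\<^sup>2 = 1 / real n" using n by (simp add: powr_minus_divide)
  have "(exp (y * (c - 1/2)) * (mangoldt n * real n powr (- c)) / (2 * pi))\<^sup>2 =
      (exp (y * (c - 1/2)))\<^sup>2 * ((mangoldt n)\<^sup>2 * (real n powr (- c))\<^sup>2 / (4 * pi\<^sup>2))"
    by (simp add: power_mult_distrib power_divide)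
  also have "\<dots> \<le> (real n powr (2 * c - 1) * (1 + 2 / real n)) * ((mangoldt n)\<^sup>2 * (real n powr (- c))\<^sup>2 / (4 * pi\<^sup>2))"
    using exp_le by (rule mult_right_mono) simp
  also have "\<dots> = (real n powr (2 * c - 1) * (real n powr (- c))\<^sup>2) * (mangoldt n)\<^sup>2 * (1 + 2 / real n) / (4 * pi\<^sup>2)"
    by (simp add: mult_ac)
  finally show ?thesis unfolding cancel by simp
qed

lemma norm_resonant_term_squared:
  "(norm (resonant_term c a b n y))\<^sup>2 =
    (exp (y * (c - 1/2)) * (mangoldt n * real n powr (- c)) / (2 * pi))\<^sup>2 * (norm (cis_integral a b (y - ln (real n))))\<^sup>2"
  unfolding resonant_term_def norm_mult norm_of_real power_mult_distrib by (simp only: power2_abs)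

lemma continuous_on_resonant_term: "continuous_on A (resonant_term c a b n)"
  unfolding resonant_term_def[abs_def] by (intro continuous_intros) auto

lemma integral_resonant_block_le:
  assumes c: "1 < c" "c \<le> 3/2" and n: "n \<ge> 2" and Y: "Y > 0" and T: "0 \<le> T0" "T0 \<le> T"
  shows "integral (block n) (\<lambda>y. (norm (resonant_term c T0 T n y))\<^sup>2 * taper Y y) \<le> T / (2 * pi) * resonant_weight Y n"
proof -
  define G where "G y = (norm (cis_integral T0 T (y - ln (real n))))\<^sup>2" for y
  define w where "w = taper Y (ln (real n)) + 1 / Y"
  define k where "k = (mangoldt n)\<^sup>2 / real n * (1 + 2 / real n) / (4 * pi\<^sup>2) * w"
  have k: "k \<ge> 0" using Y taper_nonneg[of Y "ln (real n)"] by (simp add: k_def w_def)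
  have G_cont: "continuous_on A G" for A unfolding G_def by (intro continuous_intros)
  have "integral (block n) (\<lambda>y. (norm (resonant_term c T0 T n y))\<^sup>2 * taper Y y) \<le> integral (block n) (\<lambda>y. k * G y)"
  proof (rule integral_le)
    show "(norm (resonant_term c T0 T n y))\<^sup>2 * taper Y y \<le> k * G y" if y: "y \<in> block n" for y
    proof -
      have "(exp (y * (c - 1/2)) * (mangoldt n * real n powr (- c)) / (2 * pi))\<^sup>2 * taper Y y \<le> k"
        unfolding k_def w_def using n y Y
        by (intro mult_mono resonant_coefficient_squared_le[OF c] taper_le_on_block taper_nonneg) auto
      then have "(exp (y * (c - 1/2)) * (mangoldt n * real n powr (- c)) / (2 * pi))\<^sup>2 * taper Y y * G y \<le> k * G y"
        by (rule mult_right_mono) (simp add: G_def)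
      then show ?thesis unfolding norm_resonant_term_squared G_def[symmetric] by (simp only: mult_ac)
    qed
  qed (auto simp: block_def intro!: integrable_continuous_interval continuous_intros G_cont continuous_on_resonant_term continuous_on_taper)
  also have "\<dots> = k * integral (block n) G" by simp
  also have "\<dots> \<le> k * (2 * pi * T)"
  proof (rule mult_left_mono[OF _ k])
    have "integral (block n) G \<le> integral {- ln (real n + 1/2)..ln (real n + 1/2)} G"
      unfolding block_def
    proof (intro integral_subset_le integrable_continuous_interval G_cont)
      have "0 \<le> ln (real n - 1/2)" "0 \<le> ln (real n + 1/2)" using n by auto
      then show "{ln (real n - 1/2)..ln (real n + 1/2)} \<subseteq> {- ln (real n + 1/2)..ln (real n + 1/2)}" by auto
    qed (simp add: G_def)
    also have "\<dots> \<le> 2 * pi * T" unfolding G_def by (rule integral_norm_cis_integral_squared_le[OF T])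
    finally show "integral (block n) G \<le> 2 * pi * T" .
  qed
  also have "\<dots> = T / (2 * pi) * resonant_weight Y n"
  proof -
    have "m / r * u / (4 * pi\<^sup>2) * w * (2 * pi * T) = T / (2 * pi) * (m / r * (w * u))" for m r u :: real
      by (cases "r = 0") (simp_all add: power2_eq_square field_simps)
    then show ?thesis unfolding k_def resonant_weight_def w_def .
  qed
  finally show ?thesis .
qed


subsection \<open>Assembling the mean square\<close>

lemma integral_restricted_interval_le:
  fixes g :: "real \<Rightarrow> real"
  assumes g: "continuous_on {a..b} g" "\<And>x. x \<in> {a..b} \<Longrightarrow> g x \<ge> 0"
  shows "(\<lambda>x. if x \<in> {a..b} then g x else 0) integrable_on {u..v}"
    and "integral {u..v} (\<lambda>x. if x \<in> {a..b} then g x else 0) \<le> integral {a..b} g"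
proof -
  have Int_eq: "{a..b} \<inter> {u..v} = {max a u..min b v}" by auto
  have integrable: "g integrable_on {max a u..min b v}"
    by (intro integrable_continuous_interval continuous_on_subset[OF g(1)]) auto
  show "(\<lambda>x. if x \<in> {a..b} then g x else 0) integrable_on {u..v}"
    unfolding integrable_restrict_Int Int_eq by (rule integrable)
  show "integral {u..v} (\<lambda>x. if x \<in> {a..b} then g x else 0) \<le> integral {a..b} g"
    unfolding integral_restrict_Int Int_eq
    using g by (intro integral_subset_le integrable integrable_continuous_interval) auto
qed

lemma square_add_le_weighted:
  fixes x y \<kappa> :: real
  assumes "\<kappa> > 0"
  shows "(x + y)\<^sup>2 \<le> (1 + \<kappa>) * x\<^sup>2 + (1 + 1 / \<kappa>) * y\<^sup>2"
proof -
  have "0 \<le> (\<kappa> * x - y)\<^sup>2 / \<kappa>" using assms by simp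
  also have "\<dots> = \<kappa> * x\<^sup>2 - 2 * x * y + y\<^sup>2 / \<kappa>"
    using assms by (simp add: power2_eq_square field_simps)
  finally show ?thesis by (simp add: power2_eq_square algebra_simps)
qed

lemma square_add3_le:
  fixes u v w :: real
  shows "(u + v + w)\<^sup>2 \<le> 3 * (u\<^sup>2 + (v\<^sup>2 + w\<^sup>2))"
  using zero_le_power2[of "u - v"] zero_le_power2[of "u - w"] zero_le_power2[of "v - w"]
  by (simp add: power2_eq_square algebra_simps)

lemma continuous_on_zero_sum [continuous_intros]: "continuous_on A f \<Longrightarrow> continuous_on A (\<lambda>x. zero_sum T (f x))"
  unfolding zero_sum_def by (intro continuous_intros)

lemma mult_sum_squares_le_power5:
  fixes b K L E Y :: real
  assumes "1 \<le> L" "0 \<le> Y" "Y \<le> L" "1 \<le> E"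
  shows "Y * ((b * L)\<^sup>2 + (K * L\<^sup>2 * E)\<^sup>2) \<le> (b\<^sup>2 + K\<^sup>2) * (L ^ 5 * E\<^sup>2)"
proof -
  have "Y * ((b * L)\<^sup>2 + (K * L\<^sup>2 * E)\<^sup>2) \<le> L * ((b * L)\<^sup>2 + (K * L\<^sup>2 * E)\<^sup>2)"
    using assms by (intro mult_right_mono) auto
  also have "\<dots> = b\<^sup>2 * (L ^ 3 * 1) + K\<^sup>2 * (L ^ 5 * E\<^sup>2)" by (simp add: eval_nat_numeral algebra_simps)
  also have "\<dots> \<le> b\<^sup>2 * (L ^ 5 * E\<^sup>2) + K\<^sup>2 * (L ^ 5 * E\<^sup>2)"
    using assms by (intro add_mono mult_left_mono mult_mono power_increasing) auto
  finally show ?thesis by (simp only: distrib_right)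
qed

text \<open>For \<open>y < ln (3/2)\<close> the logarithmic derivative of \<open>\<chi>\<close> dominates, for larger \<open>y\<close> the resonant
  prime powers do.\<close>

locale resonance =
  fixes c T0 T K C :: real
  assumes c_gt: "1 < c" and c_le: "c \<le> 3/2" and T0_ge: "1 \<le> T0" and T0_le: "T0 \<le> T" and K_nonneg: "K \<ge> 0"
    and zero_sum_approx: "\<And>y. y \<in> {0..ln T} \<Longrightarrow>
      norm (zero_sum T y + resonant_term c T0 T (nearest_nat_exp y) y + chi_term c T0 T y) \<le> K * (ln T)\<^sup>2 * exp (y * (c - 1/2))"
    and chi_logderiv_near: "\<And>t. t \<in> {T0..T} \<Longrightarrow> norm (chi_logderiv (Complex (1 - c) t) + of_real (ln t)) \<le> C"
begin

definition chi_deviation :: "real \<Rightarrow> complex" where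
  "chi_deviation = fourier_integral T0 T (\<lambda>t. chi_logderiv (Complex (1 - c) t) + of_real (ln T))"

definition low_term :: "real \<Rightarrow> real" where
  "low_term y = ln T / (2 * pi) * norm (cis_integral T0 T y)"

definition main_term :: "real \<Rightarrow> real" where
  "main_term y = (if y < ln (3/2) then low_term y else norm (resonant_term c T0 T (nearest_nat_exp y) y))"

definition main_majorant :: "real \<Rightarrow> real \<Rightarrow> real" where
  "main_majorant Y y = (if y \<in> {0..ln (3/2)} then (low_term y)\<^sup>2 else 0) +
     (\<Sum>n=2..nat \<lceil>exp Y\<rceil>. if y \<in> block n then (norm (resonant_term c T0 T n y))\<^sup>2 * taper Y y else 0)"

lemma ln_T_nonneg: "ln T \<ge> 0"
  using T0_ge T0_le by simp

lemma chi_logderiv_cont: "continuous_on {T0..T} (\<lambda>t. chi_logderiv (Complex (1 - c) t))"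
  using T0_ge by (intro continuous_on_chi_logderiv_vertical) auto

lemma norm_chi_term_le:
  assumes "y \<ge> 0"
  shows "norm (chi_term c T0 T y) \<le> norm (chi_deviation y) + low_term y"
proof -
  define q where "q = exp (- (y * (c - 1/2))) / (2 * pi)"
  have q: "0 \<le> q" "q \<le> 1 / (2 * pi)" using assms c_gt by (auto simp: q_def intro!: divide_right_mono)
  have "1 / (2 * pi) \<le> 1" using pi_ge_two by simp
  then have "q \<le> 1" using q(2) by linarith
  have "chi_deviation y = fourier_integral T0 T (\<lambda>t. chi_logderiv (Complex (1 - c) t)) y + of_real (ln T) * cis_integral T0 T y"
    unfolding chi_deviation_def using chi_logderiv_cont by (subst fourier_integral_add) (auto simp: fourier_integral_def)
  then have "chi_term c T0 T y = of_real q * chi_deviation y - of_real (q * ln T) * cis_integral T0 T y"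
    by (simp add: chi_term_def q_def algebra_simps)
  then have "norm (chi_term c T0 T y) \<le> q * norm (chi_deviation y) + q * ln T * norm (cis_integral T0 T y)"
    using norm_triangle_ineq4[of "of_real q * chi_deviation y" "of_real (q * ln T) * cis_integral T0 T y"] q(1) ln_T_nonneg
    by (simp add: norm_mult)
  also have "\<dots> \<le> 1 * norm (chi_deviation y) + 1 / (2 * pi) * ln T * norm (cis_integral T0 T y)"
    using q \<open>q \<le> 1\<close> ln_T_nonneg by (intro add_mono mult_right_mono) auto
  finally show ?thesis by (simp add: low_term_def)
qed

lemma low_term_le:
  assumes "y \<ge> ln (3/2)"
  shows "low_term y \<le> ln T / (pi * ln (3/2))"
proof -
  have pos: "ln (3/2 :: real) > 0" by simp
  then have "y > 0" using assms by linarith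
  then have "norm (cis_integral T0 T y) \<le> 2 / \<bar>y\<bar>" using T0_le by (intro norm_cis_integral_le_inverse) auto
  also have "\<dots> \<le> 2 / ln (3/2)" using assms pos \<open>y > 0\<close> by (intro divide_left_mono mult_pos_pos) auto
  finally have "low_term y \<le> ln T / (2 * pi) * (2 / ln (3/2))"
    unfolding low_term_def using ln_T_nonneg by (intro mult_left_mono) auto
  then show ?thesis by simp
qed

lemma nearest_nat_exp_eq_1:
  assumes "0 \<le> y" "y < ln (3/2)"
  shows "nearest_nat_exp y = 1"
proof -
  have "exp y < 3/2" using assms(2) by (metis exp_less_cancel_iff exp_ln zero_less_divide_iff zero_less_numeral)
  then have "round (exp y) < 2" by (simp add: round_def floor_less_iff)
  then show ?thesis using nearest_nat_exp_ge_1[OF assms(1)] by (simp add: nearest_nat_exp_def)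
qed

lemma norm_zero_sum_le:
  assumes y: "y \<in> {0..Y}" and Y: "Y \<le> ln T"
  shows "norm (zero_sum T y) \<le> main_term y + (norm (chi_deviation y) + ln T / (pi * ln (3/2)) + K * (ln T)\<^sup>2 * exp (Y * (c - 1/2)))"
proof -
  define r where "r = resonant_term c T0 T (nearest_nat_exp y) y"
  have "K * (ln T)\<^sup>2 * exp (y * (c - 1/2)) \<le> K * (ln T)\<^sup>2 * exp (Y * (c - 1/2))"
    using y c_gt K_nonneg by (intro mult_left_mono) (auto intro!: mult_right_mono)
  then have "norm (zero_sum T y + r + chi_term c T0 T y) \<le> K * (ln T)\<^sup>2 * exp (Y * (c - 1/2))"
    using zero_sum_approx[of y] y Y unfolding r_def by simp
  moreover have "norm (zero_sum T y) \<le> norm (zero_sum T y + r + chi_term c T0 T y) + norm r + norm (chi_term c T0 T y)"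
    using norm_triangle_ineq4[of "zero_sum T y + r + chi_term c T0 T y" "r + chi_term c T0 T y"]
      norm_triangle_ineq[of r "chi_term c T0 T y"] by simp
  ultimately have bound: "norm (zero_sum T y) \<le> norm r + low_term y + norm (chi_deviation y) + K * (ln T)\<^sup>2 * exp (Y * (c - 1/2))"
    using norm_chi_term_le[of y] y by simp
  show ?thesis
  proof (cases "y < ln (3/2)")
    case True
    then have "r = 0" using nearest_nat_exp_eq_1[of y] y by (simp add: r_def resonant_term_def)
    moreover have "0 \<le> ln T / (pi * ln (3/2))" using ln_T_nonneg by (intro divide_nonneg_nonneg mult_nonneg_nonneg) auto
    ultimately show ?thesis using True bound by (simp add: main_term_def)
  next
    case False
    then show ?thesis using bound low_term_le[of y] by (simp add: main_term_def r_def)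
  qed
qed

lemma main_term_squared_le_majorant:
  assumes y: "y \<in> {0..Y}" and Y: "Y > 0"
  shows "(main_term y)\<^sup>2 * taper Y y \<le> main_majorant Y y"
proof -
  define m where "m n = (if y \<in> block n then (norm (resonant_term c T0 T n y))\<^sup>2 * taper Y y else 0)" for n
  have m: "m n \<ge> 0" for n using taper_nonneg by (simp add: m_def)
  show ?thesis
  proof (cases "y < ln (3/2)")
    case True
    have "(main_term y)\<^sup>2 * taper Y y \<le> (main_term y)\<^sup>2 * 1" using y Y by (intro mult_left_mono taper_le_1) auto
    also have "\<dots> \<le> main_majorant Y y"
      using True y m by (auto simp: main_term_def main_majorant_def m_def[symmetric] intro: sum_nonneg)
    finally show ?thesis .
  next
    case False
    define n where "n = nearest_nat_exp y"
    have "exp y \<ge> 3/2" using False by (metis exp_le_cancel_iff exp_ln not_le zero_less_divide_iff zero_less_numeral)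
    then have "round (exp y) \<ge> 2" by (simp add: round_def le_floor_iff)
    then have "n \<ge> 2" by (simp add: n_def nearest_nat_exp_def)
    have "exp y \<le> real (nat \<lceil>exp Y\<rceil>)" using y by (intro order_trans[OF _ real_nat_ceiling_ge]) simp
    then have "round (exp y) \<le> round (real (nat \<lceil>exp Y\<rceil>))" by (rule round_mono)
    then have "n \<le> nat \<lceil>exp Y\<rceil>" by (simp add: n_def nearest_nat_exp_def)
    with \<open>n \<ge> 2\<close> have "m n \<le> (\<Sum>n=2..nat \<lceil>exp Y\<rceil>. m n)" using m by (intro member_le_sum) auto
    moreover have "(main_term y)\<^sup>2 * taper Y y = m n"
      using False nearest_nat_exp_block[of y] y by (simp add: main_term_def m_def n_def)
    ultimately show ?thesis by (auto simp: main_majorant_def m_def[symmetric] intro: add_increasing)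
  qed
qed

lemma integral_low_term_squared_le:
  defines "low \<equiv> \<lambda>y. if y \<in> {0..ln (3/2)} then (low_term y)\<^sup>2 else 0"
  shows "low integrable_on {0..Y}" "integral {0..Y} low \<le> T * (ln T)\<^sup>2 / (4 * pi)"
proof -
  have cont: "continuous_on A (\<lambda>y. (low_term y)\<^sup>2)" for A unfolding low_term_def by (intro continuous_intros) auto
  show "low integrable_on {0..Y}" unfolding low_def by (intro integral_restricted_interval_le cont) simp
  have "integral {0..Y} low \<le> integral {0..ln (3/2)} (\<lambda>y. (low_term y)\<^sup>2)"
    unfolding low_def by (intro integral_restricted_interval_le cont) simp
  also have "\<dots> = (ln T / (2 * pi))\<^sup>2 * integral {0..ln (3/2)} (\<lambda>y. (norm (cis_integral T0 T y))\<^sup>2)"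
    unfolding low_term_def power_mult_distrib by (rule integral_mult_right)
  also have "\<dots> \<le> (ln T / (2 * pi))\<^sup>2 * (pi * T)"
    using T0_ge T0_le by (intro mult_left_mono integral_norm_cis_integral_squared_half_le) auto
  also have "\<dots> = T * (ln T)\<^sup>2 / (4 * pi)" by (simp add: power2_eq_square)
  finally show "integral {0..Y} low \<le> T * (ln T)\<^sup>2 / (4 * pi)" .
qed

lemma integral_main_majorant_le:
  assumes Y: "Y > 0"
  shows "main_majorant Y integrable_on {0..Y}"
    "integral {0..Y} (main_majorant Y) \<le> T * (ln T)\<^sup>2 / (4 * pi) + T / (2 * pi) * (\<Sum>n=2..nat \<lceil>exp Y\<rceil>. resonant_weight Y n)"
proof -
  define low where "low y = (if y \<in> {0..ln (3/2)} then (low_term y)\<^sup>2 else 0)" for y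
  define m where "m n y = (if y \<in> block n then (norm (resonant_term c T0 T n y))\<^sup>2 * taper Y y else 0)" for n y
  have T: "0 \<le> T0" "T0 \<le> T" using T0_ge T0_le by auto
  have low_int: "low integrable_on {0..Y}" "integral {0..Y} low \<le> T * (ln T)\<^sup>2 / (4 * pi)"
    unfolding low_def by (rule integral_low_term_squared_le)+
  have m_int: "m n integrable_on {0..Y}" "integral {0..Y} (m n) \<le> T / (2 * pi) * resonant_weight Y n" if "n \<ge> 2" for n
  proof -
    have cont: "continuous_on A (\<lambda>y. (norm (resonant_term c T0 T n y))\<^sup>2 * taper Y y)" for A
      by (intro continuous_intros continuous_on_resonant_term continuous_on_taper)
    show "m n integrable_on {0..Y}"
      unfolding m_def block_def by (intro integral_restricted_interval_le cont) (simp add: taper_nonneg)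
    have "integral {0..Y} (m n) \<le> integral (block n) (\<lambda>y. (norm (resonant_term c T0 T n y))\<^sup>2 * taper Y y)"
      unfolding m_def block_def by (intro integral_restricted_interval_le cont) (simp add: taper_nonneg)
    also have "\<dots> \<le> T / (2 * pi) * resonant_weight Y n"
      by (rule integral_resonant_block_le[OF c_gt c_le that Y T])
    finally show "integral {0..Y} (m n) \<le> T / (2 * pi) * resonant_weight Y n" .
  qed
  have "((\<lambda>y. low y + (\<Sum>n=2..nat \<lceil>exp Y\<rceil>. m n y)) has_integral
      integral {0..Y} low + (\<Sum>n=2..nat \<lceil>exp Y\<rceil>. integral {0..Y} (m n))) {0..Y}"
    by (intro has_integral_add has_integral_sum integrable_integral low_int m_int) auto
  then have majorant: "(main_majorant Y has_integral integral {0..Y} low + (\<Sum>n=2..nat \<lceil>exp Y\<rceil>. integral {0..Y} (m n))) {0..Y}"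
    by (simp add: main_majorant_def[abs_def] low_def m_def)
  then show "main_majorant Y integrable_on {0..Y}" by blast
  have "integral {0..Y} (main_majorant Y) = integral {0..Y} low + (\<Sum>n=2..nat \<lceil>exp Y\<rceil>. integral {0..Y} (m n))"
    using majorant by (rule integral_unique)
  also have "\<dots> \<le> T * (ln T)\<^sup>2 / (4 * pi) + (\<Sum>n=2..nat \<lceil>exp Y\<rceil>. T / (2 * pi) * resonant_weight Y n)"
    by (intro add_mono low_int sum_mono m_int) auto
  finally show "integral {0..Y} (main_majorant Y) \<le> T * (ln T)\<^sup>2 / (4 * pi) + T / (2 * pi) * (\<Sum>n=2..nat \<lceil>exp Y\<rceil>. resonant_weight Y n)"
    by (simp only: sum_distrib_left)
qed

lemma integral_norm_chi_deviation_squared_le: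
  assumes "Y \<ge> 0"
  shows "(\<lambda>y. (norm (chi_deviation y))\<^sup>2) integrable_on {0..Y}"
    "integral {0..Y} (\<lambda>y. (norm (chi_deviation y))\<^sup>2) \<le> 2 * pi * ((2 * C\<^sup>2 + 4) * T)"
proof -
  have cont: "continuous_on A (\<lambda>y. (norm (chi_deviation y))\<^sup>2)" for A
    unfolding chi_deviation_def by (intro continuous_intros chi_logderiv_cont)
  then show "(\<lambda>y. (norm (chi_deviation y))\<^sup>2) integrable_on {0..Y}" by (intro integrable_continuous_interval)
  have "integral {0..Y} (\<lambda>y. (norm (chi_deviation y))\<^sup>2) \<le> integral {-Y..Y} (\<lambda>y. (norm (chi_deviation y))\<^sup>2)"
    using assms by (intro integral_subset_le integrable_continuous_interval cont) auto
  also have "\<dots> \<le> 2 * pi * ((2 * C\<^sup>2 + 4) * T)"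
    unfolding chi_deviation_def using T0_ge T0_le
    by (intro integral_norm_fourier_integral_ln_deviation_le chi_logderiv_near chi_logderiv_cont) auto
  finally show "integral {0..Y} (\<lambda>y. (norm (chi_deviation y))\<^sup>2) \<le> 2 * pi * ((2 * C\<^sup>2 + 4) * T)" .
qed

theorem integral_norm_zero_sum_squared_le:
  assumes \<kappa>: "\<kappa> > 0" and Y: "0 < Y" "Y \<le> ln T"
  defines "E \<equiv> (ln T / (pi * ln (3/2)))\<^sup>2 + (K * (ln T)\<^sup>2 * exp (Y * (c - 1/2)))\<^sup>2"
  shows "integral {0..Y} (\<lambda>y. (norm (zero_sum T y))\<^sup>2 * taper Y y) \<le>
    (1 + \<kappa>) * (T * (ln T)\<^sup>2 / (4 * pi) + T / (2 * pi) * (\<Sum>n=2..nat \<lceil>exp Y\<rceil>. resonant_weight Y n))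
    + (1 + 1 / \<kappa>) * (3 * (2 * pi * ((2 * C\<^sup>2 + 4) * T) + Y * E))"
proof -
  have pointwise: "(norm (zero_sum T y))\<^sup>2 * taper Y y \<le>
      (1 + \<kappa>) * main_majorant Y y + (1 + 1 / \<kappa>) * (3 * ((norm (chi_deviation y))\<^sup>2 + E))" if y: "y \<in> {0..Y}" for y
  proof -
    define u where "u = norm (chi_deviation y) + ln T / (pi * ln (3/2)) + K * (ln T)\<^sup>2 * exp (Y * (c - 1/2))"
    have t: "0 \<le> taper Y y" "taper Y y \<le> 1" using y Y taper_nonneg taper_le_1 by auto
    have "(norm (zero_sum T y))\<^sup>2 \<le> (main_term y + u)\<^sup>2"
      using norm_zero_sum_le[OF y Y(2)] by (intro power_mono) (auto simp: u_def)
    also have "\<dots> \<le> (1 + \<kappa>) * (main_term y)\<^sup>2 + (1 + 1 / \<kappa>) * u\<^sup>2" by (rule square_add_le_weighted[OF \<kappa>])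
    finally have "(norm (zero_sum T y))\<^sup>2 * taper Y y \<le> ((1 + \<kappa>) * (main_term y)\<^sup>2 + (1 + 1 / \<kappa>) * u\<^sup>2) * taper Y y"
      using t(1) by (rule mult_right_mono)
    also have "\<dots> = (1 + \<kappa>) * ((main_term y)\<^sup>2 * taper Y y) + (1 + 1 / \<kappa>) * u\<^sup>2 * taper Y y" by (simp only: distrib_right mult.assoc)
    also have "\<dots> \<le> (1 + \<kappa>) * main_majorant Y y + (1 + 1 / \<kappa>) * u\<^sup>2 * 1"
      using \<kappa> t Y by (intro add_mono mult_left_mono main_term_squared_le_majorant y) auto
    also have "\<dots> \<le> (1 + \<kappa>) * main_majorant Y y + (1 + 1 / \<kappa>) * (3 * ((norm (chi_deviation y))\<^sup>2 + E))"
      using \<kappa> square_add3_le[of "norm (chi_deviation y)"] unfolding u_def E_def mult_1_right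
      by (intro add_left_mono mult_left_mono) auto
    finally show ?thesis .
  qed
  have majorant: "((\<lambda>y. (1 + \<kappa>) * main_majorant Y y + (1 + 1 / \<kappa>) * (3 * ((norm (chi_deviation y))\<^sup>2 + E))) has_integral
      (1 + \<kappa>) * integral {0..Y} (main_majorant Y) + (1 + 1 / \<kappa>) * (3 * (integral {0..Y} (\<lambda>y. (norm (chi_deviation y))\<^sup>2) + (Y - 0) *\<^sub>R E))) {0..Y}"
    using has_integral_const_real[of E 0 Y] Y integral_norm_chi_deviation_squared_le(1)[of Y]
    by (intro has_integral_add has_integral_mult_right integrable_integral integral_main_majorant_le) auto
  have "((\<lambda>y. (norm (zero_sum T y))\<^sup>2 * taper Y y) has_integral integral {0..Y} (\<lambda>y. (norm (zero_sum T y))\<^sup>2 * taper Y y)) {0..Y}"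
    by (intro integrable_integral integrable_continuous_interval continuous_intros continuous_on_taper)
  from has_integral_le[OF this majorant pointwise]
  have "integral {0..Y} (\<lambda>y. (norm (zero_sum T y))\<^sup>2 * taper Y y) \<le>
      (1 + \<kappa>) * integral {0..Y} (main_majorant Y) + (1 + 1 / \<kappa>) * (3 * (integral {0..Y} (\<lambda>y. (norm (chi_deviation y))\<^sup>2) + (Y - 0) *\<^sub>R E))" .
  also have "\<dots> \<le> (1 + \<kappa>) * (T * (ln T)\<^sup>2 / (4 * pi) + T / (2 * pi) * (\<Sum>n=2..nat \<lceil>exp Y\<rceil>. resonant_weight Y n))
      + (1 + 1 / \<kappa>) * (3 * (2 * pi * ((2 * C\<^sup>2 + 4) * T) + Y * E))"
    using \<kappa> Y by (intro add_mono mult_left_mono integral_main_majorant_le integral_norm_chi_deviation_squared_le) auto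
  finally show ?thesis .
qed

theorem integral_norm_zero_sum_squared_le_explicit:
  assumes \<kappa>: "\<kappa> > 0" and Y: "1 \<le> Y" "Y \<le> ln T"
    and D: "D \<ge> 0" "(\<Sum>n=2..nat \<lceil>exp Y\<rceil>. resonant_weight Y n) \<le> Y\<^sup>2 / 6 + D * Y"
  defines "A \<equiv> (1 + \<kappa>) * D + 3 * (1 + 1 / \<kappa>) * (2 * pi * (2 * C\<^sup>2 + 4) + ((1 / (pi * ln (3/2)))\<^sup>2 + K\<^sup>2))"
  shows "integral {0..Y} (\<lambda>y. (norm (zero_sum T y))\<^sup>2 * taper Y y) \<le>
    (1 + \<kappa>) * (T * (ln T)\<^sup>2 / (4 * pi) + T * Y\<^sup>2 / (12 * pi)) + A * (T * ln T + (ln T) ^ 5 * (exp (Y * (c - 1/2)))\<^sup>2)"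
proof -
  define L where "L = ln T"
  define B where "B = T * L + L ^ 5 * (exp (Y * (c - 1/2)))\<^sup>2"
  have L: "1 \<le> L" "Y \<le> L" using Y by (auto simp: L_def)
  have "T > 0" using T0_ge T0_le by linarith
  then have B: "T * L \<le> B" "L ^ 5 * (exp (Y * (c - 1/2)))\<^sup>2 \<le> B" using L by (auto simp: B_def)
  have "T \<le> T * L" using \<open>T > 0\<close> L by simp
  with B have T_le: "T \<le> B" by linarith
  have "Y * ((1 / (pi * ln (3/2)) * L)\<^sup>2 + (K * L\<^sup>2 * exp (Y * (c - 1/2)))\<^sup>2)
      \<le> ((1 / (pi * ln (3/2)))\<^sup>2 + K\<^sup>2) * (L ^ 5 * (exp (Y * (c - 1/2)))\<^sup>2)"
    using Y L c_gt by (intro mult_sum_squares_le_power5) auto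
  also have "\<dots> \<le> ((1 / (pi * ln (3/2)))\<^sup>2 + K\<^sup>2) * B" by (intro mult_left_mono B) auto
  finally have error_le: "Y * ((L / (pi * ln (3/2)))\<^sup>2 + (K * L\<^sup>2 * exp (Y * (c - 1/2)))\<^sup>2)
      \<le> ((1 / (pi * ln (3/2)))\<^sup>2 + K\<^sup>2) * B" by simp
  have "T / (2 * pi) * (\<Sum>n=2..nat \<lceil>exp Y\<rceil>. resonant_weight Y n) \<le> T / (2 * pi) * (Y\<^sup>2 / 6 + D * Y)"
    using \<open>T > 0\<close> by (intro mult_left_mono D(2)) auto
  also have "\<dots> = T * Y\<^sup>2 / (12 * pi) + D * (T / (2 * pi) * Y)" by (simp add: field_simps)
  also have "D * (T / (2 * pi) * Y) \<le> D * (T * L)"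
    using \<open>T > 0\<close> Y L D(1) pi_ge_two by (intro mult_left_mono mult_mono) (auto simp: divide_le_eq mult_le_cancel_left1)
  also have "D * (T * L) \<le> D * B" using D(1) B by (intro mult_left_mono)
  finally have main_le: "T / (2 * pi) * (\<Sum>n=2..nat \<lceil>exp Y\<rceil>. resonant_weight Y n) \<le> T * Y\<^sup>2 / (12 * pi) + D * B" by simp
  have "0 < Y" using Y by simp
  from integral_norm_zero_sum_squared_le[OF \<kappa> this Y(2)]
  have "integral {0..Y} (\<lambda>y. (norm (zero_sum T y))\<^sup>2 * taper Y y) \<le>
      (1 + \<kappa>) * (T * L\<^sup>2 / (4 * pi) + T / (2 * pi) * (\<Sum>n=2..nat \<lceil>exp Y\<rceil>. resonant_weight Y n))
      + (1 + 1 / \<kappa>) * (3 * (2 * pi * ((2 * C\<^sup>2 + 4) * T) + Y * ((L / (pi * ln (3/2)))\<^sup>2 + (K * L\<^sup>2 * exp (Y * (c - 1/2)))\<^sup>2)))"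
    unfolding L_def .
  also have "\<dots> \<le> (1 + \<kappa>) * (T * L\<^sup>2 / (4 * pi) + (T * Y\<^sup>2 / (12 * pi) + D * B))
      + (1 + 1 / \<kappa>) * (3 * (2 * pi * ((2 * C\<^sup>2 + 4) * B) + ((1 / (pi * ln (3/2)))\<^sup>2 + K\<^sup>2) * B))"
    using \<kappa> by (intro add_mono mult_left_mono main_le error_le T_le order_refl) auto
  also have "\<dots> = (1 + \<kappa>) * (T * L\<^sup>2 / (4 * pi) + T * Y\<^sup>2 / (12 * pi)) + A * B"
    unfolding A_def by (simp only: distrib_left distrib_right mult.assoc mult.left_commute[of 3] add.assoc)
  finally show ?thesis unfolding B_def L_def .
qed

end

lemma exists_resonance:
  assumes RH: "riemann_hypothesis" and c: "1 < c" "c \<le> 3/2"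
  shows "\<exists>T0 K C. \<forall>T\<ge>6. resonance c T0 T K C"
proof -
  obtain T0 K where T0: "4 \<le> T0" "T0 \<le> 5" and K: "0 \<le> K" and approx: "\<And>T y. T \<ge> 6 \<Longrightarrow> y \<in> {0..ln T} \<Longrightarrow>
      norm (zero_sum T y + resonant_term c T0 T (nearest_nat_exp y) y + chi_term c T0 T y) \<le> K * (ln T)\<^sup>2 * exp (y * (c - 1/2))"
    using landau_gonek_formula[OF RH c] by blast
  obtain C where C: "\<And>s. \<bar>Re s\<bar> \<le> 2 \<Longrightarrow> Im s \<ge> 1 \<Longrightarrow> norm (chi_logderiv s + of_real (ln (Im s))) \<le> C"
    using norm_chi_logderiv_le by blast
  have "resonance c T0 T K C" if "T \<ge> 6" for T
  proof
    show "norm (chi_logderiv (Complex (1 - c) t) + of_real (ln t)) \<le> C" if "t \<in> {T0..T}" for t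
      using C[of "Complex (1 - c) t"] that T0 c by (simp add: abs_le_iff)
  qed (use T0 K c approx that in auto)
  then show ?thesis by blast
qed

lemma zero_sum_mean_square_explicit:
  assumes RH: "riemann_hypothesis" and \<Delta>: "0 < \<Delta>" "\<Delta> < 1" and \<kappa>: "\<kappa> > 0"
  shows "\<exists>A \<theta>. \<theta> < 1 \<and> (\<forall>T\<ge>6. \<Delta> * ln T \<ge> 1 \<longrightarrow>
    integral {0..\<Delta> * ln T} (\<lambda>y. (norm (zero_sum T y))\<^sup>2 * taper (\<Delta> * ln T) y)
      \<le> (1 + \<kappa>) * (1 + \<Delta>\<^sup>2 / 3) * (T * (ln T)\<^sup>2 / (4 * pi)) + A * (T * ln T + (ln T) ^ 5 * T powr \<theta>))"
proof -
  define c where "c = min (3/2) (3/4 + 1 / (4 * \<Delta>))"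
  define \<theta> where "\<theta> = \<Delta> * (2 * c - 1)"
  have c: "1 < c" "c \<le> 3/2" using \<Delta> by (auto simp: c_def field_simps)
  have "\<Delta> * (2 * c - 1) \<le> \<Delta> * (2 * (3/4 + 1 / (4 * \<Delta>)) - 1)"
    using \<Delta> by (intro mult_left_mono diff_right_mono) (auto simp: c_def)
  also have "\<dots> = \<Delta> / 2 + 1 / 2" using \<Delta> by (simp add: field_simps)
  finally have "\<theta> < 1" using \<Delta> by (simp add: \<theta>_def)
  obtain T0 K C where resonance: "\<And>T. T \<ge> 6 \<Longrightarrow> resonance c T0 T K C"
    using exists_resonance[OF RH c] by blast
  obtain D where D: "D \<ge> 0" "\<And>Y. Y \<ge> 1 \<Longrightarrow> (\<Sum>n=2..nat \<lceil>exp Y\<rceil>. resonant_weight Y n) \<le> Y\<^sup>2 / 6 + D * Y"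
    using sum_resonant_weight_le by blast
  define A where "A = (1 + \<kappa>) * D + 3 * (1 + 1 / \<kappa>) * (2 * pi * (2 * C\<^sup>2 + 4) + ((1 / (pi * ln (3/2)))\<^sup>2 + K\<^sup>2))"
  have "integral {0..\<Delta> * ln T} (\<lambda>y. (norm (zero_sum T y))\<^sup>2 * taper (\<Delta> * ln T) y)
      \<le> (1 + \<kappa>) * (1 + \<Delta>\<^sup>2 / 3) * (T * (ln T)\<^sup>2 / (4 * pi)) + A * (T * ln T + (ln T) ^ 5 * T powr \<theta>)"
    if T: "T \<ge> 6" and Y: "\<Delta> * ln T \<ge> 1" for T
  proof -
    interpret resonance c T0 T K C by (rule resonance[OF T])
    have "\<Delta> * ln T \<le> ln T" using \<Delta> T by (simp add: mult_le_cancel_right1)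
    from integral_norm_zero_sum_squared_le_explicit[OF \<kappa> Y this D(1) D(2)[OF Y], folded A_def]
    have "integral {0..\<Delta> * ln T} (\<lambda>y. (norm (zero_sum T y))\<^sup>2 * taper (\<Delta> * ln T) y)
      \<le> (1 + \<kappa>) * (T * (ln T)\<^sup>2 / (4 * pi) + T * (\<Delta> * ln T)\<^sup>2 / (12 * pi))
        + A * (T * ln T + (ln T) ^ 5 * (exp (\<Delta> * ln T * (c - 1/2)))\<^sup>2)" .
    also have "(exp (\<Delta> * ln T * (c - 1/2)))\<^sup>2 = T powr \<theta>"
      using T by (simp add: power2_eq_square mult_exp_exp powr_def \<theta>_def algebra_simps)
    also have "(1 + \<kappa>) * (T * (ln T)\<^sup>2 / (4 * pi) + T * (\<Delta> * ln T)\<^sup>2 / (12 * pi)) =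
        (1 + \<kappa>) * (1 + \<Delta>\<^sup>2 / 3) * (T * (ln T)\<^sup>2 / (4 * pi))"
      by (simp add: power_mult_distrib field_simps)
    finally show ?thesis .
  qed
  then show ?thesis using \<open>\<theta> < 1\<close> by blast
qed

theorem zero_sum_mean_square:
  assumes RH: "riemann_hypothesis" and \<Delta>: "0 < \<Delta>" "\<Delta> < 1" and \<epsilon>: "\<epsilon> > 0"
  shows "eventually (\<lambda>T. integral {0..\<Delta> * ln T} (\<lambda>y. (norm (zero_sum T y))\<^sup>2 * taper (\<Delta> * ln T) y)
     \<le> (1 + \<Delta>\<^sup>2 / 3 + \<epsilon>) * (T * (ln T)\<^sup>2 / (4 * pi))) at_top"
proof -
  define B \<kappa> where "B = 1 + \<Delta>\<^sup>2 / 3" and "\<kappa> = \<epsilon> / (2 * B)"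
  have B: "B > 0" by (simp add: B_def add_pos_nonneg)
  then have \<kappa>: "\<kappa> > 0" "(1 + \<kappa>) * B = B + \<epsilon> / 2" using \<epsilon> by (auto simp: \<kappa>_def distrib_right)
  obtain C \<theta> where \<theta>: "\<theta> < 1" and bound: "\<And>T. T \<ge> 6 \<Longrightarrow> \<Delta> * ln T \<ge> 1 \<Longrightarrow>
    integral {0..\<Delta> * ln T} (\<lambda>y. (norm (zero_sum T y))\<^sup>2 * taper (\<Delta> * ln T) y)
      \<le> (1 + \<kappa>) * B * (T * (ln T)\<^sup>2 / (4 * pi)) + C * (T * ln T + (ln T) ^ 5 * T powr \<theta>)"
    using zero_sum_mean_square_explicit[OF RH \<Delta> \<kappa>(1)] unfolding B_def by blast
  have "((\<lambda>T. (T * ln T + (ln T) ^ 5 * T powr \<theta>) / (T * (ln T)\<^sup>2 / (4 * pi))) \<longlongrightarrow> 0) at_top"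
    using \<theta> by real_asymp
  from tendsto_mult_left[OF this, of C]
  have "((\<lambda>T. C * ((T * ln T + (ln T) ^ 5 * T powr \<theta>) / (T * (ln T)\<^sup>2 / (4 * pi)))) \<longlongrightarrow> 0) at_top" by simp
  then have "eventually (\<lambda>T. C * ((T * ln T + (ln T) ^ 5 * T powr \<theta>) / (T * (ln T)\<^sup>2 / (4 * pi))) < \<epsilon> / 2) at_top"
    using \<epsilon> by (intro order_tendstoD) auto
  moreover have "eventually (\<lambda>T. \<Delta> * ln T \<ge> 1) at_top" using \<Delta> by real_asymp
  ultimately show ?thesis using eventually_ge_at_top[of 6]
  proof eventually_elim
    case (elim T)
    define M where "M = T * (ln T)\<^sup>2 / (4 * pi)"
    have "M > 0" using elim(3) by (simp add: M_def)
    then have "C * (T * ln T + (ln T) ^ 5 * T powr \<theta>) < \<epsilon> / 2 * M"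
      using elim(1) unfolding M_def[symmetric] by (simp only: times_divide_eq_right pos_divide_less_eq)
    then have "integral {0..\<Delta> * ln T} (\<lambda>y. (norm (zero_sum T y))\<^sup>2 * taper (\<Delta> * ln T) y) \<le> (B + \<epsilon> / 2) * M + \<epsilon> / 2 * M"
      using bound[OF elim(3,2)] unfolding \<kappa>(2) M_def[symmetric] by linarith
    also have "\<dots> = (1 + \<Delta>\<^sup>2 / 3 + \<epsilon>) * M" by (simp add: B_def algebra_simps)
    finally show ?case by (simp only: M_def)
  qed
qed

section \<open>The number of zeros\<close>

definition zero_count :: "real \<Rightarrow> real" where
  "zero_count T = (\<Sum>\<rho>\<in>zeros_upto T. real (zero_mult \<rho>))"

lemma zero_sum_0: "zero_sum T 0 = of_real (zero_count T)"
  by (simp add: zero_sum_def zero_count_def)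

lemma has_integral_ln:
  fixes a b :: real
  assumes "0 < a" "a \<le> b"
  shows "(ln has_integral (b * ln b - b) - (a * ln a - a)) {a..b}"
proof (rule fundamental_theorem_of_calculus[OF \<open>a \<le> b\<close>])
  fix t assume "t \<in> {a..b}"
  then show "((\<lambda>t. t * ln t - t) has_vector_derivative ln t) (at t within {a..b})"
    using assms unfolding has_real_derivative_iff_has_vector_derivative[symmetric]
    by (auto intro!: derivative_eq_intros)
qed

lemma Re_integral_chi_logderiv_le:
  "\<exists>C\<ge>0. \<forall>\<sigma> a b. \<bar>\<sigma>\<bar> \<le> 2 \<and> 1 \<le> a \<and> a \<le> b \<longrightarrow>
     Re (integral {a..b} (\<lambda>t. chi_logderiv (Complex \<sigma> t))) \<le> C * (b - a) - ((b * ln b - b) - (a * ln a - a))"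
proof -
  obtain C where "C \<ge> 0" and C: "\<And>s. \<bar>Re s\<bar> \<le> 2 \<and> Im s \<ge> 1 \<Longrightarrow> norm (chi_logderiv s + of_real (ln (Im s))) \<le> C"
    using norm_chi_logderiv_le by blast
  have "Re (integral {a..b} (\<lambda>t. chi_logderiv (Complex \<sigma> t))) \<le> C * (b - a) - ((b * ln b - b) - (a * ln a - a))"
    if \<sigma>: "\<bar>\<sigma>\<bar> \<le> 2" and ab: "1 \<le> a" "a \<le> b" for \<sigma> a b
  proof (rule has_integral_le)
    show "((\<lambda>t. Re (chi_logderiv (Complex \<sigma> t))) has_integral
        Re (integral {a..b} (\<lambda>t. chi_logderiv (Complex \<sigma> t)))) {a..b}"
      using ab by (intro has_integral_Re integrable_integral integrable_continuous_interval
          continuous_on_chi_logderiv_vertical) auto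
    have "((\<lambda>t. C) has_integral C * (b - a)) {a..b}"
      using has_integral_const_real[of C a b] ab by (simp add: mult.commute)
    then show "((\<lambda>t. C - ln t) has_integral C * (b - a) - ((b * ln b - b) - (a * ln a - a))) {a..b}"
      using ab by (intro has_integral_diff has_integral_ln) auto
    show "Re (chi_logderiv (Complex \<sigma> t)) \<le> C - ln t" if "t \<in> {a..b}" for t
    proof -
      have "Re (chi_logderiv (Complex \<sigma> t) + of_real (ln t)) \<le> C"
        using order_trans[OF complex_Re_le_cmod C[of "Complex \<sigma> t"]] that \<sigma> ab by simp
      then show ?thesis by simp
    qed
  qed
  then show ?thesis using \<open>C \<ge> 0\<close> by blast
qed

lemma eventually_zero_count_ge:
  assumes "riemann_hypothesis" and "\<epsilon> > 0"
  shows "eventually (\<lambda>T. (1 - \<epsilon>) * (T * ln T / (2 * pi)) \<le> zero_count T) at_top"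
proof -
  obtain T0 K where T0: "4 \<le> T0" "T0 \<le> 5" and "0 \<le> K"
    and LG: "\<And>T y. T \<ge> 6 \<Longrightarrow> y \<in> {0..ln T} \<Longrightarrow>
      norm (zero_sum T y + resonant_term (3/2) T0 T (nearest_nat_exp y) y + chi_term (3/2) T0 T y)
        \<le> K * (ln T)\<^sup>2 * exp (y * (3/2 - 1/2))"
    using landau_gonek_formula[OF assms(1), of "3/2"] by auto
  obtain C where "C \<ge> 0" and C: "\<And>\<sigma> a b. \<bar>\<sigma>\<bar> \<le> 2 \<and> 1 \<le> a \<and> a \<le> b \<Longrightarrow>
      Re (integral {a..b} (\<lambda>t. chi_logderiv (Complex \<sigma> t))) \<le> C * (b - a) - ((b * ln b - b) - (a * ln a - a))"
    using Re_integral_chi_logderiv_le by blast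
  have "eventually (\<lambda>T. (1 - \<epsilon>) * (T * ln T / (2 * pi)) \<le> (T * ln T - T - 25 - C * T) / (2 * pi) - K * (ln T)\<^sup>2) at_top"
    using \<open>\<epsilon> > 0\<close> \<open>0 \<le> K\<close> \<open>C \<ge> 0\<close> by real_asymp
  then show ?thesis using eventually_ge_at_top[of 6]
  proof eventually_elim
    case (elim T)
    define I where "I = integral {T0..T} (\<lambda>t. chi_logderiv (Complex (- 1/2) t))"
    have "nearest_nat_exp 0 = 1" by (simp add: nearest_nat_exp_def)
    then have "zero_sum T 0 + resonant_term (3/2) T0 T (nearest_nat_exp 0) 0 + chi_term (3/2) T0 T 0 =
        of_real (zero_count T) + of_real (1 / (2 * pi)) * I"
      by (simp add: zero_sum_0 resonant_term_def chi_term_def fourier_integral_def I_def)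
    then have "norm (of_real (zero_count T) + of_real (1 / (2 * pi)) * I) \<le> K * (ln T)\<^sup>2"
      using LG[of T 0] elim by simp
    then have "\<bar>zero_count T + Re I / (2 * pi)\<bar> \<le> K * (ln T)\<^sup>2"
      using order_trans[OF abs_Re_le_cmod] by fastforce
    moreover have "Re I \<le> C * T - ((T * ln T - T) - 25)"
    proof -
      have "T0 * ln T0 \<le> 5 * 5"
        using T0 ln_le_minus_one[of T0] by (intro mult_mono) auto
      moreover have "C * (T - T0) \<le> C * T" using \<open>C \<ge> 0\<close> T0 by (intro mult_left_mono) auto
      moreover have "Re I \<le> C * (T - T0) - ((T * ln T - T) - (T0 * ln T0 - T0))"
        unfolding I_def using T0 elim by (intro C) auto
      ultimately show ?thesis using T0 by linarith
    qed
    then have "(T * ln T - T - 25 - C * T) / (2 * pi) \<le> - Re I / (2 * pi)"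
      by (intro divide_right_mono) auto
    ultimately show ?case using elim by linarith
  qed
qed

section \<open>The form factor as a positive cosine sum\<close>

lemma form_factor_eq_cos_sum:
  assumes "T > 0"
  shows "form_factor \<alpha> T = 2 * pi / (T * ln T) * (\<Sum>p\<in>zeros_upto T. \<Sum>q\<in>zeros_upto T.
     real (zero_mult p) * real (zero_mult q) * pair_weight (Im p - Im q) * cos (\<alpha> * (ln T * Im p - ln T * Im q)))"
proof -
  have "Re (of_nat (zero_mult p * zero_mult q) * of_real T powr (\<i> * of_real (\<alpha> * (Im p - Im q))) *
        of_real (pair_weight (Im p - Im q))) =
      real (zero_mult p) * real (zero_mult q) * pair_weight (Im p - Im q) * cos (\<alpha> * (ln T * Im p - ln T * Im q))" for p q
  proof -
    have "of_real T powr (\<i> * of_real (\<alpha> * (Im p - Im q))) = cis (\<alpha> * (ln T * Im p - ln T * Im q))"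
      using assms by (simp add: powr_def Ln_of_real cis_conv_exp algebra_simps)
    then show ?thesis by (simp add: mult_ac)
  qed
  moreover have "Re (of_real x * z) = x * Re z" for x z by simp
  ultimately show ?thesis
    unfolding form_factor_def form_factor_complex_def by (simp only: Re_sum)
qed

lemma continuous_on_form_factor: "continuous_on A (\<lambda>\<alpha>. form_factor \<alpha> T)"
proof -
  have "continuous_on A (\<lambda>\<alpha>. of_real T powr (\<i> * of_real (\<alpha> * c)) :: complex)" for c
    unfolding powr_def by (cases "T = 0") (auto intro!: continuous_intros)
  then show ?thesis
    unfolding form_factor_def form_factor_complex_def
    by (intro continuous_on_Re continuous_on_mult continuous_on_sum continuous_on_const)
qed

lemma has_integral_exp_mult_cos:
  fixes N v :: real
  assumes "N \<ge> 0"
  shows "((\<lambda>y. exp (- 2 * y) * cos (y * v)) has_integral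
     (exp (- 2 * N) * (v * sin (N * v) - 2 * cos (N * v)) + 2) / (4 + v\<^sup>2)) {0..N}"
proof -
  define P where "P y = exp (- 2 * y) * (v * sin (y * v) - 2 * cos (y * v)) / (4 + v\<^sup>2)" for y
  have denominator_nonzero: "4 + v\<^sup>2 \<noteq> 0" using zero_le_power2[of v] by linarith
  have "((\<lambda>y. exp (- 2 * y) * cos (y * v)) has_integral P N - P 0) {0..N}"
  proof (rule fundamental_theorem_of_calculus[OF assms])
    fix y
    have "((\<lambda>y. exp (- 2 * y) * (v * sin (y * v) - 2 * cos (y * v))) has_real_derivative
        exp (- 2 * y) * cos (y * v) * (4 + v\<^sup>2)) (at y within {0..N})"
      by (auto intro!: derivative_eq_intros simp: algebra_simps power2_eq_square)
    from DERIV_cdivide[OF this, of "4 + v\<^sup>2"] show "(P has_vector_derivative exp (- 2 * y) * cos (y * v)) (at y within {0..N})"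
      using denominator_nonzero by (simp add: P_def[abs_def] has_real_derivative_iff_has_vector_derivative)
  qed
  then show ?thesis by (simp add: P_def diff_divide_distrib add_divide_distrib)
qed

lemma tendsto_integral_exp_mult_cos:
  "((\<lambda>N. integral {0..N} (\<lambda>y. exp (- 2 * y) * cos (y * v))) \<longlongrightarrow> pair_weight v / 2) at_top"
proof -
  have "((\<lambda>N. exp (- 2 * N :: real)) \<longlongrightarrow> 0) at_top" by real_asymp
  moreover have "eventually (\<lambda>N. norm (v * sin (N * v) - 2 * cos (N * v)) \<le> \<bar>v\<bar> + 2) at_top"
  proof (rule always_eventually, rule allI)
    fix N
    have "\<bar>v * sin (N * v)\<bar> \<le> \<bar>v\<bar>" by (simp add: abs_mult mult_left_le)
    then show "norm (v * sin (N * v) - 2 * cos (N * v)) \<le> \<bar>v\<bar> + 2"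
      using abs_cos_le_one[of "N * v"] unfolding real_norm_def by linarith
  qed
  ultimately have "((\<lambda>N. exp (- 2 * N) * (v * sin (N * v) - 2 * cos (N * v))) \<longlongrightarrow> 0) at_top"
    by (rule lim_null_mult_right_bounded)
  moreover have "4 + v\<^sup>2 \<noteq> 0" using zero_le_power2[of v] by linarith
  ultimately have "((\<lambda>N. (exp (- 2 * N) * (v * sin (N * v) - 2 * cos (N * v)) + 2) / (4 + v\<^sup>2)) \<longlongrightarrow> (0 + 2) / (4 + v\<^sup>2)) at_top"
    by (intro tendsto_intros)
  then have "((\<lambda>N. integral {0..N} (\<lambda>y. exp (- 2 * y) * cos (y * v))) \<longlongrightarrow> (0 + 2) / (4 + v\<^sup>2)) at_top"
  proof (rule Lim_transform_eventually)
    show "eventually (\<lambda>N. (exp (- 2 * N) * (v * sin (N * v) - 2 * cos (N * v)) + 2) / (4 + v\<^sup>2) =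
        integral {0..N} (\<lambda>y. exp (- 2 * y) * cos (y * v))) at_top"
      using eventually_ge_at_top[of 0]
      by eventually_elim (rule integral_unique[OF has_integral_exp_mult_cos, symmetric])
  qed
  moreover have "(0 + 2) / (4 + v\<^sup>2) = pair_weight v / 2" by (simp add: pair_weight_def divide_simps)
  ultimately show ?thesis by (simp only:)
qed

lemma cos_mult_cos_sum_nonneg:
  fixes m a g :: "'a \<Rightarrow> real"
  shows "0 \<le> (\<Sum>p\<in>Z. \<Sum>q\<in>Z. m p * m q * (cos (a p - a q) * cos (y * (g p - g q))))"
proof -
  have "m p * m q * (cos (a p - a q) * cos (y * (g p - g q))) =
      (m p * m q * cos (1 * ((a p + y * g p) - (a q + y * g q)))
       + m p * m q * cos (1 * ((a p - y * g p) - (a q - y * g q)))) / 2" for p q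
    by (simp add: cos_times_cos algebra_simps)
  then have sum_eq: "(\<Sum>p\<in>Z. \<Sum>q\<in>Z. m p * m q * (cos (a p - a q) * cos (y * (g p - g q)))) =
      ((norm (\<Sum>p\<in>Z. of_real (m p) * cis (1 * (a p + y * g p))))\<^sup>2
       + (norm (\<Sum>p\<in>Z. of_real (m p) * cis (1 * (a p - y * g p))))\<^sup>2) / 2"
    unfolding norm_cis_sum_squared by (simp only: sum.distrib sum_divide_distrib[symmetric])
  show ?thesis unfolding sum_eq by simp
qed

text \<open>As an average of the functions \<open>cos (y * _)\<close> the kernel \<open>pair_weight\<close> is positive definite.\<close>

lemma pair_weight_cos_sum_nonneg:
  fixes m a g :: "'a \<Rightarrow> real"
  assumes "finite Z"
  shows "0 \<le> (\<Sum>p\<in>Z. \<Sum>q\<in>Z. m p * m q * pair_weight (g p - g q) * cos (a p - a q))"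
proof -
  define I where "I N v = integral {0..N} (\<lambda>y. exp (- 2 * y) * cos (y * v))" for N v :: real
  have "0 \<le> (\<Sum>p\<in>Z. \<Sum>q\<in>Z. m p * m q * cos (a p - a q) * I N (g p - g q))" for N
  proof (rule has_integral_nonneg)
    show "((\<lambda>y. \<Sum>p\<in>Z. \<Sum>q\<in>Z. m p * m q * cos (a p - a q) * (exp (- 2 * y) * cos (y * (g p - g q)))) has_integral
        (\<Sum>p\<in>Z. \<Sum>q\<in>Z. m p * m q * cos (a p - a q) * I N (g p - g q))) {0..N}"
      unfolding I_def
      by (intro has_integral_sum has_integral_mult_right integrable_integral
          integrable_continuous_interval continuous_intros assms)
    fix y
    have "(\<Sum>p\<in>Z. \<Sum>q\<in>Z. m p * m q * cos (a p - a q) * (exp (- 2 * y) * cos (y * (g p - g q)))) =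
        exp (- 2 * y) * (\<Sum>p\<in>Z. \<Sum>q\<in>Z. m p * m q * (cos (a p - a q) * cos (y * (g p - g q))))"
      by (simp add: sum_distrib_left mult_ac)
    then show "0 \<le> (\<Sum>p\<in>Z. \<Sum>q\<in>Z. m p * m q * cos (a p - a q) * (exp (- 2 * y) * cos (y * (g p - g q))))"
      using cos_mult_cos_sum_nonneg[of m a y g Z] by simp
  qed
  moreover have "((\<lambda>N. \<Sum>p\<in>Z. \<Sum>q\<in>Z. m p * m q * cos (a p - a q) * I N (g p - g q)) \<longlongrightarrow>
      (\<Sum>p\<in>Z. \<Sum>q\<in>Z. m p * m q * cos (a p - a q) * (pair_weight (g p - g q) / 2))) at_top"
    unfolding I_def by (intro tendsto_sum tendsto_mult tendsto_const tendsto_integral_exp_mult_cos)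
  ultimately have "0 \<le> (\<Sum>p\<in>Z. \<Sum>q\<in>Z. m p * m q * cos (a p - a q) * (pair_weight (g p - g q) / 2))"
    by (intro tendsto_lowerbound[where F = at_top]) auto
  then show ?thesis by (simp add: sum_divide_distrib[symmetric] mult_ac)
qed

lemma form_factor_nonneg:
  assumes "T > 1"
  shows "form_factor \<alpha> T \<ge> 0"
  using pair_weight_cos_sum_nonneg[OF finite_zeros_upto, of "\<lambda>p. real (zero_mult p)" Im "\<lambda>p. \<alpha> * (ln T * Im p)" T] assms
  by (subst form_factor_eq_cos_sum) (auto simp: right_diff_distrib intro!: mult_nonneg_nonneg)

section \<open>Triangular averages of the form factor\<close>

lemma tri_avg_even_rescale:
  assumes cont: "continuous_on UNIV G" and even: "\<And>y. G (- y) = G y" and "L > 0" "h > 0"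
  shows "tri_avg h 0 (\<lambda>\<alpha>. G (\<alpha> * L)) = 2 * h / L * integral {0..h * L} (\<lambda>y. G y * taper (h * L) y)"
proof -
  define f where "f y = G y * taper (h * L) y" for y
  define g where "g \<alpha> = tri h \<alpha> * G (\<alpha> * L)" for \<alpha>
  have g_cont: "continuous_on A g" for A
    unfolding g_def by (intro continuous_intros continuous_on_compose2[OF cont]) auto
  have f_cont: "continuous_on A f" for A
    unfolding f_def by (intro continuous_intros continuous_on_taper continuous_on_subset[OF cont]) auto
  have "g (- \<alpha>) = g \<alpha>" for \<alpha> by (simp add: g_def tri_def even)
  then have "integral {- h..0} g = integral {0..h} g"
    using Henstock_Kurzweil_Integration.integral_reflect_real[of h 0 g] by simp
  moreover have "integral {- h..0} g + integral {0..h} g = integral {- h..h} g"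
    using \<open>h > 0\<close> by (intro Henstock_Kurzweil_Integration.integral_combine integrable_continuous_interval g_cont) auto
  ultimately have symmetric: "integral {- h..h} g = 2 * integral {0..h} g" by simp
  have "(f has_integral integral {0..h * L} f) (cbox 0 (h * L))"
    unfolding box_real by (intro integrable_integral integrable_continuous_interval f_cont)
  from has_integral_affinity'[OF this \<open>L > 0\<close>, of 0]
  have "((\<lambda>\<alpha>. f (L * \<alpha>)) has_integral integral {0..h * L} f / L) {0..h}"
    using \<open>L > 0\<close> by (simp add: field_simps)
  from has_integral_mult_right[OF this, of h]
  have "((\<lambda>\<alpha>. h * f (L * \<alpha>)) has_integral h / L * integral {0..h * L} f) {0..h}" by simp
  moreover have "h * f (L * \<alpha>) = g \<alpha>" if "\<alpha> \<in> {0..h}" for \<alpha>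
  proof -
    have "h * taper (h * L) (L * \<alpha>) = h - \<alpha>"
      using that \<open>L > 0\<close> \<open>h > 0\<close> by (simp add: taper_def field_simps)
    then have "G (L * \<alpha>) * (h * taper (h * L) (L * \<alpha>)) = tri h \<alpha> * G (\<alpha> * L)"
      using that by (simp add: tri_def mult.commute)
    then show ?thesis by (simp add: f_def g_def mult_ac)
  qed
  ultimately have "(g has_integral h / L * integral {0..h * L} f) {0..h}"
    by (rule has_integral_eq[rotated])
  then have "integral {0..h} g = h / L * integral {0..h * L} f" by (rule integral_unique)
  with symmetric show ?thesis by (simp add: tri_avg_def g_def[abs_def] f_def[abs_def])
qed

definition zero_sum_average :: "real \<Rightarrow> real \<Rightarrow> real" where
  "zero_sum_average h T = 2 * pi / (T * ln T) * tri_avg h 0 (\<lambda>\<alpha>. (norm (zero_sum T (\<alpha> * ln T)))\<^sup>2)"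

lemma tri_avg_form_factor_bounds:
  assumes "T > 1" "h \<ge> 0"
  shows "tri_avg h \<beta> (\<lambda>\<alpha>. form_factor \<alpha> T) \<le> zero_sum_average h T" (is ?upper)
    and "2 * pi / (T * ln T) * (2 * h\<^sup>2 * zero_count T) - zero_sum_average h T
           \<le> tri_avg h \<beta> (\<lambda>\<alpha>. form_factor \<alpha> T)" (is ?lower)
proof -
  define k where "k = 2 * pi / (T * ln T)"
  define m where "m p = real (zero_mult p)" for p
  define g where "g p = ln T * Im p" for p
  define W where "W p q = pair_weight (Im p - Im q)" for p q
  define G where "G \<alpha> = (\<Sum>p\<in>zeros_upto T. \<Sum>q\<in>zeros_upto T. m p * m q * W p q * cos (\<alpha> * (g p - g q)))" for \<alpha>
  define M where "M = tri_avg h 0 (\<lambda>\<alpha>. (norm (\<Sum>p\<in>zeros_upto T. of_real (m p) * cis (\<alpha> * g p)))\<^sup>2)"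
  have "k \<ge> 0" using assms by (simp add: k_def)
  have W: "0 \<le> W p q" "W p q \<le> 1" "W p p = 1" for p q
    by (auto simp: W_def pair_weight_def divide_le_eq add_pos_nonneg)
  have "(\<lambda>\<alpha>. form_factor \<alpha> T) = (\<lambda>\<alpha>. k * G \<alpha>)"
    using assms by (simp add: form_factor_eq_cos_sum k_def G_def m_def g_def W_def fun_eq_iff)
  then have avg: "tri_avg h \<beta> (\<lambda>\<alpha>. form_factor \<alpha> T) = k * tri_avg h \<beta> G"
    by (simp add: tri_avg_def mult.left_commute[of _ k])
  have average_eq: "zero_sum_average h T = k * M"
    by (simp add: zero_sum_average_def k_def M_def zero_sum_def m_def g_def mult.assoc)
  note bounds = tri_avg_weighted_cos_sum_bounds[where Z = "zeros_upto T" and h = h and m = m and W = W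
      and g = g and \<beta> = \<beta>, OF finite_zeros_upto \<open>h \<ge> 0\<close> _ W, folded G_def M_def]
  have "tri_avg h \<beta> G \<le> M" by (rule bounds) (simp add: m_def)
  then show ?upper unfolding avg average_eq using \<open>k \<ge> 0\<close> by (rule mult_left_mono)
  have "m p \<le> (m p)\<^sup>2" for p
    using le_square[of "zero_mult p"] by (simp only: m_def power2_eq_square of_nat_mult[symmetric] of_nat_le_iff)
  then have "2 * h\<^sup>2 * zero_count T \<le> 2 * h\<^sup>2 * (\<Sum>p\<in>zeros_upto T. (m p)\<^sup>2)"
    unfolding zero_count_def m_def[symmetric] by (intro mult_left_mono sum_mono) auto
  also have "2 * h\<^sup>2 * (\<Sum>p\<in>zeros_upto T. (m p)\<^sup>2) - M \<le> tri_avg h \<beta> G"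
    by (rule bounds) (simp add: m_def)
  finally have "k * (2 * h\<^sup>2 * zero_count T - M) \<le> k * tri_avg h \<beta> G"
    using \<open>k \<ge> 0\<close> by (intro mult_left_mono) auto
  then show ?lower unfolding avg average_eq k_def[symmetric] by (simp only: right_diff_distrib)
qed

lemma eventually_zero_sum_average_le:
  assumes "riemann_hypothesis" and h: "0 < h" "h < 1" and "\<epsilon> > 0"
  shows "eventually (\<lambda>T. zero_sum_average h T \<le> h + h ^ 3 / 3 + \<epsilon>) at_top"
  using zero_sum_mean_square[OF assms] eventually_gt_at_top[of 1]
proof eventually_elim
  case (elim T)
  define J where "J = integral {0..h * ln T} (\<lambda>y. (norm (zero_sum T y))\<^sup>2 * taper (h * ln T) y)"
  have "ln T > 0" using elim by simp
  have "zero_sum T (- y) = cnj (zero_sum T y)" for y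
    by (simp add: zero_sum_def cis_cnj)
  then have "zero_sum_average h T = 2 * pi / (T * ln T) * (2 * h / ln T * J)"
    unfolding zero_sum_average_def J_def using h \<open>ln T > 0\<close>
    by (subst tri_avg_even_rescale[where G = "\<lambda>y. (norm (zero_sum T y))\<^sup>2"]) (auto intro!: continuous_intros)
  also have "\<dots> \<le> 2 * pi / (T * ln T) * (2 * h / ln T * ((1 + h\<^sup>2 / 3 + \<epsilon>) * (T * (ln T)\<^sup>2 / (4 * pi))))"
    using elim h \<open>ln T > 0\<close> unfolding J_def by (intro mult_left_mono) auto
  also have "\<dots> = h + h ^ 3 / 3 + h * \<epsilon>"
    using \<open>ln T > 0\<close> elim by (simp add: field_simps power2_eq_square power3_eq_cube)
  also have "\<dots> \<le> h + h ^ 3 / 3 + \<epsilon>"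
    using h \<open>\<epsilon> > 0\<close> by simp
  finally show ?case .
qed

lemma eventually_tri_avg_form_factor_le:
  assumes "riemann_hypothesis" and h: "0 < h" "h < 1" and "\<epsilon> > 0"
  shows "eventually (\<lambda>T. \<forall>\<beta>. tri_avg h \<beta> (\<lambda>\<alpha>. form_factor \<alpha> T) \<le> h + h ^ 3 / 3 + \<epsilon>) at_top"
  using eventually_zero_sum_average_le[OF assms] eventually_gt_at_top[of 1]
proof eventually_elim
  case (elim T)
  show ?case using order_trans[OF tri_avg_form_factor_bounds(1) elim(1)] elim(2) h by simp
qed

lemma eventually_tri_avg_form_factor_ge:
  assumes RH: "riemann_hypothesis" and h: "0 < h" "h < 1" and "\<epsilon> > 0"
  shows "eventually (\<lambda>T. \<forall>\<beta>. h * (2 * h - 1 - h\<^sup>2 / 3) - \<epsilon> \<le> tri_avg h \<beta> (\<lambda>\<alpha>. form_factor \<alpha> T)) at_top"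
proof -
  define \<delta> where "\<delta> = \<epsilon> / 4"
  have "\<delta> > 0" using \<open>\<epsilon> > 0\<close> by (simp add: \<delta>_def)
  show ?thesis
    using eventually_zero_sum_average_le[OF RH h \<open>\<delta> > 0\<close>] eventually_zero_count_ge[OF RH \<open>\<delta> > 0\<close>]
      eventually_gt_at_top[of 1]
  proof eventually_elim
    case (elim T)
    have "2 * h\<^sup>2 * (1 - \<delta>) = 2 * pi / (T * ln T) * (2 * h\<^sup>2 * ((1 - \<delta>) * (T * ln T / (2 * pi))))"
      using elim by simp
    also have "\<dots> \<le> 2 * pi / (T * ln T) * (2 * h\<^sup>2 * zero_count T)"
      using elim by (intro mult_left_mono) auto
    finally have "2 * h\<^sup>2 * (1 - \<delta>) \<le> 2 * pi / (T * ln T) * (2 * h\<^sup>2 * zero_count T)" .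
    moreover have "h * (2 * h - 1 - h\<^sup>2 / 3) - \<epsilon> \<le> 2 * h\<^sup>2 * (1 - \<delta>) - (h + h ^ 3 / 3 + \<delta>)"
    proof -
      have "2 * h\<^sup>2 * \<delta> \<le> 2 * \<delta>" using h \<open>\<delta> > 0\<close> power_le_one[of h 2] by simp
      then show ?thesis
        using \<open>\<epsilon> > 0\<close> by (simp add: \<delta>_def algebra_simps power2_eq_square power3_eq_cube)
    qed
    ultimately have "h * (2 * h - 1 - h\<^sup>2 / 3) - \<epsilon> \<le> 2 * pi / (T * ln T) * (2 * h\<^sup>2 * zero_count T) - zero_sum_average h T"
      using elim(1) by linarith
    then show ?case
      using tri_avg_form_factor_bounds(2)[OF elim(3), of h] h by (auto intro: order_trans)
  qed
qed

section \<open>Comparison of an interval with triangles\<close>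

lemma sum_unit_tri:
  "(\<Sum>j<Suc n. tri 1 (u - real j)) = max 0 (min 1 (min (u + 1) (real (Suc n) - u)))"
proof (induction n)
  case (Suc n)
  have "(\<Sum>j<Suc (Suc n). tri 1 (u - real j)) =
      max 0 (min 1 (min (u + 1) (real (Suc n) - u))) + tri 1 (u - real (Suc n))"
    using Suc by simp
  also have "\<dots> = max 0 (min 1 (min (u + 1) (real (Suc (Suc n)) - u)))"
    by (auto simp: tri_def max_def min_def abs_if)
  finally show ?case .
qed (auto simp: tri_def max_def min_def abs_if)

lemma sum_unit_tri_shifted:
  "(\<Sum>j<Suc n. tri 1 (\<alpha> - (\<beta> + real j))) = max 0 (min 1 (min (\<alpha> - \<beta> + 1) (real (Suc n) - (\<alpha> - \<beta>))))"
  unfolding sum_unit_tri[symmetric] by (simp add: diff_diff_eq)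

lemma has_integral_indicator_interval:
  fixes G :: "real \<Rightarrow> real"
  assumes cont: "continuous_on UNIV G"
  shows "((\<lambda>\<alpha>. indicator {a..b} \<alpha> * G \<alpha>) has_integral integral {a..b} G) UNIV"
proof -
  have "(G has_integral integral {a..b} G) {a..b}"
    by (intro integrable_integral integrable_continuous_interval continuous_on_subset[OF cont]) auto
  then show ?thesis
    unfolding has_integral_restrict_UNIV[of "{a..b}", symmetric]
    by (rule has_integral_eq[rotated]) auto
qed

lemma has_integral_sum_tri:
  fixes n :: nat
  assumes cont: "continuous_on UNIV G"
  shows "((\<lambda>\<alpha>. (\<Sum>j<n. tri h (\<alpha> - \<beta> j)) * G \<alpha>) has_integral (\<Sum>j<n. tri_avg h (\<beta> j) G)) UNIV"
  unfolding sum_distrib_right by (intro has_integral_sum has_integral_tri_avg cont finite_lessThan)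

context
  fixes G :: "real \<Rightarrow> real"
  assumes cont: "continuous_on UNIV G" and nonneg: "\<And>\<alpha>. G \<alpha> \<ge> 0"
begin

lemma integral_interval_le:
  assumes "((\<lambda>\<alpha>. w \<alpha> * G \<alpha>) has_integral I) UNIV" "\<And>\<alpha>. indicator {a..b} \<alpha> \<le> w \<alpha>"
  shows "integral {a..b} G \<le> I"
  by (rule has_integral_le[OF has_integral_indicator_interval[OF cont] assms(1)])
     (intro mult_right_mono assms(2) nonneg)

lemma integral_interval_ge:
  assumes "((\<lambda>\<alpha>. w \<alpha> * G \<alpha>) has_integral I) UNIV" "\<And>\<alpha>. w \<alpha> \<le> indicator {a..b} \<alpha>"
  shows "I \<le> integral {a..b} G"
  by (rule has_integral_le[OF assms(1) has_integral_indicator_interval[OF cont]])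
     (intro mult_right_mono assms(2) nonneg)

lemma tri_avg_nonneg: "tri_avg h \<beta> G \<ge> 0"
  by (rule has_integral_nonneg[OF has_integral_tri_avg[OF cont]]) (simp add: tri_nonneg nonneg)

lemma tri_avg_mono: "h \<le> h' \<Longrightarrow> tri_avg h \<beta> G \<le> tri_avg h' \<beta> G"
  by (rule has_integral_le[OF has_integral_tri_avg[OF cont] has_integral_tri_avg[OF cont]])
     (auto simp: tri_def nonneg intro!: mult_right_mono)

lemma tri_avg_1_le:
  assumes h: "0 \<le> h" "h \<le> 1"
  shows "tri_avg 1 \<beta> G \<le> tri_avg h \<beta> G + 4 * (1 - h) * (tri_avg (3/4) (\<beta> - 1/2) G + tri_avg (3/4) (\<beta> + 1/2) G)"
proof (rule has_integral_le[OF has_integral_tri_avg[OF cont]])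
  define w where "w u = tri (3/4) (u + 1/2) + tri (3/4) (u - 1/2)" for u
  have "w u \<ge> 0" for u by (simp add: w_def tri_nonneg)
  have unit_le: "tri 1 u \<le> tri h u + 4 * (1 - h) * w u" for u
  proof (cases "\<bar>u\<bar> \<le> 1")
    case True
    then have "1 \<le> 4 * w u" by (auto simp: w_def tri_def abs_if max_def split: if_splits)
    from mult_left_mono[OF this, of "1 - h"] have "1 - h \<le> 4 * (1 - h) * w u" using h by (simp add: algebra_simps)
    moreover have "tri 1 u \<le> tri h u + (1 - h)" using h by (auto simp: tri_def)
    ultimately show ?thesis by linarith
  next
    case False
    then have "tri 1 u = 0" by (simp add: tri_def)
    then show ?thesis using \<open>\<And>u. w u \<ge> 0\<close> h by (simp add: tri_nonneg)
  qed
  have shift: "(\<alpha> - \<beta>) + 1/2 = \<alpha> - (\<beta> - 1/2)" "(\<alpha> - \<beta>) - 1/2 = \<alpha> - (\<beta> + 1/2)" for \<alpha> by simp_all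
  show "((\<lambda>\<alpha>. (tri h (\<alpha> - \<beta>) + 4 * (1 - h) * w (\<alpha> - \<beta>)) * G \<alpha>) has_integral
      tri_avg h \<beta> G + 4 * (1 - h) * (tri_avg (3/4) (\<beta> - 1/2) G + tri_avg (3/4) (\<beta> + 1/2) G)) UNIV"
    unfolding w_def shift distrib_right mult.assoc
    by (intro has_integral_add has_integral_mult_right has_integral_tri_avg cont)
  show "tri 1 (\<alpha> - \<beta>) * G \<alpha> \<le> (tri h (\<alpha> - \<beta>) + 4 * (1 - h) * w (\<alpha> - \<beta>)) * G \<alpha>" for \<alpha>
    by (intro mult_right_mono unit_le nonneg)
qed

lemma integral_interval_le_tiling:
  assumes h: "0 \<le> h" "h \<le> 1" and l: "l = 2 * h + real n - 1" "l > 0"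
  shows "integral {b..b + l} G \<le> (\<Sum>j<n. tri_avg 1 (b + h + real j) G) + tri_avg h b G + tri_avg h (b + l) G"
proof (rule integral_interval_le)
  show "((\<lambda>\<alpha>. ((\<Sum>j<n. tri 1 (\<alpha> - (b + h + real j))) + tri h (\<alpha> - b) + tri h (\<alpha> - (b + l))) * G \<alpha>)
    has_integral (\<Sum>j<n. tri_avg 1 (b + h + real j) G) + tri_avg h b G + tri_avg h (b + l) G) UNIV"
    unfolding distrib_right by (intro has_integral_add has_integral_sum_tri has_integral_tri_avg cont)
  show "indicator {b..b + l} \<alpha> \<le> (\<Sum>j<n. tri 1 (\<alpha> - (b + h + real j))) + tri h (\<alpha> - b) + tri h (\<alpha> - (b + l))" for \<alpha>
  proof (cases n)
    case 0
    then show ?thesis using h l by (auto simp: indicator_def tri_def max_def abs_if)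
  next
    case (Suc k)
    show ?thesis unfolding Suc sum_unit_tri_shifted using h l Suc
      by (auto simp: indicator_def tri_def max_def min_def abs_if)
  qed
qed

lemma integral_interval_le_scaled_tri_avg:
  assumes "s \<ge> 0" "s * (h - l / 2) \<ge> 1"
  shows "integral {b..b + l} G \<le> s * tri_avg h (b + l / 2) G"
proof (rule integral_interval_le)
  show "((\<lambda>\<alpha>. s * tri h (\<alpha> - (b + l / 2)) * G \<alpha>) has_integral s * tri_avg h (b + l / 2) G) UNIV"
    unfolding mult.assoc by (intro has_integral_mult_right has_integral_tri_avg cont)
  show "indicator {b..b + l} \<alpha> \<le> s * tri h (\<alpha> - (b + l / 2))" for \<alpha>
  proof (cases "\<alpha> \<in> {b..b + l}")
    case True
    then have "h - l / 2 \<le> tri h (\<alpha> - (b + l / 2))" by (auto simp: tri_def max_def abs_if field_simps)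
    then have "s * (h - l / 2) \<le> s * tri h (\<alpha> - (b + l / 2))" using assms by (intro mult_left_mono)
    then show ?thesis using True assms by simp
  qed (use assms in \<open>auto simp: tri_def\<close>)
qed

lemma tri_avg_le_integral_interval:
  assumes "h > 0"
  shows "tri_avg h (b + h) G / h \<le> integral {b..b + 2 * h} G"
proof (rule integral_interval_ge)
  show "((\<lambda>\<alpha>. tri h (\<alpha> - (b + h)) / h * G \<alpha>) has_integral tri_avg h (b + h) G / h) UNIV"
    using has_integral_divide[OF has_integral_tri_avg[OF cont]] by simp
  show "tri h (\<alpha> - (b + h)) / h \<le> indicator {b..b + 2 * h} \<alpha>" for \<alpha>
    using assms by (auto simp: tri_def max_def abs_if field_simps indicator_def)
qed

lemma tiling_le_integral_interval:
  assumes "1 / 2 \<le> h" "h \<le> 1" and "n \<ge> 1"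
  shows "(\<Sum>j<n. tri_avg 1 (b + 1 + real j) G) + tri_avg h (b + real n + h) G \<le> integral {b..b + (real n + 2 * h)} G"
proof (rule integral_interval_ge)
  show "((\<lambda>\<alpha>. ((\<Sum>j<n. tri 1 (\<alpha> - (b + 1 + real j))) + tri h (\<alpha> - (b + real n + h))) * G \<alpha>)
    has_integral (\<Sum>j<n. tri_avg 1 (b + 1 + real j) G) + tri_avg h (b + real n + h) G) UNIV"
    unfolding distrib_right by (intro has_integral_add has_integral_sum_tri has_integral_tri_avg cont)
  obtain k where "n = Suc k" using assms by (cases n) auto
  then show "(\<Sum>j<n. tri 1 (\<alpha> - (b + 1 + real j))) + tri h (\<alpha> - (b + real n + h)) \<le> indicator {b..b + (real n + 2 * h)} \<alpha>" for \<alpha>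
    unfolding \<open>n = Suc k\<close> sum_unit_tri_shifted using assms
    by (auto simp: indicator_def tri_def max_def min_def abs_if)
qed

end

section \<open>From triangular averages to intervals\<close>

definition tiling_bound :: "real \<Rightarrow> real" where
  "tiling_bound l = 4 / 3 * (l + 1) + frac l ^ 3 / 12 - frac l / 3 - 1 / 4 * pos_part (1 - frac l - (frac l)\<^sup>2)"

locale triangle_averages =
  fixes F :: "real \<Rightarrow> real \<Rightarrow> real"
  assumes cont: "\<And>T. continuous_on UNIV (F T)"
    and nonneg: "\<And>T \<alpha>. T > 1 \<Longrightarrow> F T \<alpha> \<ge> 0"
    and eventually_le_below_1: "\<And>h \<epsilon>. 0 < h \<Longrightarrow> h < 1 \<Longrightarrow> \<epsilon> > 0 \<Longrightarrow>
          eventually (\<lambda>T. \<forall>\<beta>. tri_avg h \<beta> (F T) \<le> h + h ^ 3 / 3 + \<epsilon>) at_top"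
    and eventually_ge_below_1: "\<And>h \<epsilon>. 0 < h \<Longrightarrow> h < 1 \<Longrightarrow> \<epsilon> > 0 \<Longrightarrow>
          eventually (\<lambda>T. \<forall>\<beta>. h * (2 * h - 1 - h\<^sup>2 / 3) - \<epsilon> \<le> tri_avg h \<beta> (F T)) at_top"
begin

lemma eventually_unit_tri_avg_le:
  assumes "\<epsilon> > 0"
  shows "eventually (\<lambda>T. \<forall>\<beta>. tri_avg 1 \<beta> (F T) \<le> 4 / 3 + \<epsilon>) at_top"
proof -
  define d where "d = min (1/2) (\<epsilon> / 64)"
  have d: "0 < d" "d \<le> 1/2" "64 * d \<le> \<epsilon>" using assms by (auto simp: d_def)
  have "eventually (\<lambda>T. \<forall>\<beta>. tri_avg (1 - d) \<beta> (F T) \<le> (1 - d) + (1 - d) ^ 3 / 3 + \<epsilon> / 2) at_top"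
    by (rule eventually_le_below_1) (use d in auto)
  moreover have "eventually (\<lambda>T. \<forall>\<beta>. tri_avg (3/4) \<beta> (F T) \<le> 3/4 + (3/4) ^ 3 / 3 + 1) at_top"
    by (rule eventually_le_below_1) auto
  ultimately show ?thesis using eventually_gt_at_top[of 1]
  proof eventually_elim
    case (elim T)
    show ?case
    proof
      fix \<beta>
      have "tri_avg (3/4) \<gamma> (F T) \<le> 2" for \<gamma>
        using elim(2)[rule_format, of \<gamma>] by (simp add: power3_eq_cube)
      from add_mono[OF this[of "\<beta> - 1/2"] this[of "\<beta> + 1/2"]]
      have shifted_le: "tri_avg (3/4) (\<beta> - 1/2) (F T) + tri_avg (3/4) (\<beta> + 1/2) (F T) \<le> 4" by simp
      have "tri_avg 1 \<beta> (F T) \<le> tri_avg (1 - d) \<beta> (F T)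
          + 4 * (1 - (1 - d)) * (tri_avg (3/4) (\<beta> - 1/2) (F T) + tri_avg (3/4) (\<beta> + 1/2) (F T))"
        using d elim(3) by (intro tri_avg_1_le cont nonneg) auto
      also have "\<dots> \<le> ((1 - d) + (1 - d) ^ 3 / 3 + \<epsilon> / 2) + 4 * (1 - (1 - d)) * 4"
        using elim(1) shifted_le d by (intro add_mono mult_left_mono) auto
      also have "\<dots> \<le> 4 / 3 + \<epsilon>"
        using power_le_one[of "1 - d" 3] d by simp
      finally show "tri_avg 1 \<beta> (F T) \<le> 4 / 3 + \<epsilon>" .
    qed
  qed
qed

lemma eventually_tri_avg_le:
  assumes "0 \<le> h" "h \<le> 1" "\<epsilon> > 0"
  shows "eventually (\<lambda>T. \<forall>\<beta>. tri_avg h \<beta> (F T) \<le> h + h ^ 3 / 3 + \<epsilon>) at_top"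
proof -
  consider (zero) "h = 0" | (one) "h = 1" | (between) "0 < h" "h < 1" using assms by linarith
  then show ?thesis
  proof cases
    case zero
    then show ?thesis using assms by (simp add: tri_avg_def)
  next
    case one
    then show ?thesis using eventually_unit_tri_avg_le[OF \<open>\<epsilon> > 0\<close>] by simp
  next
    case between
    then show ?thesis using \<open>\<epsilon> > 0\<close> by (rule eventually_le_below_1)
  qed
qed

lemma eventually_unit_tri_avg_ge:
  assumes "\<epsilon> > 0"
  shows "eventually (\<lambda>T. \<forall>\<beta>. 2 / 3 - \<epsilon> \<le> tri_avg 1 \<beta> (F T)) at_top"
proof -
  define d where "d = min (1/2) (\<epsilon> / 4)"
  have d: "0 < d" "d \<le> 1/2" "4 * d \<le> \<epsilon>" using assms by (auto simp: d_def)
  have "eventually (\<lambda>T. \<forall>\<beta>. (1 - d) * (2 * (1 - d) - 1 - (1 - d)\<^sup>2 / 3) - \<epsilon> / 2 \<le> tri_avg (1 - d) \<beta> (F T)) at_top"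
    by (rule eventually_ge_below_1) (use d in auto)
  then show ?thesis using eventually_gt_at_top[of 1]
  proof eventually_elim
    case (elim T)
    have "(1 - d) * (2 * (1 - d) - 1 - (1 - d)\<^sup>2 / 3) = 2/3 - 2 * d + d\<^sup>2 + d ^ 3 / 3"
      by (simp add: power2_eq_square power3_eq_cube field_simps)
    then have "2/3 - \<epsilon> \<le> (1 - d) * (2 * (1 - d) - 1 - (1 - d)\<^sup>2 / 3) - \<epsilon> / 2"
      using d zero_le_power2[of d] zero_le_power[of d 3] by linarith
    moreover have "tri_avg (1 - d) \<beta> (F T) \<le> tri_avg 1 \<beta> (F T)" for \<beta>
      using d elim(2) by (intro tri_avg_mono cont nonneg) auto
    ultimately show ?case using elim(1) by (meson order_trans)
  qed
qed

lemma eventually_tri_avg_ge: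
  assumes "0 < h" "h \<le> 1" "\<epsilon> > 0"
  shows "eventually (\<lambda>T. \<forall>\<beta>. h * pos_part (2 * h - 1 - h\<^sup>2 / 3) - \<epsilon> \<le> tri_avg h \<beta> (F T)) at_top"
proof -
  have "eventually (\<lambda>T. \<forall>\<beta>. h * (2 * h - 1 - h\<^sup>2 / 3) - \<epsilon> \<le> tri_avg h \<beta> (F T)) at_top"
    using assms eventually_ge_below_1[of h \<epsilon>] eventually_unit_tri_avg_ge[of \<epsilon>] by (cases "h = 1") auto
  then show ?thesis using eventually_gt_at_top[of 1]
  proof eventually_elim
    case (elim T)
    have "tri_avg h \<beta> (F T) \<ge> 0" for \<beta> using elim by (intro tri_avg_nonneg cont nonneg)
    then show ?case using elim(1) assms by (auto simp: pos_part_def max_def intro: order_trans[of _ 0])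
  qed
qed

lemma eventually_integral_le_tiling:
  assumes h: "0 \<le> h" "h \<le> 1" and l: "l = 2 * h + real n - 1" "l > 0" and "\<epsilon> > 0"
  shows "eventually (\<lambda>T. integral {b..b + l} (F T) \<le> 4 / 3 * real n + 2 * (h + h ^ 3 / 3) + \<epsilon>) at_top"
proof -
  define \<delta> where "\<delta> = \<epsilon> / (real n + 2)"
  have \<delta>: "\<delta> > 0" "(real n + 2) * \<delta> = \<epsilon>" using \<open>\<epsilon> > 0\<close> by (auto simp: \<delta>_def)
  show ?thesis
    using eventually_unit_tri_avg_le[OF \<delta>(1)] eventually_tri_avg_le[OF h \<delta>(1)] eventually_gt_at_top[of 1]
  proof eventually_elim
    case (elim T)
    have "integral {b..b + l} (F T) \<le> (\<Sum>j<n. tri_avg 1 (b + h + real j) (F T))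
        + tri_avg h b (F T) + tri_avg h (b + l) (F T)"
      using elim by (intro integral_interval_le_tiling h l cont nonneg)
    also have "\<dots> \<le> (\<Sum>j<n. 4 / 3 + \<delta>) + (h + h ^ 3 / 3 + \<delta>) + (h + h ^ 3 / 3 + \<delta>)"
      using elim by (intro add_mono sum_mono) auto
    also have "\<dots> = 4 / 3 * real n + 2 * (h + h ^ 3 / 3) + \<epsilon>"
      using \<delta>(2) by (simp add: algebra_simps)
    finally show ?case .
  qed
qed

lemma eventually_integral_le_tiling_bound:
  assumes "l > 0" and "\<epsilon> > 0"
  shows "eventually (\<lambda>T. integral {b..b + l} (F T) \<le> tiling_bound l + \<epsilon>) at_top"
proof -
  define \<theta> where "\<theta> = frac l"
  define k where "k = nat \<lfloor>l\<rfloor>"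
  have l: "l = real k + \<theta>" using assms by (simp add: \<theta>_def k_def frac_def)
  have \<theta>: "0 \<le> \<theta>" "\<theta> < 1" by (simp_all add: \<theta>_def frac_lt_1)
  define bound where "bound n h = 4 / 3 * real n + 2 * (h + h ^ 3 / 3)" for n h
  have tiling: "eventually (\<lambda>T. integral {b..b + l} (F T) \<le> bound n h + \<epsilon>) at_top"
    if "0 \<le> h" "h \<le> 1" "l = 2 * h + real n - 1" for n h
    unfolding bound_def using that assms by (rule eventually_integral_le_tiling)
  show ?thesis
  proof (cases "1 - \<theta> - \<theta>\<^sup>2 \<ge> 0")
    case True
    then have "tiling_bound l = bound k ((1 + \<theta>) / 2)"
      by (simp add: tiling_bound_def \<theta>_def[symmetric] bound_def l[symmetric] pos_part_def)
        (simp add: l power3_eq_cube power2_eq_square field_simps)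
    moreover have "eventually (\<lambda>T. integral {b..b + l} (F T) \<le> bound k ((1 + \<theta>) / 2) + \<epsilon>) at_top"
      by (rule tiling) (use l \<theta> in \<open>auto simp: field_simps\<close>)
    ultimately show ?thesis by simp
  next
    case False
    then have "tiling_bound l = bound (Suc k) (\<theta> / 2)"
      by (simp add: tiling_bound_def \<theta>_def[symmetric] bound_def pos_part_def)
        (simp add: l power3_eq_cube power2_eq_square field_simps)
    moreover have "eventually (\<lambda>T. integral {b..b + l} (F T) \<le> bound (Suc k) (\<theta> / 2) + \<epsilon>) at_top"
      by (rule tiling) (use l \<theta> in \<open>auto simp: field_simps\<close>)
    ultimately show ?thesis by simp
  qed
qed

lemma eventually_integral_le_scaled_triangle:
  assumes "0 < h" "h \<le> 1" and s: "s \<ge> 0" "s * (h - l / 2) \<ge> 1" and "\<epsilon> > 0"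
  shows "eventually (\<lambda>T. integral {b..b + l} (F T) \<le> s * (h + h ^ 3 / 3) + \<epsilon>) at_top"
proof -
  define \<delta> where "\<delta> = \<epsilon> / (s + 1)"
  have \<delta>: "\<delta> > 0" "(s + 1) * \<delta> = \<epsilon>" using \<open>\<epsilon> > 0\<close> s(1) by (auto simp: \<delta>_def)
  have "eventually (\<lambda>T. \<forall>\<beta>. tri_avg h \<beta> (F T) \<le> h + h ^ 3 / 3 + \<delta>) at_top"
    using assms \<delta> by (intro eventually_tri_avg_le) auto
  then show ?thesis using eventually_gt_at_top[of 1]
  proof eventually_elim
    case (elim T)
    have "integral {b..b + l} (F T) \<le> s * tri_avg h (b + l / 2) (F T)"
      using elim by (intro integral_interval_le_scaled_tri_avg s cont nonneg)
    also have "\<dots> \<le> s * (h + h ^ 3 / 3 + \<delta>)" using elim s by (intro mult_left_mono) auto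
    also have "\<dots> \<le> s * (h + h ^ 3 / 3) + \<epsilon>" using \<delta> by (simp add: algebra_simps)
    finally show ?case .
  qed
qed

lemma eventually_integral_le_single_triangle:
  assumes l: "0 < l" "l < 2" and c: "c > 0" "l / (2 - l) \<le> c" and "\<epsilon> > 0"
  shows "eventually (\<lambda>T. integral {b..b + l} (F T) \<le> (1 + c) * (1 + l\<^sup>2 * (1 + c)\<^sup>2 / (12 * c\<^sup>2)) + \<epsilon>) at_top"
proof -
  define h where "h = l * (1 + c) / (2 * c)"
  have h: "0 < h" "h \<le> 1"
    using c l by (auto simp: h_def field_simps intro!: add_pos_pos)
  have "eventually (\<lambda>T. integral {b..b + l} (F T) \<le> (1 + c) / h * (h + h ^ 3 / 3) + \<epsilon>) at_top"
  proof (rule eventually_integral_le_scaled_triangle[OF h])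
    have "(1 + c) / h = 2 * c / l" using c l by (simp add: h_def)
    moreover have "h - l / 2 = l / (2 * c)" using c by (simp add: h_def field_simps)
    ultimately show "(1 + c) / h * (h - l / 2) \<ge> 1" using c l by simp
  qed (use c h \<open>\<epsilon> > 0\<close> in auto)
  moreover have "(1 + c) / h * (h + h ^ 3 / 3) = (1 + c) * (1 + h\<^sup>2 / 3)"
    using h by (simp add: field_simps power3_eq_cube power2_eq_square)
  moreover have "h\<^sup>2 / 3 = l\<^sup>2 * (1 + c)\<^sup>2 / (12 * c\<^sup>2)"
    by (simp add: h_def power_divide power_mult_distrib)
  ultimately show ?thesis by simp
qed

lemma eventually_integral_le_C_plus:
  assumes "l > 0" and "\<epsilon> > 0"
  shows "eventually (\<lambda>T. integral {b..b + l} (F T) \<le> C_plus l + \<epsilon>) at_top"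
proof (cases "l \<ge> 1")
  case True
  then have "C_plus l = tiling_bound l" by (simp add: C_plus_def tiling_bound_def)
  then show ?thesis using eventually_integral_le_tiling_bound[OF assms] by simp
next
  case False
  define c where "c = max (6 powr (- 1 / 3) * l powr (2 / 3)) (l / (2 - l))"
  have "eventually (\<lambda>T. integral {b..b + l} (F T) \<le> (1 + c) * (1 + l\<^sup>2 * (1 + c)\<^sup>2 / (12 * c\<^sup>2)) + \<epsilon>) at_top"
    by (rule eventually_integral_le_single_triangle) (use assms False in \<open>auto simp: c_def less_max_iff_disj\<close>)
  moreover have "C_plus l = min (tiling_bound l) ((1 + c) * (1 + l\<^sup>2 * (1 + c)\<^sup>2 / (12 * c\<^sup>2)))"
    using False assms by (simp add: C_plus_def tiling_bound_def frac_eq c_def Let_def)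
  ultimately show ?thesis
    using eventually_integral_le_tiling_bound[OF assms, of b] by (auto simp: min_def)
qed

lemma eventually_tiling_le_integral:
  assumes h: "1 / 2 \<le> h" "h \<le> 1" and "n \<ge> 1" and "\<epsilon> > 0"
  shows "eventually (\<lambda>T. 2 / 3 * real n + h * pos_part (2 * h - 1 - h\<^sup>2 / 3) - \<epsilon> \<le> integral {b..b + (real n + 2 * h)} (F T)) at_top"
proof -
  define \<delta> where "\<delta> = \<epsilon> / (real n + 1)"
  have \<delta>: "\<delta> > 0" "(real n + 1) * \<delta> = \<epsilon>" using \<open>\<epsilon> > 0\<close> by (auto simp: \<delta>_def)
  have "eventually (\<lambda>T. \<forall>\<beta>. h * pos_part (2 * h - 1 - h\<^sup>2 / 3) - \<delta> \<le> tri_avg h \<beta> (F T)) at_top"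
    using h \<delta> by (intro eventually_tri_avg_ge) auto
  then show ?thesis using eventually_unit_tri_avg_ge[OF \<delta>(1)] eventually_gt_at_top[of 1]
  proof eventually_elim
    case (elim T)
    have "2 / 3 * real n + h * pos_part (2 * h - 1 - h\<^sup>2 / 3) - \<epsilon> =
        (\<Sum>j<n. 2 / 3 - \<delta>) + (h * pos_part (2 * h - 1 - h\<^sup>2 / 3) - \<delta>)"
      using \<delta>(2) by (simp add: algebra_simps)
    also have "\<dots> \<le> (\<Sum>j<n. tri_avg 1 (b + 1 + real j) (F T)) + tri_avg h (b + real n + h) (F T)"
      using elim by (intro add_mono sum_mono) auto
    also have "\<dots> \<le> integral {b..b + (real n + 2 * h)} (F T)"
      using elim by (intro tiling_le_integral_interval h \<open>n \<ge> 1\<close> cont nonneg)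
    finally show ?case .
  qed
qed

lemma eventually_triangle_le_integral:
  assumes "0 < h" "h \<le> 1" and "\<epsilon> > 0"
  shows "eventually (\<lambda>T. pos_part (2 * h - 1 - h\<^sup>2 / 3) - \<epsilon> \<le> integral {b..b + 2 * h} (F T)) at_top"
proof -
  have "h * \<epsilon> > 0" using assms by simp
  from eventually_tri_avg_ge[OF assms(1,2) this] show ?thesis using eventually_gt_at_top[of 1]
  proof eventually_elim
    case (elim T)
    have "pos_part (2 * h - 1 - h\<^sup>2 / 3) - \<epsilon> = (h * pos_part (2 * h - 1 - h\<^sup>2 / 3) - h * \<epsilon>) / h"
      using \<open>0 < h\<close> by (simp add: field_simps)
    also have "\<dots> \<le> tri_avg h (b + h) (F T) / h"
      using elim \<open>0 < h\<close> by (intro divide_right_mono) auto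
    also have "\<dots> \<le> integral {b..b + 2 * h} (F T)"
      using elim \<open>0 < h\<close> by (intro tri_avg_le_integral_interval cont nonneg)
    finally show ?case .
  qed
qed

lemma eventually_C_minus_le_integral:
  assumes "l > 0" and "\<epsilon> > 0"
  shows "eventually (\<lambda>T. C_minus l - \<epsilon> \<le> integral {b..b + l} (F T)) at_top"
proof (cases "l \<ge> 2")
  case True
  define h where "h = (1 + frac l) / 2"
  define n where "n = nat (\<lfloor>l\<rfloor> - 1)"
  have "\<lfloor>l\<rfloor> \<ge> 2" using True by (simp add: le_floor_iff)
  then have n: "n \<ge> 1" "real n = real_of_int \<lfloor>l\<rfloor> - 1" unfolding n_def by linarith+
  then have l: "l = real n + 2 * h" by (simp add: h_def frac_def field_simps)
  have h: "1 / 2 \<le> h" "h \<le> 1" using frac_ge_0[of l] frac_lt_1[of l] by (auto simp: h_def)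
  have "frac l - (1 + frac l)\<^sup>2 / 12 = 2 * h - 1 - h\<^sup>2 / 3"
    by (simp add: h_def field_simps power2_eq_square)
  moreover have "2 / 3 * (l - 1) - 2 * frac l / 3 = 2 / 3 * real n"
    by (simp add: n frac_def field_simps)
  ultimately have "C_minus l = 2 / 3 * real n + h * pos_part (2 * h - 1 - h\<^sup>2 / 3)"
    using True by (simp add: C_minus_def h_def[symmetric])
  then show ?thesis
    using eventually_tiling_le_integral[OF h n(1) \<open>\<epsilon> > 0\<close>, of b] by (simp flip: l)
next
  case False
  then have "C_minus l = pos_part (2 * (l / 2) - 1 - (l / 2)\<^sup>2 / 3)"
    by (simp add: C_minus_def power_divide)
  then show ?thesis
    using eventually_triangle_le_integral[of "l / 2" \<epsilon> b] False assms by simp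
qed

lemma Limsup_integral_le_C_plus:
  assumes "l > 0"
  shows "Limsup at_top (\<lambda>T. ereal (integral {b..b + l} (F T))) \<le> ereal (C_plus l)"
proof (rule ereal_le_epsilon2)
  fix \<epsilon> :: real assume "\<epsilon> > 0"
  from eventually_integral_le_C_plus[OF assms this, of b]
  show "Limsup at_top (\<lambda>T. ereal (integral {b..b + l} (F T))) \<le> ereal (C_plus l) + ereal \<epsilon>"
    by (intro Limsup_bounded) (auto elim: eventually_mono)
qed

lemma C_minus_le_Liminf_integral:
  assumes "l > 0"
  shows "ereal (C_minus l) \<le> Liminf at_top (\<lambda>T. ereal (integral {b..b + l} (F T)))"
proof (rule ereal_le_epsilon2)
  fix \<epsilon> :: real assume "\<epsilon> > 0"
  from eventually_C_minus_le_integral[OF assms this, of b]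
  have "ereal (C_minus l - \<epsilon>) \<le> Liminf at_top (\<lambda>T. ereal (integral {b..b + l} (F T)))"
    by (intro Liminf_bounded) (auto elim: eventually_mono)
  then show "ereal (C_minus l) \<le> Liminf at_top (\<lambda>T. ereal (integral {b..b + l} (F T))) + ereal \<epsilon>"
    by (cases "Liminf at_top (\<lambda>T. ereal (integral {b..b + l} (F T)))") auto
qed

end

lemma triangle_averages_form_factor:
  assumes "riemann_hypothesis"
  shows "triangle_averages (\<lambda>T \<alpha>. form_factor \<alpha> T)"
  by unfold_locales (fact continuous_on_form_factor, fact form_factor_nonneg,
    fact eventually_tri_avg_form_factor_le[OF assms], fact eventually_tri_avg_form_factor_ge[OF assms])

theorem theorem9:
  fixes b l :: real
  assumes "riemann_hypothesis" and "b \<ge> 1" and "l > 0"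
  shows "ereal (C_minus l) \<le> Liminf at_top (\<lambda>T. ereal (integral {b..b + l} (\<lambda>\<alpha>. form_factor \<alpha> T)))
       \<and> Limsup at_top (\<lambda>T. ereal (integral {b..b + l} (\<lambda>\<alpha>. form_factor \<alpha> T))) \<le> ereal (C_plus l)"
proof -
  interpret triangle_averages "\<lambda>T \<alpha>. form_factor \<alpha> T"
    using \<open>riemann_hypothesis\<close> by (rule triangle_averages_form_factor)
  show ?thesis
    using C_minus_le_Liminf_integral[OF \<open>l > 0\<close>] Limsup_integral_le_C_plus[OF \<open>l > 0\<close>] by blast
qed

end
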